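(* Let $d\in\{2,3\}$ and $r>3$. The Nemytskii operator $$\mathscr{F}:\mathrm{L}^2(0,T;\mathbb{V})\cap\mathrm{L}^{r+1}(0,T;\mathbb{L}^{r+1})\to\mathrm{L}^2(0,T;\mathbb{V}')+\mathrm{L}^{\frac{r+1}{r}}(0,T;\mathbb{L}^{\frac{r+1}{r}}),\qquad(\mathscr{F}(\boldsymbol{y}))(t)=\mathcal{F}(\boldsymbol{y}(t)),$$ is pseudomonotone in the following sense: (1) $\mathscr{F}$ is bounded; (2) if $\boldsymbol{y}_m\xrightarrow{w^*}\boldsymbol{y}$ in $\mathcal{W}$ and $\limsup_{m\to\infty}\langle\mathscr{F}(\boldsymbol{y}_m),\boldsymbol{y}_m-\boldsymbol{y}\rangle\leq0$, then $$\langle\mathscr{F}(\boldsymbol{y}),\boldsymbol{y}-\boldsymbol{z}\rangle\leq\liminf_{m\to\infty}\langle\mathscr{F}(\boldsymbol{y}_m),\boldsymbol{y}_m-\boldsymbol{z}\rangle\quad\text{for all }\boldsymbol{z}\in\mathcal{W}.$$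
   Context: Let $\mathcal{O}\subset\mathbb{R}^d$ be a bounded domain with sufficiently smooth boundary $\Gamma$ (at least $C^{1,1}$), unit outward normal $\boldsymbol{n}$; for a vector field $\boldsymbol{z}$ on $\Gamma$ put $z_n=\boldsymbol{z}\cdot\boldsymbol{n}$, $\boldsymbol{z}_\tau=\boldsymbol{z}-z_n\boldsymbol{n}$. Let $\mathscr{M}=\{\boldsymbol{z}\in C^\infty(\overline{\mathcal{O}};\mathbb{R}^d):\nabla\cdot\boldsymbol{z}=0\text{ in }\mathcal{O},\ \boldsymbol{z}_\tau=\boldsymbol{0}\text{ on }\Gamma\}$. $\mathbb{V}$, $\mathbb{H}$, $\mathbb{L}^p$ ($p\in(2,\infty)$) are the closures of $\mathscr{M}$ in $H^1(\mathcal{O};\mathbb{R}^d)$, $L^2(\mathcal{O};\mathbb{R}^d)$, $L^p(\mathcal{O};\mathbb{R}^d)$. $\mathbb{H}$ and $\mathbb{L}^p$ carry the $L^2$ and $L^p$ norms; $\mathbb{V}$ carries $\|\boldsymbol{y}\|_{\mathbb{V}}=\|\mathrm{curl}\,\boldsymbol{y}\|_{L^2}$, a norm on $\mathbb{V}$ equivalent to the $H^1$ norm. $\mathbb{H}$ is identified with its dual, $\mathbb{L}^{\frac{p}{p-1}}$ denotes the dual of $\mathbb{L}^p$ (via the $L^2$ pairing), and $\mathbb{V}'+\mathbb{L}^{\frac{p}{p-1}}$ is the dual of $\mathbb{V}\cap\mathbb{L}^{p}$. If $d=2$: $\mathrm{curl}\,\boldsymbol{y}=\partial_1y_2-\partial_2y_1$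 and $\omega\times\boldsymbol{z}=(-\omega z_2,\omega z_1)$ for scalar $\omega$. Let $\mu,\alpha,\beta>0$, $T>0$. Define $\langle\mathfrak{A}\boldsymbol{y},\boldsymbol{z}\rangle=(\mathrm{curl}\,\boldsymbol{y},\mathrm{curl}\,\boldsymbol{z})_{L^2}$, $\langle\mathfrak{B}(\boldsymbol{y}),\boldsymbol{w}\rangle=\int_{\mathcal{O}}(\mathrm{curl}\,\boldsymbol{y}\times\boldsymbol{y})\cdot\boldsymbol{w}\,dx$, $\mathfrak{C}(\boldsymbol{y})=|\boldsymbol{y}|^{r-1}\boldsymbol{y}$, $\mathcal{F}(\boldsymbol{y})=\mu\mathfrak{A}\boldsymbol{y}+\mathfrak{B}(\boldsymbol{y})+\alpha\boldsymbol{y}+\beta\mathfrak{C}(\boldsymbol{y})$, and $$\mathcal{W}=\{\boldsymbol{y}\in\mathrm{L}^\infty(0,T;\mathbb{H})\cap\mathrm{L}^2(0,T;\mathbb{V})\cap\mathrm{L}^{r+1}(0,T;\mathbb{L}^{r+1}):\boldsymbol{y}'\in\mathrm{L}^2(0,T;\mathbb{V}')+\mathrm{L}^{\frac{r+1}{r}}(0,T;\mathbb{L}^{\frac{r+1}{r}})\},$$ where $\boldsymbol{y}'$ is the distributional time derivative. $\boldsymbol{y}_m\xrightarrow{w^*}\boldsymbol{y}$ in $\mathcal{W}$ means: $\boldsymbol{y}_m\to\boldsymbol{y}$ weakly-* in $\mathrm{L}^\infty(0,T;\mathbb{H})$, weakly in $\mathrm{L}^2(0,T;\mathbb{V})$ and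 in $\mathrm{L}^{r+1}(0,T;\mathbb{L}^{r+1})$, and $\boldsymbol{y}_m'\to\boldsymbol{y}'$ weakly in $\mathrm{L}^2(0,T;\mathbb{V}')+\mathrm{L}^{\frac{r+1}{r}}(0,T;\mathbb{L}^{\frac{r+1}{r}})$. $\langle\cdot,\cdot\rangle$ is the duality pairing between $\mathrm{L}^2(0,T;\mathbb{V}')+\mathrm{L}^{\frac{r+1}{r}}(0,T;\mathbb{L}^{\frac{r+1}{r}})$ and $\mathrm{L}^2(0,T;\mathbb{V})\cap\mathrm{L}^{r+1}(0,T;\mathbb{L}^{r+1})$. An operator is bounded if it maps bounded sets to bounded sets. *)

theory Defs
  imports "HOL-Analysis.Analysis" "HOL-Library.Function_Algebras"
begin

section \<open>Pointwise vector space structure on functions\<close>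

instantiation "fun" :: (type, scaleR) scaleR
begin
definition scaleR_fun_def: "a *\<^sub>R f = (\<lambda>x. a *\<^sub>R f x)"
instance ..
end

lemma scaleR_fun_apply [simp]: "(a *\<^sub>R f) x = a *\<^sub>R f x"
  by (simp add: scaleR_fun_def)

instance "fun" :: (type, real_vector) real_vector
  by standard (simp_all add: fun_eq_iff scaleR_add_right scaleR_add_left)


section \<open>Function spaces given by a carrier and a norm\<close>

text \<open>Normed spaces of (classes of) functions are represented by a set \<open>X\<close> of representatives
  together with a functional \<open>N\<close>; representatives at \<open>N\<close>-distance 0 stand for the same element.
  An element of the dual is a function on the whole type of which only the values on \<open>X\<close>
  matter.\<close>

definition dual_space :: "'a::real_vector set \<Rightarrow> ('a \<Rightarrow> real) \<Rightarrow> ('a \<Rightarrow> real) set" where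
  "dual_space X N = {l. (\<forall>u\<in>X. \<forall>v\<in>X. l (u + v) = l u + l v)
                      \<and> (\<forall>a. \<forall>u\<in>X. l (a *\<^sub>R u) = a * l u)
                      \<and> (\<exists>C. \<forall>u\<in>X. \<bar>l u\<bar> \<le> C * N u)}"

definition dual_norm :: "'a set \<Rightarrow> ('a \<Rightarrow> real) \<Rightarrow> ('a \<Rightarrow> real) \<Rightarrow> real" where
  "dual_norm X N l = (SUP u\<in>{u\<in>X. N u \<le> 1}. \<bar>l u\<bar>)"

definition weakly_converges ::
    "'a::real_vector set \<Rightarrow> ('a \<Rightarrow> real) \<Rightarrow> (nat \<Rightarrow> 'a) \<Rightarrow> 'a \<Rightarrow> bool" where
  "weakly_converges X N u v \<longleftrightarrow> (\<forall>l\<in>dual_space X N. (\<lambda>m. l (u m)) \<longlonglongrightarrow> l v)"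


section \<open>Bochner spaces over the time interval\<close>

abbreviation time_measure :: "real \<Rightarrow> real measure" where
  "time_measure T \<equiv> lebesgue_on {0<..<T}"

definition strongly_measurable ::
    "real \<Rightarrow> 'a::real_vector set \<Rightarrow> ('a \<Rightarrow> real) \<Rightarrow> (real \<Rightarrow> 'a) \<Rightarrow> bool" where
  "strongly_measurable T X N u \<longleftrightarrow>
     (\<exists>s. (\<forall>k. simple_function (time_measure T) (s k) \<and> (\<forall>t\<in>{0<..<T}. s k t \<in> X))
        \<and> (AE t in time_measure T. (\<lambda>k. N (s k t - u t)) \<longlonglongrightarrow> 0))"

definition bochner_space ::
    "real \<Rightarrow> real \<Rightarrow> 'a::real_vector set \<Rightarrow> ('a \<Rightarrow> real) \<Rightarrow> (real \<Rightarrow> 'a) set" where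
  "bochner_space T p X N = {u. (AE t in time_measure T. u t \<in> X)
                             \<and> strongly_measurable T X N u
                             \<and> integrable (time_measure T) (\<lambda>t. N (u t) powr p)}"

definition bochner_norm :: "real \<Rightarrow> real \<Rightarrow> ('a \<Rightarrow> real) \<Rightarrow> (real \<Rightarrow> 'a) \<Rightarrow> real" where
  "bochner_norm T p N u = (LINT t|time_measure T. N (u t) powr p) powr (1 / p)"

definition bochner_space_inf ::
    "real \<Rightarrow> 'a::real_vector set \<Rightarrow> ('a \<Rightarrow> real) \<Rightarrow> (real \<Rightarrow> 'a) set" where
  "bochner_space_inf T X N = {u. (AE t in time_measure T. u t \<in> X)
                               \<and> strongly_measurable T X N u
                               \<and> (\<exists>C. AE t in time_measure T. N (u t) \<le> C)}"


section \<open>Smooth functions and the domain\<close>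

text \<open>\<open>f\<close> is \<open>C\<^sup>k\<close> on the whole space: all iterated directional derivatives up to order
  \<open>k\<close> exist and are continuous.\<close>

primrec C_k :: "nat \<Rightarrow> ('a::euclidean_space \<Rightarrow> 'b::real_normed_vector) \<Rightarrow> bool" where
  "C_k 0 f \<longleftrightarrow> continuous_on UNIV f"
| "C_k (Suc k) f \<longleftrightarrow> (\<forall>x. f differentiable (at x))
                     \<and> (\<forall>v. C_k k (\<lambda>x. frechet_derivative f (at x) v))"

definition smooth :: "('a::euclidean_space \<Rightarrow> 'b::real_normed_vector) \<Rightarrow> bool" where
  "smooth f \<longleftrightarrow> (\<forall>k. C_k k f)"

definition test_functions :: "'a::euclidean_space set \<Rightarrow> ('a \<Rightarrow> real) set" where
  "test_functions U = {\<phi>. smooth \<phi> \<and> compact (closure {x. \<phi> x \<noteq> 0})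
                              \<and> closure {x. \<phi> x \<noteq> 0} \<subseteq> U}"

text \<open>Near \<open>x0\<close> the set \<open>Om\<close> is the sublevel set of the \<open>C\<^sup>1\<^sup>,\<^sup>1\<close> function \<open>\<rho>\<close>,
  whose gradient \<open>g\<close> does not vanish.\<close>

definition C11_defining_function ::
    "(real^'n) set \<Rightarrow> real^'n \<Rightarrow> (real^'n) set \<Rightarrow> (real^'n \<Rightarrow> real) \<Rightarrow> (real^'n \<Rightarrow> real^'n) \<Rightarrow> bool" where
  "C11_defining_function Om x0 U \<rho> g \<longleftrightarrow>
     open U \<and> x0 \<in> U
     \<and> (\<forall>x\<in>U. GDERIV \<rho> x :> g x \<and> g x \<noteq> 0) \<and> (\<exists>L. L-lipschitz_on U g)
     \<and> Om \<inter> U = {x\<in>U. \<rho> x < 0} \<and> frontier Om \<inter> U = {x\<in>U. \<rho> x = 0}"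

definition bounded_C11_domain :: "(real^'n) set \<Rightarrow> bool" where
  "bounded_C11_domain Om \<longleftrightarrow>
     open Om \<and> connected Om \<and> bounded Om \<and> Om \<noteq> {}
     \<and> (\<forall>x\<in>frontier Om. \<exists>U \<rho> g. C11_defining_function Om x U \<rho> g)"

text \<open>The value does not depend on the choice of the defining function.\<close>

definition outer_normal :: "(real^'n) set \<Rightarrow> real^'n \<Rightarrow> real^'n" where
  "outer_normal Om x = (THE n. \<exists>U \<rho> g. C11_defining_function Om x U \<rho> g \<and> n = g x /\<^sub>R norm (g x))"

definition tangential_part :: "(real^'n) set \<Rightarrow> (real^'n \<Rightarrow> real^'n) \<Rightarrow> real^'n \<Rightarrow> real^'n" where
  "tangential_part Om z x = z x - (z x \<bullet> outer_normal Om x) *\<^sub>R outer_normal Om x"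


section \<open>Lebesgue and Sobolev spaces\<close>

definition Lp_space :: "(real^'n) set \<Rightarrow> real \<Rightarrow> (real^'n \<Rightarrow> 'b::real_normed_vector) set" where
  "Lp_space Om p = {u. u \<in> borel_measurable (lebesgue_on Om)
                     \<and> integrable (lebesgue_on Om) (\<lambda>x. norm (u x) powr p)}"

definition Lp_norm :: "(real^'n) set \<Rightarrow> real \<Rightarrow> (real^'n \<Rightarrow> 'b::real_normed_vector) \<Rightarrow> real" where
  "Lp_norm Om p u = (LINT x|lebesgue_on Om. norm (u x) powr p) powr (1 / p)"

definition L2_inner ::
    "(real^'n) set \<Rightarrow> (real^'n \<Rightarrow> 'b::real_inner) \<Rightarrow> (real^'n \<Rightarrow> 'b) \<Rightarrow> real" where
  "L2_inner Om u v = (LINT x|lebesgue_on Om. u x \<bullet> v x)"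

text \<open>As for the library's \<open>jacobian\<close>, the entry \<open>G x $ i $ j\<close> is the \<open>j\<close>-th partial
  derivative of the \<open>i\<close>-th component.\<close>

definition is_weak_jacobian ::
    "(real^'n) set \<Rightarrow> (real^'n \<Rightarrow> real^'n) \<Rightarrow> (real^'n \<Rightarrow> real^'n^'n) \<Rightarrow> bool" where
  "is_weak_jacobian Om u G \<longleftrightarrow>
     (\<forall>\<phi>\<in>test_functions Om. \<forall>i j.
        (LINT x|lebesgue_on Om. u x $ i * frechet_derivative \<phi> (at x) (axis j 1))
          = - (LINT x|lebesgue_on Om. G x $ i $ j * \<phi> x))"

definition H1_space :: "(real^'n) set \<Rightarrow> (real^'n \<Rightarrow> real^'n) set" where
  "H1_space Om = {u \<in> Lp_space Om 2. \<exists>G\<in>Lp_space Om 2. is_weak_jacobian Om u G}"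

text \<open>Determined up to null sets on \<open>Om\<close>.\<close>

definition weak_jacobian :: "(real^'n) set \<Rightarrow> (real^'n \<Rightarrow> real^'n) \<Rightarrow> real^'n \<Rightarrow> real^'n^'n" where
  "weak_jacobian Om u = (SOME G. G \<in> Lp_space Om 2 \<and> is_weak_jacobian Om u G)"

definition H1_norm :: "(real^'n) set \<Rightarrow> (real^'n \<Rightarrow> real^'n) \<Rightarrow> real" where
  "H1_norm Om u = sqrt ((Lp_norm Om 2 u)\<^sup>2 + (Lp_norm Om 2 (weak_jacobian Om u))\<^sup>2)"


section \<open>Curl and cross product in dimensions two and three\<close>

text \<open>The two dimensions are treated simultaneously: below, \<open>rot\<close> stands for the map sending a
  Jacobian matrix to the corresponding curl and \<open>cr\<close> for the product of a curl with a vector;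
  they are \<open>rot2\<close>, \<open>cr2\<close> if \<open>d = 2\<close> (the curl is then a scalar) and \<open>rot3\<close>, \<open>cross3\<close>
  if \<open>d = 3\<close>.\<close>

definition rot2 :: "real^2^2 \<Rightarrow> real" where
  "rot2 J = J $ 2 $ 1 - J $ 1 $ 2"

definition cr2 :: "real \<Rightarrow> real^2 \<Rightarrow> real^2" where
  "cr2 w z = vector [- w * z $ 2, w * z $ 1]"

definition rot3 :: "real^3^3 \<Rightarrow> real^3" where
  "rot3 J = vector [J $ 3 $ 2 - J $ 2 $ 3, J $ 1 $ 3 - J $ 3 $ 1, J $ 2 $ 1 - J $ 1 $ 2]"

definition curl :: "(real^'n^'n \<Rightarrow> 'c) \<Rightarrow> (real^'n) set \<Rightarrow> (real^'n \<Rightarrow> real^'n) \<Rightarrow> real^'n \<Rightarrow> 'c" where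
  "curl rot Om u x = rot (weak_jacobian Om u x)"


section \<open>The spaces of solenoidal fields\<close>

text \<open>Smoothness up to the boundary means being the restriction of a smooth function on the
  whole space.\<close>

definition M_space :: "(real^'n) set \<Rightarrow> (real^'n \<Rightarrow> real^'n) set" where
  "M_space Om = {z. smooth z
                  \<and> (\<forall>x\<in>Om. trace (jacobian z (at x)) = 0)
                  \<and> (\<forall>x\<in>frontier Om. tangential_part Om z x = 0)}"

definition V_space :: "(real^'n) set \<Rightarrow> (real^'n \<Rightarrow> real^'n) set" where
  "V_space Om = {u \<in> H1_space Om. \<forall>\<epsilon>>0. \<exists>z\<in>M_space Om. H1_norm Om (u - z) < \<epsilon>}"

text \<open>On domains admitting nonzero curl-free fields in \<open>V_space Om\<close> (which can only happen if the
  boundary is disconnected) this is merely a seminorm; all notions below remain meaningful then.\<close>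

definition V_norm ::
    "(real^'n^'n \<Rightarrow> 'c::real_normed_vector) \<Rightarrow> (real^'n) set \<Rightarrow> (real^'n \<Rightarrow> real^'n) \<Rightarrow> real" where
  "V_norm rot Om u = Lp_norm Om 2 (curl rot Om u)"

definition LM_space :: "(real^'n) set \<Rightarrow> real \<Rightarrow> (real^'n \<Rightarrow> real^'n) set" where
  "LM_space Om p = {u \<in> Lp_space Om p. \<forall>\<epsilon>>0. \<exists>z\<in>M_space Om. Lp_norm Om p (u - z) < \<epsilon>}"

abbreviation H_space :: "(real^'n) set \<Rightarrow> (real^'n \<Rightarrow> real^'n) set" where
  "H_space Om \<equiv> LM_space Om 2"

abbreviation H_norm :: "(real^'n) set \<Rightarrow> (real^'n \<Rightarrow> real^'n) \<Rightarrow> real" where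
  "H_norm Om \<equiv> Lp_norm Om 2"

type_synonym 'n field = "real^'n \<Rightarrow> real^'n"

abbreviation V_dual ::
    "(real^'n^'n \<Rightarrow> 'c::real_normed_vector) \<Rightarrow> (real^'n) set \<Rightarrow> ('n field \<Rightarrow> real) set" where
  "V_dual rot Om \<equiv> dual_space (V_space Om) (V_norm rot Om)"

abbreviation V_dual_norm ::
    "(real^'n^'n \<Rightarrow> 'c::real_normed_vector) \<Rightarrow> (real^'n) set \<Rightarrow> ('n field \<Rightarrow> real) \<Rightarrow> real" where
  "V_dual_norm rot Om \<equiv> dual_norm (V_space Om) (V_norm rot Om)"

abbreviation LM_dual :: "(real^'n) set \<Rightarrow> real \<Rightarrow> ('n field \<Rightarrow> real) set" where
  "LM_dual Om p \<equiv> dual_space (LM_space Om p) (Lp_norm Om p)"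

abbreviation LM_dual_norm :: "(real^'n) set \<Rightarrow> real \<Rightarrow> ('n field \<Rightarrow> real) \<Rightarrow> real" where
  "LM_dual_norm Om p \<equiv> dual_norm (LM_space Om p) (Lp_norm Om p)"


section \<open>The spaces of time dependent fields\<close>

abbreviation L2V ::
    "(real^'n^'n \<Rightarrow> 'c::real_normed_vector) \<Rightarrow> (real^'n) set \<Rightarrow> real \<Rightarrow> (real \<Rightarrow> 'n field) set" where
  "L2V rot Om T \<equiv> bochner_space T 2 (V_space Om) (V_norm rot Om)"

abbreviation L2V_norm ::
    "(real^'n^'n \<Rightarrow> 'c::real_normed_vector) \<Rightarrow> (real^'n) set \<Rightarrow> real \<Rightarrow> (real \<Rightarrow> 'n field) \<Rightarrow> real" where
  "L2V_norm rot Om T \<equiv> bochner_norm T 2 (V_norm rot Om)"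

abbreviation LpLp :: "(real^'n) set \<Rightarrow> real \<Rightarrow> real \<Rightarrow> (real \<Rightarrow> 'n field) set" where
  "LpLp Om T p \<equiv> bochner_space T p (LM_space Om p) (Lp_norm Om p)"

abbreviation LpLp_norm :: "(real^'n) set \<Rightarrow> real \<Rightarrow> real \<Rightarrow> (real \<Rightarrow> 'n field) \<Rightarrow> real" where
  "LpLp_norm Om T p \<equiv> bochner_norm T p (Lp_norm Om p)"

definition X_space ::
    "(real^'n^'n \<Rightarrow> 'c::real_normed_vector) \<Rightarrow> (real^'n) set \<Rightarrow> real \<Rightarrow> real \<Rightarrow> (real \<Rightarrow> 'n field) set" where
  "X_space rot Om T r = L2V rot Om T \<inter> LpLp Om T (r + 1)"

definition X_norm ::
    "(real^'n^'n \<Rightarrow> 'c::real_normed_vector) \<Rightarrow> (real^'n) set \<Rightarrow> real \<Rightarrow> real \<Rightarrow> (real \<Rightarrow> 'n field) \<Rightarrow> real" where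
  "X_norm rot Om T r y = L2V_norm rot Om T y + LpLp_norm Om T (r + 1) y"

text \<open>\<open>f = f1 + f2\<close> with \<open>f1\<close> in \<open>L\<^sup>2(0,T;V')\<close> and \<open>f2\<close> in the \<open>L\<^sup>(\<^sup>r\<^sup>+\<^sup>1\<^sup>)\<^sup>/\<^sup>r\<close>-space of functions
  with values in the dual of \<open>LM_space Om (r + 1)\<close>, as an identity of functionals on
  \<open>V_space Om \<inter> LM_space Om (r + 1)\<close>.\<close>

definition X_dual_decomposition ::
    "(real^'n^'n \<Rightarrow> 'c::real_normed_vector) \<Rightarrow> (real^'n) set \<Rightarrow> real \<Rightarrow> real
      \<Rightarrow> (real \<Rightarrow> 'n field \<Rightarrow> real) \<Rightarrow> (real \<Rightarrow> 'n field \<Rightarrow> real) \<Rightarrow> (real \<Rightarrow> 'n field \<Rightarrow> real) \<Rightarrow> bool" where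
  "X_dual_decomposition rot Om T r f f1 f2 \<longleftrightarrow>
     f1 \<in> bochner_space T 2 (V_dual rot Om) (V_dual_norm rot Om)
     \<and> f2 \<in> bochner_space T ((r + 1) / r) (LM_dual Om (r + 1)) (LM_dual_norm Om (r + 1))
     \<and> (AE t in time_measure T. \<forall>v\<in>V_space Om \<inter> LM_space Om (r + 1). f t v = f1 t v + f2 t v)"

definition X_dual ::
    "(real^'n^'n \<Rightarrow> 'c::real_normed_vector) \<Rightarrow> (real^'n) set \<Rightarrow> real \<Rightarrow> real
      \<Rightarrow> (real \<Rightarrow> 'n field \<Rightarrow> real) set" where
  "X_dual rot Om T r = {f. \<exists>f1 f2. X_dual_decomposition rot Om T r f f1 f2}"

definition X_dual_norm ::
    "(real^'n^'n \<Rightarrow> 'c::real_normed_vector) \<Rightarrow> (real^'n) set \<Rightarrow> real \<Rightarrow> real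
      \<Rightarrow> (real \<Rightarrow> 'n field \<Rightarrow> real) \<Rightarrow> real" where
  "X_dual_norm rot Om T r f =
     Inf {bochner_norm T 2 (V_dual_norm rot Om) f1
            + bochner_norm T ((r + 1) / r) (LM_dual_norm Om (r + 1)) f2 | f1 f2.
          X_dual_decomposition rot Om T r f f1 f2}"

definition pairing :: "real \<Rightarrow> (real \<Rightarrow> 'a \<Rightarrow> real) \<Rightarrow> (real \<Rightarrow> 'a) \<Rightarrow> real" where
  "pairing T f z = (LINT t|time_measure T. f t (z t))"

text \<open>\<open>g\<close> is the distributional time derivative of \<open>y\<close> as a distribution with values in the dual
  of \<open>V_space Om \<inter> LM_space Om (r + 1)\<close>, into which \<open>y t\<close> is embedded by the
  \<open>L\<^sup>2\<close> pairing; the identity between elements of this dual is tested against each \<open>v\<close>.\<close>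

definition is_time_derivative ::
    "(real^'n) set \<Rightarrow> real \<Rightarrow> real \<Rightarrow> (real \<Rightarrow> 'n field) \<Rightarrow> (real \<Rightarrow> 'n field \<Rightarrow> real) \<Rightarrow> bool" where
  "is_time_derivative Om T r y g \<longleftrightarrow>
     (\<forall>\<phi>\<in>test_functions {0<..<T}. \<forall>v\<in>V_space Om \<inter> LM_space Om (r + 1).
        (LINT t|time_measure T. deriv \<phi> t * L2_inner Om (y t) v)
          = - (LINT t|time_measure T. \<phi> t * g t v))"

definition W_space ::
    "(real^'n^'n \<Rightarrow> 'c::real_normed_vector) \<Rightarrow> (real^'n) set \<Rightarrow> real \<Rightarrow> real \<Rightarrow> (real \<Rightarrow> 'n field) set" where
  "W_space rot Om T r =
     {y \<in> bochner_space_inf T (H_space Om) (H_norm Om) \<inter> L2V rot Om T \<inter> LpLp Om T (r + 1).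
        \<exists>g\<in>X_dual rot Om T r. is_time_derivative Om T r y g}"

text \<open>Weak-* convergence in \<open>L\<^sup>\<infinity>(0,T;H)\<close>, regarded as the dual of \<open>L\<^sup>1(0,T;H)\<close>.\<close>

definition weak_star_converges_LinfH ::
    "(real^'n) set \<Rightarrow> real \<Rightarrow> (nat \<Rightarrow> real \<Rightarrow> 'n field) \<Rightarrow> (real \<Rightarrow> 'n field) \<Rightarrow> bool" where
  "weak_star_converges_LinfH Om T ym y \<longleftrightarrow>
     (\<forall>h\<in>bochner_space T 1 (H_space Om) (H_norm Om).
        (\<lambda>m. LINT t|time_measure T. L2_inner Om (ym m t) (h t))
          \<longlonglongrightarrow> (LINT t|time_measure T. L2_inner Om (y t) (h t)))"

definition weak_star_converges_W ::
    "(real^'n^'n \<Rightarrow> 'c::real_normed_vector) \<Rightarrow> (real^'n) set \<Rightarrow> real \<Rightarrow> real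
      \<Rightarrow> (nat \<Rightarrow> real \<Rightarrow> 'n field) \<Rightarrow> (real \<Rightarrow> 'n field) \<Rightarrow> bool" where
  "weak_star_converges_W rot Om T r ym y \<longleftrightarrow>
     (\<forall>m. ym m \<in> W_space rot Om T r) \<and> y \<in> W_space rot Om T r
     \<and> weak_star_converges_LinfH Om T ym y
     \<and> weakly_converges (L2V rot Om T) (L2V_norm rot Om T) ym y
     \<and> weakly_converges (LpLp Om T (r + 1)) (LpLp_norm Om T (r + 1)) ym y
     \<and> (\<exists>dym dy. (\<forall>m. dym m \<in> X_dual rot Om T r \<and> is_time_derivative Om T r (ym m) (dym m))
          \<and> dy \<in> X_dual rot Om T r \<and> is_time_derivative Om T r y dy
          \<and> weakly_converges (X_dual rot Om T r) (X_dual_norm rot Om T r) dym dy)"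


section \<open>The operators\<close>

definition A_op ::
    "(real^'n^'n \<Rightarrow> 'c::real_inner) \<Rightarrow> (real^'n) set \<Rightarrow> 'n field \<Rightarrow> 'n field \<Rightarrow> real" where
  "A_op rot Om y z = L2_inner Om (curl rot Om y) (curl rot Om z)"

definition B_op ::
    "(real^'n^'n \<Rightarrow> 'c) \<Rightarrow> ('c \<Rightarrow> real^'n \<Rightarrow> real^'n) \<Rightarrow> (real^'n) set
      \<Rightarrow> 'n field \<Rightarrow> 'n field \<Rightarrow> real" where
  "B_op rot cr Om y w = (LINT x|lebesgue_on Om. cr (curl rot Om y x) (y x) \<bullet> w x)"

definition C_op :: "real \<Rightarrow> 'n field \<Rightarrow> 'n::finite field" where
  "C_op r y = (\<lambda>x. norm (y x) powr (r - 1) *\<^sub>R y x)"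

definition F_op ::
    "(real^'n^'n \<Rightarrow> 'c::real_inner) \<Rightarrow> ('c \<Rightarrow> real^'n \<Rightarrow> real^'n) \<Rightarrow> (real^'n) set
      \<Rightarrow> real \<Rightarrow> real \<Rightarrow> real \<Rightarrow> real \<Rightarrow> 'n field \<Rightarrow> 'n field \<Rightarrow> real" where
  "F_op rot cr Om r \<mu> \<alpha> \<beta> y w =
     \<mu> * A_op rot Om y w + B_op rot cr Om y w + \<alpha> * L2_inner Om y w
       + \<beta> * L2_inner Om (C_op r y) w"

definition nemytskii :: "('a \<Rightarrow> 'b) \<Rightarrow> (real \<Rightarrow> 'a) \<Rightarrow> (real \<Rightarrow> 'b)" where
  "nemytskii F y = (\<lambda>t. F (y t))"

definition bounded_operator ::
    "'a set \<Rightarrow> ('a \<Rightarrow> real) \<Rightarrow> 'b set \<Rightarrow> ('b \<Rightarrow> real) \<Rightarrow> ('a \<Rightarrow> 'b) \<Rightarrow> bool" where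
  "bounded_operator X N Y N' G \<longleftrightarrow>
     (\<forall>y\<in>X. G y \<in> Y)
     \<and> (\<forall>S\<subseteq>X. (\<exists>R. \<forall>y\<in>S. N y \<le> R) \<longrightarrow> (\<exists>K. \<forall>y\<in>S. N' (G y) \<le> K))"

definition pseudomonotone ::
    "(real^'n^'n \<Rightarrow> 'c::real_normed_vector) \<Rightarrow> (real^'n) set \<Rightarrow> real \<Rightarrow> real
      \<Rightarrow> ((real \<Rightarrow> 'n field) \<Rightarrow> (real \<Rightarrow> 'n field \<Rightarrow> real)) \<Rightarrow> bool" where
  "pseudomonotone rot Om T r G \<longleftrightarrow>
     bounded_operator (X_space rot Om T r) (X_norm rot Om T r)
                      (X_dual rot Om T r) (X_dual_norm rot Om T r) G
     \<and> (\<forall>ym y. weak_star_converges_W rot Om T r ym y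
           \<and> limsup (\<lambda>m. ereal (pairing T (G (ym m)) (ym m - y))) \<le> 0
         \<longrightarrow> (\<forall>z\<in>W_space rot Om T r.
                ereal (pairing T (G y) (y - z))
                  \<le> liminf (\<lambda>m. ereal (pairing T (G (ym m)) (ym m - z)))))"

end

(* Since r > 3, the convection term is dominated by viscosity and damping up to an L2 term, so F + kappa I
   is monotone.  Together with the limsup hypothesis this also bounds y_m - y, and the theorem reduces by
   Minty's trick to the strong convergence y_m -> y in L2(0,T;L2).  No boundary regularity is needed for
   that: a solenoidal field with square integrable curl has interior H1 bounds, a thin layer at the boundary
   contributes little because of the L^(r+1) bound, and the scalar functions (y_m(t) - y(t), v) tend to 0
   for almost every t by the weak convergence of the time derivatives. *)

theory Submission
  imports Defs
begin

section \<open>Smooth functions and cutoffs\<close>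

text \<open>Two mismatches shape the compactness step. The time derivatives are functionals on the
  intersection of \<open>V_space Om\<close> and \<open>LM_space Om (r + 1)\<close>, so they control
  pairings of y_m - y with such fields only, while local averages of a cut-off field are pairings
  with arbitrary L2 functions; near-minimisers of the L2 distance bridge the two. And the curl is
  turned into the whole gradient J by compact support: there J : J^T and (trace J)^2 have the same
  integral, so that |rot J|^2 = |J|^2 - J : J^T bounds |J|^2 once the divergence is known. The
  operator depends on y through the curl, measured in V, and through the field, measured in L^(r+1).
  Strong measurability provides separate simple approximations in the two norms; hence the operator
  is split and the two dependencies become independent arguments. In Minty's trick at v = y -
  \<theta> D the term kappa |y_m - v|^2 has the wrong sign; after strong convergence it is of order
  \<theta>^2 and disappears on division by \<theta>.\<close>

lemma C_k_SucI:
  assumes "\<And>x. (f has_derivative D x) (at x)" "\<And>v. C_k k (\<lambda>x. D x v)"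
  shows "C_k (Suc k) f"
proof -
  have "frechet_derivative f (at x) = D x" for x
    using frechet_derivative_at[OF assms(1)] by simp
  then show ?thesis
    using assms by (auto simp: differentiable_def)
qed

lemma C_k_Suc_imp: "C_k (Suc k) f \<Longrightarrow> C_k k f"
proof (induction k arbitrary: f)
  case 0
  then show ?case
    by (auto intro!: continuous_at_imp_continuous_on differentiable_imp_continuous_within)
next
  case (Suc k)
  show ?case
    using Suc.prems Suc.IH unfolding C_k.simps(2)[of "Suc k"] C_k.simps(2)[of k f] by blast
qed

lemma C_k_has_derivative:
  "C_k (Suc k) f \<Longrightarrow> (f has_derivative frechet_derivative f (at x)) (at x)"
  using frechet_derivative_works by auto

lemma C_k_const: "C_k k (\<lambda>x::'a::euclidean_space. c)"
  by (induction k arbitrary: c) (auto intro!: C_k_SucI[where D="\<lambda>x v. 0"])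

lemma C_k_id: "C_k k (\<lambda>x::'a::euclidean_space. x)"
  by (cases k) (auto intro!: C_k_SucI[where D="\<lambda>x v. v"] C_k_const continuous_intros)

lemma C_k_linear_comp:
  assumes "bounded_linear L" "C_k k f"
  shows "C_k k (\<lambda>x. L (f x))"
  using assms(2)
proof (induction k arbitrary: f)
  case 0
  then show ?case by (auto intro!: bounded_linear.continuous_on[OF assms(1)])
next
  case (Suc k)
  show ?case
    by (rule C_k_SucI[where D="\<lambda>x v. L (frechet_derivative f (at x) v)"])
      (use Suc in \<open>auto intro!: bounded_linear.has_derivative[OF assms(1)] C_k_has_derivative[OF Suc.prems]\<close>)
qed

lemma C_k_add:
  assumes "C_k k f" "C_k k g"
  shows "C_k k (\<lambda>x. f x + g x)"
  using assms
proof (induction k arbitrary: f g)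
  case 0
  then show ?case by (auto intro!: continuous_intros)
next
  case (Suc k)
  show ?case
    by (rule C_k_SucI[where D="\<lambda>x v. frechet_derivative f (at x) v + frechet_derivative g (at x) v"])
      (use Suc in \<open>auto intro!: has_derivative_add C_k_has_derivative[OF Suc.prems(1)] C_k_has_derivative[OF Suc.prems(2)]\<close>)
qed

lemma C_k_scaleR:
  fixes a :: "'a::euclidean_space \<Rightarrow> real"
  assumes "C_k k a" "C_k k f"
  shows "C_k k (\<lambda>x. a x *\<^sub>R f x)"
  using assms
proof (induction k arbitrary: a f)
  case 0
  then show ?case by (auto intro!: continuous_intros)
next
  case (Suc k)
  show ?case
  proof (rule C_k_SucI[where D="\<lambda>x v. a x *\<^sub>R frechet_derivative f (at x) v + frechet_derivative a (at x) v *\<^sub>R f x"])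
    show "((\<lambda>x. a x *\<^sub>R f x) has_derivative
         (\<lambda>v. a x *\<^sub>R frechet_derivative f (at x) v + frechet_derivative a (at x) v *\<^sub>R f x)) (at x)" for x
      by (intro has_derivative_scaleR C_k_has_derivative[OF Suc.prems(1)] C_k_has_derivative[OF Suc.prems(2)])
    show "C_k k (\<lambda>x. a x *\<^sub>R frechet_derivative f (at x) v + frechet_derivative a (at x) v *\<^sub>R f x)" for v
      by (intro C_k_add Suc.IH) (use Suc.prems C_k_Suc_imp in auto)
  qed
qed

text \<open>The outer function lives on the reals because a linear map there is a multiple of its
  value at 1. The chain rule then gives a product of a derivative of \<open>f\<close> with a
  composition of the same kind and lower order, which closes the induction.\<close>

lemma C_k_compose:
  fixes g :: "real \<Rightarrow> 'b::real_normed_vector" and f :: "'a::euclidean_space \<Rightarrow> real"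
  assumes "C_k k g" "C_k k f"
  shows "C_k k (\<lambda>x. g (f x))"
  using assms
proof (induction k arbitrary: g f)
  case 0
  then show ?case by (auto intro: continuous_on_compose2)
next
  case (Suc k)
  show ?case
  proof (rule C_k_SucI[where D="\<lambda>x v. frechet_derivative f (at x) v *\<^sub>R frechet_derivative g (at (f x)) 1"])
    fix x
    have *: "bounded_linear (frechet_derivative g (at (f x)))"
      using C_k_has_derivative[OF Suc.prems(1)] has_derivative_bounded_linear by blast
    have "((\<lambda>x. g (f x)) has_derivative
         (\<lambda>v. frechet_derivative g (at (f x)) (frechet_derivative f (at x) v))) (at x)"
      using has_derivative_compose[OF C_k_has_derivative[OF Suc.prems(2)] C_k_has_derivative[OF Suc.prems(1)]] .
    moreover have "frechet_derivative g (at (f x)) s = s *\<^sub>R frechet_derivative g (at (f x)) 1" for s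
      using linear_simps(5)[OF *, of s 1] by simp
    ultimately show "((\<lambda>x. g (f x)) has_derivative
         (\<lambda>v. frechet_derivative f (at x) v *\<^sub>R frechet_derivative g (at (f x)) 1)) (at x)"
      by (rule has_derivative_eq_rhs[OF _ ext])
  next
    fix v
    show "C_k k (\<lambda>x. frechet_derivative f (at x) v *\<^sub>R frechet_derivative g (at (f x)) 1)"
      by (intro C_k_scaleR Suc.IH[where g="\<lambda>s. frechet_derivative g (at s) 1"])
         (use Suc.prems C_k_Suc_imp in auto)
  qed
qed

lemma smooth_const: "smooth (\<lambda>x. c)"
  by (simp add: smooth_def C_k_const)

lemma smooth_id: "smooth (\<lambda>x. x)"
  by (simp add: smooth_def C_k_id)

lemma smooth_linear_comp: "bounded_linear L \<Longrightarrow> smooth f \<Longrightarrow> smooth (\<lambda>x. L (f x))"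
  by (simp add: smooth_def C_k_linear_comp)

lemma smooth_add: "smooth f \<Longrightarrow> smooth g \<Longrightarrow> smooth (\<lambda>x. f x + g x)"
  by (simp add: smooth_def C_k_add)

lemma smooth_minus: "smooth f \<Longrightarrow> smooth (\<lambda>x. - f x)"
  by (rule smooth_linear_comp[OF bounded_linear_minus[OF bounded_linear_ident]])

lemma smooth_diff: "smooth f \<Longrightarrow> smooth g \<Longrightarrow> smooth (\<lambda>x. f x - g x)"
  using smooth_add[of f "\<lambda>x. - g x"] smooth_minus[of g] by simp

lemma smooth_scaleR: "smooth a \<Longrightarrow> smooth f \<Longrightarrow> smooth (\<lambda>x. a x *\<^sub>R f x)"
  by (simp add: smooth_def C_k_scaleR)

lemma smooth_mult: "smooth a \<Longrightarrow> smooth f \<Longrightarrow> smooth (\<lambda>x. a x * f x :: real)"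
  using smooth_scaleR[of a f] by simp

lemma smooth_compose:
  fixes g :: "real \<Rightarrow> 'b::real_normed_vector"
  shows "smooth g \<Longrightarrow> smooth f \<Longrightarrow> smooth (\<lambda>x. g (f x))"
  by (simp add: smooth_def C_k_compose)

lemma smooth_prod:
  fixes f :: "'i \<Rightarrow> 'a::euclidean_space \<Rightarrow> real"
  assumes "\<And>i. i \<in> I \<Longrightarrow> smooth (f i)"
  shows "smooth (\<lambda>x. \<Prod>i\<in>I. f i x)"
  using assms by (induction I rule: infinite_finite_induct) (auto intro!: smooth_const smooth_mult)

lemma smooth_has_derivative:
  "smooth f \<Longrightarrow> (f has_derivative frechet_derivative f (at x)) (at x)"
  unfolding smooth_def using C_k_has_derivative by blast

lemma smooth_derivative: "smooth f \<Longrightarrow> smooth (\<lambda>x. frechet_derivative f (at x) v)"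
  unfolding smooth_def by (metis C_k.simps(2))

lemma smooth_continuous_on: "smooth f \<Longrightarrow> continuous_on S f"
  unfolding smooth_def by (metis C_k.simps(1) continuous_on_subset top_greatest)

text \<open>Order \<open>k\<close> is read off from order \<open>Suc k\<close>, which involves only
  the derivative. This serves for primitives, whose derivative is known to be smooth.\<close>

lemma smooth_SucI:
  assumes "\<And>x. (f has_derivative D x) (at x)" "\<And>v. smooth (\<lambda>x. D x v)"
  shows "smooth f"
  unfolding smooth_def
proof
  fix k
  show "C_k k f"
    by (rule C_k_Suc_imp, rule C_k_SucI[OF assms(1)]) (use assms(2) smooth_def in auto)
qed

section \<open>Smooth bump functions and cutoffs of open sets\<close>

definition exp_bump :: "nat \<Rightarrow> real \<Rightarrow> real" where
  "exp_bump k t = (if t > 0 then inverse t ^ k * exp (- inverse t) else 0)"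

lemma exp_bump_at_right_0: "(exp_bump k \<longlongrightarrow> 0) (at_right 0)"
proof -
  have "((\<lambda>t::real. inverse t ^ k / exp (inverse t)) \<longlongrightarrow> 0) (at_right 0)"
    using filterlim_compose[OF tendsto_power_div_exp_0 filterlim_inverse_at_top_right] .
  then show ?thesis
    by (rule Lim_transform_eventually)
       (auto simp: eventually_at_right_field exp_bump_def exp_minus divide_inverse intro!: exI[of _ 1])
qed

text \<open>The powers of \<open>inverse t\<close> are carried along because the family is then
  closed under differentiation up to linear combinations, and smoothness becomes an induction over
  all \<open>k\<close> at once.\<close>

lemma DERIV_exp_bump:
  "(exp_bump k has_real_derivative (exp_bump (k + 2) t - real k * exp_bump (Suc k) t)) (at t)"
proof -
  consider "t > 0" | "t < 0" | "t = 0" by linarith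
  then show ?thesis
  proof cases
    case 1
    have "((\<lambda>t. inverse t ^ k * exp (- inverse t)) has_real_derivative
        (exp_bump (k + 2) t - real k * exp_bump (Suc k) t)) (at t)"
    proof -
      have "((\<lambda>t. inverse t ^ k * exp (- inverse t)) has_real_derivative
          (real k * inverse t ^ (k - Suc 0) * - (inverse t ^ Suc (Suc 0))) * exp (- inverse t)
            + exp (- inverse t) * - (- (inverse t ^ Suc (Suc 0))) * inverse t ^ k) (at t)"
        using 1 by (intro DERIV_mult DERIV_chain2[OF DERIV_exp] DERIV_minus DERIV_inverse
            DERIV_cong[OF DERIV_power[OF DERIV_inverse]]) auto
      moreover have "(real k * inverse t ^ (k - Suc 0) * - (inverse t ^ Suc (Suc 0))) * exp (- inverse t)
            + exp (- inverse t) * - (- (inverse t ^ Suc (Suc 0))) * inverse t ^ k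
          = exp_bump (k + 2) t - real k * exp_bump (Suc k) t"
        using 1 by (cases k) (simp_all add: exp_bump_def power2_eq_square algebra_simps)
      ultimately show ?thesis by (rule DERIV_cong)
    qed
    then show ?thesis
      by (rule has_field_derivative_transform_within_open[where S="{0<..}"])
         (use 1 in \<open>auto simp: exp_bump_def\<close>)
  next
    case 2
    have "((\<lambda>t. 0) has_real_derivative (exp_bump (k + 2) t - real k * exp_bump (Suc k) t)) (at t)"
      using 2 by (simp add: exp_bump_def)
    then show ?thesis
      by (rule has_field_derivative_transform_within_open[where S="{..<0}"])
         (use 2 in \<open>auto simp: exp_bump_def\<close>)
  next
    case 3
    have "((\<lambda>y. (exp_bump k y - exp_bump k 0) / (y - 0)) \<longlongrightarrow> 0) (at 0)"
    proof (rule filterlim_split_at)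
      show "((\<lambda>y. (exp_bump k y - exp_bump k 0) / (y - 0)) \<longlongrightarrow> 0) (at_left 0)"
        by (rule tendsto_eventually) (auto simp: eventually_at_left_field exp_bump_def intro!: exI[of _ "-1"])
      \<comment> \<open>For positive \<open>y\<close> the quotient is
        \<open>exp_bump (Suc k) y\<close>, so its limit is that of another member of the
        family.\<close>
      show "((\<lambda>y. (exp_bump k y - exp_bump k 0) / (y - 0)) \<longlongrightarrow> 0) (at_right 0)"
        by (rule Lim_transform_eventually[OF exp_bump_at_right_0[of "Suc k"]])
           (auto simp: eventually_at_right_field exp_bump_def field_simps intro!: exI[of _ 1])
    qed
    then show ?thesis
      using 3 by (simp add: has_field_derivative_iff exp_bump_def)
  qed
qed

lemma smooth_exp_bump: "smooth (exp_bump k)"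
  unfolding smooth_def
proof
  fix j
  show "C_k j (exp_bump k)"
  proof (induction j arbitrary: k)
    case 0
    then show ?case
      using DERIV_isCont[OF DERIV_exp_bump] by (auto intro!: continuous_at_imp_continuous_on)
  next
    case (Suc j)
    show ?case
    proof (rule C_k_SucI)
      show "(exp_bump k has_derivative
              (\<lambda>v. (exp_bump (k + 2) t + (- real k) *\<^sub>R exp_bump (Suc k) t) * v)) (at t)" for t
        using DERIV_exp_bump[of k t] unfolding has_field_derivative_def by simp
      show "C_k j (\<lambda>t. (exp_bump (k + 2) t + (- real k) *\<^sub>R exp_bump (Suc k) t) * v)" for v
        by (rule C_k_linear_comp[OF bounded_linear_mult_left])
           (intro C_k_add C_k_scaleR C_k_const Suc.IH)
    qed
  qed
qed

lemma exp_bump_le_1: "exp_bump 0 t \<le> 1" and exp_bump_nonneg: "0 \<le> exp_bump 0 t"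
  and exp_bump_pos: "exp_bump 0 t \<noteq> 0 \<longleftrightarrow> t > 0"
  by (auto simp: exp_bump_def)

lemma exp_bump_at_top: "(exp_bump 0 \<longlongrightarrow> 1) at_top"
proof -
  have "((\<lambda>t::real. exp (- inverse t)) \<longlongrightarrow> exp (- 0)) at_top"
    by (intro tendsto_intros tendsto_inverse_0_at_top filterlim_ident)
  then have "((\<lambda>t::real. exp (- inverse t)) \<longlongrightarrow> 1) at_top"
    by simp
  then show ?thesis
    by (rule Lim_transform_eventually)
       (auto simp: exp_bump_def eventually_at_top_linorder intro!: exI[of _ 1])
qed

text \<open>In each factor the inner \<open>n\<close> makes the bump vanish within distance
  \<open>1 / n\<close> of the faces; the outer \<open>n\<close> drives the argument to infinity
  inside the box, where \<open>exp_bump 0\<close> tends to 1.\<close>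

definition box_bump :: "'a::euclidean_space \<Rightarrow> 'a \<Rightarrow> nat \<Rightarrow> 'a \<Rightarrow> real" where
  "box_bump a b n x = (\<Prod>i\<in>Basis. exp_bump 0 (real n * (real n * (x \<bullet> i - a \<bullet> i) - 1))
                                * exp_bump 0 (real n * (real n * (b \<bullet> i - x \<bullet> i) - 1)))"

lemma smooth_box_bump: "smooth (box_bump a b n)"
  unfolding box_bump_def
  by (intro smooth_prod smooth_mult smooth_compose[OF smooth_exp_bump] smooth_diff smooth_const
      smooth_linear_comp[OF bounded_linear_inner_left smooth_id])

lemma box_bump_bounds: "0 \<le> box_bump a b n x" "box_bump a b n x \<le> 1"
  unfolding box_bump_def
  by (auto intro!: prod_nonneg prod_le_1 mult_nonneg_nonneg mult_le_one exp_bump_nonneg exp_bump_le_1)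

lemma box_bump_support:
  obtains c d where "\<And>x. box_bump a b n x \<noteq> 0 \<Longrightarrow> x \<in> cbox c d" "cbox c d \<subseteq> box a b"
proof (cases "n = 0")
  \<comment> \<open>For \<open>n = 0\<close> every argument is 0, so the bump vanishes identically
    and the empty box with corners \<open>One\<close> and \<open>0\<close> will do.\<close>
  case True
  show ?thesis
    by (rule that[of One 0])
      (use True in \<open>force simp: box_bump_def exp_bump_def mem_box\<close>)+
next
  case False
  define c where "c = a + (1 / real n) *\<^sub>R One"
  define d where "d = b - (1 / real n) *\<^sub>R One"
  show ?thesis
  proof (rule that[of c d])
    fix x assume "box_bump a b n x \<noteq> 0"
    then have "real n * (real n * (x \<bullet> i - a \<bullet> i) - 1) > 0" "real n * (real n * (b \<bullet> i - x \<bullet> i) - 1) > 0"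
      if "i \<in> Basis" for i
      using that by (auto simp: box_bump_def exp_bump_pos)
    then have "real n * (x \<bullet> i - a \<bullet> i) > 1" "real n * (b \<bullet> i - x \<bullet> i) > 1" if "i \<in> Basis" for i
      using that False by (simp_all add: zero_less_mult_iff)
    then show "x \<in> cbox c d"
      using False by (fastforce simp: mem_box c_def d_def algebra_simps field_simps)
  next
    show "cbox c d \<subseteq> box a b"
    proof
      fix x assume x: "x \<in> cbox c d"
      have "a \<bullet> i < x \<bullet> i \<and> x \<bullet> i < b \<bullet> i" if "i \<in> Basis" for i
      proof -
        have "0 < 1 / real n" using False by simp
        moreover have "a \<bullet> i + 1 / real n \<le> x \<bullet> i \<and> x \<bullet> i \<le> b \<bullet> i - 1 / real n"
          using x that by (simp add: mem_box c_def d_def inner_add_left inner_diff_left)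
        ultimately show ?thesis by linarith
      qed
      then show "x \<in> box a b" by (simp add: mem_box)
    qed
  qed
qed

lemma box_bump_tendsto:
  assumes "x \<in> box a b"
  shows "(\<lambda>n. box_bump a b n x) \<longlonglongrightarrow> 1"
proof -
  have *: "(\<lambda>n. exp_bump 0 (real n * (real n * e - 1))) \<longlonglongrightarrow> 1" if "e > 0" for e
  proof (rule filterlim_compose[OF exp_bump_at_top])
    have "filterlim (\<lambda>n. real n * e) at_top sequentially"
      using that by (simp add: filterlim_tendsto_pos_mult_at_top[OF tendsto_const] filterlim_real_sequentially mult.commute)
    then have "filterlim (\<lambda>n. -1 + real n * e) at_top sequentially"
      by (rule filterlim_tendsto_add_at_top[OF tendsto_const])
    from filterlim_at_top_mult_at_top[OF filterlim_real_sequentially this]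
    show "filterlim (\<lambda>n. real n * (real n * e - 1)) at_top sequentially"
      by (simp add: algebra_simps)
  qed
  have "(\<lambda>n. box_bump a b n x) \<longlonglongrightarrow> (\<Prod>i\<in>(Basis::'a set). 1 * 1)"
    unfolding box_bump_def
    by (intro tendsto_prod tendsto_mult *) (use assms in \<open>auto simp: mem_box\<close>)
  then show ?thesis by simp
qed

text \<open>\<open>W\<close> is a countable union of boxes. One minus the product of
  \<open>1 - \<psi> j n x\<close> over the first \<open>n\<close> boxes is a smooth union: it stays
  between 0 and 1, is supported in finitely many closed boxes and is at least as large as each
  single bump. The index \<open>n\<close> governs both the number of boxes and the sharpness of the
  bumps.\<close>

lemma test_functions_cutoff:
  fixes W :: "'a::euclidean_space set"
  assumes "open W"
  obtains \<phi> where "\<And>n. \<phi> n \<in> test_functions W" "\<And>n x. 0 \<le> \<phi> n x" "\<And>n x. \<phi> n x \<le> 1"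
    "\<And>x. (\<lambda>n. \<phi> n x) \<longlonglongrightarrow> indicat_real W x"
proof (cases "W = {}")
  case True
  show ?thesis
    by (rule that[of "\<lambda>n x. 0"]) (use True in \<open>auto simp: test_functions_def smooth_const\<close>)
next
  case False
  obtain \<D> where D: "countable \<D>" "\<D> \<subseteq> Pow W" "\<And>X. X \<in> \<D> \<Longrightarrow> \<exists>a b. X = box a b" "\<Union>\<D> = W"
    using open_countable_Union_open_box[OF assms] by blast
  have ne: "\<D> \<noteq> {}" using D False by auto
  define X where "X = from_nat_into \<D>"
  have rX: "range X = \<D>" using ne D(1) by (simp add: X_def range_from_nat_into)
  then have "\<exists>a b. X j = box a b" for j using D(3) by auto
  then obtain a b where X: "\<And>j. X j = box (a j) (b j)" by metis
  define \<psi> where "\<psi> j = box_bump (a j) (b j)" for j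
  define \<phi> where "\<phi> n x = 1 - (\<Prod>j<n. 1 - \<psi> j n x)" for n x
  have psi: "0 \<le> \<psi> j n x" "\<psi> j n x \<le> 1" for j n x
    by (simp_all add: \<psi>_def box_bump_bounds)
  show ?thesis
  proof (rule that[of \<phi>])
    fix n x
    have "(\<Prod>j<n. 1 - \<psi> j n x) \<le> 1" "0 \<le> (\<Prod>j<n. 1 - \<psi> j n x)"
      using psi by (auto intro!: prod_le_1 prod_nonneg)
    then show "0 \<le> \<phi> n x" "\<phi> n x \<le> 1" by (auto simp: \<phi>_def)
  next
    fix n
    have "\<exists>K. (\<forall>x. \<psi> j n x \<noteq> 0 \<longrightarrow> x \<in> K) \<and> compact K \<and> K \<subseteq> W" for j
    proof -
      obtain c d where "\<And>x. \<psi> j n x \<noteq> 0 \<Longrightarrow> x \<in> cbox c d" "cbox c d \<subseteq> box (a j) (b j)"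
        unfolding \<psi>_def using box_bump_support by metis
      moreover have "box (a j) (b j) \<subseteq> W" using X[of j] rX D(2) by auto
      ultimately show ?thesis using compact_cbox by blast
    qed
    then obtain K where K: "\<And>j x. \<psi> j n x \<noteq> 0 \<Longrightarrow> x \<in> K j" "\<And>j. compact (K j)" "\<And>j. K j \<subseteq> W"
      by metis
    have sub: "{x. \<phi> n x \<noteq> 0} \<subseteq> (\<Union>j<n. K j)"
    proof
      fix x assume "x \<in> {x. \<phi> n x \<noteq> 0}"
      then have "(\<Prod>j<n. 1 - \<psi> j n x) \<noteq> 1" by (simp add: \<phi>_def)
      then have "\<exists>j<n. \<psi> j n x \<noteq> 0"
        by (metis (mono_tags, lifting) diff_zero lessThan_iff prod.neutral)
      then show "x \<in> (\<Union>j<n. K j)" using K(1) by auto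
    qed
    have cK: "compact (\<Union>j<n. K j)" using K(2) by auto
    then have cl: "closure {x. \<phi> n x \<noteq> 0} \<subseteq> (\<Union>j<n. K j)"
      using sub closure_minimal compact_imp_closed by blast
    have "smooth (\<phi> n)"
      unfolding \<phi>_def
      by (intro smooth_diff smooth_const smooth_prod) (auto simp: \<psi>_def smooth_box_bump)
    moreover have "compact (closure {x. \<phi> n x \<noteq> 0})"
      using cl cK by (meson closed_closure compact_closure compact_imp_bounded bounded_subset compact_eq_bounded_closed)
    ultimately show "\<phi> n \<in> test_functions W"
      using cl K(3) by (auto simp: test_functions_def)
  next
    fix x
    show "(\<lambda>n. \<phi> n x) \<longlonglongrightarrow> indicat_real W x"
    proof (cases "x \<in> W")
      case True
      then obtain j where j: "x \<in> box (a j) (b j)"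
        using D(4) rX X by (metis UnionE imageE)
      have "(\<lambda>n. \<phi> n x) \<longlonglongrightarrow> 1"
      proof (rule tendsto_sandwich[OF _ _ _ tendsto_const])
        show "(\<lambda>n. \<psi> j n x) \<longlonglongrightarrow> 1" using box_bump_tendsto[OF j] by (simp add: \<psi>_def)
        show "\<forall>\<^sub>F n in sequentially. \<psi> j n x \<le> \<phi> n x"
          unfolding eventually_sequentially
        proof (intro exI[of _ "Suc j"] allI impI)
          fix n assume "Suc j \<le> n"
          then have "(\<Prod>i<n. 1 - \<psi> i n x) = (1 - \<psi> j n x) * (\<Prod>i\<in>{..<n}-{j}. 1 - \<psi> i n x)"
            by (intro prod.remove) auto
          also have "\<dots> \<le> (1 - \<psi> j n x) * 1"
            using psi by (intro mult_left_mono prod_le_1) auto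
          finally show "\<psi> j n x \<le> \<phi> n x" by (simp add: \<phi>_def)
        qed
        show "\<forall>\<^sub>F n in sequentially. \<phi> n x \<le> 1"
          using psi by (auto simp: \<phi>_def intro!: always_eventually prod_nonneg)
      qed
      then show ?thesis using True by simp
    next
      case False
      then have "\<psi> j n x = 0" for j n
        using box_bump_support[of "a j" "b j" n] X[of j] rX D(2) unfolding \<psi>_def
        by (metis PowD rangeI subsetD)
      then show ?thesis using False by (simp add: \<phi>_def)
    qed
  qed
qed

section \<open>The fundamental lemma and integral inequalities\<close>

lemma complete_measure_lebesgue_on:
  assumes "S \<in> sets lebesgue"
  shows "complete_measure (lebesgue_on S)"
proof
  fix A B :: "'a set" assume "B \<subseteq> A" "A \<in> null_sets (lebesgue_on S)"
  then have "B \<in> null_sets lebesgue" "B \<subseteq> S"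
    using assms completion.complete2 null_sets_restrict_space by (blast, metis assms sets.sets_into_space[of A "lebesgue_on S"] null_setsD2 space_lebesgue_on subset_trans)
  then show "B \<in> sets (lebesgue_on S)"
    using assms by (simp add: sets_restrict_space_iff null_setsD2)
qed

lemma borel_measurable_lebesgue_on_AE_cong:
  fixes f g :: "'a::euclidean_space \<Rightarrow> 'b::topological_space"
  assumes S: "S \<in> sets lebesgue" and f: "f \<in> borel_measurable (lebesgue_on S)"
    and ae: "AE x in lebesgue_on S. f x = g x"
  shows "g \<in> borel_measurable (lebesgue_on S)"
proof (rule measurableI)
  interpret complete_measure "lebesgue_on S" by (rule complete_measure_lebesgue_on[OF S])
  fix A :: "'b set" assume A: "A \<in> sets borel"
  show "g -` A \<inter> space (lebesgue_on S) \<in> sets (lebesgue_on S)"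
  proof (rule in_sets_AE)
    show "AE x in lebesgue_on S. x \<in> f -` A \<inter> space (lebesgue_on S) \<longleftrightarrow> x \<in> g -` A \<inter> space (lebesgue_on S)"
      using ae by eventually_elim auto
    show "f -` A \<inter> space (lebesgue_on S) \<in> sets (lebesgue_on S)"
      using f A by (rule measurable_sets)
  qed auto
qed auto

lemma borel_measurable_lebesgue_on_AE_lim:
  fixes f :: "nat \<Rightarrow> 'a::euclidean_space \<Rightarrow> real"
  assumes S: "S \<in> sets lebesgue" and f: "\<And>k. f k \<in> borel_measurable (lebesgue_on S)"
    and ae: "AE x in lebesgue_on S. (\<lambda>k. f k x) \<longlonglongrightarrow> g x"
  shows "g \<in> borel_measurable (lebesgue_on S)"
proof (rule borel_measurable_lebesgue_on_AE_cong[OF S])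
  show "(\<lambda>x. lim (\<lambda>k. f k x)) \<in> borel_measurable (lebesgue_on S)"
    using f by measurable
  show "AE x in lebesgue_on S. lim (\<lambda>k. f k x) = g x"
    using ae by eventually_elim (simp add: limI)
qed

text \<open>By outer regularity a measurable \<open>S\<close> differs by a null set from a
  decreasing intersection of open sets, so the vanishing integrals extend from open to all
  measurable subsets. The sets where \<open>f\<close> is positive or negative then must be
  null.\<close>

lemma AE_zero_of_integrals_over_open:
  fixes f :: "'a::euclidean_space \<Rightarrow> real"
  assumes U: "open U" and f: "integrable (lebesgue_on U) f"
    and int: "\<And>W. open W \<Longrightarrow> W \<subseteq> U \<Longrightarrow> (LINT x|lebesgue_on U. indicat_real W x * f x) = 0"
  shows "AE x in lebesgue_on U. f x = 0"
proof -
  have Uleb: "U \<in> sets lebesgue" using U by auto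
  have [measurable]: "f \<in> borel_measurable (lebesgue_on U)" using f by auto
  have zero: "(LINT x|lebesgue_on U. indicat_real S x * f x) = 0" if S: "S \<in> sets lebesgue" "S \<subseteq> U" for S
  proof -
    have "\<exists>T. open T \<and> S \<subseteq> T \<and> (T - S) \<in> lmeasurable \<and> emeasure lebesgue (T - S) < ennreal (1 / Suc n)" for n
      using sets_lebesgue_outer_open[OF S(1), of "1 / Suc n"] by (metis of_nat_0_less_iff zero_less_Suc zero_less_divide_1_iff)
    then obtain T where T: "\<And>n. open (T n)" "\<And>n. S \<subseteq> T n" "\<And>n. (T n - S) \<in> lmeasurable"
      "\<And>n. emeasure lebesgue (T n - S) < ennreal (1 / Suc n)" by metis
    define W where "W n = U \<inter> (\<Inter>i\<le>n. T i)" for n :: nat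
    have Wopen: "open (W n)" for n unfolding W_def using U T(1) by auto
    define N where "N = (\<Inter>n. T n) - S"
    have Nsets: "N \<in> sets lebesgue" unfolding N_def using T(1) S(1) by auto
    have "emeasure lebesgue N \<le> ennreal (1 / Suc n)" for n
    proof -
      have "emeasure lebesgue N \<le> emeasure lebesgue (T n - S)"
        by (rule emeasure_mono) (use T(3) in \<open>auto simp: N_def\<close>)
      then show ?thesis using T(4)[of n] by (meson less_imp_le order_trans)
    qed
    moreover have "(\<lambda>n. ennreal (1 / Suc n)) \<longlonglongrightarrow> ennreal 0"
      using LIMSEQ_inverse_real_of_nat by (intro tendsto_ennrealI) (simp add: inverse_eq_divide)
    ultimately have "emeasure lebesgue N \<le> 0"
      by (metis LIMSEQ_le_const ennreal_0)
    then have "AE x in lebesgue. x \<notin> N" using Nsets by (intro AE_not_in) auto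
    then have aeN: "AE x in lebesgue_on U. x \<notin> N"
      using Uleb by (simp add: AE_restrict_space_iff) (auto elim: eventually_mono)
    have "(\<lambda>n. LINT x|lebesgue_on U. indicat_real (W n) x * f x) \<longlonglongrightarrow> (LINT x|lebesgue_on U. indicat_real S x * f x)"
    proof (rule integral_dominated_convergence[where w="\<lambda>x. \<bar>f x\<bar>"])
      have "S \<in> sets (lebesgue_on U)" "\<And>n. W n \<in> sets (lebesgue_on U)"
        using S Uleb Wopen by (auto simp: sets_restrict_space_iff W_def)
      then show "(\<lambda>x. indicat_real S x * f x) \<in> borel_measurable (lebesgue_on U)"
        "\<And>n. (\<lambda>x. indicat_real (W n) x * f x) \<in> borel_measurable (lebesgue_on U)"
        by measurable
      show "integrable (lebesgue_on U) (\<lambda>x. \<bar>f x\<bar>)" using f by auto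
      show "AE x in lebesgue_on U. norm (indicat_real (W n) x * f x) \<le> \<bar>f x\<bar>" for n
        by (auto simp: indicator_def)
      have "x \<notin> N \<longrightarrow> (\<lambda>n. indicat_real (W n) x * f x) \<longlonglongrightarrow> indicat_real S x * f x" if "x \<in> U" for x
      proof
        assume "x \<notin> N"
        have "\<exists>k. \<forall>n\<ge>k. indicat_real (W n) x = indicat_real S x"
        proof (cases "x \<in> S")
          case True
          then show ?thesis using T(2) S(2) by (auto simp: W_def indicator_def)
        next
          case False
          then obtain i where "x \<notin> T i" using \<open>x \<notin> N\<close> by (auto simp: N_def)
          then show ?thesis using False by (intro exI[of _ i]) (auto simp: W_def indicator_def)
        qed
        then have "(\<lambda>n. indicat_real (W n) x) \<longlonglongrightarrow> indicat_real S x"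
          by (intro tendsto_eventually) (auto simp: eventually_sequentially)
        then show "(\<lambda>n. indicat_real (W n) x * f x) \<longlonglongrightarrow> indicat_real S x * f x"
          by (intro tendsto_intros)
      qed
      then show "AE x in lebesgue_on U. (\<lambda>n. indicat_real (W n) x * f x) \<longlonglongrightarrow> indicat_real S x * f x"
        using aeN AE_space by (auto elim!: eventually_elim2)
    qed
    moreover have "(LINT x|lebesgue_on U. indicat_real (W n) x * f x) = 0" for n
      by (rule int[OF Wopen]) (auto simp: W_def)
    ultimately show ?thesis
      by (simp add: LIMSEQ_const_iff)
  qed
  \<comment> \<open>The sign \<open>s\<close> covers the positive and the negative set in one
    argument.\<close>
  have half: "AE x in lebesgue_on U. \<not> s * f x > 0" for s :: real
  proof -
    define S where "S = {x\<in>space (lebesgue_on U). s * f x > 0}"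
    have S': "S \<in> sets (lebesgue_on U)" unfolding S_def by measurable
    then have "S \<in> sets lebesgue" "S \<subseteq> U"
      using Uleb by (auto simp: sets_restrict_space_iff S_def)
    then have "s * (LINT x|lebesgue_on U. indicat_real S x * f x) = 0" using zero by simp
    then have i0: "(LINT x|lebesgue_on U. s * (indicat_real S x * f x)) = 0"
      by simp
    have "AE x in lebesgue_on U. s * (indicat_real S x * f x) = 0"
    proof (rule integral_nonneg_eq_0_iff_AE[THEN iffD1, OF _ _ i0])
      show "integrable (lebesgue_on U) (\<lambda>x. s * (indicat_real S x * f x))"
        using integrable_real_mult_indicator[OF S' f] by (intro integrable_mult_right) (simp add: mult.commute)
      show "AE x in lebesgue_on U. 0 \<le> s * (indicat_real S x * f x)"
        by (auto simp: S_def indicator_def)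
    qed
    then show ?thesis
      using AE_space by eventually_elim (auto simp: S_def indicator_def)
  qed
  show ?thesis
    using half[of 1] half[of "-1"] by eventually_elim auto
qed

lemma test_functions_mono: "W \<subseteq> U \<Longrightarrow> test_functions W \<subseteq> test_functions U"
  by (auto simp: test_functions_def)

lemma test_functions_measurable:
  fixes \<phi> :: "'a::euclidean_space \<Rightarrow> real"
  assumes "\<phi> \<in> test_functions U"
  shows "\<phi> \<in> borel_measurable (lebesgue_on S)"
  using assms smooth_continuous_on[of \<phi> UNIV]
  by (intro measurable_restrict_space1 measurable_completion)
     (auto simp: test_functions_def borel_measurable_continuous_onI)

text \<open>The cutoffs of an open set are test functions bounded by 1 that tend to its indicator,
  so dominated convergence with bound \<open>\<bar>f x\<bar>\<close> reduces the claim to integrals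
  over open sets.\<close>

lemma fundamental_lemma_calculus_of_variations:
  fixes f :: "'a::euclidean_space \<Rightarrow> real"
  assumes U: "open U" and f: "integrable (lebesgue_on U) f"
    and int: "\<And>\<phi>. \<phi> \<in> test_functions U \<Longrightarrow> (LINT x|lebesgue_on U. f x * \<phi> x) = 0"
  shows "AE x in lebesgue_on U. f x = 0"
proof (rule AE_zero_of_integrals_over_open[OF U f])
  fix W assume W: "open W" "W \<subseteq> U"
  obtain \<phi> where \<phi>: "\<And>n. \<phi> n \<in> test_functions W" "\<And>n x. 0 \<le> \<phi> n x" "\<And>n x. \<phi> n x \<le> 1"
    "\<And>x. (\<lambda>n. \<phi> n x) \<longlonglongrightarrow> indicat_real W x"
    using test_functions_cutoff[OF W(1)] by metis
  have [measurable]: "f \<in> borel_measurable (lebesgue_on U)" using f by auto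
  have [measurable]: "\<phi> n \<in> borel_measurable (lebesgue_on U)" for n
    using test_functions_measurable[OF \<phi>(1)] .
  have "(\<lambda>n. LINT x|lebesgue_on U. f x * \<phi> n x) \<longlonglongrightarrow> (LINT x|lebesgue_on U. indicat_real W x * f x)"
  proof (rule integral_dominated_convergence[where w="\<lambda>x. \<bar>f x\<bar>"])
    have "W \<in> sets (lebesgue_on U)"
      using W U by (auto simp: sets_restrict_space_iff)
    then show "(\<lambda>x. indicat_real W x * f x) \<in> borel_measurable (lebesgue_on U)" by measurable
    show "AE x in lebesgue_on U. norm (f x * \<phi> n x) \<le> \<bar>f x\<bar>" for n
      using \<phi>(2,3) by (auto simp: abs_mult mult_left_le)
    show "AE x in lebesgue_on U. (\<lambda>n. f x * \<phi> n x) \<longlonglongrightarrow> indicat_real W x * f x"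
      by (rule AE_I2) (subst mult.commute, intro tendsto_intros \<phi>(4))
  qed (use f in auto)
  moreover have "(LINT x|lebesgue_on U. f x * \<phi> n x) = 0" for n
    using int test_functions_mono[OF W(2)] \<phi>(1) by blast
  ultimately show "(LINT x|lebesgue_on U. indicat_real W x * f x) = 0"
    by (simp add: LIMSEQ_const_iff)
qed

section \<open>Hoelder and Minkowski inequalities\<close>

lemma weighted_am_gm:
  fixes x y a b :: real
  assumes "0 < a" "0 < b" "a + b = 1" "0 \<le> x" "0 \<le> y"
  shows "x powr a * y powr b \<le> a * x + b * y"
proof (cases "x = 0 \<or> y = 0")
  case False
  then show ?thesis using Youngs_inequality_0[of a b x y] assms by simp
qed (use assms in auto)

text \<open>The exponents act on nonnegative integrable functions; with \<open>f\<close> and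
  \<open>g\<close> powers of norms this is the usual form. After division by the two integrals it is
  the pointwise weighted mean inequality, and a zero integral makes the product vanish almost
  everywhere.\<close>

lemma Holder_integral2:
  fixes f g :: "'a \<Rightarrow> real"
  assumes ab: "0 < a" "0 < b" "a + b = 1"
    and f: "integrable M f" "\<And>x. 0 \<le> f x" and g: "integrable M g" "\<And>x. 0 \<le> g x"
  shows "integrable M (\<lambda>x. f x powr a * g x powr b)" (is ?I)
    and "(LINT x|M. f x powr a * g x powr b) \<le> (LINT x|M. f x) powr a * (LINT x|M. g x) powr b" (is ?le)
proof -
  have [measurable]: "f \<in> borel_measurable M" "g \<in> borel_measurable M" using f g by auto
  have le: "f x powr a * g x powr b \<le> a * f x + b * g x" for x
    using weighted_am_gm ab f(2) g(2) by simp
  show I: ?I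
  proof (rule Bochner_Integration.integrable_bound)
    show "integrable M (\<lambda>x. a * f x + b * g x)" using f g by auto
    show "AE x in M. norm (f x powr a * g x powr b) \<le> norm (a * f x + b * g x)"
      using le f g ab by (auto intro!: AE_I2 simp: abs_mult abs_of_nonneg)
  qed measurable
  define F where "F = (LINT x|M. f x)"
  define G where "G = (LINT x|M. g x)"
  have nn: "F \<ge> 0" "G \<ge> 0" using f g by (auto simp: F_def G_def)
  show ?le
  proof (cases "F = 0 \<or> G = 0")
    case True
    then have "(AE x in M. f x = 0) \<or> (AE x in M. g x = 0)"
      using integral_nonneg_eq_0_iff_AE[OF f(1)] integral_nonneg_eq_0_iff_AE[OF g(1)] f g
      by (auto simp: F_def G_def)
    then have "AE x in M. f x powr a * g x powr b = 0" by (auto elim: eventually_mono)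
    then have "(LINT x|M. f x powr a * g x powr b) = 0"
      by (rule integral_eq_zero_AE)
    then show ?thesis by simp
  next
    case False
    then have pos: "F > 0" "G > 0" using nn by auto
    have "f x powr a * g x powr b \<le> F powr a * G powr b * (a * (f x / F) + b * (g x / G))" for x
    proof -
      have "f x powr a * g x powr b = F powr a * G powr b * ((f x / F) powr a * (g x / G) powr b)"
        using pos f g by (simp add: powr_divide)
      also have "\<dots> \<le> F powr a * G powr b * (a * (f x / F) + b * (g x / G))"
        using weighted_am_gm[OF ab, of "f x / F" "g x / G"] f g pos by (intro mult_left_mono) auto
      finally show ?thesis .
    qed
    then have "(LINT x|M. f x powr a * g x powr b) \<le> (LINT x|M. F powr a * G powr b * (a * (f x / F) + b * (g x / G)))"
      using I f g by (intro integral_mono) auto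
    also have "\<dots> = F powr a * G powr b * (a * (F / F) + b * (G / G))"
      using f g by (simp add: F_def G_def)
    also have "\<dots> = F powr a * G powr b" using pos ab by simp
    finally show ?thesis by (simp add: F_def G_def)
  qed
qed

text \<open>\<open>g\<close> and \<open>h\<close> are merged into one function with weights
  \<open>b / (b + c)\<close> and \<open>c / (b + c)\<close>, which leaves two factors.\<close>

lemma Holder_integral3:
  fixes f g h :: "'a \<Rightarrow> real"
  assumes ab: "0 < a" "0 < b" "0 < c" "a + b + c = 1"
    and f: "integrable M f" "\<And>x. 0 \<le> f x" and g: "integrable M g" "\<And>x. 0 \<le> g x"
    and h: "integrable M h" "\<And>x. 0 \<le> h x"
  shows "integrable M (\<lambda>x. f x powr a * g x powr b * h x powr c)" (is ?I)
    and "(LINT x|M. f x powr a * g x powr b * h x powr c)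
      \<le> (LINT x|M. f x) powr a * (LINT x|M. g x) powr b * (LINT x|M. h x) powr c" (is ?le)
proof -
  define k where "k x = g x powr (b/(b+c)) * h x powr (c/(b+c))" for x
  have bc: "0 < b / (b+c)" "0 < c / (b+c)" "b/(b+c) + c/(b+c) = 1"
    using ab by (auto simp: add_divide_distrib[symmetric])
  have k: "integrable M k" "\<And>x. 0 \<le> k x"
    and kle: "(LINT x|M. k x) \<le> (LINT x|M. g x) powr (b/(b+c)) * (LINT x|M. h x) powr (c/(b+c))"
    using Holder_integral2[OF bc g h] unfolding k_def[abs_def] by (auto intro!: mult_nonneg_nonneg)
  have *: "(x powr (b/(b+c)) * y powr (c/(b+c))) powr (b + c) = x powr b * y powr c" for x y :: real
    using ab by (simp add: powr_mult powr_powr)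
  have eq: "f x powr a * g x powr b * h x powr c = f x powr a * k x powr (b + c)" for x
    unfolding k_def * by (simp add: mult.assoc)
  have ab': "0 < a" "0 < b + c" "a + (b + c) = 1" using ab by auto
  show ?I unfolding eq using Holder_integral2(1)[OF ab' f k] .
  have "(LINT x|M. f x powr a * g x powr b * h x powr c) \<le> (LINT x|M. f x) powr a * (LINT x|M. k x) powr (b + c)"
    unfolding eq using Holder_integral2(2)[OF ab' f k] .
  also have "\<dots> \<le> (LINT x|M. f x) powr a * ((LINT x|M. g x) powr (b/(b+c)) * (LINT x|M. h x) powr (c/(b+c))) powr (b + c)"
    using kle k ab by (intro mult_left_mono powr_mono2) auto
  finally show ?le unfolding * by (simp add: mult.assoc)
qed

lemma convex_powr_nonneg:
  fixes x y a b p :: real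
  assumes "0 \<le> a" "0 \<le> b" "a + b = 1" "0 \<le> x" "0 \<le> y" "1 \<le> p"
  shows "(a * x + b * y) powr p \<le> a * x powr p + b * y powr p"
proof -
  \<comment> \<open>If \<open>x\<close> or \<open>y\<close> is 0, a single term is left and
    \<open>a powr p \<le> a\<close> for \<open>a\<close> between 0 and 1 settles it.\<close>
  have *: "(a * x) powr p \<le> a * x powr p" if "0 \<le> a" "a \<le> 1" "0 \<le> x" for a x
  proof -
    have "a powr p \<le> a powr 1" using powr_mono_both'[of 1 p a a] that assms
      by (cases "a = 0") (auto simp: powr_mono')
    then show ?thesis using that by (simp add: powr_mult mult_right_mono)
  qed
  consider "x = 0" | "y = 0" | "x > 0 \<and> y > 0" using assms by linarith
  then show ?thesis
  proof cases
    case 3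
    have a: "a = 1 - b" using assms by simp
    show ?thesis
      unfolding a using convex_onD[OF powr_convex[OF assms(6)], of b x y] assms 3 by simp
  qed (use *[of b y] *[of a x] assms in auto)
qed

text \<open>With \<open>A\<close> and \<open>B\<close> the two norms, the sum of the pointwise norms
  is \<open>A + B\<close> times a convex combination of the normalised functions; convexity of the
  power and integration give the bound. The same inequality with \<open>A = B = 1\<close> yields
  integrability, and a vanishing norm makes one function zero almost everywhere.\<close>

lemma Minkowski_integral:
  fixes u v :: "'a \<Rightarrow> 'b::euclidean_space"
  assumes p: "1 \<le> p" and u[measurable]: "u \<in> borel_measurable M" and ui: "integrable M (\<lambda>x. norm (u x) powr p)"
    and v[measurable]: "v \<in> borel_measurable M" and vi: "integrable M (\<lambda>x. norm (v x) powr p)"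
  shows "integrable M (\<lambda>x. norm (u x + v x) powr p)" (is ?I)
    and "(LINT x|M. norm (u x + v x) powr p) powr (1/p)
       \<le> (LINT x|M. norm (u x) powr p) powr (1/p) + (LINT x|M. norm (v x) powr p) powr (1/p)" (is ?le)
proof -
  have conv: "norm (u x + v x) powr p \<le> (A + B) powr p * (A / (A + B) * (norm (u x) / A) powr p + B / (A + B) * (norm (v x) / B) powr p)"
    if "A > 0" "B > 0" for A B x
  proof -
    have "norm (u x + v x) powr p \<le> ((A + B) * (A / (A + B) * (norm (u x) / A) + B / (A + B) * (norm (v x) / B))) powr p"
    proof (rule powr_mono2)
      have "(A + B) * (A / (A + B) * (norm (u x) / A) + B / (A + B) * (norm (v x) / B)) = norm (u x) + norm (v x)"
        using that by (simp add: distrib_left)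
      then show "norm (u x + v x) \<le> (A + B) * (A / (A + B) * (norm (u x) / A) + B / (A + B) * (norm (v x) / B))"
        using norm_triangle_ineq by metis
    qed (use p in auto)
    also have "\<dots> = (A + B) powr p * (A / (A + B) * (norm (u x) / A) + B / (A + B) * (norm (v x) / B)) powr p"
      using that by (simp add: powr_mult)
    also have "\<dots> \<le> (A + B) powr p * (A / (A + B) * (norm (u x) / A) powr p + B / (A + B) * (norm (v x) / B) powr p)"
      using that p by (intro mult_left_mono convex_powr_nonneg) (auto simp: add_divide_distrib[symmetric])
    finally show ?thesis .
  qed
  have conv': "norm (u x + v x) powr p \<le> (A + B) powr p * (A / (A + B) * (norm (u x) powr p / A powr p) + B / (A + B) * (norm (v x) powr p / B powr p))"
    if "A > 0" "B > 0" for A B x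
    using conv[OF that, of x] that by (simp add: powr_divide)
  show I: ?I
  proof (rule Bochner_Integration.integrable_bound)
    show "integrable M (\<lambda>x. (1 + 1) powr p * (1 / (1 + 1) * (norm (u x) powr p / 1 powr p) + 1 / (1 + 1) * (norm (v x) powr p / 1 powr p)))"
      using ui vi by auto
    show "AE x in M. norm (norm (u x + v x) powr p) \<le> norm ((1 + 1) powr p * (1 / (1 + 1) * (norm (u x) powr p / 1 powr p) + 1 / (1 + 1) * (norm (v x) powr p / 1 powr p)))"
      using conv'[of 1 1] by (intro AE_I2) (smt (verit) powr_ge_zero real_norm_def)
  qed measurable
  define A where "A = (LINT x|M. norm (u x) powr p) powr (1/p)"
  define B where "B = (LINT x|M. norm (v x) powr p) powr (1/p)"
  have nn: "A \<ge> 0" "B \<ge> 0" by (auto simp: A_def B_def)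
  have Ap: "A powr p = (LINT x|M. norm (u x) powr p)" "B powr p = (LINT x|M. norm (v x) powr p)"
    using p by (auto simp: A_def B_def powr_powr)
  show ?le
  proof (cases "A = 0 \<or> B = 0")
    case True
    then have "(LINT x|M. norm (u x) powr p) = 0 \<or> (LINT x|M. norm (v x) powr p) = 0"
      by (auto simp: A_def B_def)
    then have "(AE x in M. u x = 0) \<or> (AE x in M. v x = 0)"
      using integral_nonneg_eq_0_iff_AE[OF ui] integral_nonneg_eq_0_iff_AE[OF vi] p by auto
    then have "(LINT x|M. norm (u x + v x) powr p) = (LINT x|M. norm (v x) powr p)
       \<or> (LINT x|M. norm (u x + v x) powr p) = (LINT x|M. norm (u x) powr p)"
    proof
      assume "AE x in M. u x = 0"
      then show ?thesis by (intro disjI1 integral_cong_AE) (measurable, auto elim: eventually_mono)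
    next
      assume "AE x in M. v x = 0"
      then show ?thesis by (intro disjI2 integral_cong_AE) (measurable, auto elim: eventually_mono)
    qed
    then show ?thesis using nn by (auto simp: A_def B_def)
  next
    case False
    then have pos: "A > 0" "B > 0" using nn by auto
    have "(LINT x|M. norm (u x + v x) powr p)
      \<le> (LINT x|M. (A + B) powr p * (A / (A + B) * (norm (u x) powr p / A powr p) + B / (A + B) * (norm (v x) powr p / B powr p)))"
      using conv'[OF pos] I ui vi by (intro integral_mono) auto
    also have "\<dots> = (A + B) powr p * (A / (A + B) * (A powr p / A powr p) + B / (A + B) * (B powr p / B powr p))"
      unfolding Ap using ui vi by simp
    also have "\<dots> = (A + B) powr p" using pos by (simp add: add_divide_distrib[symmetric])
    finally have "(LINT x|M. norm (u x + v x) powr p) powr (1/p) \<le> ((A + B) powr p) powr (1/p)"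
      using p by (intro powr_mono2) auto
    also have "\<dots> = A + B" using pos p by (simp add: powr_powr)
    finally show ?thesis by (simp add: A_def B_def)
  qed
qed

section \<open>Seminormed spaces and Bochner spaces\<close>

text \<open>A single interface for the spatial spaces and for their duals. Their elements are
  representatives, hence a seminorm on a carrier inside a function type.\<close>

locale seminormed_space =
  fixes X :: "'a::real_vector set" and N :: "'a \<Rightarrow> real"
  assumes subspace: "subspace X"
    and nonneg: "u \<in> X \<Longrightarrow> 0 \<le> N u"
    and triangle: "u \<in> X \<Longrightarrow> v \<in> X \<Longrightarrow> N (u + v) \<le> N u + N v"
    and homogeneous: "u \<in> X \<Longrightarrow> N (a *\<^sub>R u) = \<bar>a\<bar> * N u"
begin

lemmas zero_mem = subspace_0[OF subspace]
lemmas add_mem = subspace_add[OF subspace]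
lemmas diff_mem = subspace_diff[OF subspace]
lemmas scale_mem = subspace_mul[OF subspace]

lemma N_zero: "N 0 = 0"
  using homogeneous[OF zero_mem, of 0] by simp

lemma N_minus: "u \<in> X \<Longrightarrow> N (- u) = N u"
  using homogeneous[of u "-1"] by simp

lemma N_diff_commute: "u \<in> X \<Longrightarrow> v \<in> X \<Longrightarrow> N (u - v) = N (v - u)"
  using N_minus[of "u - v"] diff_mem by simp

lemma N_le_add_diff: "u \<in> X \<Longrightarrow> v \<in> X \<Longrightarrow> N u \<le> N v + N (u - v)"
  using triangle[of v "u - v"] diff_mem by simp

lemma abs_diff_le: "u \<in> X \<Longrightarrow> v \<in> X \<Longrightarrow> \<bar>N u - N v\<bar> \<le> N (u - v)"
  using N_le_add_diff[of u v] N_le_add_diff[of v u] N_diff_commute[of u v] by linarith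

lemma tendsto_N:
  assumes "u \<in> X" "\<And>k. s k \<in> X" "(\<lambda>k. N (s k - u)) \<longlonglongrightarrow> 0"
  shows "(\<lambda>k. N (s k)) \<longlonglongrightarrow> N u"
proof (rule Lim_null[THEN iffD2], rule tendsto_rabs_zero_cancel, rule tendsto_sandwich[OF _ _ tendsto_const assms(3)])
  show "\<forall>\<^sub>F k in sequentially. \<bar>N (s k) - N u\<bar> \<le> N (s k - u)"
    using abs_diff_le assms by auto
qed auto

lemma dual_add: "l \<in> dual_space X N \<Longrightarrow> u \<in> X \<Longrightarrow> v \<in> X \<Longrightarrow> l (u + v) = l u + l v"
  and dual_scale: "l \<in> dual_space X N \<Longrightarrow> u \<in> X \<Longrightarrow> l (a *\<^sub>R u) = a * l u"
  by (auto simp: dual_space_def)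

lemma dual_diff: "l \<in> dual_space X N \<Longrightarrow> u \<in> X \<Longrightarrow> v \<in> X \<Longrightarrow> l (u - v) = l u - l v"
  using dual_add[of l "u - v" v] diff_mem by simp

lemma dual_norm_bdd: "l \<in> dual_space X N \<Longrightarrow> bdd_above ((\<lambda>u. \<bar>l u\<bar>) ` {u \<in> X. N u \<le> 1})"
proof -
  assume "l \<in> dual_space X N"
  then obtain C where C: "\<And>u. u \<in> X \<Longrightarrow> \<bar>l u\<bar> \<le> C * N u" unfolding dual_space_def by blast
  have "\<bar>l u\<bar> \<le> \<bar>C\<bar>" if "u \<in> X" "N u \<le> 1" for u
  proof -
    have "C * N u \<le> \<bar>C\<bar> * 1" using that nonneg[of u] by (intro mult_mono) auto
    then show ?thesis using C[of u] that by simp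
  qed
  then show ?thesis by (intro bdd_aboveI[of _ "\<bar>C\<bar>"]) auto
qed

lemma dual_norm_nonneg: "l \<in> dual_space X N \<Longrightarrow> 0 \<le> dual_norm X N l"
  unfolding dual_norm_def using dual_norm_bdd zero_mem N_zero
  by (intro cSUP_upper2[where x=0]) auto

lemma dual_bound:
  assumes l: "l \<in> dual_space X N" and u: "u \<in> X"
  shows "\<bar>l u\<bar> \<le> dual_norm X N l * N u"
\<comment> \<open>A null vector cannot be normalised; there any bounding constant already gives
  \<open>l u = 0\<close>.\<close>
proof (cases "N u = 0")
  case True
  obtain C where "\<bar>l u\<bar> \<le> C * N u" using l u by (auto simp: dual_space_def)
  then show ?thesis using True by simp
next
  case False
  then have pos: "N u > 0" using nonneg[OF u] by simp
  have "\<bar>l ((1 / N u) *\<^sub>R u)\<bar> \<le> dual_norm X N l"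
    unfolding dual_norm_def using pos u scale_mem[OF u] homogeneous[OF u]
    by (intro cSUP_upper dual_norm_bdd l) auto
  then show ?thesis using pos u dual_scale[OF l u] by (simp add: abs_mult field_simps)
qed

lemma dual_norm_le:
  assumes "0 \<le> C" "\<And>u. u \<in> X \<Longrightarrow> \<bar>l u\<bar> \<le> C * N u"
  shows "dual_norm X N l \<le> C"
  unfolding dual_norm_def
proof (rule cSUP_least)
  show "{u \<in> X. N u \<le> 1} \<noteq> {}" using zero_mem N_zero by force
  fix u assume u: "u \<in> {u \<in> X. N u \<le> 1}"
  then have "C * N u \<le> C * 1" using assms by (intro mult_left_mono) auto
  then show "\<bar>l u\<bar> \<le> C" using assms(2)[of u] u by auto
qed

lemma subspace_dual: "subspace (dual_space X N)"
proof (rule subspaceI)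
  show "0 \<in> dual_space X N"
    by (auto simp: dual_space_def intro: exI[of _ 0])
  show "l + k \<in> dual_space X N" if l: "l \<in> dual_space X N" and k: "k \<in> dual_space X N" for l k
  proof -
    have "\<bar>l u + k u\<bar> \<le> (dual_norm X N l + dual_norm X N k) * N u" if "u \<in> X" for u
      using dual_bound[OF l that] dual_bound[OF k that] by (simp add: distrib_right)
    then show ?thesis
      using l k by (auto simp: dual_space_def distrib_left)
  qed
  show "c *\<^sub>R l \<in> dual_space X N" if l: "l \<in> dual_space X N" for l c
  proof -
    have "\<bar>c * l u\<bar> \<le> (\<bar>c\<bar> * dual_norm X N l) * N u" if "u \<in> X" for u
      using mult_left_mono[OF dual_bound[OF l that], of "\<bar>c\<bar>"] by (simp add: abs_mult mult.assoc)
    then show ?thesis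
      using l by (auto simp: dual_space_def distrib_left)
  qed
qed

text \<open>Dual spaces are again instances of the locale, so the facts on time-dependent functions
  also serve functions with values in a dual.\<close>

lemma seminormed_dual: "seminormed_space (dual_space X N) (dual_norm X N)"
proof
  fix l k :: "'a \<Rightarrow> real" and a :: real
  assume l: "l \<in> dual_space X N"
  show "0 \<le> dual_norm X N l" using dual_norm_nonneg[OF l] .
  show "dual_norm X N (l + k) \<le> dual_norm X N l + dual_norm X N k" if k: "k \<in> dual_space X N"
  proof (rule dual_norm_le)
    show "\<bar>(l + k) u\<bar> \<le> (dual_norm X N l + dual_norm X N k) * N u" if "u \<in> X" for u
      using dual_bound[OF l that] dual_bound[OF k that] by (simp add: distrib_right)
  qed (use l k dual_norm_nonneg in auto)
  have le: "dual_norm X N (a *\<^sub>R l) \<le> \<bar>a\<bar> * dual_norm X N l" if l: "l \<in> dual_space X N" for l a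
  proof (rule dual_norm_le)
    show "\<bar>(a *\<^sub>R l) u\<bar> \<le> (\<bar>a\<bar> * dual_norm X N l) * N u" if "u \<in> X" for u
      using mult_left_mono[OF dual_bound[OF l that], of "\<bar>a\<bar>"] by (simp add: abs_mult mult.assoc)
  qed (use l dual_norm_nonneg in auto)
  show "dual_norm X N (a *\<^sub>R l) = \<bar>a\<bar> * dual_norm X N l"
  proof (cases "a = 0")
    case True
    then show ?thesis using le[OF l, of a] dual_norm_nonneg[OF subspace_mul[OF subspace_dual l, of a]] by simp
  next
    case False
    \<comment> \<open>The reverse inequality is the one already proved, for the factor
      \<open>1 / a\<close>.\<close>
    have "dual_norm X N l \<le> \<bar>1 / a\<bar> * dual_norm X N (a *\<^sub>R l)"
      using le[OF subspace_mul[OF subspace_dual l, of a], of "1/a"] False by (simp add: )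
    then have "\<bar>a\<bar> * dual_norm X N l \<le> dual_norm X N (a *\<^sub>R l)"
      using False by (simp add: field_simps)
    then show ?thesis using le[OF l, of a] by simp
  qed
qed (rule subspace_dual)

end

section \<open>Measurability and duality in Bochner spaces\<close>

lemma finite_measure_time: "finite_measure (time_measure T)"
  by (intro finite_measureI) (cases "0 \<le> T", simp_all add: emeasure_restrict_space)

text \<open>A sequentially continuous map of two arguments can be applied to the approximating
  simple functions. Norms, pairings, linear combinations and both parts of the operator obtain their
  measurability in this way; the two arguments may be approximated in two different spaces.\<close>

lemma strongly_measurable_compose2:
  assumes u: "strongly_measurable T X N u" "AE t in time_measure T. u t \<in> X"
    and v: "strongly_measurable T X' N' v" "AE t in time_measure T. v t \<in> X'"
    and \<Phi>: "\<And>a b. a \<in> X \<Longrightarrow> b \<in> X' \<Longrightarrow> \<Phi> a b \<in> Y"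
    and cont: "\<And>a b s s'. a \<in> X \<Longrightarrow> b \<in> X' \<Longrightarrow> (\<And>k::nat. s k \<in> X) \<Longrightarrow> (\<And>k. s' k \<in> X') \<Longrightarrow>
        (\<lambda>k. N (s k - a)) \<longlonglongrightarrow> 0 \<Longrightarrow> (\<lambda>k. N' (s' k - b)) \<longlonglongrightarrow> 0 \<Longrightarrow>
        (\<lambda>k. N'' (\<Phi> (s k) (s' k) - \<Phi> a b)) \<longlonglongrightarrow> 0"
  shows "strongly_measurable T Y N'' (\<lambda>t. \<Phi> (u t) (v t))"
proof -
  obtain s where s: "\<And>k. simple_function (time_measure T) (s k)" "\<And>k t. t \<in> {0<..<T} \<Longrightarrow> s k t \<in> X"
    "AE t in time_measure T. (\<lambda>k. N (s k t - u t)) \<longlonglongrightarrow> 0"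
    using u(1) unfolding strongly_measurable_def by blast
  obtain s' where s': "\<And>k. simple_function (time_measure T) (s' k)" "\<And>k t. t \<in> {0<..<T} \<Longrightarrow> s' k t \<in> X'"
    "AE t in time_measure T. (\<lambda>k. N' (s' k t - v t)) \<longlonglongrightarrow> 0"
    using v(1) unfolding strongly_measurable_def by blast
  show ?thesis
    unfolding strongly_measurable_def
  proof (intro exI conjI allI ballI)
    show "simple_function (time_measure T) (\<lambda>t. \<Phi> (s k t) (s' k t))" for k
      using s(1) s'(1) by (rule simple_function_compose2)
    show "\<Phi> (s k t) (s' k t) \<in> Y" if "t \<in> {0<..<T}" for k t
      using that s(2) s'(2) \<Phi> by blast
    have "AE t in time_measure T. t \<in> {0<..<T}"
      using AE_space[of "time_measure T"] by simp
    then show "AE t in time_measure T. (\<lambda>k. N'' (\<Phi> (s k t) (s' k t) - \<Phi> (u t) (v t))) \<longlonglongrightarrow> 0"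
      using u(2) v(2) s(3) s'(3)
    proof eventually_elim
      case (elim t)
      show ?case
        by (rule cont[OF elim(2,3) _ _ elim(4,5)]) (use s(2) s'(2) elim(1) in auto)
    qed
  qed
qed

lemma strongly_measurable_const:
  assumes "seminormed_space X N" "c \<in> X"
  shows "strongly_measurable T X N (\<lambda>t. c)"
  unfolding strongly_measurable_def
  using assms seminormed_space.N_zero[OF assms(1)] by (intro exI[of _ "\<lambda>k t. c"]) auto

lemma strongly_measurable_realD:
  assumes "strongly_measurable T UNIV abs f"
  shows "f \<in> borel_measurable (time_measure T)"
proof -
  obtain s where s: "\<And>k. simple_function (time_measure T) (s k)"
    "AE t in time_measure T. (\<lambda>k. \<bar>s k t - f t\<bar>) \<longlonglongrightarrow> 0"
    using assms unfolding strongly_measurable_def by blast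
  show ?thesis
  proof (rule borel_measurable_lebesgue_on_AE_lim)
    show "s k \<in> borel_measurable (time_measure T)" for k
      using s(1) by (rule borel_measurable_simple_function)
    show "AE t in time_measure T. (\<lambda>k. s k t) \<longlonglongrightarrow> f t"
      using s(2) by eventually_elim (simp add: LIM_zero_iff tendsto_rabs_zero_iff)
  qed auto
qed

context seminormed_space
begin

lemma strongly_measurable_lincomb:
  assumes "strongly_measurable T X N u" "AE t in time_measure T. u t \<in> X"
    and "strongly_measurable T X N v" "AE t in time_measure T. v t \<in> X"
  shows "strongly_measurable T X N (\<lambda>t. c *\<^sub>R u t + d *\<^sub>R v t)"
proof (rule strongly_measurable_compose2[OF assms])
  show "c *\<^sub>R a + d *\<^sub>R b \<in> X" if "a \<in> X" "b \<in> X" for a b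
    using that by (intro add_mem scale_mem)
  fix a b s s'
  assume a: "a \<in> X" "b \<in> X" "\<And>k::nat. s k \<in> X" "\<And>k. s' k \<in> X"
    "(\<lambda>k. N (s k - a)) \<longlonglongrightarrow> 0" "(\<lambda>k. N (s' k - b)) \<longlonglongrightarrow> 0"
  show "(\<lambda>k. N (c *\<^sub>R s k + d *\<^sub>R s' k - (c *\<^sub>R a + d *\<^sub>R b))) \<longlonglongrightarrow> 0"
  proof (rule tendsto_sandwich[OF _ _ tendsto_const])
    show "(\<lambda>k. \<bar>c\<bar> * N (s k - a) + \<bar>d\<bar> * N (s' k - b)) \<longlonglongrightarrow> 0"
      using a(5,6) by (auto intro!: tendsto_eq_intros)
    show "\<forall>\<^sub>F k in sequentially. N (c *\<^sub>R s k + d *\<^sub>R s' k - (c *\<^sub>R a + d *\<^sub>R b)) \<le> \<bar>c\<bar> * N (s k - a) + \<bar>d\<bar> * N (s' k - b)"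
    proof (intro always_eventually allI)
      fix k
      have "c *\<^sub>R s k + d *\<^sub>R s' k - (c *\<^sub>R a + d *\<^sub>R b) = c *\<^sub>R (s k - a) + d *\<^sub>R (s' k - b)"
        by (simp add: algebra_simps)
      then show "N (c *\<^sub>R s k + d *\<^sub>R s' k - (c *\<^sub>R a + d *\<^sub>R b)) \<le> \<bar>c\<bar> * N (s k - a) + \<bar>d\<bar> * N (s' k - b)"
        using triangle[of "c *\<^sub>R (s k - a)" "d *\<^sub>R (s' k - b)"] a(1-4)
        by (simp add: homogeneous diff_mem scale_mem)
    qed
    show "\<forall>\<^sub>F k in sequentially. 0 \<le> N (c *\<^sub>R s k + d *\<^sub>R s' k - (c *\<^sub>R a + d *\<^sub>R b))"
      by (intro always_eventually allI nonneg diff_mem add_mem scale_mem a)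
  qed
qed

lemma N_measurable:
  assumes "strongly_measurable T X N u" "AE t in time_measure T. u t \<in> X"
  shows "(\<lambda>t. N (u t)) \<in> borel_measurable (time_measure T)"
  using strongly_measurable_realD[OF strongly_measurable_compose2[OF assms assms, of "\<lambda>a b. N a" UNIV abs]]
    tendsto_N by (simp add: Lim_null[of _ "N _"] tendsto_rabs_zero_iff)

text \<open>Evaluation is jointly continuous: an increment splits into the change of the functional
  at the approximating vector and the limit functional at the change of the vector.\<close>

lemma dual_measurable:
  assumes f: "strongly_measurable T (dual_space X N) (dual_norm X N) f" "AE t in time_measure T. f t \<in> dual_space X N"
    and u: "strongly_measurable T X N u" "AE t in time_measure T. u t \<in> X"
  shows "(\<lambda>t. f t (u t)) \<in> borel_measurable (time_measure T)"
proof (rule strongly_measurable_realD, rule strongly_measurable_compose2[OF f u])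
  interpret D: seminormed_space "dual_space X N" "dual_norm X N" by (rule seminormed_dual)
  fix l u s s'
  assume a: "l \<in> dual_space X N" "u \<in> X" "\<And>k::nat. s k \<in> dual_space X N" "\<And>k. s' k \<in> X"
    "(\<lambda>k. dual_norm X N (s k - l)) \<longlonglongrightarrow> 0" "(\<lambda>k. N (s' k - u)) \<longlonglongrightarrow> 0"
  have *: "(\<lambda>k. N (s' k)) \<longlonglongrightarrow> N u" using tendsto_N a by blast
  show "(\<lambda>k. \<bar>s k (s' k) - l u\<bar>) \<longlonglongrightarrow> 0"
  proof (rule tendsto_sandwich[OF _ _ tendsto_const])
    have "(\<lambda>k. dual_norm X N (s k - l) * N (s' k) + dual_norm X N l * N (s' k - u)) \<longlonglongrightarrow> 0 * N u + dual_norm X N l * 0"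
      by (intro tendsto_intros a *)
    then show "(\<lambda>k. dual_norm X N (s k - l) * N (s' k) + dual_norm X N l * N (s' k - u)) \<longlonglongrightarrow> 0"
      by simp
    show "\<forall>\<^sub>F k in sequentially. \<bar>s k (s' k) - l u\<bar> \<le> dual_norm X N (s k - l) * N (s' k) + dual_norm X N l * N (s' k - u)"
    proof (intro always_eventually allI)
      fix k
      have "s k (s' k) - l u = (s k - l) (s' k) + l (s' k - u)"
        using dual_diff[OF a(1)] a by simp
      moreover have "\<bar>(s k - l) (s' k)\<bar> \<le> dual_norm X N (s k - l) * N (s' k)"
        using a by (intro dual_bound D.diff_mem)
      moreover have "\<bar>l (s' k - u)\<bar> \<le> dual_norm X N l * N (s' k - u)"
        using a by (intro dual_bound diff_mem)
      ultimately show "\<bar>s k (s' k) - l u\<bar> \<le> dual_norm X N (s k - l) * N (s' k) + dual_norm X N l * N (s' k - u)"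
        by linarith
    qed
  qed auto
qed auto

lemma bochner_lincomb:
  assumes p: "1 \<le> p" and u: "u \<in> bochner_space T p X N" and v: "v \<in> bochner_space T p X N"
  shows "(\<lambda>t. c *\<^sub>R u t + d *\<^sub>R v t) \<in> bochner_space T p X N"
proof -
  have u': "AE t in time_measure T. u t \<in> X" "strongly_measurable T X N u" "integrable (time_measure T) (\<lambda>t. N (u t) powr p)"
    and v': "AE t in time_measure T. v t \<in> X" "strongly_measurable T X N v" "integrable (time_measure T) (\<lambda>t. N (v t) powr p)"
    using u v by (auto simp: bochner_space_def)
  have ae: "AE t in time_measure T. c *\<^sub>R u t + d *\<^sub>R v t \<in> X"
    using u'(1) v'(1) by eventually_elim (intro add_mem scale_mem)
  have sm: "strongly_measurable T X N (\<lambda>t. c *\<^sub>R u t + d *\<^sub>R v t)"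
    using strongly_measurable_lincomb u' v' by blast
  have [measurable]: "(\<lambda>t. N (c *\<^sub>R u t + d *\<^sub>R v t)) \<in> borel_measurable (time_measure T)"
    using N_measurable[OF sm ae] .
  have "integrable (time_measure T) (\<lambda>t. N (c *\<^sub>R u t + d *\<^sub>R v t) powr p)"
  proof (rule Bochner_Integration.integrable_bound)
    show "integrable (time_measure T) (\<lambda>t. \<bar>2 * c\<bar> powr p * N (u t) powr p + \<bar>2 * d\<bar> powr p * N (v t) powr p)"
      using u' v' by auto
    show "AE t in time_measure T. norm (N (c *\<^sub>R u t + d *\<^sub>R v t) powr p) \<le> norm (\<bar>2 * c\<bar> powr p * N (u t) powr p + \<bar>2 * d\<bar> powr p * N (v t) powr p)"
      using u'(1) v'(1)
    proof eventually_elim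
      case (elim t)
      \<comment> \<open>Each term is doubled and weighted by one half, so that convexity of the
        power applies.\<close>
      have "N (c *\<^sub>R u t + d *\<^sub>R v t) powr p \<le> (1/2 * (\<bar>2 * c\<bar> * N (u t)) + 1/2 * (\<bar>2 * d\<bar> * N (v t))) powr p"
        using triangle[of "c *\<^sub>R u t" "d *\<^sub>R v t"] elim p
        by (intro powr_mono2) (auto simp: homogeneous scale_mem add_mem nonneg abs_mult)
      also have "\<dots> \<le> 1/2 * (\<bar>2 * c\<bar> * N (u t)) powr p + 1/2 * (\<bar>2 * d\<bar> * N (v t)) powr p"
        using elim p by (intro convex_powr_nonneg) (auto simp: nonneg)
      also have "\<dots> \<le> \<bar>2 * c\<bar> powr p * N (u t) powr p + \<bar>2 * d\<bar> powr p * N (v t) powr p"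
      proof -
        have "(\<bar>2 * c\<bar> * N (u t)) powr p = \<bar>2 * c\<bar> powr p * N (u t) powr p"
          "(\<bar>2 * d\<bar> * N (v t)) powr p = \<bar>2 * d\<bar> powr p * N (v t) powr p"
          using elim by (auto simp: powr_mult nonneg)
        moreover have "0 \<le> \<bar>2 * c\<bar> powr p * N (u t) powr p" "0 \<le> \<bar>2 * d\<bar> powr p * N (v t) powr p"
          by auto
        ultimately show ?thesis by linarith
      qed
      finally show ?case by simp
    qed
  qed measurable
  then show ?thesis using ae sm by (simp add: bochner_space_def)
qed

lemma bochner_diff:
  assumes "1 \<le> p" "u \<in> bochner_space T p X N" "v \<in> bochner_space T p X N"
  shows "u - v \<in> bochner_space T p X N"
  using bochner_lincomb[OF assms, of 1 "-1"] by (simp add: fun_diff_def)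

lemma pairing_bound:
  assumes pq: "1 < p" "1 < q" "1/p + 1/q = 1"
    and f: "f \<in> bochner_space T q (dual_space X N) (dual_norm X N)"
    and u: "u \<in> bochner_space T p X N"
  shows "integrable (time_measure T) (\<lambda>t. f t (u t))"
    and "\<bar>LINT t|time_measure T. f t (u t)\<bar> \<le> bochner_norm T q (dual_norm X N) f * bochner_norm T p N u"
proof -
  let ?M = "time_measure T"
  have u': "AE t in ?M. u t \<in> X" "strongly_measurable T X N u" "integrable ?M (\<lambda>t. N (u t) powr p)"
    and f': "AE t in ?M. f t \<in> dual_space X N" "strongly_measurable T (dual_space X N) (dual_norm X N) f"
      "integrable ?M (\<lambda>t. dual_norm X N (f t) powr q)"
    using u f by (auto simp: bochner_space_def)
  have [measurable]: "(\<lambda>t. f t (u t)) \<in> borel_measurable ?M"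
    using dual_measurable f' u' by blast
  have pq': "0 < 1/q" "0 < 1/p" "1/q + 1/p = 1" using pq by auto
  note H = Holder_integral2[OF pq' f'(3) powr_ge_zero u'(3) powr_ge_zero]
  have le: "AE t in ?M. \<bar>f t (u t)\<bar> \<le> (dual_norm X N (f t) powr q) powr (1/q) * (N (u t) powr p) powr (1/p)"
    using u'(1) f'(1)
  proof eventually_elim
    case (elim t)
    then show ?case using dual_bound[of "f t" "u t"] dual_norm_nonneg[of "f t"] nonneg[of "u t"] pq
      by (simp add: powr_powr)
  qed
  show I: "integrable ?M (\<lambda>t. f t (u t))"
    by (rule Bochner_Integration.integrable_bound[OF H(1)]) (use le in \<open>auto elim!: eventually_mono\<close>)
  have "\<bar>LINT t|?M. f t (u t)\<bar> \<le> (LINT t|?M. \<bar>f t (u t)\<bar>)"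
    by (rule integral_abs_bound)
  also have "\<dots> \<le> (LINT t|?M. (dual_norm X N (f t) powr q) powr (1/q) * (N (u t) powr p) powr (1/p))"
    using I H(1) le by (intro integral_mono_AE) auto
  also have "\<dots> \<le> bochner_norm T q (dual_norm X N) f * bochner_norm T p N u"
    using H(2) by (simp add: bochner_norm_def)
  finally show "\<bar>LINT t|?M. f t (u t)\<bar> \<le> bochner_norm T q (dual_norm X N) f * bochner_norm T p N u" .
qed

text \<open>Weak convergence is defined through all functionals on the Bochner space; this supplies
  the ones that come from dual-valued functions of time.\<close>

lemma pairing_mem_dual:
  assumes pq: "1 < p" "1 < q" "1/p + 1/q = 1"
    and f: "f \<in> bochner_space T q (dual_space X N) (dual_norm X N)"
  shows "(\<lambda>u. LINT t|time_measure T. f t (u t)) \<in> dual_space (bochner_space T p X N) (bochner_norm T p N)"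
  unfolding dual_space_def
proof (intro CollectI conjI ballI allI exI)
  have f': "AE t in time_measure T. f t \<in> dual_space X N"
    using f by (auto simp: bochner_space_def)
  fix u assume u: "u \<in> bochner_space T p X N"
  then have u': "AE t in time_measure T. u t \<in> X" by (auto simp: bochner_space_def)
  note iu = pairing_bound(1)[OF pq f u]
  show "\<bar>LINT t|time_measure T. f t (u t)\<bar> \<le> bochner_norm T q (dual_norm X N) f * bochner_norm T p N u"
    by (rule pairing_bound(2)[OF pq f u])
  show "(LINT t|time_measure T. f t ((a *\<^sub>R u) t)) = a * (LINT t|time_measure T. f t (u t))" for a
  proof -
    have "(a *\<^sub>R u) \<in> bochner_space T p X N"
      using bochner_lincomb[OF _ u u, of a 0] pq by (simp add: scaleR_fun_def)
    note iau = pairing_bound(1)[OF pq f this]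
    have "(LINT t|time_measure T. f t ((a *\<^sub>R u) t)) = (LINT t|time_measure T. a * f t (u t))"
      using iau iu f' u' by (intro integral_cong_AE) (auto elim!: eventually_elim2 simp: dual_scale)
    then show ?thesis by simp
  qed
  fix v assume v: "v \<in> bochner_space T p X N"
  then have v': "AE t in time_measure T. v t \<in> X" by (auto simp: bochner_space_def)
  note iv = pairing_bound(1)[OF pq f v]
  have "u + v \<in> bochner_space T p X N"
    using bochner_lincomb[OF _ u v, of 1 1] pq by (simp add: plus_fun_def)
  note iuv = pairing_bound(1)[OF pq f this]
  have "AE t in time_measure T. f t ((u + v) t) = f t (u t) + f t (v t)"
    using f' u' v' by eventually_elim (simp add: dual_add)
  then have "(LINT t|time_measure T. f t ((u + v) t)) = (LINT t|time_measure T. f t (u t) + f t (v t))"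
    using iuv iu iv by (intro integral_cong_AE) auto
  then show "(LINT t|time_measure T. f t ((u + v) t)) = (LINT t|time_measure T. f t (u t)) + (LINT t|time_measure T. f t (v t))"
    using iu iv by simp
qed

end

section \<open>Test functions and integration by parts\<close>

lemma C_k_translate: "C_k k f \<Longrightarrow> C_k k (\<lambda>x. f (x + a))"
proof (induction k arbitrary: f)
  case 0
  then show ?case by (auto intro!: continuous_on_compose2[of UNIV f] continuous_intros)
next
  case (Suc k)
  show ?case
  proof (rule C_k_SucI[where D="\<lambda>x. frechet_derivative f (at (x + a))"])
    show "((\<lambda>x. f (x + a)) has_derivative frechet_derivative f (at (x + a))) (at x)" for x
      using has_derivative_compose[OF has_derivative_add_const[OF has_derivative_ident] C_k_has_derivative[OF Suc.prems]] .
    show "C_k k (\<lambda>x. frechet_derivative f (at (x + a)) v)" for v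
      using Suc.IH[of "\<lambda>x. frechet_derivative f (at x) v"] Suc.prems by simp
  qed
qed

lemma smooth_translate: "smooth f \<Longrightarrow> smooth (\<lambda>x. f (x + a))"
  by (simp add: smooth_def C_k_translate)

lemma frechet_derivative_mult_smooth:
  fixes f g :: "'a::euclidean_space \<Rightarrow> real"
  shows "smooth f \<Longrightarrow> smooth g \<Longrightarrow>
    frechet_derivative (\<lambda>x. f x * g x) (at x) v = f x * frechet_derivative g (at x) v + frechet_derivative f (at x) v * g x"
  by (subst frechet_derivative_at[symmetric], rule has_derivative_mult) (auto intro: smooth_has_derivative)

lemma test_functionsI:
  assumes "smooth \<phi>" "compact K" "K \<subseteq> U" "\<And>x. x \<notin> K \<Longrightarrow> \<phi> x = 0"
  shows "\<phi> \<in> test_functions U"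
proof -
  have "closure {x. \<phi> x \<noteq> 0} \<subseteq> K"
    using assms by (intro closure_minimal compact_imp_closed) auto
  moreover from this have "compact (closure {x. \<phi> x \<noteq> 0})"
    using assms(2) by (meson bounded_subset compact_imp_bounded compact_closure closure_subset)
  ultimately show ?thesis using assms by (auto simp: test_functions_def)
qed

lemma test_functionsE:
  assumes "\<phi> \<in> test_functions U"
  obtains K where "smooth \<phi>" "compact K" "K \<subseteq> U" "\<And>x. x \<notin> K \<Longrightarrow> \<phi> x = 0"
proof (rule that[of "closure {x. \<phi> x \<noteq> 0}"])
  show "\<phi> x = 0" if "x \<notin> closure {x. \<phi> x \<noteq> 0}" for x
    using that closure_subset[of "{x. \<phi> x \<noteq> 0}"] by blast
qed (use assms in \<open>auto simp: test_functions_def\<close>)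

lemma test_function_smooth: "\<phi> \<in> test_functions U \<Longrightarrow> smooth \<phi>"
  by (simp add: test_functions_def)

lemma test_function_outside: "\<phi> \<in> test_functions U \<Longrightarrow> x \<notin> U \<Longrightarrow> \<phi> x = 0"
  by (elim test_functionsE) blast

lemma test_function_mult:
  assumes "\<phi> \<in> test_functions U" "smooth a"
  shows "(\<lambda>x. \<phi> x * a x) \<in> test_functions U"
proof -
  obtain K where K: "smooth \<phi>" "compact K" "K \<subseteq> U" "\<And>x. x \<notin> K \<Longrightarrow> \<phi> x = 0"
    by (rule test_functionsE[OF assms(1)]) (rule that)
  show ?thesis
    by (rule test_functionsI[OF _ K(2,3)]) (use K assms(2) in \<open>auto intro: smooth_mult\<close>)
qed

lemma test_function_add:
  assumes "\<phi> \<in> test_functions U" "\<psi> \<in> test_functions U"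
  shows "(\<lambda>x. \<phi> x + \<psi> x) \<in> test_functions U"
proof -
  obtain K where K: "smooth \<phi>" "compact K" "K \<subseteq> U" "\<And>x. x \<notin> K \<Longrightarrow> \<phi> x = 0"
    by (rule test_functionsE[OF assms(1)]) (rule that)
  obtain L where L: "smooth \<psi>" "compact L" "L \<subseteq> U" "\<And>x. x \<notin> L \<Longrightarrow> \<psi> x = 0"
    by (rule test_functionsE[OF assms(2)]) (rule that)
  show ?thesis
    by (rule test_functionsI[of _ "K \<union> L"]) (use K L in \<open>auto intro: smooth_add\<close>)
qed

lemma test_function_UNIV: "\<phi> \<in> test_functions U \<Longrightarrow> \<phi> \<in> test_functions UNIV"
  using test_functions_mono by blast

lemma test_function_translate:
  assumes "\<phi> \<in> test_functions UNIV"
  shows "(\<lambda>x. \<phi> (x + a)) \<in> test_functions UNIV"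
proof -
  obtain K where K: "smooth \<phi>" "compact K" "\<And>x. x \<notin> K \<Longrightarrow> \<phi> x = 0"
    using test_functionsE[OF assms] by metis
  show ?thesis
  proof (rule test_functionsI[of _ "(\<lambda>x. x - a) ` K"])
    show "compact ((\<lambda>x. x - a) ` K)"
      by (intro compact_continuous_image continuous_intros K)
    show "\<phi> (x + a) = 0" if "x \<notin> (\<lambda>x. x - a) ` K" for x
    proof (rule K(3))
      show "x + a \<notin> K" using that by (metis add_diff_cancel_right' imageI)
    qed
  qed (auto intro: smooth_translate K)
qed

lemma test_function_derivative:
  assumes "\<phi> \<in> test_functions U"
  shows "(\<lambda>x. frechet_derivative \<phi> (at x) v) \<in> test_functions U"
proof -
  obtain K where K: "smooth \<phi>" "compact K" "K \<subseteq> U" "\<And>x. x \<notin> K \<Longrightarrow> \<phi> x = 0"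
    by (rule test_functionsE[OF assms]) (rule that)
  show ?thesis
  proof (rule test_functionsI[OF _ K(2,3)])
    show "smooth (\<lambda>x. frechet_derivative \<phi> (at x) v)" by (rule smooth_derivative[OF K(1)])
    fix x assume x: "x \<notin> K"
    have "((\<lambda>y. 0) has_derivative (\<lambda>h. 0)) (at x)" by simp
    then have "(\<phi> has_derivative (\<lambda>h. 0)) (at x)"
      by (rule has_derivative_transform_within_open[where s="- K"])
        (use K x compact_imp_closed in auto)
    then show "frechet_derivative \<phi> (at x) v = 0"
      by (metis frechet_derivative_at)
  qed
qed

lemma test_function_bounded:
  assumes "\<phi> \<in> test_functions U"
  obtains B where "B > 0" "\<And>x. \<bar>\<phi> x\<bar> \<le> B"
proof -
  obtain K where K: "smooth \<phi>" "compact K" "\<And>x. x \<notin> K \<Longrightarrow> \<phi> x = 0"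
    using test_functionsE[OF assms] by metis
  have "bounded (\<phi> ` K)"
    by (intro compact_imp_bounded compact_continuous_image smooth_continuous_on K)
  then obtain B where "B > 0" "\<And>x. x \<in> K \<Longrightarrow> \<bar>\<phi> x\<bar> \<le> B"
    by (metis bounded_pos imageI real_norm_def)
  then show ?thesis using K(3) by (intro that[of B]) (auto, metis abs_zero less_imp_le)
qed

lemma smooth_borel_measurable: "smooth f \<Longrightarrow> f \<in> borel_measurable borel"
  by (intro borel_measurable_continuous_onI smooth_continuous_on)

lemma test_function_integrable:
  assumes "\<phi> \<in> test_functions U"
  shows "integrable lborel \<phi>"
proof -
  obtain K where K: "smooth \<phi>" "compact K" "\<And>x. x \<notin> K \<Longrightarrow> \<phi> x = 0"
    using test_functionsE[OF assms] by metis
  have "integrable lborel (\<lambda>x. indicator K x *\<^sub>R \<phi> x)"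
    by (intro borel_integrable_compact smooth_continuous_on K)
  moreover have "(\<lambda>x. indicator K x *\<^sub>R \<phi> x) = \<phi>"
    using K(3) by (auto simp: indicator_def fun_eq_iff)
  ultimately show ?thesis by simp
qed

lemma integral_lebesgue_on_eq_lborel:
  fixes f :: "'a::euclidean_space \<Rightarrow> real"
  assumes "S \<in> sets lebesgue" "f \<in> borel_measurable borel" "\<And>x. x \<notin> S \<Longrightarrow> f x = 0"
  shows "(LINT x|lebesgue_on S. f x) = (LINT x|lborel. f x)"
proof -
  have "(LINT x|lebesgue_on S. f x) = (LINT x|lebesgue. indicator S x *\<^sub>R f x)"
    using assms(1) by (intro integral_restrict_space) simp
  also have "(\<lambda>x. indicator S x *\<^sub>R f x) = f"
    using assms(3) by (auto simp: indicator_def fun_eq_iff)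
  finally show ?thesis using assms(2) by (simp add: integral_completion)
qed

lemma lborel_integral_translate:
  fixes f :: "'a::euclidean_space \<Rightarrow> real"
  assumes "f \<in> borel_measurable borel"
  shows "(LINT x|lborel. f (x + a)) = (LINT x|lborel. f x)"
proof -
  have "(LINT x|lborel. f x) = (LINT x|distr lborel borel ((+) a). f x)"
    by (simp add: lborel_distr_plus)
  also have "\<dots> = (LINT x|lborel. f (a + x))"
    using assms by (intro integral_distr) auto
  finally show ?thesis by (simp add: add.commute)
qed

section \<open>Difference quotients and integration by parts\<close>

lemma smooth_DERIV_line:
  fixes f :: "'a::euclidean_space \<Rightarrow> real"
  assumes "smooth f"
  shows "((\<lambda>s. f (x + s *\<^sub>R v)) has_real_derivative frechet_derivative f (at (x + s *\<^sub>R v)) v) (at s)"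
proof -
  have "((\<lambda>s. x + s *\<^sub>R v) has_derivative (\<lambda>h. h *\<^sub>R v)) (at s)"
    by (auto intro!: derivative_eq_intros)
  from has_derivative_compose[OF this smooth_has_derivative[OF assms]]
  have "((\<lambda>s. f (x + s *\<^sub>R v)) has_derivative (\<lambda>h. frechet_derivative f (at (x + s *\<^sub>R v)) (h *\<^sub>R v))) (at s)" .
  moreover have "(\<lambda>h. frechet_derivative f (at (x + s *\<^sub>R v)) (h *\<^sub>R v)) = (*) (frechet_derivative f (at (x + s *\<^sub>R v)) v)"
    using linear_simps(5)[OF has_derivative_bounded_linear[OF smooth_has_derivative[OF assms]]]
    by (auto simp: fun_eq_iff mult.commute)
  ultimately show ?thesis by (simp add: has_field_derivative_def)
qed

text \<open>The quotients are bounded by the mean value theorem and vanish outside a fixed ball, so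
  dominated convergence applies against any continuous \<open>k\<close>.\<close>

lemma difference_quotient_tendsto:
  fixes \<phi> k :: "'a::euclidean_space \<Rightarrow> real"
  assumes \<phi>: "\<phi> \<in> test_functions UNIV" and k: "continuous_on UNIV k"
    and s: "s \<longlonglongrightarrow> 0" "\<And>n::nat. s n \<noteq> 0"
  shows "(\<lambda>n. LINT x|lborel. (\<phi> (x + s n *\<^sub>R v) - \<phi> x) / s n * k x)
      \<longlonglongrightarrow> (LINT x|lborel. frechet_derivative \<phi> (at x) v * k x)"
proof -
  have sm: "smooth \<phi>" using \<phi> test_function_smooth by blast
  obtain K where K: "compact K" "\<And>x. x \<notin> K \<Longrightarrow> \<phi> x = 0"
    using test_functionsE[OF \<phi>] by metis
  obtain R where R: "\<And>x. x \<in> K \<Longrightarrow> norm x \<le> R"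
    using compact_imp_bounded[OF K(1)] bounded_iff by metis
  obtain B where B: "B > 0" "\<And>x. \<bar>frechet_derivative \<phi> (at x) v\<bar> \<le> B"
    using test_function_bounded[OF test_function_derivative[OF \<phi>]] by metis
  obtain c where c: "\<And>n. \<bar>s n\<bar> \<le> c"
    using convergent_imp_bounded[OF s(1)] by (metis bounded_iff rangeI real_norm_def)
  \<comment> \<open>\<open>c\<close> bounds all \<open>\<bar>s n\<bar>\<close>, so the quotients
    vanish outside this enlarged ball.\<close>
  define C where "C = cball (0::'a) (R + c * norm v)"
  have "bounded (k ` C)"
    by (intro compact_imp_bounded compact_continuous_image continuous_on_subset[OF k]) (auto simp: C_def)
  then obtain L where L: "L > 0" "\<And>x. x \<in> C \<Longrightarrow> \<bar>k x\<bar> \<le> L"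
    by (metis bounded_pos imageI real_norm_def)
  have [measurable]: "\<phi> \<in> borel_measurable borel" "k \<in> borel_measurable borel"
    "(\<lambda>x. frechet_derivative \<phi> (at x) v) \<in> borel_measurable borel"
    using sm k smooth_derivative by (auto intro: smooth_borel_measurable borel_measurable_continuous_onI)
  show ?thesis
  proof (rule integral_dominated_convergence[where w="\<lambda>x. B * L * indicator C x"])
    show "(\<lambda>x. frechet_derivative \<phi> (at x) v * k x) \<in> borel_measurable lborel" by measurable
    show "(\<lambda>x. (\<phi> (x + s n *\<^sub>R v) - \<phi> x) / s n * k x) \<in> borel_measurable lborel" for n by measurable
    show "integrable lborel (\<lambda>x. B * L * indicator C x)"
      using emeasure_lborel_cball_finite[of 0 "R + c * norm v"] by (intro integrable_mult_right) (auto simp: C_def)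
    show "AE x in lborel. (\<lambda>n. (\<phi> (x + s n *\<^sub>R v) - \<phi> x) / s n * k x) \<longlonglongrightarrow> frechet_derivative \<phi> (at x) v * k x"
    proof (intro AE_I2 tendsto_intros)
      fix x
      have "((\<lambda>h. (\<phi> (x + h *\<^sub>R v) - \<phi> x) / h) \<longlongrightarrow> frechet_derivative \<phi> (at x) v) (at 0)"
        using smooth_DERIV_line[OF sm, of x v 0] by (simp add: has_field_derivative_iff)
      then show "(\<lambda>n. (\<phi> (x + s n *\<^sub>R v) - \<phi> x) / s n) \<longlonglongrightarrow> frechet_derivative \<phi> (at x) v"
        by (rule filterlim_compose) (use s in \<open>auto simp: filterlim_at\<close>)
    qed
    show "AE x in lborel. norm ((\<phi> (x + s n *\<^sub>R v) - \<phi> x) / s n * k x) \<le> B * L * indicator C x" for n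
    proof (rule AE_I2)
      fix x
      show "norm ((\<phi> (x + s n *\<^sub>R v) - \<phi> x) / s n * k x) \<le> B * L * indicator C x"
      proof (cases "x \<in> C")
        case True
        have "norm (\<phi> (x + s n *\<^sub>R v) - \<phi> (x + 0 *\<^sub>R v)) \<le> B * norm (s n - 0)"
          by (rule field_differentiable_bound[of UNIV, OF _ smooth_DERIV_line[OF sm]]) (use B in auto)
        then have "\<bar>(\<phi> (x + s n *\<^sub>R v) - \<phi> x) / s n\<bar> \<le> B"
          using s(2)[of n] by (simp add: abs_divide field_simps)
        then have "\<bar>(\<phi> (x + s n *\<^sub>R v) - \<phi> x) / s n\<bar> * \<bar>k x\<bar> \<le> B * L"
          using True L(2)[of x] B by (intro mult_mono) auto
        then show ?thesis using True by (simp only: real_norm_def abs_mult indicator_simps mult_1_right)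
      next
        case False
        then have far: "R + c * norm v < norm x" by (simp add: C_def)
        have "norm (s n *\<^sub>R v) \<le> c * norm v" using c[of n] by (simp add: mult_right_mono)
        moreover have "0 \<le> c * norm v" using c[of n] by simp
        moreover have "norm x \<le> norm (x + s n *\<^sub>R v) + norm (s n *\<^sub>R v)"
          by (metis add_diff_cancel_right' norm_triangle_ineq4)
        ultimately have "R < norm x" "R < norm (x + s n *\<^sub>R v)"
          using far by linarith+
        then have "\<phi> x = 0" "\<phi> (x + s n *\<^sub>R v) = 0"
          using R K(2) by (force)+
        then show ?thesis using False by simp
      qed
    qed
  qed
qed

text \<open>Translation invariance moves the shift from \<open>F\<close> to \<open>G\<close> with
  the opposite sign; the compact support of \<open>F\<close> makes all integrals finite.\<close>

lemma difference_quotient_by_parts: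
  fixes F G :: "'a::euclidean_space \<Rightarrow> real"
  assumes F: "F \<in> test_functions UNIV" and G: "smooth G"
  shows "(LINT x|lborel. (F (x + s *\<^sub>R v) - F x) / s * G x) = - (LINT x|lborel. (G (x + (- s) *\<^sub>R v) - G x) / (- s) * F x)"
proof -
  have [measurable]: "F \<in> borel_measurable borel" "G \<in> borel_measurable borel"
    using F G test_function_smooth by (auto intro: smooth_borel_measurable)
  have i1: "integrable lborel (\<lambda>x. F (x + s *\<^sub>R v) * G x)"
    using test_function_integrable[OF test_function_mult[OF test_function_translate[OF F] G]] .
  have i2: "integrable lborel (\<lambda>x. F x * G x)"
    using test_function_integrable[OF test_function_mult[OF F G]] .
  have i3: "integrable lborel (\<lambda>x. F x * G (x - s *\<^sub>R v))"
    using test_function_integrable[OF test_function_mult[OF F smooth_translate[OF G, of "- s *\<^sub>R v"]]] by simp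
  have "(LINT x|lborel. F (x + s *\<^sub>R v) * G x) = (LINT x|lborel. F x * G (x - s *\<^sub>R v))"
    using lborel_integral_translate[of "\<lambda>x. F x * G (x - s *\<^sub>R v)" "s *\<^sub>R v"] by simp
  then have "(LINT x|lborel. F (x + s *\<^sub>R v) * G x - F x * G x) = (LINT x|lborel. F x * G (x - s *\<^sub>R v) - F x * G x)"
    using i1 i2 i3 by simp
  then have "(LINT x|lborel. (F (x + s *\<^sub>R v) * G x - F x * G x) / s) = (LINT x|lborel. (F x * G (x - s *\<^sub>R v) - F x * G x) / s)"
    by simp
  then have "(LINT x|lborel. (F (x + s *\<^sub>R v) - F x) / s * G x) = (LINT x|lborel. - ((G (x + (- s) *\<^sub>R v) - G x) / (- s) * F x))"
    by (simp add: algebra_simps diff_divide_distrib)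
  then show ?thesis by simp
qed

lemma integral_by_parts:
  fixes f g :: "'a::euclidean_space \<Rightarrow> real"
  assumes f: "f \<in> test_functions UNIV" and g: "smooth g"
  shows "(LINT x|lborel. frechet_derivative f (at x) v * g x) = - (LINT x|lborel. f x * frechet_derivative g (at x) v)"
proof -
  define s where "s n = 1 / real (Suc n)" for n
  have s: "s \<longlonglongrightarrow> 0" "\<And>n. s n \<noteq> 0"
    using LIMSEQ_inverse_real_of_nat by (auto simp: s_def[abs_def] inverse_eq_divide)
  let ?h = "\<lambda>x. f x * g x"
  have h: "?h \<in> test_functions UNIV" by (rule test_function_mult[OF f g])
  \<comment> \<open>Paired with the constant 1, the quotients of the product integrate to 0; in the
    limit, the derivative of a compactly supported function has integral 0.\<close>
  have "(LINT x|lborel. (?h (x + s n *\<^sub>R v) - ?h x) / s n * 1) = 0" for n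
    using difference_quotient_by_parts[OF h smooth_const[of 1], of "s n" v] by simp
  then have "(LINT x|lborel. frechet_derivative ?h (at x) v * 1) = 0"
    using difference_quotient_tendsto[OF h continuous_on_const s, of v 1] by (simp only: LIMSEQ_const_iff)
  then have *: "(LINT x|lborel. f x * frechet_derivative g (at x) v + frechet_derivative f (at x) v * g x) = 0"
    using frechet_derivative_mult_smooth[OF test_function_smooth[OF f] g] by simp
  have "integrable lborel (\<lambda>x. f x * frechet_derivative g (at x) v)"
    "integrable lborel (\<lambda>x. frechet_derivative f (at x) v * g x)"
    by (intro test_function_integrable[of _ UNIV] test_function_mult f smooth_derivative g test_function_derivative)+
  then show ?thesis using * by simp
qed

text \<open>One derivative is kept as a difference quotient, which commutes with the other
  derivative by translation. Moving first the derivative and then the quotient across to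
  \<open>g\<close>, and letting the step tend to 0, exchanges the two directions.\<close>

lemma integral_derivatives_swap:
  fixes f g :: "'a::euclidean_space \<Rightarrow> real"
  assumes f: "f \<in> test_functions UNIV" and g: "g \<in> test_functions UNIV"
  shows "(LINT x|lborel. frechet_derivative f (at x) v * frechet_derivative g (at x) w)
       = (LINT x|lborel. frechet_derivative f (at x) w * frechet_derivative g (at x) v)"
proof -
  define s where "s n = 1 / real (Suc n)" for n
  have s: "s \<longlonglongrightarrow> 0" "\<And>n. s n \<noteq> 0"
    using LIMSEQ_inverse_real_of_nat by (auto simp: s_def[abs_def] inverse_eq_divide)
  have s': "(\<lambda>n. - s n) \<longlonglongrightarrow> 0" "\<And>n. - s n \<noteq> 0"
    using s tendsto_minus[OF s(1)] by auto
  have fs: "smooth f" and gs: "smooth g" using f g test_function_smooth by auto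
  let ?Df = "\<lambda>x. frechet_derivative f (at x) w" and ?Dg = "\<lambda>x. frechet_derivative g (at x) w"
  have eq: "(LINT x|lborel. (f (x + s n *\<^sub>R v) - f x) / s n * ?Dg x)
      = (LINT x|lborel. (g (x + (- s n) *\<^sub>R v) - g x) / (- s n) * ?Df x)" for n
  proof -
    define q where "q = (\<lambda>x. (f (x + s n *\<^sub>R v) + (- 1) * f x) * (1 / s n))"
    have q: "q \<in> test_functions UNIV"
      unfolding q_def
      by (rule test_function_mult[OF test_function_add[OF test_function_translate[OF f]] smooth_const])
         (use test_function_mult[OF f smooth_const[of "-1"]] in \<open>simp add: mult.commute\<close>)
    have Dq: "frechet_derivative q (at x) w = (?Df (x + s n *\<^sub>R v) - ?Df x) / s n" for x
    proof -
      have "((\<lambda>x. f (x + s n *\<^sub>R v)) has_derivative frechet_derivative f (at (x + s n *\<^sub>R v))) (at x)"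
        by (rule has_derivative_compose[OF has_derivative_add_const[OF has_derivative_ident] smooth_has_derivative[OF fs]])
      then have d: "(q has_derivative (\<lambda>h. (frechet_derivative f (at (x + s n *\<^sub>R v)) h + (-1) * frechet_derivative f (at x) h) * (1 / s n))) (at x)"
        unfolding q_def
        by (intro has_derivative_mult_left has_derivative_add has_derivative_mult_right smooth_has_derivative[OF fs])
      show ?thesis unfolding frechet_derivative_at[OF d, symmetric] by simp
    qed
    have "(LINT x|lborel. q x * ?Dg x) = - (LINT x|lborel. frechet_derivative q (at x) w * g x)"
      using integral_by_parts[OF q gs, of w] by simp
    also have "\<dots> = (LINT x|lborel. (g (x + (- s n) *\<^sub>R v) - g x) / (- s n) * ?Df x)"
      unfolding Dq using difference_quotient_by_parts[OF test_function_derivative[OF f] gs, of "s n" v w] by simp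
    finally show ?thesis by (simp add: q_def)
  qed
  have "(\<lambda>n. LINT x|lborel. (f (x + s n *\<^sub>R v) - f x) / s n * ?Dg x)
      \<longlonglongrightarrow> (LINT x|lborel. frechet_derivative f (at x) v * ?Dg x)"
    by (rule difference_quotient_tendsto[OF f smooth_continuous_on[OF smooth_derivative[OF gs]] s])
  moreover have "(\<lambda>n. LINT x|lborel. (g (x + (- s n) *\<^sub>R v) - g x) / (- s n) * ?Df x)
      \<longlonglongrightarrow> (LINT x|lborel. frechet_derivative g (at x) v * ?Df x)"
    by (rule difference_quotient_tendsto[OF g smooth_continuous_on[OF smooth_derivative[OF fs]] s'])
  ultimately have "(LINT x|lborel. frechet_derivative f (at x) v * ?Dg x) = (LINT x|lborel. frechet_derivative g (at x) v * ?Df x)"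
    unfolding eq using LIMSEQ_unique by blast
  then show ?thesis by (simp add: mult.commute)
qed

section \<open>A finite rank estimate for compactly supported functions\<close>

lemma Fubini_compact:
  fixes g :: "'a::euclidean_space \<Rightarrow> 'b::euclidean_space \<Rightarrow> real"
  assumes K: "compact K" and L: "compact L" and g: "continuous_on (K \<times> L) (\<lambda>(x, y). g x y)"
  shows "(LINT y|lborel. indicator L y * (LINT x|lborel. indicator K x * g x y))
       = (LINT x|lborel. indicator K x * (LINT y|lborel. indicator L y * g x y))" (is ?eq)
    and "integrable lborel (\<lambda>x. indicator K x * (LINT y|lborel. indicator L y * g x y))" (is ?int1)
    and "integrable lborel (\<lambda>y. indicator L y * (LINT x|lborel. indicator K x * g x y))" (is ?int2)
proof -
  let ?f = "\<lambda>x y. indicator K x * (indicator L y * g x y)"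
  have "integrable lborel (\<lambda>z. indicator (K \<times> L) z *\<^sub>R (\<lambda>(x, y). g x y) z)"
    by (intro borel_integrable_compact compact_Times K L g)
  also have "(\<lambda>z. indicator (K \<times> L) z *\<^sub>R (\<lambda>(x, y). g x y) z) = (\<lambda>(x, y). ?f x y)"
    by (auto simp: fun_eq_iff indicator_def)
  finally have I: "integrable (lborel \<Otimes>\<^sub>M lborel) (\<lambda>(x, y). ?f x y)"
    by (simp add: lborel_prod)
  have "(LINT y|lborel. LINT x|lborel. ?f x y) = (LINT x|lborel. LINT y|lborel. ?f x y)"
    by (rule lborel_pair.Fubini_integral[OF I])
  moreover have s: "(LINT x|lborel. ?f x y) = indicator L y * (LINT x|lborel. indicator K x * g x y)" for y
    by (subst integral_mult_right_zero[symmetric]) (simp add: ac_simps)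
  moreover have f: "(LINT y|lborel. ?f x y) = indicator K x * (LINT y|lborel. indicator L y * g x y)" for x
    by simp
  ultimately show ?eq by simp
  show ?int1 using lborel_pair.integrable_fst[OF I] f by simp
  show ?int2 using lborel_pair.integrable_snd[OF I] s by simp
qed

text \<open>Cauchy-Schwarz on the unit interval: the increment \<open>c\<close> is the mean of the
  directional derivative \<open>g\<close>, and the integral of \<open>(g s - c)\<^sup>2\<close> is
  nonnegative.\<close>

lemma square_increment_le:
  fixes f :: "'a::euclidean_space \<Rightarrow> real"
  assumes f: "smooth f"
  shows "(f (x + h) - f x)\<^sup>2 \<le> (LINT s|lborel. indicator {0..1} s * (frechet_derivative f (at (x + s *\<^sub>R h)) h)\<^sup>2)"
proof -
  define g where "g s = frechet_derivative f (at (x + s *\<^sub>R h)) h" for s :: real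
  have cg: "continuous_on S g" for S
    unfolding g_def
    by (intro continuous_on_compose2[OF smooth_continuous_on[OF smooth_derivative[OF f], of UNIV]] continuous_intros) auto
  define c where "c = f (x + h) - f x"
  have "(LINT s|lborel. indicator {0..1} s *\<^sub>R g s) = f (x + 1 *\<^sub>R h) - f (x + 0 *\<^sub>R h)"
  proof (rule integral_FTC_atLeastAtMost)
    show "((\<lambda>s. f (x + s *\<^sub>R h)) has_vector_derivative g s) (at s within {0..1})" for s
      unfolding g_def has_real_derivative_iff_has_vector_derivative[symmetric]
      using has_field_derivative_at_within[OF smooth_DERIV_line[OF f]] .
  qed (auto intro: cg)
  then have c: "(LINT s|lborel. indicator {0..1} s * g s) = c" by (simp add: c_def)
  have I: "integrable lborel (\<lambda>s. indicator {0..1::real} s * k s)" if "continuous_on {0..1} k" for k :: "real \<Rightarrow> real"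
    using borel_integrable_compact[OF compact_Icc that] by simp
  have "0 \<le> (LINT s|lborel. indicator {0..1} s * (g s - c)\<^sup>2)"
    by (intro integral_nonneg_AE AE_I2) auto
  also have "(\<lambda>s. indicator {0..1} s * (g s - c)\<^sup>2) = (\<lambda>s. indicator {0..1} s * (g s)\<^sup>2 - 2 * c * (indicator {0..1} s * g s) + c\<^sup>2 * (indicator {0..1} s * 1))"
    by (auto simp: power2_eq_square algebra_simps)
  also have "(LINT s|lborel. indicator {0..1} s * (g s)\<^sup>2 - 2 * c * (indicator {0..1} s * g s) + c\<^sup>2 * (indicator {0..1} s * 1))
     = (LINT s|lborel. indicator {0..1} s * (g s)\<^sup>2) - 2 * c * (LINT s|lborel. indicator {0..1} s * g s) + c\<^sup>2 * (LINT s|lborel. indicator {0..1::real} s * 1)"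
    by (subst Bochner_Integration.integral_add Bochner_Integration.integral_diff,
        (intro Bochner_Integration.integrable_diff integrable_mult_right I continuous_intros cg)+)+
       (simp add: )
  also have "\<dots> = (LINT s|lborel. indicator {0..1} s * (g s)\<^sup>2) - c\<^sup>2"
    unfolding c by (simp add: power2_eq_square)
  finally show ?thesis by (simp add: c_def g_def)
qed

text \<open>The pointwise bound on the increment is integrated over \<open>x\<close>. By Fubini and
  translation invariance every \<open>s\<close> contributes the same integral of the squared
  directional derivative, and Cauchy-Schwarz over the basis turns it into the full gradient.\<close>

lemma translation_L2_bound:
  fixes f :: "'a::euclidean_space \<Rightarrow> real"
  assumes f: "f \<in> test_functions UNIV"
  shows "(LINT x|lborel. (f (x + h) - f x)\<^sup>2) \<le> (norm h)\<^sup>2 * (\<Sum>b\<in>Basis. LINT x|lborel. (frechet_derivative f (at x) b)\<^sup>2)"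
proof -
  have sm: "smooth f" using f test_function_smooth by blast
  let ?D = "\<lambda>x. frechet_derivative f (at x) h"
  have D: "?D \<in> test_functions UNIV" by (rule test_function_derivative[OF f])
  obtain K0 where K0: "compact K0" "\<And>x. x \<notin> K0 \<Longrightarrow> f x = 0" "\<And>x. x \<notin> K0 \<Longrightarrow> ?D x = 0"
  proof -
    obtain K1 where K1: "compact K1" "\<And>x. x \<notin> K1 \<Longrightarrow> f x = 0" using test_functionsE[OF f] by metis
    obtain K2 where K2: "compact K2" "\<And>x. x \<notin> K2 \<Longrightarrow> ?D x = 0" using test_functionsE[OF D] by metis
    show ?thesis by (rule that[of "K1 \<union> K2"]) (use K1 K2 in auto)
  qed
  \<comment> \<open>The set swept out by moving the support backwards along \<open>h\<close>:
    outside it all shifted functions vanish, so Fubini takes place on a compact set.\<close>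
  define K where "K = (\<lambda>(x, s). x - s *\<^sub>R h) ` (K0 \<times> {0..1::real})"
  have cK: "compact K"
    unfolding K_def case_prod_beta by (intro compact_continuous_image compact_Times K0 compact_Icc continuous_intros)
  have out: "?D (x + s *\<^sub>R h) = 0" if "x \<notin> K" "s \<in> {0..1}" for x s
  proof (rule K0(3))
    show "x + s *\<^sub>R h \<notin> K0"
    proof
      assume "x + s *\<^sub>R h \<in> K0"
      then have "x \<in> K" unfolding K_def using that(2) by (intro image_eqI[of _ _ "(x + s *\<^sub>R h, s)"]) auto
      then show False using that by simp
    qed
  qed
  let ?g = "\<lambda>x s. (?D (x + s *\<^sub>R h))\<^sup>2"
  have cg: "continuous_on (K \<times> {0..1}) (\<lambda>(x, s). ?g x s)"
    unfolding case_prod_beta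
    by (intro continuous_intros continuous_on_compose2[OF smooth_continuous_on[OF smooth_derivative[OF sm], of UNIV]]) auto
  note F = Fubini_compact[OF cK compact_Icc cg]
  have I2: "integrable lborel (\<lambda>x. (\<psi> x)\<^sup>2)" if "\<psi> \<in> test_functions UNIV" for \<psi> :: "'a \<Rightarrow> real"
    using test_function_integrable[OF test_function_mult[OF that test_function_smooth[OF that]]] by (simp add: power2_eq_square)
  have "(\<lambda>x. f (x + h) + - 1 * f x) \<in> test_functions UNIV"
    using test_function_add[OF test_function_translate[OF f] test_function_mult[OF f smooth_const[of "-1"]]]
    by (simp add: mult.commute)
  then have id: "integrable lborel (\<lambda>x. (f (x + h) - f x)\<^sup>2)"
    using I2 by fastforce
  have "(LINT x|lborel. (f (x + h) - f x)\<^sup>2) \<le> (LINT x|lborel. indicator K x * (LINT s|lborel. indicator {0..1} s * ?g x s))"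
  proof (rule integral_mono[OF id F(2)])
    fix x
    have le: "(f (x + h) - f x)\<^sup>2 \<le> (LINT s|lborel. indicator {0..1} s * ?g x s)" by (rule square_increment_le[OF sm])
    show "(f (x + h) - f x)\<^sup>2 \<le> indicator K x * (LINT s|lborel. indicator {0..1} s * ?g x s)"
    proof (cases "x \<in> K")
      case False
      then have z: "indicator {0..1} s * ?g x s = 0" for s using out by (auto simp: indicator_def)
      have "(LINT s|lborel. indicator {0..1} s * ?g x s) = 0" unfolding z by simp
      then show ?thesis using le False by simp
    qed (use le in simp)
  qed
  also have "\<dots> = (LINT s|lborel. indicator {0..1} s * (LINT x|lborel. indicator K x * ?g x s))"
    by (rule F(1)[symmetric])
  also have "(\<lambda>s. indicator {0..1} s * (LINT x|lborel. indicator K x * ?g x s)) = (\<lambda>s. indicator {0..1} s * (LINT x|lborel. (?D x)\<^sup>2))"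
  proof
    fix s :: real
    show "indicator {0..1} s * (LINT x|lborel. indicator K x * ?g x s) = indicator {0..1} s * (LINT x|lborel. (?D x)\<^sup>2)"
    proof (cases "s \<in> {0..1}")
      case True
      have "(LINT x|lborel. indicator K x * ?g x s) = (LINT x|lborel. ?g x s)"
        using out True by (intro Bochner_Integration.integral_cong refl) (auto simp: indicator_def)
      also have "\<dots> = (LINT x|lborel. (?D x)\<^sup>2)"
        using smooth_borel_measurable[OF smooth_derivative[OF sm]] by (intro lborel_integral_translate[of "\<lambda>x. (?D x)\<^sup>2"]) simp
      finally show ?thesis by simp
    qed simp
  qed
  also have "(LINT s|lborel. indicator {0..1::real} s * (LINT x|lborel. (?D x)\<^sup>2)) = (LINT x|lborel. (?D x)\<^sup>2)"
    by simp
  also have "\<dots> \<le> (LINT x|lborel. (norm h)\<^sup>2 * (\<Sum>b\<in>Basis. (frechet_derivative f (at x) b)\<^sup>2))"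
  proof (rule integral_mono)
    show "integrable lborel (\<lambda>x. (?D x)\<^sup>2)" by (rule I2[OF D])
    show "integrable lborel (\<lambda>x. (norm h)\<^sup>2 * (\<Sum>b\<in>Basis. (frechet_derivative f (at x) b)\<^sup>2))"
      by (intro integrable_mult_right Bochner_Integration.integrable_sum I2 test_function_derivative f)
    fix x
    have bl: "bounded_linear (frechet_derivative f (at x))"
      using smooth_has_derivative[OF sm] has_derivative_bounded_linear by blast
    have "?D x = frechet_derivative f (at x) (\<Sum>b\<in>Basis. (h \<bullet> b) *\<^sub>R b)"
      by (simp add: euclidean_representation)
    also have "\<dots> = (\<Sum>b\<in>Basis. (h \<bullet> b) * frechet_derivative f (at x) b)"
      using bounded_linear.linear[OF bl] by (simp add: linear_sum linear_cmul)
    finally have "(?D x)\<^sup>2 \<le> (\<Sum>b\<in>Basis. (h \<bullet> b)\<^sup>2) * (\<Sum>b\<in>Basis. (frechet_derivative f (at x) b)\<^sup>2)"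
      using Cauchy_Schwarz_ineq_sum by simp
    also have "(\<Sum>b\<in>Basis. (h \<bullet> b)\<^sup>2) = (norm h)\<^sup>2"
      unfolding power2_norm_eq_inner euclidean_inner[of h h] by (simp add: power2_eq_square)
    finally show "(?D x)\<^sup>2 \<le> (norm h)\<^sup>2 * (\<Sum>b\<in>Basis. (frechet_derivative f (at x) b)\<^sup>2)" .
  qed
  also have "\<dots> = (norm h)\<^sup>2 * (\<Sum>b\<in>Basis. LINT x|lborel. (frechet_derivative f (at x) b)\<^sup>2)"
    by (simp add: Bochner_Integration.integral_sum I2 test_function_derivative f)
  finally show ?thesis .
qed

text \<open>Takes the place of Poincare's inequality on a cell: expanding
  \<open>(f x - f y)\<^sup>2\<close> separates the mean from a double integral of differences, which
  translation estimates control.\<close>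

lemma square_integral_eq_mean_plus_variance:
  fixes f :: "'a::euclidean_space \<Rightarrow> real"
  assumes Q: "Q \<in> sets borel" "emeasure lborel Q = ennreal q" "0 < q"
    and f: "f \<in> test_functions UNIV"
  shows "(LINT x|lborel. indicator Q x * (f x)\<^sup>2)
    = (LINT x|lborel. indicator Q x * f x)\<^sup>2 / q
      + (LINT x|lborel. indicator Q x * (LINT y|lborel. indicator Q y * (f x - f y)\<^sup>2)) / (2 * q)" (is ?eq)
    and "integrable lborel (\<lambda>x. indicator Q x * (LINT y|lborel. indicator Q y * (f x - f y)\<^sup>2))" (is ?int)
proof -
  define a where "a = (LINT x|lborel. indicator Q x * f x)"
  define b where "b = (LINT x|lborel. indicator Q x * (f x)\<^sup>2)"
  have I: "integrable lborel (\<lambda>x. indicator Q x * \<psi> x)" if "\<psi> \<in> test_functions UNIV" for \<psi> :: "'a \<Rightarrow> real"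
    using integrable_real_mult_indicator[OF _ test_function_integrable[OF that], of Q] Q by (simp add: mult.commute)
  have f2: "(\<lambda>x. (f x)\<^sup>2) \<in> test_functions UNIV"
    using test_function_mult[OF f test_function_smooth[OF f]] by (simp add: power2_eq_square)
  have I1: "integrable lborel (indicat_real Q)"
    using Q by (intro integrable_real_indicator) auto
  have m1: "(LINT x|lborel. indicat_real Q x) = q"
    using Q by (simp add: measure_def)
  have inner: "(LINT y|lborel. indicator Q y * (f x - f y)\<^sup>2) = q * (f x)\<^sup>2 - 2 * f x * a + b" for x
  proof -
    have "(\<lambda>y. indicator Q y * (f x - f y)\<^sup>2) = (\<lambda>y. (f x)\<^sup>2 * indicator Q y - 2 * f x * (indicator Q y * f y) + indicator Q y * (f y)\<^sup>2)"
      by (auto simp: power2_eq_square algebra_simps)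
    then show ?thesis
      using I[OF f] I[OF f2] I1 m1 by (simp add: a_def b_def mult.commute)
  qed
  have outer: "(\<lambda>x. indicator Q x * (LINT y|lborel. indicator Q y * (f x - f y)\<^sup>2))
     = (\<lambda>x. q * (indicator Q x * (f x)\<^sup>2) - 2 * a * (indicator Q x * f x) + b * indicator Q x)"
    unfolding inner by (auto simp: algebra_simps)
  show ?int unfolding outer using I[OF f] I[OF f2] I1 by auto
  have J: "(LINT x|lborel. indicator Q x * (LINT y|lborel. indicator Q y * (f x - f y)\<^sup>2)) = 2 * q * b - 2 * a\<^sup>2"
    unfolding outer using I[OF f] I[OF f2] I1 m1 by (simp add: a_def[symmetric] b_def[symmetric] power2_eq_square[of a])
  show ?eq unfolding J a_def[symmetric] b_def[symmetric] using Q(3) by (simp add: field_simps)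
qed

text \<open>Cubes of side \<open>\<delta>\<close> cover the ball, and on each the square integral is
  mean plus variance. Two points of one cube differ by a vector of the cube \<open>B\<close> of
  half-width \<open>\<delta>\<close>, so all variances together are at most the integral over
  \<open>B\<close> of the squared translation differences, which is small with
  \<open>\<delta>\<close>. The cell means remain as finitely many functionals.\<close>

lemma finite_rank_L2_estimate:
  fixes \<epsilon> R :: real
  assumes "\<epsilon> > 0"
  obtains I :: "('a::euclidean_space \<Rightarrow> int) set" and Q :: "('a \<Rightarrow> int) \<Rightarrow> 'a set" and C :: real
  where "finite I" "\<And>k. k \<in> I \<Longrightarrow> Q k \<in> sets borel" "0 \<le> C"
    "\<And>f. f \<in> test_functions UNIV \<Longrightarrow> \<forall>x. R < norm x \<longrightarrow> f x = 0 \<Longrightarrow>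
      (LINT x|lborel. (f x)\<^sup>2) \<le> \<epsilon> * (\<Sum>b\<in>Basis. LINT x|lborel. (frechet_derivative f (at x) b)\<^sup>2)
          + C * (\<Sum>k\<in>I. (LINT x|lborel. indicator (Q k) x * f x)\<^sup>2)"
proof -
  define d where "d = real DIM('a)"
  have d: "d > 0" by (simp add: d_def)
  \<comment> \<open>The cube \<open>B\<close> below has volume \<open>2 ^ DIM('a) * q\<close> and
    its vectors have squared norm at most \<open>d * \<delta>\<^sup>2\<close>; the product of the
    two is to be \<open>q * \<epsilon>\<close>.\<close>
  define \<delta> where "\<delta> = sqrt (\<epsilon> / (2 ^ DIM('a) * d))"
  have \<delta>: "\<delta> > 0" "2 ^ DIM('a) * d * \<delta>\<^sup>2 = \<epsilon>"
    using assms d by (auto simp: \<delta>_def)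
  define N where "N = \<lceil>R / \<delta>\<rceil> + 1"
  define I where "I = (Basis :: 'a set) \<rightarrow>\<^sub>E {-N..N}"
  \<comment> \<open>Half-open, so that each point lies in exactly one cube.\<close>
  define Q where "Q k = {x. \<forall>i\<in>Basis. of_int (k i) * \<delta> \<le> x \<bullet> i \<and> x \<bullet> i < (of_int (k i) + 1) * \<delta>}" for k :: "'a \<Rightarrow> int"
  define q where "q = \<delta> ^ DIM('a)"
  have q: "q > 0" using \<delta> by (simp add: q_def)
  have finI: "finite I" unfolding I_def by (intro finite_PiE) auto
  have Qborel: "Q k \<in> sets borel" for k
    unfolding Q_def by measurable
  have Qq: "emeasure lborel (Q k) = ennreal q" for k
  proof -
    define l where "l = (\<Sum>i\<in>Basis. (of_int (k i) * \<delta>) *\<^sub>R i)"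
    define u where "u = (\<Sum>i\<in>Basis. ((of_int (k i) + 1) * \<delta>) *\<^sub>R (i::'a))"
    have lu: "l \<bullet> i = of_int (k i) * \<delta>" "u \<bullet> i = (of_int (k i) + 1) * \<delta>" if "i \<in> Basis" for i
      using that by (simp_all add: l_def u_def)
    have "(\<Prod>b\<in>Basis. (u - l) \<bullet> b) = (\<Prod>b\<in>(Basis::'a set). \<delta>)"
      by (intro prod.cong refl) (simp add: inner_diff_left lu algebra_simps)
    then have m: "(\<Prod>b\<in>Basis. (u - l) \<bullet> b) = q" by (simp add: q_def)
    have le: "l \<bullet> b \<le> u \<bullet> b" if "b \<in> Basis" for b
      using lu[OF that] \<delta> by (simp add: algebra_simps)
    \<comment> \<open>\<open>Q k\<close> lies between an open and a closed box of the same
      volume.\<close>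
    have "emeasure lborel (box l u) \<le> emeasure lborel (Q k)"
      using Qborel by (intro emeasure_mono) (auto simp: Q_def mem_box lu less_imp_le)
    moreover have "emeasure lborel (Q k) \<le> emeasure lborel (cbox l u)"
      by (intro emeasure_mono) (auto simp: Q_def mem_box lu less_imp_le)
    ultimately show ?thesis
      using emeasure_lborel_box[OF le] emeasure_lborel_cbox[OF le] m by (metis antisym)
  qed
  have inQ: "x \<in> Q k \<longleftrightarrow> (\<forall>i\<in>Basis. k i = \<lfloor>x \<bullet> i / \<delta>\<rfloor>)" for x k
  proof -
    have "(of_int (k i) * \<delta> \<le> x \<bullet> i \<and> x \<bullet> i < (of_int (k i) + 1) * \<delta>) \<longleftrightarrow> k i = \<lfloor>x \<bullet> i / \<delta>\<rfloor>" for i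
    proof -
      have "(of_int (k i) * \<delta> \<le> x \<bullet> i \<and> x \<bullet> i < (of_int (k i) + 1) * \<delta>) \<longleftrightarrow> \<lfloor>x \<bullet> i / \<delta>\<rfloor> = k i"
        using \<delta>(1) by (simp add: floor_eq_iff pos_le_divide_eq pos_divide_less_eq)
      then show ?thesis by auto
    qed
    then show ?thesis by (simp add: Q_def)
  qed
  have uniq: "k = k'" if "k \<in> I" "k' \<in> I" "x \<in> Q k" "x \<in> Q k'" for k k' x
    using that unfolding I_def inQ by (intro PiE_ext[of k Basis _ k']) auto
  have single: "(\<Sum>j\<in>I. indicator (Q j) x * c j) = c k" if "k \<in> I" "x \<in> Q k" for x k and c :: "_ \<Rightarrow> real"
  proof -
    have "(\<Sum>j\<in>I. indicator (Q j) x * c j) = (\<Sum>j\<in>I. if j = k then c k else 0)"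
      using uniq that by (intro sum.cong refl) (auto simp: indicator_def)
    then show ?thesis using finI that by simp
  qed
  have cover: "\<exists>k\<in>I. x \<in> Q k" if "norm x \<le> R" for x
  proof (intro bexI)
    let ?k = "\<lambda>i\<in>Basis. \<lfloor>x \<bullet> i / \<delta>\<rfloor>"
    show "x \<in> Q ?k" by (simp add: inQ)
    have "\<lfloor>x \<bullet> i / \<delta>\<rfloor> \<in> {-N..N}" if i: "i \<in> Basis" for i
    proof -
      have "\<bar>x \<bullet> i\<bar> \<le> R" using Basis_le_norm[OF i, of x] \<open>norm x \<le> R\<close> by linarith
      then have "x \<bullet> i \<le> R" "- R \<le> x \<bullet> i" by auto
      have "x \<bullet> i / \<delta> \<le> R / \<delta>" by (rule divide_right_mono) (use \<open>x \<bullet> i \<le> R\<close> \<delta>(1) in auto)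
      moreover have "- R / \<delta> \<le> x \<bullet> i / \<delta>" by (rule divide_right_mono) (use \<open>- R \<le> x \<bullet> i\<close> \<delta>(1) in auto)
      ultimately show ?thesis unfolding N_def atLeastAtMost_iff minus_divide_left[symmetric] by linarith
    qed
    then show "?k \<in> I" unfolding I_def by auto
  qed
  define B where "B = cbox (- (\<delta> *\<^sub>R One)) (\<delta> *\<^sub>R (One::'a))"
  have inB: "h \<in> B \<longleftrightarrow> (\<forall>i\<in>Basis. \<bar>h \<bullet> i\<bar> \<le> \<delta>)" for h
    by (auto simp: B_def mem_box abs_le_iff)
  have Bm: "(LINT h|lborel. indicator B h * c) = 2 ^ DIM('a) * q * c" for c :: real
  proof -
    have "emeasure lborel B = ennreal (\<Prod>b\<in>Basis. (\<delta> *\<^sub>R One - - (\<delta> *\<^sub>R One)) \<bullet> (b::'a))"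
      unfolding B_def using \<delta> by (intro emeasure_lborel_cbox) simp
    also have "(\<Prod>b\<in>Basis. (\<delta> *\<^sub>R One - - (\<delta> *\<^sub>R One)) \<bullet> (b::'a)) = (\<Prod>b\<in>(Basis::'a set). 2 * \<delta>)"
      by (intro prod.cong refl) (simp add: inner_add_left)
    finally have "emeasure lborel B = ennreal (2 ^ DIM('a) * q)"
      by (simp add: q_def power_mult_distrib)
    then have "measure lborel B = 2 ^ DIM('a) * q"
      using q by (simp add: measure_def)
    then show ?thesis by simp
  qed
  have Bnorm: "(norm h)\<^sup>2 \<le> d * \<delta>\<^sup>2" if "h \<in> B" for h
  proof -
    have "(norm h)\<^sup>2 = (\<Sum>b\<in>Basis. (h \<bullet> b)\<^sup>2)"
      unfolding power2_norm_eq_inner euclidean_inner[of h h] by (simp add: power2_eq_square)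
    also have "\<dots> \<le> (\<Sum>b\<in>(Basis::'a set). \<delta>\<^sup>2)"
      using that \<delta> unfolding inB by (intro sum_mono) (simp add: abs_le_square_iff[symmetric])
    finally show ?thesis by (simp add: d_def)
  qed
  show ?thesis
  proof (rule that[of I Q "1 / q"])
    fix f :: "'a \<Rightarrow> real"
    assume f: "f \<in> test_functions UNIV" and "\<forall>x. R < norm x \<longrightarrow> f x = 0"
    then have supp: "\<And>x. R < norm x \<Longrightarrow> f x = 0" by blast
    define E where "E = (\<Sum>b\<in>Basis. LINT x|lborel. (frechet_derivative f (at x) b)\<^sup>2)"
    have sm: "smooth f" using f test_function_smooth by blast
    define J where "J k x = (LINT y|lborel. indicator (Q k) y * (f x - f y)\<^sup>2)" for k x
    define S where "S x = (LINT h|lborel. indicator B h * (f (x + h) - f x)\<^sup>2)" for x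
    \<comment> \<open>Vectors of \<open>B\<close> have norm at most \<open>d * \<delta>\<close>, so
      beyond this ball both \<open>f x\<close> and \<open>f (x + h)\<close> vanish.\<close>
    define K where "K = cball (0::'a) (R + d * \<delta>)"
    have cK: "compact K" "compact B" by (auto simp: K_def B_def)
    have "continuous_on (K \<times> B) (\<lambda>(x, h). (f (x + h) - f x)\<^sup>2)"
      unfolding case_prod_beta
      by (intro continuous_intros continuous_on_compose2[OF smooth_continuous_on[OF sm, of UNIV]]) auto
    note F = Fubini_compact[OF cK this]
    have cB: "continuous_on B (\<lambda>h. (f (x + h) - f x)\<^sup>2)" for x
      by (intro continuous_intros continuous_on_compose2[OF smooth_continuous_on[OF sm, of UNIV]]) auto
    have IB: "integrable lborel (\<lambda>h. indicator B h * (f (x + h) - f x)\<^sup>2)" for x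
      using borel_integrable_compact[OF cK(2) cB] by simp
    have Bnorm1: "norm h \<le> d * \<delta>" if "h \<in> B" for h
    proof -
      have "norm h \<le> (\<Sum>b\<in>Basis. \<bar>h \<bullet> b\<bar>)" by (rule norm_le_l1)
      also have "\<dots> \<le> (\<Sum>b\<in>(Basis::'a set). \<delta>)" using that unfolding inB by (intro sum_mono) auto
      finally show ?thesis by (simp add: d_def)
    qed
    have far: "f (x + h) - f x = 0" if "x \<notin> K" "h \<in> B" for x h
    proof -
      have "R + d * \<delta> < norm x" using that by (simp add: K_def)
      moreover have "norm x \<le> norm (x + h) + norm h"
        by (metis add_diff_cancel_right' norm_triangle_ineq4)
      ultimately have "R < norm (x + h)" "R < norm x"
        using Bnorm1[OF that(2)] d \<delta>(1) by (smt (verit) mult_pos_pos)+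
      then show ?thesis using supp by simp
    qed
    have SK: "indicator K x * S x = S x" for x
    proof (cases "x \<in> K")
      case False
      then have z: "indicator B h * (f (x + h) - f x)\<^sup>2 = 0" for h using far by (auto simp: indicator_def)
      have "S x = 0" unfolding S_def z by simp
      then show ?thesis by simp
    qed simp
    have Sint: "integrable lborel S"
      using F(2) unfolding S_def[symmetric] SK by simp
    have "(LINT x|lborel. S x) = (LINT h|lborel. indicator B h * (LINT x|lborel. indicator K x * (f (x + h) - f x)\<^sup>2))"
      using F(1) unfolding S_def[symmetric] SK by simp
    also have "\<dots> \<le> (LINT h|lborel. indicator B h * (d * \<delta>\<^sup>2 * E))"
    proof (rule integral_mono[OF F(3)])
      show "integrable lborel (\<lambda>h. indicator B h * (d * \<delta>\<^sup>2 * E))"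
        using borel_integrable_compact[OF cK(2), of "\<lambda>h. d * \<delta>\<^sup>2 * E"] by simp
      fix h
      have "(LINT x|lborel. indicator K x * (f (x + h) - f x)\<^sup>2) \<le> d * \<delta>\<^sup>2 * E" if h: "h \<in> B"
      proof -
        have "(LINT x|lborel. indicator K x * (f (x + h) - f x)\<^sup>2) = (LINT x|lborel. (f (x + h) - f x)\<^sup>2)"
          using far[OF _ h] by (intro Bochner_Integration.integral_cong refl) (auto simp: indicator_def)
        also have "\<dots> \<le> (norm h)\<^sup>2 * E" unfolding E_def by (rule translation_L2_bound[OF f])
        also have "\<dots> \<le> d * \<delta>\<^sup>2 * E" using Bnorm[OF h] by (intro mult_right_mono) (auto simp: E_def intro!: sum_nonneg)
        finally show ?thesis .
      qed
      then show "indicator B h * (LINT x|lborel. indicator K x * (f (x + h) - f x)\<^sup>2) \<le> indicator B h * (d * \<delta>\<^sup>2 * E)"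
        by (auto simp: indicator_def)
    qed
    also have "\<dots> = q * \<epsilon> * E" unfolding Bm \<delta>(2)[symmetric] by simp
    finally have Sle: "(LINT x|lborel. S x) \<le> q * \<epsilon> * E" .
    \<comment> \<open>Substitution \<open>y = h + x\<close>: if \<open>x\<close> and
      \<open>h + x\<close> lie in the same cube, then \<open>h\<close> lies in
      \<open>B\<close>.\<close>
    have Jle: "(\<Sum>k\<in>I. indicator (Q k) x * J k x) \<le> S x" for x
    proof (cases "\<exists>k\<in>I. x \<in> Q k")
      case True
      then obtain k where k: "k \<in> I" "x \<in> Q k" by blast
      note [measurable] = Qborel
      have [measurable]: "f \<in> borel_measurable borel" using smooth_borel_measurable[OF sm] .
      have "J k x = (LINT h|lborel. indicator (Q k) (h + x) * (f x - f (h + x))\<^sup>2)"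
        unfolding J_def
        by (intro lborel_integral_translate[symmetric, of "\<lambda>y. indicator (Q k) y * (f x - f y)\<^sup>2"]) measurable
      also have "\<dots> \<le> S x"
        unfolding S_def
      proof (rule integral_mono')
        show "integrable lborel (\<lambda>h. indicator B h * (f (x + h) - f x)\<^sup>2)" by (rule IB)
        fix h
        have "h \<in> B" if "h + x \<in> Q k"
          unfolding inB
        proof
          fix i :: 'a assume i: "i \<in> Basis"
          have "of_int (k i) * \<delta> \<le> x \<bullet> i" "x \<bullet> i < of_int (k i) * \<delta> + \<delta>"
            "of_int (k i) * \<delta> \<le> h \<bullet> i + x \<bullet> i" "h \<bullet> i + x \<bullet> i < of_int (k i) * \<delta> + \<delta>"
            using k(2) that i unfolding Q_def by (auto simp: inner_add_left algebra_simps)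
          then show "\<bar>h \<bullet> i\<bar> \<le> \<delta>" by linarith
        qed
        then show "indicator (Q k) (h + x) * (f x - f (h + x))\<^sup>2 \<le> indicator B h * (f (x + h) - f x)\<^sup>2"
          by (auto simp: indicator_def add.commute power2_commute)
      qed auto
      finally show ?thesis using single[OF k, of "\<lambda>j. J j x"] by simp
    next
      case False
      then have "(\<Sum>k\<in>I. indicator (Q k) x * J k x) = 0" by (auto intro!: sum.neutral)
      then show ?thesis by (auto simp: S_def intro!: integral_nonneg_AE)
    qed
    note V = square_integral_eq_mean_plus_variance[OF Qborel Qq q f, folded J_def]
    have f2: "integrable lborel (\<lambda>x. (f x)\<^sup>2)"
      using test_function_integrable[OF test_function_mult[OF f sm]] by (simp add: power2_eq_square)
    have "(f x)\<^sup>2 = (\<Sum>k\<in>I. indicator (Q k) x * (f x)\<^sup>2)" for x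
    proof (cases "norm x \<le> R")
      case True
      then obtain k where "k \<in> I" "x \<in> Q k" using cover by blast
      then show ?thesis using single[of k x "\<lambda>j. (f x)\<^sup>2"] by simp
    qed (use supp in auto)
    then have "(LINT x|lborel. (f x)\<^sup>2) = (LINT x|lborel. (\<Sum>k\<in>I. indicator (Q k) x * (f x)\<^sup>2))" by simp
    also have "\<dots> = (\<Sum>k\<in>I. (LINT x|lborel. indicator (Q k) x * (f x)\<^sup>2))"
      using integrable_real_mult_indicator[OF _ f2] Qborel
      by (intro Bochner_Integration.integral_sum) (simp add: mult.commute)
    also have "\<dots> = (\<Sum>k\<in>I. (LINT x|lborel. indicator (Q k) x * f x)\<^sup>2 / q + (LINT x|lborel. indicator (Q k) x * J k x) / (2 * q))"
      unfolding V(1) ..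
    also have "\<dots> = 1 / q * (\<Sum>k\<in>I. (LINT x|lborel. indicator (Q k) x * f x)\<^sup>2) + (\<Sum>k\<in>I. LINT x|lborel. indicator (Q k) x * J k x) / (2 * q)"
      by (simp add: sum.distrib sum_divide_distrib)
    also have "(\<Sum>k\<in>I. LINT x|lborel. indicator (Q k) x * J k x) = (LINT x|lborel. (\<Sum>k\<in>I. indicator (Q k) x * J k x))"
      using V(2) by (intro Bochner_Integration.integral_sum[symmetric])
    also have "\<dots> \<le> (LINT x|lborel. S x)"
      using V(2) Jle by (intro integral_mono[OF _ Sint] Bochner_Integration.integrable_sum)
    also have "\<dots> \<le> q * \<epsilon> * E" by (rule Sle)
    finally have "(LINT x|lborel. (f x)\<^sup>2) \<le> 1 / q * (\<Sum>k\<in>I. (LINT x|lborel. indicator (Q k) x * f x)\<^sup>2) + q * \<epsilon> * E / (2 * q)"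
      using q by (simp add: divide_right_mono)
    moreover have "q * \<epsilon> * E / (2 * q) \<le> \<epsilon> * E"
    proof -
      have "0 \<le> \<epsilon> * E" using assms by (auto simp: E_def intro!: mult_nonneg_nonneg sum_nonneg)
      then show ?thesis using q by (simp add: mult.commute)
    qed
    ultimately show "(LINT x|lborel. (f x)\<^sup>2) \<le> \<epsilon> * (\<Sum>b\<in>Basis. LINT x|lborel. (frechet_derivative f (at x) b)\<^sup>2)
          + 1 / q * (\<Sum>k\<in>I. (LINT x|lborel. indicator (Q k) x * f x)\<^sup>2)"
      unfolding E_def[symmetric] by linarith
  qed (use finI Qborel q in auto)
qed

section \<open>Lebesgue and Sobolev spaces on a bounded open set\<close>

text \<open>\<open>V_space\<close> and \<open>LM_space\<close> are both closures of
  \<open>M_space\<close> of this form, taken in different seminorms.\<close>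

lemma (in seminormed_space) seminormed_closure:
  assumes M: "subspace M" "M \<subseteq> X"
  shows "seminormed_space {u \<in> X. \<forall>\<epsilon>>0. \<exists>z\<in>M. N (u - z) < \<epsilon>} N"
proof
  let ?Y = "{u \<in> X. \<forall>\<epsilon>>0. \<exists>z\<in>M. N (u - z) < \<epsilon>}"
  show "subspace ?Y"
  proof (rule subspaceI)
    show "0 \<in> ?Y" using zero_mem N_zero subspace_0[OF M(1)] by force
    show "u + v \<in> ?Y" if u: "u \<in> ?Y" and v: "v \<in> ?Y" for u v
    proof (intro CollectI conjI allI impI)
      show "u + v \<in> X" using u v add_mem by auto
      fix \<epsilon> :: real assume e: "\<epsilon> > 0"
      obtain z where z: "z \<in> M" "N (u - z) < \<epsilon> / 2" using u e half_gt_zero by blast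
      obtain w where w: "w \<in> M" "N (v - w) < \<epsilon> / 2" using v e half_gt_zero by blast
      have "N ((u - z) + (v - w)) \<le> N (u - z) + N (v - w)"
        using u v z w M by (intro triangle diff_mem) auto
      moreover have "(u - z) + (v - w) = (u + v) - (z + w)" by simp
      ultimately have "N ((u + v) - (z + w)) < \<epsilon>" using z w by simp
      then show "\<exists>y\<in>M. N (u + v - y) < \<epsilon>" using subspace_add[OF M(1) z(1) w(1)] by blast
    qed
    show "c *\<^sub>R u \<in> ?Y" if u: "u \<in> ?Y" for u c
    proof (intro CollectI conjI allI impI)
      show "c *\<^sub>R u \<in> X" using u scale_mem by auto
      fix \<epsilon> :: real assume e: "\<epsilon> > 0"
      \<comment> \<open>Adding 1 keeps the divisor positive when \<open>c = 0\<close>.\<close>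
      obtain z where z: "z \<in> M" "N (u - z) < \<epsilon> / (\<bar>c\<bar> + 1)"
      proof -
        have "\<epsilon> / (\<bar>c\<bar> + 1) > 0" using e by (simp add: add_nonneg_pos)
        then show ?thesis using u that by blast
      qed
      have uz: "u - z \<in> X" using u z M by (intro diff_mem) auto
      have "N (c *\<^sub>R u - c *\<^sub>R z) = \<bar>c\<bar> * N (u - z)"
        using homogeneous[OF uz, of c] by (simp add: scaleR_diff_right)
      also have "\<dots> \<le> (\<bar>c\<bar> + 1) * N (u - z)" using nonneg[OF uz] by (intro mult_right_mono) auto
      also have "\<dots> < \<epsilon>" using z(2) by (simp add: field_simps)
      finally show "\<exists>y\<in>M. N (c *\<^sub>R u - y) < \<epsilon>" using subspace_mul[OF M(1) z(1)] by blast
    qed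
  qed
qed (auto intro: nonneg triangle homogeneous)

lemma M_space_subspace: "subspace (M_space (Om :: (real^'n) set))"
proof (rule subspaceI)
  have jac: "jacobian (\<lambda>x. a *\<^sub>R z x + b *\<^sub>R w x) (at x) = a *\<^sub>R jacobian z (at x) + b *\<^sub>R jacobian w (at x)"
    if "smooth z" "smooth w" for a b x and z w :: "real^'n \<Rightarrow> real^'n"
  proof -
    have d: "((\<lambda>x. a *\<^sub>R z x + b *\<^sub>R w x) has_derivative
       (\<lambda>h. a *\<^sub>R frechet_derivative z (at x) h + b *\<^sub>R frechet_derivative w (at x) h)) (at x)"
      by (intro has_derivative_add has_derivative_scaleR_right smooth_has_derivative that)
    show ?thesis
      unfolding jacobian_def frechet_derivative_at[OF d, symmetric]
      by (simp add: matrix_def vec_eq_iff)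
  qed
  have tr: "trace (a *\<^sub>R A + b *\<^sub>R B) = a * trace A + b * trace B" for a b and A B :: "real^'n^'n"
    by (simp add: trace_def sum.distrib sum_distrib_left)
  have lin: "(\<lambda>x. a *\<^sub>R z x + b *\<^sub>R w x) \<in> M_space Om" if z: "z \<in> M_space Om" and w: "w \<in> M_space Om" for a b z w
  proof -
    have "smooth (\<lambda>x. a *\<^sub>R z x + b *\<^sub>R w x)"
      using z w by (intro smooth_add smooth_scaleR smooth_const) (auto simp: M_space_def)
    moreover have "tangential_part Om (\<lambda>x. a *\<^sub>R z x + b *\<^sub>R w x) x = a *\<^sub>R tangential_part Om z x + b *\<^sub>R tangential_part Om w x" for x
      by (simp add: tangential_part_def algebra_simps inner_add_left)
    ultimately show ?thesis using z w by (simp add: M_space_def jac tr)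
  qed
  have z0: "(0::real^'n \<Rightarrow> real^'n) = (\<lambda>x. 0)" by (simp add: zero_fun_def)
  have d0: "jacobian (\<lambda>x. 0::real^'n) (at x) = 0" for x :: "real^'n"
    unfolding jacobian_def by (simp add: matrix_def vec_eq_iff frechet_derivative_const)
  show "0 \<in> M_space Om"
    unfolding z0 M_space_def using d0 by (simp add: smooth_const tangential_part_def trace_def)
  show "u + v \<in> M_space Om" if "u \<in> M_space Om" "v \<in> M_space Om" for u v
    using lin[OF that, of 1 1] by (simp add: plus_fun_def)
  show "c *\<^sub>R u \<in> M_space Om" if "u \<in> M_space Om" for u c
    using lin[OF that that, of c 0] by (simp add: scaleR_fun_def)
qed

locale bounded_open =
  fixes Om :: "(real^'n) set"
  assumes open_Om: "open Om" and bounded_Om: "bounded Om"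
begin

abbreviation "\<Omega> \<equiv> lebesgue_on Om"

lemma Om_lebesgue [simp]: "Om \<in> sets lebesgue"
  using open_Om by auto

lemma Om_lmeasurable: "Om \<in> lmeasurable"
  using open_Om bounded_Om lmeasurable_open by blast

lemma finite_measure_Om: "finite_measure \<Omega>"
  using Om_lmeasurable by (intro finite_measureI) (auto simp: emeasure_restrict_space fmeasurable_def)

lemma integrable_const_Om [simp]: "integrable \<Omega> (\<lambda>x. c::real)"
  using finite_measure.integrable_const[OF finite_measure_Om] .

lemma Lp_measurable: "u \<in> Lp_space Om p \<Longrightarrow> u \<in> borel_measurable \<Omega>"
  and Lp_integrable: "u \<in> Lp_space Om p \<Longrightarrow> integrable \<Omega> (\<lambda>x. norm (u x) powr p)"
  by (auto simp: Lp_space_def)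

lemma Lp_norm_nonneg: "0 \<le> Lp_norm Om p u"
  by (simp add: Lp_norm_def)

lemma Lp_norm_powr: "0 < p \<Longrightarrow> Lp_norm Om p u powr p = (LINT x|\<Omega>. norm (u x) powr p)"
  by (simp add: Lp_norm_def powr_powr)

lemma Lp_norm_square: "(Lp_norm Om 2 u)\<^sup>2 = (LINT x|\<Omega>. (norm (u x))\<^sup>2)"
  using Lp_norm_powr[of 2 u] Lp_norm_nonneg[of 2 u] by (simp add: powr_numeral)

lemma Lp2_integrable: "u \<in> Lp_space Om 2 \<Longrightarrow> integrable \<Omega> (\<lambda>x. (norm (u x))\<^sup>2)"
  using Lp_integrable[of u 2] by (simp add: powr_numeral)

lemma seminormed_Lp:
  assumes p: "1 \<le> p"
  shows "seminormed_space (Lp_space Om p :: (real^'n \<Rightarrow> 'b::euclidean_space) set) (Lp_norm Om p)"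
proof
  have scale: "c *\<^sub>R u \<in> Lp_space Om p" if "u \<in> Lp_space Om p" for c and u :: "real^'n \<Rightarrow> 'b"
    using Lp_measurable[OF that] Lp_integrable[OF that]
    by (auto simp: Lp_space_def powr_mult scaleR_fun_def)
  show "subspace (Lp_space Om p :: (real^'n \<Rightarrow> 'b) set)"
  proof (rule subspaceI)
    show "(0 :: real^'n \<Rightarrow> 'b) \<in> Lp_space Om p" by (auto simp: Lp_space_def zero_fun_def)
    show "u + v \<in> Lp_space Om p" if u: "u \<in> Lp_space Om p" and v: "v \<in> Lp_space Om p" for u v :: "real^'n \<Rightarrow> 'b"
      using Minkowski_integral(1)[OF p Lp_measurable[OF u] Lp_integrable[OF u] Lp_measurable[OF v] Lp_integrable[OF v]]
        Lp_measurable[OF u] Lp_measurable[OF v]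
      by (auto simp: Lp_space_def plus_fun_def)
  qed (rule scale)
  fix u v :: "real^'n \<Rightarrow> 'b" and a :: real
  assume u: "u \<in> Lp_space Om p"
  show "0 \<le> Lp_norm Om p u" by (rule Lp_norm_nonneg)
  show "Lp_norm Om p (u + v) \<le> Lp_norm Om p u + Lp_norm Om p v" if v: "v \<in> Lp_space Om p"
    using Minkowski_integral(2)[OF p Lp_measurable[OF u] Lp_integrable[OF u] Lp_measurable[OF v] Lp_integrable[OF v]]
    by (simp add: Lp_norm_def)
  show "Lp_norm Om p (a *\<^sub>R u) = \<bar>a\<bar> * Lp_norm Om p u"
    using p by (simp add: Lp_norm_def powr_mult powr_powr)
qed

lemma Lp_norm_cong_AE:
  assumes "u \<in> borel_measurable \<Omega>" "v \<in> borel_measurable \<Omega>" "AE x in \<Omega>. u x = v x"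
  shows "Lp_norm Om p u = Lp_norm Om p (v :: real^'n \<Rightarrow> 'b::euclidean_space)"
proof -
  have "(LINT x|\<Omega>. norm (u x) powr p) = (LINT x|\<Omega>. norm (v x) powr p)"
    using assms by (intro integral_cong_AE) auto
  then show ?thesis by (simp add: Lp_norm_def)
qed

lemma Lp_dominated:
  fixes u :: "real^'n \<Rightarrow> 'b::euclidean_space" and v :: "real^'n \<Rightarrow> 'c::euclidean_space"
  assumes v: "v \<in> Lp_space Om p" and u[measurable]: "u \<in> borel_measurable \<Omega>"
    and le: "AE x in \<Omega>. norm (u x) \<le> C * norm (v x)" and C: "0 \<le> C" and p: "0 < p"
  shows "u \<in> Lp_space Om p" "Lp_norm Om p u \<le> C * Lp_norm Om p v"
proof -
  have le': "AE x in \<Omega>. norm (u x) powr p \<le> C powr p * norm (v x) powr p"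
    using le
  proof eventually_elim
    case (elim x)
    then have "norm (u x) powr p \<le> (C * norm (v x)) powr p" using p by (intro powr_mono2) auto
    then show ?case using C by (simp add: powr_mult)
  qed
  have I: "integrable \<Omega> (\<lambda>x. C powr p * norm (v x) powr p)" using Lp_integrable[OF v] by auto
  have Iu: "integrable \<Omega> (\<lambda>x. norm (u x) powr p)"
    by (rule Bochner_Integration.integrable_bound[OF I]) (use le' in \<open>auto elim!: eventually_mono\<close>)
  then show "u \<in> Lp_space Om p" using u by (simp add: Lp_space_def)
  have "(LINT x|\<Omega>. norm (u x) powr p) \<le> C powr p * (LINT x|\<Omega>. norm (v x) powr p)"
    using integral_mono_AE[OF Iu I le'] by simp
  then have "Lp_norm Om p u \<le> (C powr p * (LINT x|\<Omega>. norm (v x) powr p)) powr (1/p)"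
    unfolding Lp_norm_def using p by (intro powr_mono2) (auto intro!: integral_nonneg_AE)
  also have "\<dots> = C * Lp_norm Om p v"
    using C p by (simp add: Lp_norm_def powr_mult powr_powr)
  finally show "Lp_norm Om p u \<le> C * Lp_norm Om p v" .
qed

lemma continuous_in_Lp:
  fixes z :: "real^'n \<Rightarrow> 'b::euclidean_space"
  assumes "continuous_on UNIV z" "0 < p"
  shows "z \<in> Lp_space Om p"
proof -
  have "bounded (z ` closure Om)"
    using bounded_Om assms(1)
    by (intro compact_imp_bounded compact_continuous_image) (auto intro: continuous_on_subset)
  then obtain B where B: "B > 0" "\<And>x. x \<in> Om \<Longrightarrow> norm (z x) \<le> B"
    by (metis bounded_pos closure_subset imageI subsetD)
  have m: "z \<in> borel_measurable \<Omega>"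
    using assms(1) by (intro measurable_restrict_space1 measurable_completion) (simp add: borel_measurable_continuous_onI)
  have one: "(\<lambda>x. 1::real) \<in> Lp_space Om p" by (simp add: Lp_space_def)
  show ?thesis
    by (rule Lp_dominated(1)[OF one m _ _ assms(2), of B]) (use B in \<open>auto intro!: AE_I2\<close>)
qed

definition embed_const :: "real \<Rightarrow> real \<Rightarrow> real" where
  "embed_const q p = measure lebesgue Om powr (1/q - 1/p)"

text \<open>Hoelder's inequality against the constant 1 on a set of finite measure.\<close>

lemma Lp_embed:
  fixes u :: "real^'n \<Rightarrow> 'b::euclidean_space"
  assumes qp: "0 < q" "q < p" and u: "u \<in> Lp_space Om p"
  shows "u \<in> Lp_space Om q" "Lp_norm Om q u \<le> embed_const q p * Lp_norm Om p u"
proof -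
  have e: "0 < q/p" "0 < 1 - q/p" "q/p + (1 - q/p) = 1" using qp by auto
  note H = Holder_integral2[OF e Lp_integrable[OF u] powr_ge_zero integrable_const_Om[of 1] zero_le_one]
  have eq: "(norm (u x) powr p) powr (q/p) * 1 powr (1 - q/p) = norm (u x) powr q" for x
    using qp by (simp add: powr_powr)
  show "u \<in> Lp_space Om q"
    using H(1) Lp_measurable[OF u] unfolding eq by (simp add: Lp_space_def)
  have m1: "(LINT x|\<Omega>. (1::real)) = measure lebesgue Om"
    by (simp add: measure_restrict_space)
  have "(LINT x|\<Omega>. norm (u x) powr q) powr (1/q)
    \<le> ((LINT x|\<Omega>. norm (u x) powr p) powr (q/p) * (measure lebesgue Om) powr (1 - q/p)) powr (1/q)"
    using H(2) unfolding eq m1 using qp by (intro powr_mono2) (auto intro!: integral_nonneg_AE)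
  also have "\<dots> = (LINT x|\<Omega>. norm (u x) powr p) powr (1/p) * measure lebesgue Om powr ((1 - q/p) * (1/q))"
    using qp by (simp add: powr_mult powr_powr)
  also have "(1 - q/p) * (1/q) = 1/q - 1/p" using qp by (simp add: field_simps)
  finally show "Lp_norm Om q u \<le> embed_const q p * Lp_norm Om p u"
    by (simp add: Lp_norm_def embed_const_def mult.commute)
qed

lemma L2_norm_mult:
  fixes u :: "real^'n \<Rightarrow> 'b::euclidean_space" and v :: "real^'n \<Rightarrow> 'c::euclidean_space"
  assumes u: "u \<in> Lp_space Om 2" and v: "v \<in> Lp_space Om 2"
  shows "integrable \<Omega> (\<lambda>x. norm (u x) * norm (v x))"
    and "(LINT x|\<Omega>. norm (u x) * norm (v x)) \<le> Lp_norm Om 2 u * Lp_norm Om 2 v"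
  using Holder_integral2[OF _ _ _ Lp_integrable[OF u] powr_ge_zero Lp_integrable[OF v] powr_ge_zero, of "1/2" "1/2"]
  by (auto simp: powr_powr Lp_norm_def)

lemma Holder3_Lp:
  fixes u :: "real^'n \<Rightarrow> 'b::euclidean_space" and v :: "real^'n \<Rightarrow> 'c::euclidean_space" and w :: "real^'n \<Rightarrow> 'd::euclidean_space"
  assumes abc: "0 < a" "0 < b" "0 < c" "1/a + 1/b + 1/c = 1"
    and u: "u \<in> Lp_space Om a" and v: "v \<in> Lp_space Om b" and w: "w \<in> Lp_space Om c"
  shows "integrable \<Omega> (\<lambda>x. norm (u x) * norm (v x) * norm (w x))"
    and "(LINT x|\<Omega>. norm (u x) * norm (v x) * norm (w x)) \<le> Lp_norm Om a u * Lp_norm Om b v * Lp_norm Om c w"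
  using Holder_integral3[OF _ _ _ abc(4) Lp_integrable[OF u] powr_ge_zero Lp_integrable[OF v] powr_ge_zero Lp_integrable[OF w] powr_ge_zero] abc
  by (auto simp: powr_powr Lp_norm_def)

lemma L2_inner_integrable:
  fixes u v :: "real^'n \<Rightarrow> 'b::euclidean_space"
  assumes "u \<in> Lp_space Om 2" "v \<in> Lp_space Om 2"
  shows "integrable \<Omega> (\<lambda>x. u x \<bullet> v x)"
  by (rule Bochner_Integration.integrable_bound[OF L2_norm_mult(1)[OF assms]])
     (use Lp_measurable[OF assms(1)] Lp_measurable[OF assms(2)] in \<open>auto simp: Cauchy_Schwarz_ineq2\<close>)

lemma L2_inner_bound:
  fixes u v :: "real^'n \<Rightarrow> 'b::euclidean_space"
  assumes "u \<in> Lp_space Om 2" "v \<in> Lp_space Om 2"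
  shows "\<bar>L2_inner Om u v\<bar> \<le> Lp_norm Om 2 u * Lp_norm Om 2 v"
proof -
  have "\<bar>L2_inner Om u v\<bar> \<le> (LINT x|\<Omega>. \<bar>u x \<bullet> v x\<bar>)"
    unfolding L2_inner_def by (rule integral_abs_bound)
  also have "\<dots> \<le> (LINT x|\<Omega>. norm (u x) * norm (v x))"
    using L2_inner_integrable[OF assms] L2_norm_mult(1)[OF assms]
    by (intro integral_mono) (auto simp: Cauchy_Schwarz_ineq2)
  finally show ?thesis using L2_norm_mult(2)[OF assms] by linarith
qed

lemma L2_inner_commute: "L2_inner Om u v = L2_inner Om v u"
  by (simp add: L2_inner_def inner_commute)

lemma L2_inner_lincomb:
  fixes u v w :: "real^'n \<Rightarrow> 'b::euclidean_space"
  assumes "u \<in> Lp_space Om 2" "v \<in> Lp_space Om 2" "w \<in> Lp_space Om 2"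
  shows "L2_inner Om (a *\<^sub>R u + b *\<^sub>R v) w = a * L2_inner Om u w + b * L2_inner Om v w"
  using L2_inner_integrable[OF assms(1,3)] L2_inner_integrable[OF assms(2,3)]
  by (simp add: L2_inner_def inner_add_left)

lemma L2_inner_self: "L2_inner Om u u = (Lp_norm Om 2 u)\<^sup>2"
  by (simp add: Lp_norm_square L2_inner_def power2_norm_eq_inner)

lemma L2_inner_cong_AE:
  fixes u v :: "real^'n \<Rightarrow> 'b::euclidean_space"
  assumes "u \<in> borel_measurable \<Omega>" "u' \<in> borel_measurable \<Omega>" "v \<in> borel_measurable \<Omega>" "AE x in \<Omega>. u x = u' x"
  shows "L2_inner Om u v = L2_inner Om u' v"
  unfolding L2_inner_def using assms by (intro integral_cong_AE) auto

section \<open>Weak Jacobians and the space H1\<close>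

lemma integrable_mult_test_function:
  fixes g :: "real^'n \<Rightarrow> real"
  assumes g: "g \<in> Lp_space Om 2" and \<phi>: "\<phi> \<in> test_functions Om"
  shows "integrable \<Omega> (\<lambda>x. g x * \<phi> x)"
proof -
  have "\<phi> \<in> Lp_space Om 2"
    using \<phi> by (intro continuous_in_Lp smooth_continuous_on test_function_smooth) auto
  from L2_inner_integrable[OF g this] show ?thesis by simp
qed

lemma component_in_L2:
  fixes u :: "real^'n \<Rightarrow> 'b::euclidean_space^'m"
  assumes u: "u \<in> Lp_space Om 2"
  shows "(\<lambda>x. u x $ i) \<in> Lp_space Om 2"
proof (rule Lp_dominated(1)[OF u, where C=1])
  show "(\<lambda>x. u x $ i) \<in> borel_measurable \<Omega>"
    by (rule measurable_compose[OF Lp_measurable[OF u]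
        borel_measurable_continuous_onI[OF linear_continuous_on[OF bounded_linear_vec_nth]]])
qed (auto simp: Finite_Cartesian_Product.norm_nth_le)

lemma entry_in_L2: "G \<in> Lp_space Om 2 \<Longrightarrow> (\<lambda>x. G x $ i $ j) \<in> Lp_space Om 2" for G :: "real^'n \<Rightarrow> real^'m^'k"
  using component_in_L2[OF component_in_L2] .

lemma weak_jacobian_lincomb:
  assumes u: "u \<in> Lp_space Om 2" "G \<in> Lp_space Om 2" "is_weak_jacobian Om u G"
    and v: "v \<in> Lp_space Om 2" "H \<in> Lp_space Om 2" "is_weak_jacobian Om v H"
  shows "is_weak_jacobian Om (a *\<^sub>R u + b *\<^sub>R v) (a *\<^sub>R G + b *\<^sub>R H)"
  unfolding is_weak_jacobian_def
proof (intro ballI allI)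
  fix \<phi> i j assume \<phi>: "\<phi> \<in> test_functions Om"
  let ?D = "\<lambda>x. frechet_derivative \<phi> (at x) (axis j 1)"
  have D: "?D \<in> test_functions Om" by (rule test_function_derivative[OF \<phi>])
  note I = integrable_mult_test_function[OF component_in_L2[OF u(1)] D] integrable_mult_test_function[OF component_in_L2[OF v(1)] D]
    integrable_mult_test_function[OF entry_in_L2[OF u(2)] \<phi>] integrable_mult_test_function[OF entry_in_L2[OF v(2)] \<phi>]
  have "(LINT x|\<Omega>. (a *\<^sub>R u + b *\<^sub>R v) x $ i * ?D x) = a * (LINT x|\<Omega>. u x $ i * ?D x) + b * (LINT x|\<Omega>. v x $ i * ?D x)"
    using I by (simp add: distrib_right mult.assoc)
  also have "\<dots> = - (a * (LINT x|\<Omega>. G x $ i $ j * \<phi> x) + b * (LINT x|\<Omega>. H x $ i $ j * \<phi> x))"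
    using u(3) v(3) \<phi> unfolding is_weak_jacobian_def by simp
  also have "a * (LINT x|\<Omega>. G x $ i $ j * \<phi> x) + b * (LINT x|\<Omega>. H x $ i $ j * \<phi> x) = (LINT x|\<Omega>. (a *\<^sub>R G + b *\<^sub>R H) x $ i $ j * \<phi> x)"
    using I by (simp add: distrib_right mult.assoc)
  finally show "(LINT x|\<Omega>. (a *\<^sub>R u + b *\<^sub>R v) x $ i * ?D x) = - (LINT x|\<Omega>. (a *\<^sub>R G + b *\<^sub>R H) x $ i $ j * \<phi> x)" .
qed

text \<open>\<open>weak_jacobian\<close> is an arbitrary choice, so linearity of Jacobian and curl
  can hold only almost everywhere. Uniqueness, obtained entry by entry from the fundamental lemma,
  provides it.\<close>

lemma weak_jacobian_unique:
  assumes G: "G \<in> Lp_space Om 2" "is_weak_jacobian Om u G"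
    and H: "H \<in> Lp_space Om 2" "is_weak_jacobian Om u H"
  shows "AE x in \<Omega>. G x = H x"
proof -
  have "AE x in \<Omega>. G x $ i $ j - H x $ i $ j = 0" for i j
  proof (rule fundamental_lemma_calculus_of_variations[OF open_Om])
    have g: "(\<lambda>x. G x $ i $ j) \<in> Lp_space Om 2" and h: "(\<lambda>x. H x $ i $ j) \<in> Lp_space Om 2"
      using entry_in_L2 G H by auto
    have one: "(\<lambda>x. 1::real) \<in> Lp_space Om 2" by (simp add: Lp_space_def)
    show "integrable \<Omega> (\<lambda>x. G x $ i $ j - H x $ i $ j)"
      using L2_inner_integrable[OF g one] L2_inner_integrable[OF h one] by simp
    fix \<phi> assume \<phi>: "\<phi> \<in> test_functions Om"
    have "(LINT x|\<Omega>. G x $ i $ j * \<phi> x) = (LINT x|\<Omega>. H x $ i $ j * \<phi> x)"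
      using G(2)[unfolded is_weak_jacobian_def, rule_format, OF \<phi>, of i j]
        H(2)[unfolded is_weak_jacobian_def, rule_format, OF \<phi>, of i j] by linarith
    then show "(LINT x|\<Omega>. (G x $ i $ j - H x $ i $ j) * \<phi> x) = 0"
      using integrable_mult_test_function[OF g \<phi>] integrable_mult_test_function[OF h \<phi>]
      unfolding left_diff_distrib by (subst Bochner_Integration.integral_diff) linarith+
  qed
  then have "AE x in \<Omega>. \<forall>i\<in>UNIV. \<forall>j\<in>UNIV. G x $ i $ j - H x $ i $ j = 0"
    by (intro AE_finite_allI) auto
  then show ?thesis by eventually_elim (simp add: vec_eq_iff)
qed

lemma H1_D:
  assumes "u \<in> H1_space Om"
  shows "u \<in> Lp_space Om 2" "weak_jacobian Om u \<in> Lp_space Om 2" "is_weak_jacobian Om u (weak_jacobian Om u)"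
proof -
  show "u \<in> Lp_space Om 2" using assms by (simp add: H1_space_def)
  have "\<exists>G. G \<in> Lp_space Om 2 \<and> is_weak_jacobian Om u G" using assms by (auto simp: H1_space_def)
  from someI_ex[OF this] show "weak_jacobian Om u \<in> Lp_space Om 2" "is_weak_jacobian Om u (weak_jacobian Om u)"
    by (auto simp: weak_jacobian_def)
qed

lemma weak_jacobian_AE_eq:
  assumes "u \<in> Lp_space Om 2" "G \<in> Lp_space Om 2" "is_weak_jacobian Om u G"
  shows "u \<in> H1_space Om" "AE x in \<Omega>. weak_jacobian Om u x = G x"
proof -
  show u: "u \<in> H1_space Om" using assms by (auto simp: H1_space_def)
  show "AE x in \<Omega>. weak_jacobian Om u x = G x"
    by (rule weak_jacobian_unique[OF H1_D(2,3)[OF u] assms(2,3)])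
qed

lemma H1_lincomb:
  assumes u: "u \<in> H1_space Om" and v: "v \<in> H1_space Om"
  shows "a *\<^sub>R u + b *\<^sub>R v \<in> H1_space Om"
    "AE x in \<Omega>. weak_jacobian Om (a *\<^sub>R u + b *\<^sub>R v) x = a *\<^sub>R weak_jacobian Om u x + b *\<^sub>R weak_jacobian Om v x"
proof -
  interpret A: seminormed_space "Lp_space Om 2 :: (real^'n \<Rightarrow> real^'n) set" "Lp_norm Om 2" by (rule seminormed_Lp) simp
  interpret B: seminormed_space "Lp_space Om 2 :: (real^'n \<Rightarrow> real^'n^'n) set" "Lp_norm Om 2" by (rule seminormed_Lp) simp
  note U = H1_D[OF u] and V = H1_D[OF v]
  have "a *\<^sub>R u + b *\<^sub>R v \<in> Lp_space Om 2" "a *\<^sub>R weak_jacobian Om u + b *\<^sub>R weak_jacobian Om v \<in> Lp_space Om 2"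
    by (intro A.add_mem A.scale_mem B.add_mem B.scale_mem U V)+
  from weak_jacobian_AE_eq[OF this weak_jacobian_lincomb[OF U V]]
  show "a *\<^sub>R u + b *\<^sub>R v \<in> H1_space Om"
    "AE x in \<Omega>. weak_jacobian Om (a *\<^sub>R u + b *\<^sub>R v) x = a *\<^sub>R weak_jacobian Om u x + b *\<^sub>R weak_jacobian Om v x"
    by simp_all
qed

text \<open>Test functions vanish outside \<open>Om\<close>, so integration by parts over the whole
  space leaves no boundary term.\<close>

lemma smooth_H1:
  assumes z: "smooth z"
  shows "z \<in> H1_space Om" "AE x in \<Omega>. weak_jacobian Om z x = jacobian z (at x)"
proof -
  have zL: "z \<in> Lp_space Om 2" using smooth_continuous_on[OF z] by (intro continuous_in_Lp) auto
  have entry: "jacobian z (at x) $ i $ j = frechet_derivative (\<lambda>x. z x $ i) (at x) (axis j 1)" for x i j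
  proof -
    have d: "((\<lambda>x. z x $ i) has_derivative (\<lambda>h. frechet_derivative z (at x) h $ i)) (at x)"
      by (rule bounded_linear.has_derivative[OF bounded_linear_vec_nth smooth_has_derivative[OF z]])
    show ?thesis unfolding frechet_derivative_at[OF d, symmetric] by (simp add: jacobian_def matrix_def)
  qed
  have zi: "smooth (\<lambda>x. z x $ i)" for i
    by (rule smooth_linear_comp[OF bounded_linear_vec_nth z])
  have "continuous_on UNIV (\<lambda>x. \<chi> i j. jacobian z (at x) $ i $ j)"
    unfolding entry by (intro continuous_on_vec_lambda smooth_continuous_on smooth_derivative zi)
  then have "continuous_on UNIV (\<lambda>x. jacobian z (at x))" by simp
  then have JL: "(\<lambda>x. jacobian z (at x)) \<in> Lp_space Om 2" by (intro continuous_in_Lp) auto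
  have "is_weak_jacobian Om z (\<lambda>x. jacobian z (at x))"
    unfolding is_weak_jacobian_def
  proof (intro ballI allI)
    fix \<phi> i j assume \<phi>: "\<phi> \<in> test_functions Om"
    let ?D = "\<lambda>x. frechet_derivative \<phi> (at x) (axis j 1)"
    have D: "?D \<in> test_functions Om" by (rule test_function_derivative[OF \<phi>])
    have bm: "(\<lambda>x. z x $ i * ?D x) \<in> borel_measurable borel" "(\<lambda>x. jacobian z (at x) $ i $ j * \<phi> x) \<in> borel_measurable borel"
      unfolding entry by (intro smooth_borel_measurable smooth_mult zi test_function_smooth[OF D] test_function_smooth[OF \<phi>] smooth_derivative)+
    have "(LINT x|\<Omega>. z x $ i * ?D x) = (LINT x|lborel. ?D x * z x $ i)"
      using integral_lebesgue_on_eq_lborel[OF Om_lebesgue bm(1)] test_function_outside[OF D] by (simp add: mult.commute)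
    also have "\<dots> = - (LINT x|lborel. \<phi> x * frechet_derivative (\<lambda>x. z x $ i) (at x) (axis j 1))"
      by (rule integral_by_parts[OF test_function_UNIV[OF \<phi>] zi])
    also have "(LINT x|lborel. \<phi> x * frechet_derivative (\<lambda>x. z x $ i) (at x) (axis j 1)) = (LINT x|\<Omega>. jacobian z (at x) $ i $ j * \<phi> x)"
      using integral_lebesgue_on_eq_lborel[OF Om_lebesgue bm(2)] test_function_outside[OF \<phi>] by (simp add: mult.commute entry)
    finally show "(LINT x|\<Omega>. z x $ i * ?D x) = - (LINT x|\<Omega>. jacobian z (at x) $ i $ j * \<phi> x)" .
  qed
  from weak_jacobian_AE_eq[OF zL JL this]
  show "z \<in> H1_space Om" "AE x in \<Omega>. weak_jacobian Om z x = jacobian z (at x)" by auto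
qed

lemma seminormed_H1: "seminormed_space (H1_space Om) (H1_norm Om)"
proof
  interpret A: seminormed_space "Lp_space Om 2 :: (real^'n \<Rightarrow> real^'n) set" "Lp_norm Om 2" by (rule seminormed_Lp) simp
  interpret B: seminormed_space "Lp_space Om 2 :: (real^'n \<Rightarrow> real^'n^'n) set" "Lp_norm Om 2" by (rule seminormed_Lp) simp
  have norm_jac: "Lp_norm Om 2 (weak_jacobian Om (a *\<^sub>R u + b *\<^sub>R v)) = Lp_norm Om 2 (a *\<^sub>R weak_jacobian Om u + b *\<^sub>R weak_jacobian Om v)"
    if "u \<in> H1_space Om" "v \<in> H1_space Om" for a b u v
    using that H1_lincomb[OF that, of a b]
    by (intro Lp_norm_cong_AE Lp_measurable[of _ 2] H1_D B.add_mem B.scale_mem) auto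
  have smooth0: "0 \<in> H1_space Om"
    using smooth_H1(1)[OF smooth_const[of 0]] by (simp add: zero_fun_def)
  show "subspace (H1_space Om)"
  proof (rule subspaceI)
    show "0 \<in> H1_space Om" by (rule smooth0)
    show "u + v \<in> H1_space Om" if "u \<in> H1_space Om" "v \<in> H1_space Om" for u v
      using H1_lincomb(1)[OF that, of 1 1] by simp
    show "c *\<^sub>R u \<in> H1_space Om" if "u \<in> H1_space Om" for u c
      using H1_lincomb(1)[OF that that, of c 0] by simp
  qed
  fix u v a assume u: "u \<in> H1_space Om"
  show "0 \<le> H1_norm Om u" by (simp add: H1_norm_def)
  show "H1_norm Om (u + v) \<le> H1_norm Om u + H1_norm Om v" if v: "v \<in> H1_space Om"
  proof -
    have "Lp_norm Om 2 (weak_jacobian Om (u + v)) \<le> Lp_norm Om 2 (weak_jacobian Om u) + Lp_norm Om 2 (weak_jacobian Om v)"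
      using norm_jac[OF u v, of 1 1] B.triangle[OF H1_D(2)[OF u] H1_D(2)[OF v]] by simp
    moreover have "Lp_norm Om 2 (u + v) \<le> Lp_norm Om 2 u + Lp_norm Om 2 v"
      using A.triangle[OF H1_D(1)[OF u] H1_D(1)[OF v]] .
    ultimately have "H1_norm Om (u + v) \<le> sqrt ((Lp_norm Om 2 u + Lp_norm Om 2 v)\<^sup>2 + (Lp_norm Om 2 (weak_jacobian Om u) + Lp_norm Om 2 (weak_jacobian Om v))\<^sup>2)"
      unfolding H1_norm_def by (intro real_sqrt_le_mono add_mono power_mono Lp_norm_nonneg)
    also have "\<dots> \<le> H1_norm Om u + H1_norm Om v"
      unfolding H1_norm_def by (rule real_sqrt_sum_squares_triangle_ineq)
    finally show ?thesis .
  qed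
  show "H1_norm Om (a *\<^sub>R u) = \<bar>a\<bar> * H1_norm Om u"
  proof -
    have "Lp_norm Om 2 (weak_jacobian Om (a *\<^sub>R u)) = \<bar>a\<bar> * Lp_norm Om 2 (weak_jacobian Om u)"
      using norm_jac[OF u u, of a 0] B.homogeneous[OF H1_D(2)[OF u]] by simp
    moreover have "Lp_norm Om 2 (a *\<^sub>R u) = \<bar>a\<bar> * Lp_norm Om 2 u" using A.homogeneous[OF H1_D(1)[OF u]] .
    ultimately show ?thesis
      unfolding H1_norm_def
      by (simp add: power_mult_distrib distrib_left[symmetric] real_sqrt_mult)
  qed
qed

lemma seminormed_LM: "1 \<le> p \<Longrightarrow> seminormed_space (LM_space Om p) (Lp_norm Om p)"
proof -
  assume p: "1 \<le> p"
  interpret A: seminormed_space "Lp_space Om p :: (real^'n \<Rightarrow> real^'n) set" "Lp_norm Om p" by (rule seminormed_Lp[OF p])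
  have "M_space Om \<subseteq> Lp_space Om p"
    using p by (auto simp: M_space_def intro!: continuous_in_Lp smooth_continuous_on)
  from A.seminormed_closure[OF M_space_subspace this] show ?thesis by (simp add: LM_space_def)
qed

lemma LM_Lp: "u \<in> LM_space Om p \<Longrightarrow> u \<in> Lp_space Om p"
  by (simp add: LM_space_def)

lemma V_H1: "u \<in> V_space Om \<Longrightarrow> u \<in> H1_space Om"
  by (simp add: V_space_def)

lemma M_space_H1: "M_space Om \<subseteq> H1_space Om"
  by (auto simp: M_space_def intro: smooth_H1)

lemma seminormed_V_H1: "seminormed_space (V_space Om) (H1_norm Om)"
  using seminormed_space.seminormed_closure[OF seminormed_H1 M_space_subspace M_space_H1]
  by (simp add: V_space_def)

end

section \<open>Curl and interior compactness\<close>

lemma sum_Basis_cart: "(\<Sum>b\<in>(Basis :: (real^'n) set). F b) = (\<Sum>j\<in>UNIV. F (axis j 1))"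
proof -
  have B: "(Basis :: (real^'n) set) = range (\<lambda>j. axis j 1)"
    by (auto simp: Basis_vec_def)
  have "inj (\<lambda>j::'n. axis j (1::real))"
    by (auto simp: inj_on_def axis_eq_axis)
  then show ?thesis unfolding B by (simp add: sum.reindex o_def)
qed

text \<open>Above the threshold \<open>s0\<close>, where \<open>\<delta> * s powr (p - 2)\<close>
  reaches 1, the first term suffices; below it the constant does. Used wherever a quadratic term has
  to be paid for by a higher power.\<close>

lemma square_le_powr:
  fixes p \<delta> :: real
  assumes "2 < p" "0 < \<delta>"
  obtains c where "0 \<le> c" "\<And>s. 0 \<le> s \<Longrightarrow> s\<^sup>2 \<le> \<delta> * s powr p + c"
proof
  define s0 where "s0 = (1 / \<delta>) powr (1 / (p - 2))"
  show "0 \<le> s0\<^sup>2" by simp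
  fix s :: real assume s: "0 \<le> s"
  show "s\<^sup>2 \<le> \<delta> * s powr p + s0\<^sup>2"
  proof (cases "s \<le> s0")
    case True
    then have "s\<^sup>2 \<le> s0\<^sup>2" using s by (intro power_mono) auto
    then show ?thesis using assms by (simp add: add_increasing)
  next
    case False
    have pos: "s > 0" using False assms by (simp add: s0_def) (smt (verit) powr_ge_zero)
    have "1 / \<delta> = s0 powr (p - 2)" using assms by (simp add: s0_def powr_powr)
    also have "\<dots> \<le> s powr (p - 2)" using False assms by (intro powr_mono2) (auto simp: s0_def)
    finally have "1 \<le> \<delta> * s powr (p - 2)" using assms by (simp add: field_simps)
    then have "s\<^sup>2 * 1 \<le> s\<^sup>2 * (\<delta> * s powr (p - 2))" by (intro mult_left_mono) auto
    also have "\<dots> = \<delta> * s powr p"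
      using pos by (simp add: powr_diff powr_numeral)
    finally show ?thesis using zero_le_power2[of s0] by linarith
  qed
qed

text \<open>What the two dimensions share. The identity for the norm of \<open>rot J\<close> says
  that its square is half the squared norm of \<open>J\<close> minus its transpose, which holds for
  the scalar and for the vector curl alike. \<open>cr_orthogonal\<close> makes the convection
  skew.\<close>

locale curl_domain = bounded_open Om for Om :: "(real^'n) set" +
  fixes rot :: "real^'n^'n \<Rightarrow> 'c::euclidean_space" and cr :: "'c \<Rightarrow> real^'n \<Rightarrow> real^'n"
  assumes linear_rot: "bounded_linear rot"
    and norm_rot: "(norm (rot J))\<^sup>2 = (\<Sum>i\<in>UNIV. \<Sum>j\<in>UNIV. (J $ i $ j)\<^sup>2) - (\<Sum>i\<in>UNIV. \<Sum>j\<in>UNIV. J $ i $ j * J $ j $ i)"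
    and bilinear_cr: "bounded_bilinear cr"
    and norm_cr: "norm (cr c w) \<le> norm c * norm w"
    and cr_orthogonal: "cr c w \<bullet> w = 0"
begin

lemma norm_matrix: "(norm J)\<^sup>2 = (\<Sum>i\<in>UNIV. \<Sum>j\<in>UNIV. (J $ i $ j)\<^sup>2)" for J :: "real^'n^'n"
  unfolding power2_norm_eq_inner by (simp add: inner_vec_def power2_eq_square)

lemma norm_rot_le: "norm (rot J) \<le> 2 * norm J"
proof (rule power2_le_imp_le)
  have "\<bar>J $ i $ j * J $ j $ i\<bar> \<le> ((J $ i $ j)\<^sup>2 + (J $ j $ i)\<^sup>2) / 2" for i j
  proof -
    have "0 \<le> (J $ i $ j + J $ j $ i)\<^sup>2" "0 \<le> (J $ i $ j - J $ j $ i)\<^sup>2" by auto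
    then show ?thesis by (auto simp: abs_if power2_sum power2_diff)
  qed
  then have "- (\<Sum>i\<in>UNIV. \<Sum>j\<in>UNIV. J $ i $ j * J $ j $ i) \<le> (\<Sum>i\<in>UNIV. \<Sum>j\<in>UNIV. ((J $ i $ j)\<^sup>2 + (J $ j $ i)\<^sup>2) / 2)"
    unfolding sum_negf[symmetric] by (intro sum_mono order_trans[OF abs_ge_minus_self])
  also have "\<dots> = ((\<Sum>i\<in>UNIV. \<Sum>j\<in>UNIV. (J $ i $ j)\<^sup>2) + (\<Sum>i\<in>UNIV. \<Sum>j\<in>UNIV. (J $ j $ i)\<^sup>2)) / 2"
    by (simp add: sum.distrib sum_divide_distrib[symmetric])
  also have "(\<Sum>i\<in>UNIV. \<Sum>j\<in>UNIV. (J $ j $ i)\<^sup>2) = (\<Sum>i\<in>UNIV. \<Sum>j\<in>UNIV. (J $ i $ j)\<^sup>2)"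
    by (rule sum.swap)
  finally have "(norm (rot J))\<^sup>2 \<le> 2 * (norm J)\<^sup>2"
    unfolding norm_rot norm_matrix by simp
  also have "\<dots> \<le> (2 * norm J)\<^sup>2" by (simp add: power_mult_distrib)
  finally show "(norm (rot J))\<^sup>2 \<le> (2 * norm J)\<^sup>2" .
qed simp

lemma curl_L2:
  assumes u: "u \<in> H1_space Om"
  shows "curl rot Om u \<in> Lp_space Om 2" "V_norm rot Om u \<le> 2 * H1_norm Om u"
proof -
  have m: "curl rot Om u \<in> borel_measurable \<Omega>"
    unfolding curl_def
    by (rule measurable_compose[OF Lp_measurable[OF H1_D(2)[OF u]]
        borel_measurable_continuous_onI[OF linear_continuous_on[OF linear_rot]]])
  note D = Lp_dominated[OF H1_D(2)[OF u] m _ _ zero_less_numeral, of 2]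
  show "curl rot Om u \<in> Lp_space Om 2"
    by (rule D(1)) (auto simp: curl_def norm_rot_le)
  have "V_norm rot Om u \<le> 2 * Lp_norm Om 2 (weak_jacobian Om u)"
    unfolding V_norm_def by (rule D(2)) (auto simp: curl_def norm_rot_le)
  also have "Lp_norm Om 2 (weak_jacobian Om u) \<le> H1_norm Om u"
    unfolding H1_norm_def by (rule real_sqrt_sum_squares_ge2)
  finally show "V_norm rot Om u \<le> 2 * H1_norm Om u" by simp
qed

lemma curl_lincomb:
  assumes u: "u \<in> H1_space Om" and v: "v \<in> H1_space Om"
  shows "AE x in \<Omega>. curl rot Om (a *\<^sub>R u + b *\<^sub>R v) x = a *\<^sub>R curl rot Om u x + b *\<^sub>R curl rot Om v x"
  using H1_lincomb(2)[OF u v, of a b]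
proof eventually_elim
  case (elim x)
  show ?case unfolding curl_def elim
    using bounded_linear.linear[OF linear_rot] by (simp add: linear_add linear_cmul)
qed

lemma seminormed_V: "seminormed_space (V_space Om) (V_norm rot Om)"
proof
  interpret VH: seminormed_space "V_space Om" "H1_norm Om" by (rule seminormed_V_H1)
  interpret B: seminormed_space "Lp_space Om 2 :: (real^'n \<Rightarrow> 'c) set" "Lp_norm Om 2" by (rule seminormed_Lp) simp
  have norm_eq: "V_norm rot Om (a *\<^sub>R u + b *\<^sub>R v) = Lp_norm Om 2 (a *\<^sub>R curl rot Om u + b *\<^sub>R curl rot Om v)"
    if "u \<in> V_space Om" "v \<in> V_space Om" for a b u v
    unfolding V_norm_def using curl_lincomb[OF that[THEN V_H1], of a b] that[THEN V_H1]
    by (intro Lp_norm_cong_AE Lp_measurable[of _ 2] curl_L2 B.add_mem B.scale_mem H1_lincomb(1)) auto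
  show "subspace (V_space Om)" by (rule VH.subspace)
  fix u v a assume u: "u \<in> V_space Om"
  show "0 \<le> V_norm rot Om u" by (simp add: V_norm_def Lp_norm_nonneg)
  show "V_norm rot Om (u + v) \<le> V_norm rot Om u + V_norm rot Om v" if v: "v \<in> V_space Om"
    using norm_eq[OF u v, of 1 1] B.triangle[OF curl_L2(1)[OF V_H1[OF u]] curl_L2(1)[OF V_H1[OF v]]]
    by (simp add: V_norm_def)
  show "V_norm rot Om (a *\<^sub>R u) = \<bar>a\<bar> * V_norm rot Om u"
    using norm_eq[OF u u, of a 0] B.homogeneous[OF curl_L2(1)[OF V_H1[OF u]]]
    by (simp add: V_norm_def)
qed

lemma curl_smooth:
  assumes "smooth z"
  shows "AE x in \<Omega>. curl rot Om z x = rot (jacobian z (at x))"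
  using smooth_H1(2)[OF assms] by eventually_elim (simp add: curl_def)

text \<open>For a compactly supported smooth field, the integral of the squared gradient is that of the
  squared curl plus that of the squared divergence; a cutoff therefore controls interior
  gradients without any information at the boundary.\<close>

lemma interior_gradient_estimate:
  assumes \<phi>: "\<phi> \<in> test_functions Om" "\<And>x. 0 \<le> \<phi> x" "\<And>x. \<phi> x \<le> 1"
  obtains C where "0 \<le> C" "\<And>z. z \<in> M_space Om \<Longrightarrow>
    (\<Sum>i\<in>UNIV. \<Sum>j\<in>UNIV. LINT x|lborel. (frechet_derivative (\<lambda>x. \<phi> x * z x $ i) (at x) (axis j 1))\<^sup>2)
      \<le> 2 * (V_norm rot Om z)\<^sup>2 + C * (Lp_norm Om 2 z)\<^sup>2"
proof -
  have "\<exists>B. B > 0 \<and> (\<forall>x. \<bar>frechet_derivative \<phi> (at x) (axis j 1)\<bar> \<le> B)" for j :: 'n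
    using test_function_bounded[OF test_function_derivative[OF \<phi>(1)]] by metis
  then obtain Bj where Bj: "\<And>j::'n. Bj j > 0" "\<And>j x. \<bar>frechet_derivative \<phi> (at x) (axis j 1)\<bar> \<le> Bj j"
    by metis
  define G where "G = (\<Sum>j\<in>UNIV. (Bj j)\<^sup>2)"
  have G0: "G \<ge> 0" by (simp add: G_def sum_nonneg)
  have G: "(\<Sum>j\<in>UNIV. (frechet_derivative \<phi> (at x) (axis j 1))\<^sup>2) \<le> G" for x
    unfolding G_def using Bj by (intro sum_mono) (metis abs_le_square_iff abs_of_pos)
  show ?thesis
  \<comment> \<open>8 parts come from the gradient of the cutoff in the curl, 1 from the same
    gradient in the divergence.\<close>
  proof (rule that[of "9 * G"])
    show "0 \<le> 9 * G" using G0 by simp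
    fix z assume z: "z \<in> M_space Om"
    then have zs: "smooth z" and div: "\<And>x. x \<in> Om \<Longrightarrow> trace (jacobian z (at x)) = 0"
      by (auto simp: M_space_def)
    have zi: "smooth (\<lambda>x. z x $ i)" for i
      by (rule smooth_linear_comp[OF bounded_linear_vec_nth zs])
    define f where "f i = (\<lambda>x. \<phi> x * z x $ i)" for i
    define D where "D x i j = frechet_derivative (f i) (at x) (axis j 1)" for x i j
    define g where "g x j = frechet_derivative \<phi> (at x) (axis j 1)" for x j
    have ft: "f i \<in> test_functions Om" for i
      unfolding f_def by (rule test_function_mult[OF \<phi>(1) zi])
    have Dt: "(\<lambda>x. D x i j) \<in> test_functions Om" for i j
      unfolding D_def by (rule test_function_derivative[OF ft])
    have DDt: "(\<lambda>x. D x i j * D x k l) \<in> test_functions Om" for i j k l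
      using test_function_mult[OF Dt test_function_smooth[OF Dt]] .
    have DI: "integrable lborel (\<lambda>x. D x i j * D x k l)" for i j k l
      using test_function_integrable[OF DDt] .
    define J where "J x = (\<chi> i j. D x i j)" for x
    have zJ: "jacobian z (at x) $ i $ j = frechet_derivative (\<lambda>x. z x $ i) (at x) (axis j 1)" for x i j
    proof -
      have d: "((\<lambda>x. z x $ i) has_derivative (\<lambda>h. frechet_derivative z (at x) h $ i)) (at x)"
        by (rule bounded_linear.has_derivative[OF bounded_linear_vec_nth smooth_has_derivative[OF zs]])
      show ?thesis unfolding frechet_derivative_at[OF d, symmetric] by (simp add: jacobian_def matrix_def)
    qed
    \<comment> \<open>The product rule splits \<open>J x\<close> into the cut-off Jacobian of
      \<open>z\<close> and this rank-one matrix.\<close>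
    define P where "P x = (\<chi> i j. g x j * z x $ i)" for x
    have J: "J x = \<phi> x *\<^sub>R jacobian z (at x) + P x" for x
      unfolding J_def D_def f_def vec_eq_iff P_def g_def
      by (simp add: frechet_derivative_mult_smooth[OF test_function_smooth[OF \<phi>(1)] zi] zJ)
    have Pn: "(norm (P x))\<^sup>2 \<le> G * (norm (z x))\<^sup>2" for x
    proof -
      have "(norm (P x))\<^sup>2 = (\<Sum>i\<in>UNIV. (\<Sum>j\<in>UNIV. (g x j)\<^sup>2) * (z x $ i)\<^sup>2)"
        unfolding norm_matrix by (simp add: P_def power_mult_distrib sum_distrib_right)
      also have "\<dots> = (\<Sum>j\<in>UNIV. (g x j)\<^sup>2) * (norm (z x))\<^sup>2"
        unfolding power2_norm_eq_inner[of "z x"] by (simp add: inner_vec_def power2_eq_square[of "z x $ _"] sum_distrib_left)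
      also have "\<dots> \<le> G * (norm (z x))\<^sup>2"
        using G by (intro mult_right_mono) (auto simp: g_def)
      finally show ?thesis .
    qed
    have rotJ: "(norm (rot (J x)))\<^sup>2 \<le> 2 * (norm (rot (jacobian z (at x))))\<^sup>2 + 8 * G * (norm (z x))\<^sup>2" for x
    proof -
      have "rot (J x) = \<phi> x *\<^sub>R rot (jacobian z (at x)) + rot (P x)"
        unfolding J using bounded_linear.linear[OF linear_rot] by (simp add: linear_add linear_cmul)
      then have "norm (rot (J x)) \<le> norm (\<phi> x *\<^sub>R rot (jacobian z (at x))) + norm (rot (P x))"
        using norm_triangle_ineq by metis
      also have "norm (\<phi> x *\<^sub>R rot (jacobian z (at x))) \<le> 1 * norm (rot (jacobian z (at x)))"
        unfolding norm_scaleR using \<phi>(2,3) by (intro mult_right_mono) auto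
      finally have "norm (rot (J x)) \<le> norm (rot (jacobian z (at x))) + 2 * norm (P x)"
        using norm_rot_le[of "P x"] by simp
      then have "(norm (rot (J x)))\<^sup>2 \<le> (norm (rot (jacobian z (at x))) + 2 * norm (P x))\<^sup>2"
        by (intro power_mono) auto
      also have "\<dots> \<le> 2 * (norm (rot (jacobian z (at x))))\<^sup>2 + 2 * (2 * norm (P x))\<^sup>2"
        using zero_le_power2[of "norm (rot (jacobian z (at x))) - 2 * norm (P x)"] unfolding power2_sum power2_diff by simp
      also have "\<dots> \<le> 2 * (norm (rot (jacobian z (at x))))\<^sup>2 + 8 * G * (norm (z x))\<^sup>2"
        using Pn[of x] by (simp add: power_mult_distrib)
      finally show ?thesis .
    qed
    have trJ: "(\<Sum>i\<in>UNIV. D x i i)\<^sup>2 \<le> G * (norm (z x))\<^sup>2" if x: "x \<in> Om" for x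
    proof -
      have "(\<Sum>i\<in>UNIV. D x i i) = trace (J x)" by (simp add: trace_def J_def)
      also have "\<dots> = \<phi> x * trace (jacobian z (at x)) + trace (P x)"
        unfolding J by (simp add: trace_def sum.distrib sum_distrib_left)
      also have "\<dots> = (\<Sum>i\<in>UNIV. g x i * z x $ i)" using div[OF x] by (simp add: trace_def P_def)
      finally have "(\<Sum>i\<in>UNIV. D x i i)\<^sup>2 \<le> (\<Sum>i\<in>UNIV. (g x i)\<^sup>2) * (\<Sum>i\<in>UNIV. (z x $ i)\<^sup>2)"
        using Cauchy_Schwarz_ineq_sum by simp
      also have "(\<Sum>i\<in>UNIV. (z x $ i)\<^sup>2) = (norm (z x))\<^sup>2"
        unfolding power2_norm_eq_inner by (simp add: inner_vec_def power2_eq_square)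
      also have "(\<Sum>i\<in>UNIV. (g x i)\<^sup>2) * (norm (z x))\<^sup>2 \<le> G * (norm (z x))\<^sup>2"
        using G by (intro mult_right_mono) (auto simp: g_def)
      finally show ?thesis .
    qed
    \<comment> \<open>The last two sums have equal integrals by the exchange of derivatives, so
      \<open>h\<close> integrates to the squared gradient, while pointwise it is the squared curl
      plus the squared divergence.\<close>
    define h where "h x = (\<Sum>i\<in>UNIV. \<Sum>j\<in>UNIV. D x i j * D x i j) - (\<Sum>i\<in>UNIV. \<Sum>j\<in>UNIV. D x i j * D x j i)
         + (\<Sum>i\<in>UNIV. \<Sum>j\<in>UNIV. D x i i * D x j j)" for x
    have h_eq: "h x = (norm (rot (J x)))\<^sup>2 + (\<Sum>i\<in>UNIV. D x i i)\<^sup>2" for x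
      unfolding norm_rot h_def by (simp add: J_def power2_eq_square sum_product)
    have Db: "(\<lambda>x. D x i j) \<in> borel_measurable borel" for i j
      using smooth_borel_measurable[OF test_function_smooth[OF Dt]] .
    have hb: "h \<in> borel_measurable borel"
      unfolding h_def[abs_def] using Db by (intro borel_measurable_add borel_measurable_diff borel_measurable_sum borel_measurable_times)
    have hI: "integrable lborel h"
      unfolding h_def[abs_def] by (intro Bochner_Integration.integrable_add Bochner_Integration.integrable_diff Bochner_Integration.integrable_sum DI)
    have h0: "h x = 0" if "x \<notin> Om" for x
      using test_function_outside[OF Dt that] by (simp add: h_def)
    have swap: "(LINT x|lborel. D x i j * D x j i) = (LINT x|lborel. D x i i * D x j j)" for i j
      using integral_derivatives_swap[OF ft[THEN test_function_UNIV] ft[THEN test_function_UNIV]] unfolding D_def .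
    have "(\<Sum>i\<in>UNIV. \<Sum>j\<in>UNIV. LINT x|lborel. (D x i j)\<^sup>2) = (LINT x|lborel. h x)"
      unfolding h_def by (simp add: DI swap power2_eq_square)
    also have "\<dots> = (LINT x|\<Omega>. h x)"
      by (rule integral_lebesgue_on_eq_lborel[OF Om_lebesgue hb h0, symmetric])
    also have "\<dots> \<le> (LINT x|\<Omega>. 2 * (norm (curl rot Om z x))\<^sup>2 + 9 * G * (norm (z x))\<^sup>2)"
    proof (rule integral_mono_AE)
      show "integrable \<Omega> h"
      proof -
        have "integrable lebesgue h" using hI hb by (simp add: integrable_completion)
        then have "integrable lebesgue (\<lambda>x. indicator Om x *\<^sub>R h x)"
          using integrable_real_mult_indicator[OF Om_lebesgue, of h] by (simp add: mult.commute)
        then show ?thesis by (subst integrable_restrict_space) auto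
      qed
      show "integrable \<Omega> (\<lambda>x. 2 * (norm (curl rot Om z x))\<^sup>2 + 9 * G * (norm (z x))\<^sup>2)"
        using Lp2_integrable[OF curl_L2(1)[OF smooth_H1(1)[OF zs]]] Lp2_integrable[OF H1_D(1)[OF smooth_H1(1)[OF zs]]] by auto
      show "AE x in \<Omega>. h x \<le> 2 * (norm (curl rot Om z x))\<^sup>2 + 9 * G * (norm (z x))\<^sup>2"
        using curl_smooth[OF zs] AE_space
      proof eventually_elim
        case (elim x)
        then show ?case unfolding h_eq elim(1) using rotJ[of x] trJ[of x] by simp
      qed
    qed
    also have "\<dots> = 2 * (V_norm rot Om z)\<^sup>2 + 9 * G * (Lp_norm Om 2 z)\<^sup>2"
      unfolding V_norm_def Lp_norm_square
      using Lp2_integrable[OF curl_L2(1)[OF smooth_H1(1)[OF zs]]] Lp2_integrable[OF H1_D(1)[OF smooth_H1(1)[OF zs]]] by simp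
    finally show "(\<Sum>i\<in>UNIV. \<Sum>j\<in>UNIV. LINT x|lborel. (frechet_derivative (\<lambda>x. \<phi> x * z x $ i) (at x) (axis j 1))\<^sup>2)
      \<le> 2 * (V_norm rot Om z)\<^sup>2 + 9 * G * (Lp_norm Om 2 z)\<^sup>2" by (simp add: D_def f_def)
  qed
qed

end

section \<open>Compactness modulo finitely many functionals\<close>

lemma tendsto_sum_list:
  fixes f :: "'i \<Rightarrow> 'a \<Rightarrow> real"
  assumes "\<And>x. x \<in> set xs \<Longrightarrow> ((\<lambda>k. f k x) \<longlongrightarrow> g x) F"
  shows "((\<lambda>k. \<Sum>x\<leftarrow>xs. f k x) \<longlongrightarrow> (\<Sum>x\<leftarrow>xs. g x)) F"
  using assms by (induction xs) (auto intro!: tendsto_add)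

context bounded_open
begin

text \<open>\<open>Y\<close> need not be closed in L2, so an almost optimal approximation
  \<open>v\<close> of \<open>\<psi>\<close> takes the place of the projection. If the residual
  \<open>w\<close> correlated with some \<open>u\<close> by more than \<open>\<eta>\<close> times
  its norm, moving from \<open>v\<close> along \<open>u\<close> would beat the infimum.\<close>

lemma near_projection:
  assumes Y: "subspace Y" "Y \<subseteq> Lp_space Om 2" and \<psi>: "\<psi> \<in> Lp_space Om 2" and \<eta>: "\<eta> > 0"
  shows "\<exists>v\<in>Y. \<forall>u\<in>Y. \<bar>L2_inner Om u \<psi>\<bar> \<le> \<bar>L2_inner Om u v\<bar> + \<eta> * Lp_norm Om 2 (u :: real^'n \<Rightarrow> real^'n)"
proof -
  interpret A: seminormed_space "Lp_space Om 2 :: (real^'n \<Rightarrow> real^'n) set" "Lp_norm Om 2" by (rule seminormed_Lp) simp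
  define S where "S = (\<lambda>v. (Lp_norm Om 2 (\<psi> - v))\<^sup>2) ` Y"
  have ne: "S \<noteq> {}" using subspace_0[OF Y(1)] by (auto simp: S_def)
  have bdd: "bdd_below S" by (auto simp: S_def intro!: bdd_belowI[of _ 0])
  have "Inf S < Inf S + \<eta>\<^sup>2" using \<eta> by simp
  then obtain v where v: "v \<in> Y" "(Lp_norm Om 2 (\<psi> - v))\<^sup>2 < Inf S + \<eta>\<^sup>2"
    using cInf_lessD[OF ne] unfolding S_def by blast
  have vL: "v \<in> Lp_space Om 2" using v Y by auto
  define w where "w = \<psi> - v"
  have wL: "w \<in> Lp_space Om 2" unfolding w_def by (rule A.diff_mem[OF \<psi> vL])
  show ?thesis
  proof (intro bexI[OF _ v(1)] ballI)
    fix u assume u: "u \<in> Y"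
    then have uL: "u \<in> Lp_space Om 2" using Y by auto
    have "\<bar>L2_inner Om w u\<bar> \<le> \<eta> * Lp_norm Om 2 u"
    proof (cases "Lp_norm Om 2 u = 0")
      case True
      then show ?thesis using L2_inner_bound[OF wL uL] by simp
    next
      case False
      define n where "n = (Lp_norm Om 2 u)\<^sup>2"
      have n: "n > 0" using False by (simp add: n_def)
      \<comment> \<open>The minimiser of the squared distance to \<open>\<psi>\<close> on the line
        through \<open>v\<close> in direction \<open>u\<close>.\<close>
      define t where "t = L2_inner Om w u / n"
      have tu: "v + t *\<^sub>R u \<in> Y" using Y(1) v(1) u by (intro subspace_add subspace_mul)
      have "Inf S \<le> (Lp_norm Om 2 (\<psi> - (v + t *\<^sub>R u)))\<^sup>2"
        using tu by (intro cInf_lower bdd) (auto simp: S_def)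
      also have "\<psi> - (v + t *\<^sub>R u) = 1 *\<^sub>R w + (- t) *\<^sub>R u" by (simp add: w_def)
      also have "(Lp_norm Om 2 (1 *\<^sub>R w + (- t) *\<^sub>R u))\<^sup>2
          = 1 * (1 * L2_inner Om w w + (- t) * L2_inner Om u w) + (- t) * (1 * L2_inner Om w u + (- t) * L2_inner Om u u)"
        unfolding L2_inner_self[symmetric]
        using L2_inner_lincomb[OF wL uL, of _ 1 "-t"] wL uL A.add_mem A.scale_mem L2_inner_commute
        by metis
      also have "\<dots> = (Lp_norm Om 2 w)\<^sup>2 - 2 * t * L2_inner Om w u + t\<^sup>2 * n"
        unfolding L2_inner_self n_def L2_inner_commute[of u w] by (simp add: power2_eq_square algebra_simps)
      also have "\<dots> = (Lp_norm Om 2 w)\<^sup>2 - (L2_inner Om w u)\<^sup>2 / n"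
        using n by (simp add: t_def power2_eq_square field_simps)
      finally have "(L2_inner Om w u)\<^sup>2 / n < \<eta>\<^sup>2" using v(2) by (simp add: w_def)
      then have "(L2_inner Om w u)\<^sup>2 < (\<eta> * Lp_norm Om 2 u)\<^sup>2"
        using n by (simp add: pos_divide_less_eq n_def power_mult_distrib)
      then have "\<bar>L2_inner Om w u\<bar>\<^sup>2 < (\<eta> * Lp_norm Om 2 u)\<^sup>2" by simp
      from power_less_imp_less_base[OF this] show ?thesis
        using \<eta> Lp_norm_nonneg[of 2 u] by simp
    qed
    moreover have "L2_inner Om w u = L2_inner Om \<psi> u - L2_inner Om v u"
      using L2_inner_lincomb[OF \<psi> vL uL, of 1 "-1"] by (simp add: w_def)
    ultimately show "\<bar>L2_inner Om u \<psi>\<bar> \<le> \<bar>L2_inner Om u v\<bar> + \<eta> * Lp_norm Om 2 u"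
      unfolding L2_inner_commute[of u] by linarith
  qed
qed

text \<open>\<open>1 - (\<phi> x)\<^sup>2\<close> is the share of the squared field that the cutoff
  removes. Cutoffs exhausting \<open>Om\<close> make its integral small by dominated
  convergence.\<close>

lemma cutoff_small_layer:
  assumes "0 < e"
  obtains \<phi> where "\<phi> \<in> test_functions Om" "\<And>x. 0 \<le> \<phi> x" "\<And>x. \<phi> x \<le> 1" "(LINT x|\<Omega>. 1 - (\<phi> x)\<^sup>2) < e"
proof -
  obtain \<phi> where \<phi>: "\<And>n. \<phi> n \<in> test_functions Om" "\<And>n x. 0 \<le> \<phi> n x" "\<And>n x. \<phi> n x \<le> 1"
    "\<And>x. (\<lambda>n. \<phi> n x) \<longlonglongrightarrow> indicat_real Om x"
    by (rule test_functions_cutoff[OF open_Om]) (rule that)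
  have [measurable]: "\<phi> n \<in> borel_measurable \<Omega>" for n
    using test_functions_measurable[OF \<phi>(1)] .
  have "(\<lambda>n. LINT x|\<Omega>. 1 - (\<phi> n x)\<^sup>2) \<longlonglongrightarrow> (LINT x|\<Omega>. 0)"
  proof (rule integral_dominated_convergence[where w="\<lambda>x. 1"])
    show "AE x in \<Omega>. (\<lambda>n. 1 - (\<phi> n x)\<^sup>2) \<longlonglongrightarrow> 0"
      using AE_space
    proof eventually_elim
      case (elim x)
      then have "(\<lambda>n. \<phi> n x) \<longlonglongrightarrow> 1" using \<phi>(4)[of x] by simp
      then have "(\<lambda>n. 1 - (\<phi> n x)\<^sup>2) \<longlonglongrightarrow> 1 - 1\<^sup>2" by (intro tendsto_intros)
      then show ?case by simp
    qed
    show "AE x in \<Omega>. norm (1 - (\<phi> n x)\<^sup>2) \<le> 1" for n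
      using \<phi>(2,3) by (intro AE_I2) (simp add: abs_le_iff power_le_one add_increasing2)
  qed auto
  then have "\<forall>\<^sub>F n in sequentially. (LINT x|\<Omega>. 1 - (\<phi> n x)\<^sup>2) < e"
    using assms order_tendstoD(2) by fastforce
  then obtain n where "(LINT x|\<Omega>. 1 - (\<phi> n x)\<^sup>2) < e" unfolding eventually_sequentially by blast
  then show ?thesis using that[of "\<phi> n"] \<phi> by blast
qed

end

context curl_domain
begin

lemma M_space_V: "M_space Om \<subseteq> V_space Om"
proof
  fix z assume z: "z \<in> M_space Om"
  have "H1_norm Om (z - z) = 0"
    using seminormed_space.N_zero[OF seminormed_H1] by simp
  then have "\<exists>w\<in>M_space Om. H1_norm Om (z - w) < \<epsilon>" if "\<epsilon> > 0" for \<epsilon>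
    by (intro bexI[OF _ z]) (use that in \<open>simp only:\<close>)
  then show "z \<in> V_space Om" using z M_space_H1 unfolding V_space_def by blast
qed

text \<open>On \<open>M_space\<close> the components of the cut-off field are test functions, so the
  cube estimate applies to each of them, with gradients controlled by the interior bound.\<close>

lemma cutoff_compactness_M:
  assumes \<phi>: "\<phi> \<in> test_functions Om" "\<And>x. 0 \<le> \<phi> x" "\<And>x. \<phi> x \<le> 1" and \<epsilon>: "\<epsilon> > 0"
  obtains \<Psi> C where "set \<Psi> \<subseteq> Lp_space Om 2" "0 \<le> C"
    "\<And>z. z \<in> M_space Om \<Longrightarrow> (Lp_norm Om 2 (\<lambda>x. \<phi> x *\<^sub>R z x))\<^sup>2
      \<le> \<epsilon> * ((V_norm rot Om z)\<^sup>2 + (Lp_norm Om 2 z)\<^sup>2) + C * (\<Sum>\<psi>\<leftarrow>\<Psi>. (L2_inner Om z \<psi>)\<^sup>2)"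
proof -
  obtain C0 where C0: "0 \<le> C0" "\<And>z. z \<in> M_space Om \<Longrightarrow>
    (\<Sum>i\<in>UNIV. \<Sum>j\<in>UNIV. LINT x|lborel. (frechet_derivative (\<lambda>x. \<phi> x * z x $ i) (at x) (axis j 1))\<^sup>2)
      \<le> 2 * (V_norm rot Om z)\<^sup>2 + C0 * (Lp_norm Om 2 z)\<^sup>2"
    by (rule interior_gradient_estimate[OF \<phi>]) (rule that)
  \<comment> \<open>Pays for both constants of the gradient estimate, as 2 and \<open>C0\<close> are
    at most \<open>2 + C0\<close>.\<close>
  define e where "e = \<epsilon> / (2 + C0)"
  have e: "e > 0" using \<epsilon> C0 by (simp add: e_def)
  obtain R where R: "\<And>x. x \<in> Om \<Longrightarrow> norm x \<le> R" using bounded_Om by (auto simp: bounded_iff)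
  obtain I :: "((real^'n) \<Rightarrow> int) set" and Q C where IQ: "finite I" "\<And>k. k \<in> I \<Longrightarrow> Q k \<in> sets borel" "0 \<le> C"
    and est: "\<And>f. f \<in> test_functions UNIV \<Longrightarrow> \<forall>x::real^'n. R < norm x \<longrightarrow> f x = 0 \<Longrightarrow>
      (LINT x|lborel. (f x)\<^sup>2) \<le> e * (\<Sum>b\<in>Basis. LINT x|lborel. (frechet_derivative f (at x) b)\<^sup>2)
          + C * (\<Sum>k\<in>I. (LINT x|lborel. indicator (Q k) x * f x)\<^sup>2)"
    by (rule finite_rank_L2_estimate[OF e, of R]) (rule that)
  \<comment> \<open>A list rather than a set: later each entry is replaced by a field, and
    repetitions must still be counted then.\<close>
  obtain xs where xs: "set xs = I \<times> (UNIV :: 'n set)" "distinct xs"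
    using finite_distinct_list[of "I \<times> (UNIV :: 'n set)"] IQ(1) by auto
  \<comment> \<open>Cutoff and indicator are moved to the test vector, so that a cube integral of a
    cut-off component becomes an L2 pairing with \<open>z\<close> itself.\<close>
  define \<psi> where "\<psi> ki = (\<lambda>x. (indicator (Q (fst ki)) x * \<phi> x) *\<^sub>R axis (snd ki) (1::real))" for ki :: "_ \<times> 'n"
  have \<phi>s: "smooth \<phi>" using \<phi> test_function_smooth by blast
  have \<phi>m [measurable]: "\<phi> \<in> borel_measurable \<Omega>" using test_functions_measurable[OF \<phi>(1)] .
  show ?thesis
  proof (rule that[of "map \<psi> xs" C])
    show "set (map \<psi> xs) \<subseteq> Lp_space Om 2"
    proof clarsimp
      fix k i assume "(k, i) \<in> set xs"
      then have k: "k \<in> I" using xs by auto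
      have one: "(\<lambda>x. 1::real) \<in> Lp_space Om 2" by (simp add: Lp_space_def)
      have "indicator (Q k) \<in> borel_measurable \<Omega>"
        using IQ(2)[OF k] by (intro measurable_restrict_space1 measurable_completion) simp
      then have m: "\<psi> (k, i) \<in> borel_measurable \<Omega>" unfolding \<psi>_def fst_conv snd_conv by measurable
      show "\<psi> (k, i) \<in> Lp_space Om 2"
        by (rule Lp_dominated(1)[OF one m, of 1])
          (use \<phi>(2,3) in \<open>auto simp: \<psi>_def indicator_def norm_axis_1\<close>)
    qed
    show "0 \<le> C" by (rule IQ(3))
    fix z assume z: "z \<in> M_space Om"
    then have zs: "smooth z" by (auto simp: M_space_def)
    have zi: "smooth (\<lambda>x. z x $ i)" for i
      by (rule smooth_linear_comp[OF bounded_linear_vec_nth zs])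
    define f where "f i = (\<lambda>x. \<phi> x * z x $ i)" for i
    have ft: "f i \<in> test_functions Om" for i
      unfolding f_def by (rule test_function_mult[OF \<phi>(1) zi])
    have fb: "f i \<in> borel_measurable borel" for i by (rule smooth_borel_measurable[OF test_function_smooth[OF ft]])
    have f0: "f i x = 0" if "x \<notin> Om" for i x using test_function_outside[OF ft that] .
    have inner: "L2_inner Om z (\<psi> (k, i)) = (LINT x|lborel. indicator (Q k) x * f i x)" if "k \<in> I" for k i
    proof -
      have "L2_inner Om z (\<psi> (k, i)) = (LINT x|\<Omega>. indicator (Q k) x * f i x)"
        unfolding L2_inner_def by (simp add: \<psi>_def f_def inner_axis mult.assoc)
      also have "\<dots> = (LINT x|lborel. indicator (Q k) x * f i x)"
        using fb IQ(2)[OF that] f0 by (intro integral_lebesgue_on_eq_lborel) auto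
      finally show ?thesis .
    qed
    have fI: "integrable \<Omega> (\<lambda>x. (f i x)\<^sup>2)" for i
      using Lp2_integrable[OF continuous_in_Lp[OF smooth_continuous_on[OF test_function_smooth[OF ft]]], of i] by simp
    have "(Lp_norm Om 2 (\<lambda>x. \<phi> x *\<^sub>R z x))\<^sup>2 = (LINT x|\<Omega>. (\<Sum>i\<in>UNIV. (f i x)\<^sup>2))"
      unfolding Lp_norm_square power2_norm_eq_inner by (simp add: inner_vec_def f_def power2_eq_square)
    also have "\<dots> = (\<Sum>i\<in>UNIV. LINT x|\<Omega>. (f i x)\<^sup>2)"
      by (rule Bochner_Integration.integral_sum[OF fI])
    also have "\<dots> = (\<Sum>i\<in>UNIV. LINT x|lborel. (f i x)\<^sup>2)"
      using fb f0 by (intro sum.cong refl integral_lebesgue_on_eq_lborel) auto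
    also have "\<dots> \<le> (\<Sum>i\<in>UNIV. e * (\<Sum>b\<in>Basis. LINT x|lborel. (frechet_derivative (f i) (at x) b)\<^sup>2)
          + C * (\<Sum>k\<in>I. (LINT x|lborel. indicator (Q k) x * f i x)\<^sup>2))"
    proof (rule sum_mono, rule est[OF test_function_UNIV[OF ft]], intro allI impI)
      show "f i x = 0" if "R < norm x" for i x using f0[of x i] R[of x] that by force
    qed
    also have "\<dots> = e * (\<Sum>i\<in>UNIV. \<Sum>j\<in>UNIV. LINT x|lborel. (frechet_derivative (f i) (at x) (axis j 1))\<^sup>2)
          + C * (\<Sum>i\<in>UNIV. \<Sum>k\<in>I. (L2_inner Om z (\<psi> (k, i)))\<^sup>2)"
      unfolding sum_Basis_cart by (simp add: sum.distrib sum_distrib_left inner)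
    also have "(\<Sum>i\<in>UNIV. \<Sum>k\<in>I. (L2_inner Om z (\<psi> (k, i)))\<^sup>2) = (\<Sum>\<psi>\<leftarrow>map \<psi> xs. (L2_inner Om z \<psi>)\<^sup>2)"
    proof -
      have "(\<Sum>\<psi>\<leftarrow>map \<psi> xs. (L2_inner Om z \<psi>)\<^sup>2) = (\<Sum>ki\<in>I \<times> UNIV. (L2_inner Om z (\<psi> ki))\<^sup>2)"
        using sum_list_distinct_conv_sum_set[OF xs(2), of "\<lambda>ki. (L2_inner Om z (\<psi> ki))\<^sup>2"] xs(1) by (simp add: o_def)
      also have "\<dots> = (\<Sum>k\<in>I. \<Sum>i\<in>UNIV. (L2_inner Om z (\<psi> (k, i)))\<^sup>2)"
        by (simp add: sum.cartesian_product)
      finally have eq: "(\<Sum>\<psi>\<leftarrow>map \<psi> xs. (L2_inner Om z \<psi>)\<^sup>2) = (\<Sum>k\<in>I. \<Sum>i\<in>UNIV. (L2_inner Om z (\<psi> (k, i)))\<^sup>2)" .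
      show ?thesis unfolding eq by (rule sum.swap)
    qed
    also have "e * (\<Sum>i\<in>UNIV. \<Sum>j\<in>UNIV. LINT x|lborel. (frechet_derivative (f i) (at x) (axis j 1))\<^sup>2)
        \<le> e * (2 * (V_norm rot Om z)\<^sup>2 + C0 * (Lp_norm Om 2 z)\<^sup>2)"
      using C0(2)[OF z] e by (intro mult_left_mono) (auto simp: f_def)
    also have "\<dots> \<le> e * ((2 + C0) * ((V_norm rot Om z)\<^sup>2 + (Lp_norm Om 2 z)\<^sup>2))"
      using e C0 by (intro mult_left_mono) (auto simp: algebra_simps)
    also have "\<dots> = \<epsilon> * ((V_norm rot Om z)\<^sup>2 + (Lp_norm Om 2 z)\<^sup>2)"
      using C0 by (simp add: e_def)
    finally show "(Lp_norm Om 2 (\<lambda>x. \<phi> x *\<^sub>R z x))\<^sup>2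
      \<le> \<epsilon> * ((V_norm rot Om z)\<^sup>2 + (Lp_norm Om 2 z)\<^sup>2) + C * (\<Sum>\<psi>\<leftarrow>map \<psi> xs. (L2_inner Om z \<psi>)\<^sup>2)"
      by simp
  qed
qed

text \<open>Both sides are continuous for \<open>H1_norm\<close>, in which \<open>M_space\<close> is
  dense in \<open>V_space\<close>, so the estimate passes to the limit.\<close>

lemma cutoff_compactness_V:
  assumes \<phi>: "\<phi> \<in> test_functions Om" "\<And>x. 0 \<le> \<phi> x" "\<And>x. \<phi> x \<le> 1" and \<epsilon>: "\<epsilon> > 0"
  obtains \<Psi> C where "set \<Psi> \<subseteq> Lp_space Om 2" "0 \<le> C"
    "\<And>u. u \<in> V_space Om \<Longrightarrow> (Lp_norm Om 2 (\<lambda>x. \<phi> x *\<^sub>R u x))\<^sup>2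
      \<le> \<epsilon> * ((V_norm rot Om u)\<^sup>2 + (Lp_norm Om 2 u)\<^sup>2) + C * (\<Sum>\<psi>\<leftarrow>\<Psi>. (L2_inner Om u \<psi>)\<^sup>2)"
proof -
  obtain \<Psi> C where \<Psi>: "set \<Psi> \<subseteq> Lp_space Om 2" "0 \<le> C"
    and M: "\<And>z. z \<in> M_space Om \<Longrightarrow> (Lp_norm Om 2 (\<lambda>x. \<phi> x *\<^sub>R z x))\<^sup>2
      \<le> \<epsilon> * ((V_norm rot Om z)\<^sup>2 + (Lp_norm Om 2 z)\<^sup>2) + C * (\<Sum>\<psi>\<leftarrow>\<Psi>. (L2_inner Om z \<psi>)\<^sup>2)"
    by (rule cutoff_compactness_M[OF \<phi> \<epsilon>]) (rule that)
  interpret A: seminormed_space "Lp_space Om 2 :: (real^'n \<Rightarrow> real^'n) set" "Lp_norm Om 2" by (rule seminormed_Lp) simp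
  interpret VH: seminormed_space "V_space Om" "H1_norm Om" by (rule seminormed_V_H1)
  interpret V: seminormed_space "V_space Om" "V_norm rot Om" by (rule seminormed_V)
  have \<phi>m [measurable]: "\<phi> \<in> borel_measurable \<Omega>" using test_functions_measurable[OF \<phi>(1)] .
  show ?thesis
  proof (rule that[OF \<Psi>])
    fix u assume u: "u \<in> V_space Om"
    have ap: "\<exists>z\<in>M_space Om. H1_norm Om (u - z) < d" if "d > 0" for d
      using u that unfolding V_space_def by blast
    have "\<exists>z\<in>M_space Om. H1_norm Om (u - z) < 1 / real (Suc k)" for k
      by (rule ap) simp
    then obtain z where z: "\<And>k. z k \<in> M_space Om" "\<And>k. H1_norm Om (u - z k) < 1 / real (Suc k)" by metis
    have zV: "z k \<in> V_space Om" for k using z(1) M_space_V by auto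
    have H: "(\<lambda>k. H1_norm Om (z k - u)) \<longlonglongrightarrow> 0"
    proof (rule tendsto_sandwich[OF _ _ tendsto_const])
      show "(\<lambda>k. 1 / real (Suc k)) \<longlonglongrightarrow> 0" using LIMSEQ_inverse_real_of_nat by (simp add: inverse_eq_divide)
      show "\<forall>\<^sub>F k in sequentially. H1_norm Om (z k - u) \<le> 1 / real (Suc k)"
        using z(2) VH.N_diff_commute[OF zV u] by (simp add: less_imp_le)
    qed (auto simp: H1_norm_def)
    have L2: "u \<in> Lp_space Om 2" "z k \<in> Lp_space Om 2" for k
      using H1_D(1) V_H1 u zV by auto
    have L: "(\<lambda>k. Lp_norm Om 2 (z k - u)) \<longlonglongrightarrow> 0"
    proof (rule tendsto_sandwich[OF _ _ tendsto_const H])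
      show "\<forall>\<^sub>F k in sequentially. Lp_norm Om 2 (z k - u) \<le> H1_norm Om (z k - u)"
        unfolding H1_norm_def by (intro always_eventually allI real_sqrt_sum_squares_ge1)
    qed (auto simp: Lp_norm_nonneg)
    have VV: "(\<lambda>k. V_norm rot Om (z k - u)) \<longlonglongrightarrow> 0"
    proof (rule tendsto_sandwich[OF _ _ tendsto_const])
      show "(\<lambda>k. 2 * H1_norm Om (z k - u)) \<longlonglongrightarrow> 0" using tendsto_mult_right_zero[OF H] .
      show "\<forall>\<^sub>F k in sequentially. V_norm rot Om (z k - u) \<le> 2 * H1_norm Om (z k - u)"
        by (intro always_eventually allI curl_L2(2) V_H1 V.diff_mem zV u)
    qed (auto simp: V_norm_def Lp_norm_nonneg)
    have t1: "(\<lambda>k. V_norm rot Om (z k)) \<longlonglongrightarrow> V_norm rot Om u" by (rule V.tendsto_N[OF u zV VV])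
    have t2: "(\<lambda>k. Lp_norm Om 2 (z k)) \<longlonglongrightarrow> Lp_norm Om 2 u" by (rule A.tendsto_N[OF L2 L])
    have cut: "(\<lambda>x. \<phi> x *\<^sub>R w x) \<in> Lp_space Om 2 \<and> Lp_norm Om 2 (\<lambda>x. \<phi> x *\<^sub>R w x) \<le> 1 * Lp_norm Om 2 w"
      if w: "w \<in> Lp_space Om 2" for w :: "real^'n \<Rightarrow> real^'n"
    proof -
      have "(\<lambda>x. \<phi> x *\<^sub>R w x) \<in> borel_measurable \<Omega>" using Lp_measurable[OF w] by measurable
      note D = Lp_dominated[OF w this, of 1]
      have "AE x in \<Omega>. norm (\<phi> x *\<^sub>R w x) \<le> 1 * norm (w x)"
        using \<phi>(2,3) by (intro AE_I2) (simp add: mult_left_le_one_le)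
      from D[OF this] show ?thesis by simp
    qed
    have t3: "(\<lambda>k. Lp_norm Om 2 (\<lambda>x. \<phi> x *\<^sub>R z k x)) \<longlonglongrightarrow> Lp_norm Om 2 (\<lambda>x. \<phi> x *\<^sub>R u x)"
    proof (rule A.tendsto_N)
      show "(\<lambda>x. \<phi> x *\<^sub>R u x) \<in> Lp_space Om 2" "\<And>k. (\<lambda>x. \<phi> x *\<^sub>R z k x) \<in> Lp_space Om 2"
        using cut L2 by auto
      show "(\<lambda>k. Lp_norm Om 2 ((\<lambda>x. \<phi> x *\<^sub>R z k x) - (\<lambda>x. \<phi> x *\<^sub>R u x))) \<longlonglongrightarrow> 0"
      proof (rule tendsto_sandwich[OF _ _ tendsto_const L])
        have "(\<lambda>x. \<phi> x *\<^sub>R z k x) - (\<lambda>x. \<phi> x *\<^sub>R u x) = (\<lambda>x. \<phi> x *\<^sub>R (z k - u) x)" for k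
          by (auto simp: scaleR_diff_right)
        then show "\<forall>\<^sub>F k in sequentially. Lp_norm Om 2 ((\<lambda>x. \<phi> x *\<^sub>R z k x) - (\<lambda>x. \<phi> x *\<^sub>R u x)) \<le> Lp_norm Om 2 (z k - u)"
          using cut[OF A.diff_mem[OF L2(2) L2(1)]] by simp
      qed (auto simp: Lp_norm_nonneg)
    qed
    have t4: "(\<lambda>k. L2_inner Om (z k) \<psi>) \<longlonglongrightarrow> L2_inner Om u \<psi>" if \<psi>: "\<psi> \<in> set \<Psi>" for \<psi>
    proof (rule Lim_null[THEN iffD2], rule tendsto_rabs_zero_cancel, rule tendsto_sandwich[OF _ _ tendsto_const])
      have \<psi>L: "\<psi> \<in> Lp_space Om 2" using \<psi> \<Psi> by auto
      show "(\<lambda>k. Lp_norm Om 2 (z k - u) * Lp_norm Om 2 \<psi>) \<longlonglongrightarrow> 0" using tendsto_mult_left_zero[OF L] .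
      have "L2_inner Om (z k) \<psi> - L2_inner Om u \<psi> = L2_inner Om (z k - u) \<psi>" for k
        using L2_inner_lincomb[OF L2(2) L2(1) \<psi>L, of 1 _ "-1"] by simp
      then show "\<forall>\<^sub>F k in sequentially. \<bar>L2_inner Om (z k) \<psi> - L2_inner Om u \<psi>\<bar> \<le> Lp_norm Om 2 (z k - u) * Lp_norm Om 2 \<psi>"
        using L2_inner_bound[OF A.diff_mem[OF L2(2) L2(1)] \<psi>L] by simp
    qed auto
    show "(Lp_norm Om 2 (\<lambda>x. \<phi> x *\<^sub>R u x))\<^sup>2
      \<le> \<epsilon> * ((V_norm rot Om u)\<^sup>2 + (Lp_norm Om 2 u)\<^sup>2) + C * (\<Sum>\<psi>\<leftarrow>\<Psi>. (L2_inner Om u \<psi>)\<^sup>2)"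
    proof (rule LIMSEQ_le)
      show "(\<lambda>k. (Lp_norm Om 2 (\<lambda>x. \<phi> x *\<^sub>R z k x))\<^sup>2) \<longlonglongrightarrow> (Lp_norm Om 2 (\<lambda>x. \<phi> x *\<^sub>R u x))\<^sup>2"
        by (intro tendsto_intros t3)
      show "(\<lambda>k. \<epsilon> * ((V_norm rot Om (z k))\<^sup>2 + (Lp_norm Om 2 (z k))\<^sup>2) + C * (\<Sum>\<psi>\<leftarrow>\<Psi>. (L2_inner Om (z k) \<psi>)\<^sup>2))
        \<longlonglongrightarrow> \<epsilon> * ((V_norm rot Om u)\<^sup>2 + (Lp_norm Om 2 u)\<^sup>2) + C * (\<Sum>\<psi>\<leftarrow>\<Psi>. (L2_inner Om u \<psi>)\<^sup>2)"
        by (intro tendsto_intros tendsto_sum_list t1 t2 t4)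
    qed (use M z(1) in auto)
  qed
qed

text \<open>Near the boundary, where no gradient bound is available, the \<open>L\<^sup>p\<close> norm makes the
  contribution of a thin layer small; near-projection replaces the averages over cubes by
  pairings with admissible fields.\<close>

lemma compactness_estimate:
  assumes p: "2 < p" and \<epsilon>: "\<epsilon> > 0"
  obtains vs C where "set vs \<subseteq> V_space Om \<inter> LM_space Om p" "0 \<le> C"
    "\<And>u. u \<in> V_space Om \<inter> LM_space Om p \<Longrightarrow> (Lp_norm Om 2 u)\<^sup>2
      \<le> \<epsilon> * (1 + (V_norm rot Om u)\<^sup>2 + Lp_norm Om p u powr p) + C * (\<Sum>v\<leftarrow>vs. (L2_inner Om u v)\<^sup>2)"
proof -
  define Y where "Y = V_space Om \<inter> LM_space Om p"
  interpret V: seminormed_space "V_space Om" "V_norm rot Om" by (rule seminormed_V)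
  interpret LM: seminormed_space "LM_space Om p" "Lp_norm Om p" using p by (intro seminormed_LM) simp
  have Ysub: "subspace Y" unfolding Y_def by (intro subspace_inter V.subspace LM.subspace)
  have YL: "Y \<subseteq> Lp_space Om 2" unfolding Y_def using V_H1 H1_D(1) by blast
  \<comment> \<open>The quarter lets \<open>2 * (e * a)\<close> be absorbed as half of
    \<open>a\<close>. This doubles the remaining terms, so \<open>2 * e\<close> must not exceed
    \<open>\<epsilon>\<close>.\<close>
  define e where "e = min (\<epsilon> / 2) (1 / 4)"
  have e: "e > 0" "2 * e \<le> \<epsilon>" "e \<le> 1/4" using \<epsilon> by (auto simp: e_def)
  obtain c where c: "0 \<le> c" "\<And>s. 0 \<le> s \<Longrightarrow> s\<^sup>2 \<le> e * s powr p + c"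
    by (rule square_le_powr[OF p e(1)]) (rule that)
  \<comment> \<open>The layer is taken so thin that \<open>c\<close> times its weight is at most
    \<open>e\<close>.\<close>
  have "e / (c + 1) > 0" using e c by simp
  then obtain \<phi> where \<phi>: "\<phi> \<in> test_functions Om" "\<And>x. 0 \<le> \<phi> x" "\<And>x. \<phi> x \<le> 1" "(LINT x|\<Omega>. 1 - (\<phi> x)\<^sup>2) < e / (c + 1)"
    by (rule cutoff_small_layer) (rule that)
  obtain \<Psi> C1 where \<Psi>: "set \<Psi> \<subseteq> Lp_space Om 2" "0 \<le> C1"
    and est: "\<And>u. u \<in> V_space Om \<Longrightarrow> (Lp_norm Om 2 (\<lambda>x. \<phi> x *\<^sub>R u x))\<^sup>2
      \<le> e * ((V_norm rot Om u)\<^sup>2 + (Lp_norm Om 2 u)\<^sup>2) + C1 * (\<Sum>\<psi>\<leftarrow>\<Psi>. (L2_inner Om u \<psi>)\<^sup>2)"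
    by (rule cutoff_compactness_V[OF \<phi>(1-3) e(1)]) (rule that)
  define n where "n = real (length \<Psi>)"
  \<comment> \<open>The errors of the \<open>n\<close> projections add up to
    \<open>C1 * (2 * n * \<eta>\<^sup>2)\<close> times the squared norm, which this keeps below
    \<open>e\<close>; the summand 1 keeps the denominator positive.\<close>
  define \<eta> where "\<eta> = sqrt (e / (2 * C1 * n + 1))"
  have \<eta>: "\<eta> > 0" "\<eta>\<^sup>2 = e / (2 * C1 * n + 1)"
    using e \<Psi>(2) by (auto simp: \<eta>_def n_def add_nonneg_pos)
  have C1\<eta>: "C1 * (2 * n * \<eta>\<^sup>2) \<le> e"
  proof -
    have "0 \<le> 2 * C1 * n" using \<Psi>(2) by (simp add: n_def)
    then show ?thesis unfolding \<eta>(2) using e(1) by (simp add: field_simps)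
  qed
  have "\<forall>\<psi>\<in>set \<Psi>. \<exists>v\<in>Y. \<forall>u\<in>Y. \<bar>L2_inner Om u \<psi>\<bar> \<le> \<bar>L2_inner Om u v\<bar> + \<eta> * Lp_norm Om 2 u"
    using near_projection[OF Ysub YL _ \<eta>(1)] \<Psi>(1) by blast
  then obtain pr where pr: "\<And>\<psi>. \<psi> \<in> set \<Psi> \<Longrightarrow> pr \<psi> \<in> Y"
    "\<And>\<psi> u. \<psi> \<in> set \<Psi> \<Longrightarrow> u \<in> Y \<Longrightarrow> \<bar>L2_inner Om u \<psi>\<bar> \<le> \<bar>L2_inner Om u (pr \<psi>)\<bar> + \<eta> * Lp_norm Om 2 u"
    by metis
  show ?thesis
  proof (rule that[of "map pr \<Psi>" "4 * C1"])
    show "set (map pr \<Psi>) \<subseteq> V_space Om \<inter> LM_space Om p" using pr(1) unfolding Y_def by auto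
    show "0 \<le> 4 * C1" using \<Psi>(2) by simp
    fix u assume "u \<in> V_space Om \<inter> LM_space Om p"
    then have u: "u \<in> Y" "u \<in> V_space Om" "u \<in> LM_space Om p" by (auto simp: Y_def)
    have uL: "u \<in> Lp_space Om 2" "u \<in> Lp_space Om p" using u YL LM_Lp by auto
    have [measurable]: "u \<in> borel_measurable \<Omega>" using Lp_measurable[OF uL(1)] .
    have [measurable]: "\<phi> \<in> borel_measurable \<Omega>" using test_functions_measurable[OF \<phi>(1)] .
    have \<phi>2: "(\<phi> x)\<^sup>2 \<le> 1" for x using \<phi>(2,3) by (simp add: power_le_one)
    define S where "S = (\<Sum>v\<leftarrow>map pr \<Psi>. (L2_inner Om u v)\<^sup>2)"
    define a where "a = (Lp_norm Om 2 u)\<^sup>2"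
    define P where "P = Lp_norm Om p u powr p"
    have "(\<Sum>\<psi>\<leftarrow>\<Psi>. (L2_inner Om u \<psi>)\<^sup>2) \<le> (\<Sum>\<psi>\<leftarrow>\<Psi>. 2 * (L2_inner Om u (pr \<psi>))\<^sup>2 + 2 * \<eta>\<^sup>2 * a)"
    proof (rule sum_list_mono)
      fix \<psi> assume "\<psi> \<in> set \<Psi>"
      from pr(2)[OF this u(1)]
      have "\<bar>L2_inner Om u \<psi>\<bar>\<^sup>2 \<le> (\<bar>L2_inner Om u (pr \<psi>)\<bar> + \<eta> * Lp_norm Om 2 u)\<^sup>2"
        by (intro power_mono) auto
      also have "\<dots> \<le> 2 * \<bar>L2_inner Om u (pr \<psi>)\<bar>\<^sup>2 + 2 * (\<eta> * Lp_norm Om 2 u)\<^sup>2"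
        using zero_le_power2[of "\<bar>L2_inner Om u (pr \<psi>)\<bar> - \<eta> * Lp_norm Om 2 u"] unfolding power2_sum power2_diff by simp
      finally show "(L2_inner Om u \<psi>)\<^sup>2 \<le> 2 * (L2_inner Om u (pr \<psi>))\<^sup>2 + 2 * \<eta>\<^sup>2 * a"
        by (simp add: a_def power_mult_distrib)
    qed
    also have "\<dots> = 2 * S + n * (2 * \<eta>\<^sup>2 * a)"
      by (simp add: sum_list_addf sum_list_const_mult sum_list_triv S_def n_def o_def)
    finally have "C1 * (\<Sum>\<psi>\<leftarrow>\<Psi>. (L2_inner Om u \<psi>)\<^sup>2) \<le> C1 * (2 * S + n * (2 * \<eta>\<^sup>2 * a))"
      using \<Psi>(2) by (intro mult_left_mono)
    also have "\<dots> = 2 * C1 * S + C1 * (2 * n * \<eta>\<^sup>2) * a" by (simp add: algebra_simps)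
    also have "\<dots> \<le> 2 * C1 * S + e * a" using C1\<eta> by (intro add_left_mono mult_right_mono) (auto simp: a_def)
    finally have 1: "(Lp_norm Om 2 (\<lambda>x. \<phi> x *\<^sub>R u x))\<^sup>2 \<le> e * ((V_norm rot Om u)\<^sup>2 + a) + 2 * C1 * S + e * a"
      using est[OF u(2)] unfolding a_def by linarith
    note Iu = Lp2_integrable[OF uL(1)] and Ip = Lp_integrable[OF uL(2)]
    have I\<phi>: "integrable \<Omega> (\<lambda>x. 1 - (\<phi> x)\<^sup>2)"
      by (rule Bochner_Integration.integrable_bound[OF integrable_const_Om[of 1]]) (use \<phi>2 in \<open>auto intro!: AE_I2 simp: abs_le_iff add_increasing2\<close>)
    have I1: "integrable \<Omega> (\<lambda>x. (\<phi> x)\<^sup>2 * (norm (u x))\<^sup>2)"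
      by (rule Bochner_Integration.integrable_bound[OF Iu]) (use \<phi>2 in \<open>auto intro!: AE_I2 mult_left_le_one_le\<close>)
    have I2: "integrable \<Omega> (\<lambda>x. (1 - (\<phi> x)\<^sup>2) * (norm (u x))\<^sup>2)"
      using Bochner_Integration.integrable_diff[OF Iu I1] by (simp add: left_diff_distrib)
    have "a = (LINT x|\<Omega>. (\<phi> x)\<^sup>2 * (norm (u x))\<^sup>2 + (1 - (\<phi> x)\<^sup>2) * (norm (u x))\<^sup>2)"
      unfolding a_def Lp_norm_square by (simp add: left_diff_distrib)
    also have "\<dots> = (LINT x|\<Omega>. (\<phi> x)\<^sup>2 * (norm (u x))\<^sup>2) + (LINT x|\<Omega>. (1 - (\<phi> x)\<^sup>2) * (norm (u x))\<^sup>2)"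
      by (rule Bochner_Integration.integral_add[OF I1 I2])
    also have "(LINT x|\<Omega>. (\<phi> x)\<^sup>2 * (norm (u x))\<^sup>2) = (Lp_norm Om 2 (\<lambda>x. \<phi> x *\<^sub>R u x))\<^sup>2"
      unfolding Lp_norm_square by (simp add: power_mult_distrib)
    also have "(LINT x|\<Omega>. (1 - (\<phi> x)\<^sup>2) * (norm (u x))\<^sup>2) \<le> (LINT x|\<Omega>. e * norm (u x) powr p + c * (1 - (\<phi> x)\<^sup>2))"
    proof (rule integral_mono[OF I2])
      show "integrable \<Omega> (\<lambda>x. e * norm (u x) powr p + c * (1 - (\<phi> x)\<^sup>2))" using Ip I\<phi> by auto
      fix x
      have "(1 - (\<phi> x)\<^sup>2) * (norm (u x))\<^sup>2 \<le> (1 - (\<phi> x)\<^sup>2) * (e * norm (u x) powr p + c)"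
        using c(2)[of "norm (u x)"] \<phi>2[of x] by (intro mult_left_mono) auto
      also have "\<dots> = (1 - (\<phi> x)\<^sup>2) * (e * norm (u x) powr p) + c * (1 - (\<phi> x)\<^sup>2)" by (simp add: algebra_simps)
      also have "(1 - (\<phi> x)\<^sup>2) * (e * norm (u x) powr p) \<le> e * norm (u x) powr p"
        using \<phi>2[of x] e by (intro mult_left_le_one_le) auto
      finally show "(1 - (\<phi> x)\<^sup>2) * (norm (u x))\<^sup>2 \<le> e * norm (u x) powr p + c * (1 - (\<phi> x)\<^sup>2)" by simp
    qed
    also have "\<dots> = e * P + c * (LINT x|\<Omega>. 1 - (\<phi> x)\<^sup>2)"
      using Ip I\<phi> p Lp_norm_powr[of p u] by (subst Bochner_Integration.integral_add) (auto simp: P_def)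
    also have "\<dots> \<le> e * P + e"
    proof -
      have "c * (LINT x|\<Omega>. 1 - (\<phi> x)\<^sup>2) \<le> c * (e / (c + 1))" using \<phi>(4) c by (intro mult_left_mono) auto
      also have "\<dots> \<le> e" using c e by (simp add: field_simps)
      finally show ?thesis by simp
    qed
    finally have "a \<le> e * (V_norm rot Om u)\<^sup>2 + 2 * (e * a) + 2 * C1 * S + e * P + e"
      using 1 by (simp add: algebra_simps)
    moreover have "e * a \<le> 1/4 * a" using e by (intro mult_right_mono) (auto simp: a_def)
    ultimately have "a \<le> 2 * e * (1 + (V_norm rot Om u)\<^sup>2 + P) + 4 * C1 * S" by (simp add: algebra_simps)
    also have "\<dots> \<le> \<epsilon> * (1 + (V_norm rot Om u)\<^sup>2 + P) + 4 * C1 * S"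
      using e(2) by (intro add_right_mono mult_right_mono) (auto simp: P_def)
    finally show "(Lp_norm Om 2 u)\<^sup>2 \<le> \<epsilon> * (1 + (V_norm rot Om u)\<^sup>2 + Lp_norm Om p u powr p) + 4 * C1 * (\<Sum>v\<leftarrow>map pr \<Psi>. (L2_inner Om u v)\<^sup>2)"
      by (simp add: a_def P_def S_def)
  qed
qed

end

section \<open>The operator\<close>

text \<open>The power lies above its tangent at \<open>x\<close>; the weighted mean inequality gives
  this including the case \<open>y = 0\<close>.\<close>

lemma powr_diff_le:
  fixes x y q :: real
  assumes "1 < q" "0 \<le> y" "y \<le> x"
  shows "x powr q - y powr q \<le> q * x powr (q - 1) * (x - y)"
proof (cases "x = 0")
  case False
  then have x: "x > 0" using assms by simp
  have "(y powr q) powr (1/q) * (x powr q) powr ((q - 1)/q) \<le> 1/q * y powr q + (q - 1)/q * x powr q"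
    using assms by (intro weighted_am_gm) (auto simp: field_simps)
  then have "y * x powr (q - 1) \<le> 1/q * y powr q + (q - 1)/q * x powr q"
    using assms x by (simp add: powr_powr)
  then have "q * (y * x powr (q - 1)) \<le> q * (1/q * y powr q + (q - 1)/q * x powr q)"
    using assms by (intro mult_left_mono) auto
  also have "\<dots> = y powr q + (q - 1) * x powr q" using assms by (simp add: field_simps)
  also have "x powr q = x * x powr (q - 1)" using x by (simp add: powr_mult_base)
  finally have "q * (y * x powr (q - 1)) \<le> y powr q + (q - 1) * (x * x powr (q - 1))" .
  then show ?thesis using powr_mult_base[of x "q - 1"] x by (simp add: algebra_simps)
qed (use assms in auto)

text \<open>By symmetry the longer vector may be called \<open>a\<close>. The difference of the
  weights is bounded by \<open>powr_diff_le\<close> with exponent \<open>r - 1\<close>, which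
  exceeds 1, and \<open>norm b \<le> norm a\<close> restores the power that is lost there.\<close>

lemma power_field_Lipschitz:
  fixes a b :: "'a::real_inner"
  assumes r: "2 < r"
  shows "norm (norm a powr (r - 1) *\<^sub>R a - norm b powr (r - 1) *\<^sub>R b) \<le> r * (norm a + norm b) powr (r - 1) * norm (a - b)"
proof -
  have main: "norm (norm a powr (r - 1) *\<^sub>R a - norm b powr (r - 1) *\<^sub>R b) \<le> r * (norm a + norm b) powr (r - 1) * norm (a - b)"
    if le: "norm b \<le> norm a" for a b :: 'a
  proof -
    have "norm a powr (r - 1) *\<^sub>R a - norm b powr (r - 1) *\<^sub>R b
       = norm a powr (r - 1) *\<^sub>R (a - b) + (norm a powr (r - 1) - norm b powr (r - 1)) *\<^sub>R b"
      by (simp add: algebra_simps)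
    then have "norm (norm a powr (r - 1) *\<^sub>R a - norm b powr (r - 1) *\<^sub>R b)
       \<le> norm a powr (r - 1) * norm (a - b) + \<bar>norm a powr (r - 1) - norm b powr (r - 1)\<bar> * norm b"
      using norm_triangle_ineq[of "norm a powr (r - 1) *\<^sub>R (a - b)" "(norm a powr (r - 1) - norm b powr (r - 1)) *\<^sub>R b"]
      by simp
    also have "\<bar>norm a powr (r - 1) - norm b powr (r - 1)\<bar> = norm a powr (r - 1) - norm b powr (r - 1)"
      using le r by (simp add: powr_mono2)
    also have "(norm a powr (r - 1) - norm b powr (r - 1)) * norm b \<le> ((r - 1) * norm a powr (r - 1 - 1) * (norm a - norm b)) * norm a"
      using powr_diff_le[of "r - 1" "norm b" "norm a"] r le by (intro mult_mono) auto
    also have "\<dots> = (r - 1) * norm a powr (r - 1) * (norm a - norm b)"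
    proof -
      have e: "norm a powr (r - 1) = norm a * norm a powr (r - 1 - 1)"
        using powr_mult_base[of "norm a" "r - 1 - 1"] by simp
      show ?thesis unfolding e by (simp only: ac_simps)
    qed
    also have "\<dots> \<le> (r - 1) * norm a powr (r - 1) * norm (a - b)"
      using r norm_triangle_ineq2[of a b] by (intro mult_left_mono) auto
    finally have "norm (norm a powr (r - 1) *\<^sub>R a - norm b powr (r - 1) *\<^sub>R b) \<le> r * norm a powr (r - 1) * norm (a - b)"
      by (simp add: algebra_simps)
    also have "\<dots> \<le> r * (norm a + norm b) powr (r - 1) * norm (a - b)"
      using r by (intro mult_right_mono mult_left_mono powr_mono2) auto
    finally show ?thesis .
  qed
  show ?thesis
    using main[of b a] main[of a b] by (cases "norm b \<le> norm a") (auto simp: norm_minus_commute add.commute)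
qed

text \<open>With \<open>x\<close> and \<open>y\<close> the weights of \<open>a\<close> and
  \<open>b\<close>, the product is exactly the right hand side plus
  \<open>(x - y) * ((norm a)\<^sup>2 - (norm b)\<^sup>2) / 2\<close>, whose two differences have the
  same sign.\<close>

lemma power_field_monotone:
  fixes a b :: "'a::real_inner"
  assumes r: "1 < r"
  shows "(norm a powr (r - 1) *\<^sub>R a - norm b powr (r - 1) *\<^sub>R b) \<bullet> (a - b)
     \<ge> (norm a powr (r - 1) + norm b powr (r - 1)) / 2 * (norm (a - b))\<^sup>2"
proof -
  define x where "x = norm a powr (r - 1)"
  define y where "y = norm b powr (r - 1)"
  have eq: "(x *\<^sub>R a - y *\<^sub>R b) \<bullet> (a - b) = (x + y) / 2 * (norm (a - b))\<^sup>2 + (x - y) * ((norm a)\<^sup>2 - (norm b)\<^sup>2) / 2"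
    unfolding power2_norm_eq_inner by (simp add: inner_diff_left inner_diff_right inner_commute algebra_simps) (simp add: field_simps)
  have "0 \<le> (x - y) * ((norm a)\<^sup>2 - (norm b)\<^sup>2)"
  proof (cases "norm a \<le> norm b")
    case True
    then show ?thesis using r by (intro mult_nonpos_nonpos) (auto simp: x_def y_def powr_mono2 power_mono)
  next
    case False
    then show ?thesis using r by (intro mult_nonneg_nonneg) (auto simp: x_def y_def powr_mono2 power_mono)
  qed
  then show ?thesis using eq by (simp add: x_def y_def)
qed

locale cbf_operator = curl_domain Om rot cr
  for Om :: "(real^'n) set" and rot :: "real^'n^'n \<Rightarrow> 'c::euclidean_space" and cr +
  fixes T r \<mu> \<alpha> \<beta> :: real
  assumes T: "T > 0" and r: "r > 3" and \<mu>: "\<mu> > 0" and \<alpha>: "\<alpha> > 0" and \<beta>: "\<beta> > 0"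
begin

abbreviation "V \<equiv> V_space Om"
abbreviation "NV \<equiv> V_norm rot Om"
abbreviation "L \<equiv> LM_space Om (r + 1)"
abbreviation "NL \<equiv> (Lp_norm Om (r + 1) :: (real^'n \<Rightarrow> real^'n) \<Rightarrow> real)"
abbreviation "F \<equiv> F_op rot cr Om r \<mu> \<alpha> \<beta>"

lemma NL_nonneg: "0 \<le> NL u" and NV_nonneg: "0 \<le> NV u"
  by (simp_all add: Lp_norm_nonneg V_norm_def)

sublocale VS: seminormed_space V NV by (rule seminormed_V)
sublocale LS: seminormed_space L NL using r by (intro seminormed_LM) simp

lemma L_L2: "u \<in> L \<Longrightarrow> u \<in> Lp_space Om 2"
  using Lp_embed(1)[of 2 "r + 1" u] LM_Lp r by auto

lemma curl_V_L2: "u \<in> V \<Longrightarrow> curl rot Om u \<in> Lp_space Om 2"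
  using curl_L2(1) V_H1 by blast

text \<open>The damping provides half of \<open>norm a powr (r - 1) + norm b powr (r - 1)\<close>
  times the squared difference. A quarter of the power of \<open>norm b\<close> is granted to the
  convection; a quarter of the sum remains, and the sum is at least
  \<open>(1/2 * norm (a - b)) powr (r - 1)\<close>.\<close>

definition damping_const :: real where
  "damping_const = 1 / 4 * (1 / 2) powr (r - 1)"

lemma damping_const_pos: "damping_const > 0"
  by (simp add: damping_const_def)

text \<open>Since \<open>r > 3\<close>, the term \<open>|b|\<^sup>2 |a - b|\<^sup>2\<close> produced by the convection is dominated by a
  fraction of the damping, up to a multiple of \<open>|a - b|\<^sup>2\<close>.\<close>

lemma pointwise_monotone:
  obtains \<kappa> where "0 \<le> \<kappa>" "\<And>ca cb a b.
    \<mu> * ((ca - cb) \<bullet> (ca - cb)) + (cr ca a - cr cb b) \<bullet> (a - b) + \<alpha> * ((a - b) \<bullet> (a - b))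
      + \<beta> * ((norm a powr (r - 1) *\<^sub>R a - norm b powr (r - 1) *\<^sub>R b) \<bullet> (a - b))
    \<ge> \<mu> / 2 * (norm (ca - cb))\<^sup>2 + \<beta> * damping_const * norm (a - b) powr (r + 1) - \<kappa> * (norm (a - b))\<^sup>2"
proof -
  \<comment> \<open>After division by \<open>2 * \<mu>\<close> this fraction becomes
    \<open>\<beta> / 4\<close>, the share of the damping granted to the convection.\<close>
  have d: "\<mu> * \<beta> / 2 > 0" using \<mu> \<beta> by simp
  have r2: "2 < r - 1" using r by simp
  obtain c where c: "0 \<le> c" "\<And>s. 0 \<le> s \<Longrightarrow> s\<^sup>2 \<le> \<mu> * \<beta> / 2 * s powr (r - 1) + c"
    by (rule square_le_powr[OF r2 d]) (rule that)
  show ?thesis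
  proof (rule that[of "c / (2 * \<mu>)"])
    show "0 \<le> c / (2 * \<mu>)" using c \<mu> by simp
    fix ca cb :: 'c and a b :: "real^'n"
    interpret cr: bounded_bilinear cr by (rule bilinear_cr)
    define w where "w = norm (a - b)"
    define k where "k = norm (ca - cb)"
    have wk: "w \<ge> 0" "k \<ge> 0" by (auto simp: w_def k_def)
    \<comment> \<open>As \<open>cr ca (a - b)\<close> is orthogonal to \<open>a - b\<close>, only
      the difference of the curls survives, next to a single undifferenced factor
      \<open>b\<close>.\<close>
    have "(cr ca a - cr cb b) \<bullet> (a - b) = cr ca (a - b) \<bullet> (a - b) + cr (ca - cb) b \<bullet> (a - b)"
      by (simp add: cr.diff_left cr.diff_right inner_diff_left)
    also have "cr ca (a - b) \<bullet> (a - b) = 0" by (rule cr_orthogonal)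
    finally have conv: "(cr ca a - cr cb b) \<bullet> (a - b) = cr (ca - cb) b \<bullet> (a - b)" by simp
    have "\<bar>cr (ca - cb) b \<bullet> (a - b)\<bar> \<le> norm (cr (ca - cb) b) * w"
      unfolding w_def by (rule Cauchy_Schwarz_ineq2)
    also have "\<dots> \<le> k * norm b * w" using norm_cr[of "ca - cb" b] wk by (intro mult_right_mono) (auto simp: k_def)
    also have "\<dots> \<le> \<mu> / 2 * k\<^sup>2 + (norm b)\<^sup>2 * w\<^sup>2 / (2 * \<mu>)"
    proof -
      have "0 \<le> (\<mu> * k - norm b * w)\<^sup>2" by simp
      then have "2 * \<mu> * (k * norm b * w) \<le> \<mu>\<^sup>2 * k\<^sup>2 + (norm b)\<^sup>2 * w\<^sup>2"
        by (simp add: power2_diff power_mult_distrib algebra_simps)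
      then have "(2 * \<mu> * (k * norm b * w)) / (2 * \<mu>) \<le> (\<mu>\<^sup>2 * k\<^sup>2 + (norm b)\<^sup>2 * w\<^sup>2) / (2 * \<mu>)"
        using \<mu> by (intro divide_right_mono) auto
      then show ?thesis using \<mu> by (simp add: add_divide_distrib power2_eq_square)
    qed
    also have "(norm b)\<^sup>2 * w\<^sup>2 / (2 * \<mu>) \<le> (\<mu> * \<beta> / 2 * norm b powr (r - 1) + c) * w\<^sup>2 / (2 * \<mu>)"
      using c(2)[of "norm b"] \<mu> by (intro divide_right_mono mult_right_mono) auto
    also have "\<dots> = \<beta> / 4 * norm b powr (r - 1) * w\<^sup>2 + c / (2 * \<mu>) * w\<^sup>2"
      using \<mu> by (simp add: field_simps)
    finally have B: "(cr ca a - cr cb b) \<bullet> (a - b) \<ge> - (\<mu> / 2 * k\<^sup>2) - \<beta> / 4 * norm b powr (r - 1) * w\<^sup>2 - c / (2 * \<mu>) * w\<^sup>2"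
      unfolding conv by linarith
    \<comment> \<open>The longer of two vectors has at least half the length of their
      difference.\<close>
    have mx: "(1/2) powr (r - 1) * w powr (r - 1) \<le> norm a powr (r - 1) + norm b powr (r - 1)"
    proof -
      have "w \<le> 2 * max (norm a) (norm b)" unfolding w_def using norm_triangle_ineq4[of a b] by simp
      then have "(1/2 * w) powr (r - 1) \<le> (max (norm a) (norm b)) powr (r - 1)"
        using r wk by (intro powr_mono2) auto
      also have "\<dots> \<le> norm a powr (r - 1) + norm b powr (r - 1)" by (auto simp: max_def)
      finally show ?thesis using powr_mult[of "1/2" w "r - 1"] wk by simp
    qed
    have ww: "w powr (r - 1) * w\<^sup>2 = w powr (r + 1)"
    proof (cases "w = 0")
      case False
      then have "w > 0" using wk by simp
      then have sq: "w\<^sup>2 = w powr 2" by (simp add: powr_numeral)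
      show ?thesis unfolding sq powr_add[symmetric] by (simp add: algebra_simps)
    qed simp
    have "\<beta> * ((norm a powr (r - 1) *\<^sub>R a - norm b powr (r - 1) *\<^sub>R b) \<bullet> (a - b)) \<ge> \<beta> * ((norm a powr (r - 1) + norm b powr (r - 1)) / 2 * w\<^sup>2)"
      unfolding w_def using power_field_monotone[of r a b] r \<beta> by (intro mult_left_mono) auto
    moreover have "\<beta> * ((norm a powr (r - 1) + norm b powr (r - 1)) / 2 * w\<^sup>2)
        \<ge> \<beta> / 4 * norm b powr (r - 1) * w\<^sup>2 + \<beta> * damping_const * w powr (r + 1)"
    proof -
      have "\<beta> / 4 * norm b powr (r - 1) * w\<^sup>2 + \<beta> * damping_const * w powr (r + 1)
          = \<beta> * w\<^sup>2 / 4 * (norm b powr (r - 1) + (1/2) powr (r - 1) * w powr (r - 1))"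
        unfolding ww[symmetric] damping_const_def by (simp add: field_simps)
      also have "\<dots> \<le> \<beta> * w\<^sup>2 / 4 * (2 * (norm a powr (r - 1) + norm b powr (r - 1)))"
      proof (rule mult_left_mono)
        have "y + x \<le> 2 * (a' + y)" if "x \<le> a' + y" "0 \<le> a'" for x y a' :: real
          using that by simp
        from this[OF mx powr_ge_zero]
        show "norm b powr (r - 1) + (1/2) powr (r - 1) * w powr (r - 1) \<le> 2 * (norm a powr (r - 1) + norm b powr (r - 1))" .
        show "0 \<le> \<beta> * w\<^sup>2 / 4" using \<beta> by simp
      qed
      finally show ?thesis by (simp add: field_simps)
    qed
    moreover have "\<mu> * ((ca - cb) \<bullet> (ca - cb)) = \<mu> * k\<^sup>2" by (simp add: k_def power2_norm_eq_inner)
    moreover have "0 \<le> \<alpha> * ((a - b) \<bullet> (a - b))" using \<alpha> by simp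
    ultimately show "\<mu> * ((ca - cb) \<bullet> (ca - cb)) + (cr ca a - cr cb b) \<bullet> (a - b) + \<alpha> * ((a - b) \<bullet> (a - b))
      + \<beta> * ((norm a powr (r - 1) *\<^sub>R a - norm b powr (r - 1) *\<^sub>R b) \<bullet> (a - b))
    \<ge> \<mu> / 2 * (norm (ca - cb))\<^sup>2 + \<beta> * damping_const * norm (a - b) powr (r + 1) - c / (2 * \<mu>) * (norm (a - b))\<^sup>2"
      using B unfolding w_def[symmetric] k_def[symmetric] by linarith
  qed
qed

text \<open>The convection as a trilinear form: the field whose curl is taken and the field it
  multiplies are separate, the first ranging over \<open>V\<close> and the second over
  \<open>L\<close>. The diagonal \<open>B3 u u w\<close> is \<open>B_op\<close>.\<close>

definition B3 :: "(real^'n \<Rightarrow> real^'n) \<Rightarrow> (real^'n \<Rightarrow> real^'n) \<Rightarrow> (real^'n \<Rightarrow> real^'n) \<Rightarrow> real" where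
  "B3 u v w = (LINT x|\<Omega>. cr (curl rot Om u x) (v x) \<bullet> w x)"

text \<open>\<open>2 * (r + 1) / (r - 1)\<close> is the exponent that completes 2 and
  \<open>r + 1\<close> in Hoelder's inequality. It lies below \<open>r + 1\<close> exactly for
  \<open>r > 3\<close>.\<close>

definition Kt :: real where "Kt = embed_const (2 * (r + 1) / (r - 1)) (r + 1)"

lemma Kt_nonneg: "0 \<le> Kt"
  by (simp add: Kt_def embed_const_def)

lemma Holder_2_p_p:
  fixes c :: "real^'n \<Rightarrow> 'b::euclidean_space"
  assumes c: "c \<in> Lp_space Om 2" and v: "v \<in> L" and w: "w \<in> L"
  shows "integrable \<Omega> (\<lambda>x. norm (c x) * norm (v x) * norm (w x))"
    and "(LINT x|\<Omega>. norm (c x) * norm (v x) * norm (w x)) \<le> Kt * Lp_norm Om 2 c * NL v * NL w"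
proof -
  define s where "s = 2 * (r + 1) / (r - 1)"
  have "2 * (r + 1) < (r - 1) * (r + 1)" using r by (intro mult_strict_right_mono) auto
  then have s: "0 < s" "s < r + 1" using r by (auto simp: s_def pos_divide_less_eq mult.commute)
  have "1 / s = (r - 1) / (2 * (r + 1))" by (simp add: s_def)
  moreover have "r + 1 \<noteq> 0" using r by simp
  ultimately have ex: "1 / 2 + 1 / (r + 1) + 1 / s = 1" by (simp add: field_simps)
  note E = Lp_embed[OF s LM_Lp[OF w]]
  note H = Holder3_Lp[OF _ _ _ ex c LM_Lp[OF v] E(1)]
  show "integrable \<Omega> (\<lambda>x. norm (c x) * norm (v x) * norm (w x))" using H(1) r s by simp
  have "(LINT x|\<Omega>. norm (c x) * norm (v x) * norm (w x)) \<le> Lp_norm Om 2 c * NL v * Lp_norm Om s w"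
    using H(2) r s by simp
  also have "\<dots> \<le> Lp_norm Om 2 c * NL v * (Kt * NL w)"
    using E(2) unfolding Kt_def s_def by (intro mult_left_mono mult_nonneg_nonneg Lp_norm_nonneg) auto
  finally show "(LINT x|\<Omega>. norm (c x) * norm (v x) * norm (w x)) \<le> Kt * Lp_norm Om 2 c * NL v * NL w"
    by (simp add: ac_simps)
qed

lemma cr_measurable:
  assumes "c \<in> borel_measurable \<Omega>" "v \<in> borel_measurable \<Omega>"
  shows "(\<lambda>x. cr (c x) (v x)) \<in> borel_measurable \<Omega>"
proof -
  have "continuous_on UNIV (\<lambda>z. cr (fst z) (snd z))"
    by (intro bounded_bilinear.continuous_on[OF bilinear_cr] continuous_intros)
  then have "(\<lambda>z. cr (fst z) (snd z)) \<in> borel_measurable borel" by (rule borel_measurable_continuous_onI)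
  from measurable_compose[OF borel_measurable_Pair[OF assms] this] show ?thesis by simp
qed

lemma B3_integrable:
  assumes u: "u \<in> V" and v: "v \<in> L" and w: "w \<in> L"
  shows "integrable \<Omega> (\<lambda>x. cr (curl rot Om u x) (v x) \<bullet> w x)"
proof (rule Bochner_Integration.integrable_bound[OF Holder_2_p_p(1)[OF curl_V_L2[OF u] v w]])
  show "(\<lambda>x. cr (curl rot Om u x) (v x) \<bullet> w x) \<in> borel_measurable \<Omega>"
    by (intro borel_measurable_inner cr_measurable Lp_measurable[OF curl_V_L2[OF u]] Lp_measurable[OF LM_Lp[OF v]] Lp_measurable[OF LM_Lp[OF w]])
  show "AE x in \<Omega>. norm (cr (curl rot Om u x) (v x) \<bullet> w x) \<le> norm (norm (curl rot Om u x) * norm (v x) * norm (w x))"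
  proof (rule AE_I2)
    fix x
    have "\<bar>cr (curl rot Om u x) (v x) \<bullet> w x\<bar> \<le> norm (cr (curl rot Om u x) (v x)) * norm (w x)"
      by (rule Cauchy_Schwarz_ineq2)
    also have "\<dots> \<le> norm (curl rot Om u x) * norm (v x) * norm (w x)"
      using norm_cr by (intro mult_right_mono) auto
    finally show "norm (cr (curl rot Om u x) (v x) \<bullet> w x) \<le> norm (norm (curl rot Om u x) * norm (v x) * norm (w x))" by simp
  qed
qed

lemma B3_bound:
  assumes u: "u \<in> V" and v: "v \<in> L" and w: "w \<in> L"
  shows "\<bar>B3 u v w\<bar> \<le> Kt * NV u * NL v * NL w"
proof -
  have "\<bar>B3 u v w\<bar> \<le> (LINT x|\<Omega>. \<bar>cr (curl rot Om u x) (v x) \<bullet> w x\<bar>)"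
    unfolding B3_def by (rule integral_abs_bound)
  also have "\<dots> \<le> (LINT x|\<Omega>. norm (curl rot Om u x) * norm (v x) * norm (w x))"
  proof (rule integral_mono)
    show "integrable \<Omega> (\<lambda>x. \<bar>cr (curl rot Om u x) (v x) \<bullet> w x\<bar>)" using B3_integrable[OF assms] by simp
    show "integrable \<Omega> (\<lambda>x. norm (curl rot Om u x) * norm (v x) * norm (w x))" by (rule Holder_2_p_p(1)[OF curl_V_L2[OF u] v w])
    fix x
    have "\<bar>cr (curl rot Om u x) (v x) \<bullet> w x\<bar> \<le> norm (cr (curl rot Om u x) (v x)) * norm (w x)"
      by (rule Cauchy_Schwarz_ineq2)
    also have "\<dots> \<le> norm (curl rot Om u x) * norm (v x) * norm (w x)"
      using norm_cr by (intro mult_right_mono) auto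
    finally show "\<bar>cr (curl rot Om u x) (v x) \<bullet> w x\<bar> \<le> norm (curl rot Om u x) * norm (v x) * norm (w x)" .
  qed
  also have "\<dots> \<le> Kt * NV u * NL v * NL w"
    using Holder_2_p_p(2)[OF curl_V_L2[OF u] v w] by (simp add: V_norm_def)
  finally show ?thesis .
qed

lemma B3_linear3:
  assumes "u \<in> V" "v \<in> L" "w \<in> L" "w' \<in> L"
  shows "B3 u v (a *\<^sub>R w + b *\<^sub>R w') = a * B3 u v w + b * B3 u v w'"
  using B3_integrable[OF assms(1,2,3)] B3_integrable[OF assms(1,2,4)]
  by (simp add: B3_def inner_add_right)

lemma B3_linear2:
  assumes "u \<in> V" "v \<in> L" "v' \<in> L" "w \<in> L"
  shows "B3 u (a *\<^sub>R v + b *\<^sub>R v') w = a * B3 u v w + b * B3 u v' w"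
proof -
  interpret cr: bounded_bilinear cr by (rule bilinear_cr)
  show ?thesis
    using B3_integrable[OF assms(1,2,4)] B3_integrable[OF assms(1,3,4)]
    by (simp add: B3_def cr.add_right cr.scaleR_right inner_add_left)
qed

lemma B3_linear1:
  assumes u: "u \<in> V" "u' \<in> V" and v: "v \<in> L" and w: "w \<in> L"
  shows "B3 (a *\<^sub>R u + b *\<^sub>R u') v w = a * B3 u v w + b * B3 u' v w"
proof -
  interpret cr: bounded_bilinear cr by (rule bilinear_cr)
  have uu: "a *\<^sub>R u + b *\<^sub>R u' \<in> V" using u by (intro VS.add_mem VS.scale_mem)
  have "B3 (a *\<^sub>R u + b *\<^sub>R u') v w = (LINT x|\<Omega>. a * (cr (curl rot Om u x) (v x) \<bullet> w x) + b * (cr (curl rot Om u' x) (v x) \<bullet> w x))"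
    unfolding B3_def
  proof (rule integral_cong_AE)
    show "(\<lambda>x. cr (curl rot Om (a *\<^sub>R u + b *\<^sub>R u') x) (v x) \<bullet> w x) \<in> borel_measurable \<Omega>"
      using B3_integrable[OF uu v w] by auto
    show "(\<lambda>x. a * (cr (curl rot Om u x) (v x) \<bullet> w x) + b * (cr (curl rot Om u' x) (v x) \<bullet> w x)) \<in> borel_measurable \<Omega>"
      using B3_integrable[OF u(1) v w] B3_integrable[OF u(2) v w] by auto
    show "AE x in \<Omega>. cr (curl rot Om (a *\<^sub>R u + b *\<^sub>R u') x) (v x) \<bullet> w x = a * (cr (curl rot Om u x) (v x) \<bullet> w x) + b * (cr (curl rot Om u' x) (v x) \<bullet> w x)"
      using curl_lincomb[OF V_H1[OF u(1)] V_H1[OF u(2)], of a b]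
      by eventually_elim (simp add: cr.add_left cr.scaleR_left inner_add_left)
  qed
  also have "\<dots> = a * B3 u v w + b * B3 u' v w"
    using B3_integrable[OF u(1) v w] B3_integrable[OF u(2) v w] by (simp add: B3_def)
  finally show ?thesis .
qed

text \<open>Hoelder with exponents \<open>(r + 1) / (r - 1)\<close>, \<open>r + 1\<close> and
  \<open>r + 1\<close>; the first norm of \<open>s powr (r - 1)\<close> is a power of the
  \<open>r + 1\<close> norm of \<open>s\<close>.\<close>

lemma Holder_power:
  fixes s :: "real^'n \<Rightarrow> real" and d w :: "real^'n \<Rightarrow> real^'n"
  assumes s: "s \<in> Lp_space Om (r + 1)" "\<And>x. 0 \<le> s x" and d: "d \<in> Lp_space Om (r + 1)" and w: "w \<in> Lp_space Om (r + 1)"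
  shows "integrable \<Omega> (\<lambda>x. s x powr (r - 1) * norm (d x) * norm (w x))"
    and "(LINT x|\<Omega>. s x powr (r - 1) * norm (d x) * norm (w x)) \<le> Lp_norm Om (r + 1) s powr (r - 1) * NL d * NL w"
proof -
  define q where "q = (r + 1) / (r - 1)"
  have q: "q > 0" "(r - 1) * q = r + 1" using r by (auto simp: q_def)
  have eq: "norm (s x powr (r - 1)) powr q = norm (s x) powr (r + 1)" for x
    using s(2) q by (simp add: powr_powr)
  have sL: "(\<lambda>x. s x powr (r - 1)) \<in> Lp_space Om q"
  proof -
    have "(\<lambda>x. s x powr (r - 1)) \<in> borel_measurable \<Omega>" using Lp_measurable[OF s(1)] by measurable
    then show ?thesis using Lp_integrable[OF s(1)] unfolding Lp_space_def mem_Collect_eq eq by blast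
  qed
  have sn: "Lp_norm Om q (\<lambda>x. s x powr (r - 1)) = Lp_norm Om (r + 1) s powr (r - 1)"
    unfolding Lp_norm_def eq using r q by (simp add: powr_powr q_def)
  have ex: "1 / q + 1 / (r + 1) + 1 / (r + 1) = 1" using r by (simp add: q_def field_simps)
  note H = Holder3_Lp[OF q(1) _ _ ex sL d w]
  show "integrable \<Omega> (\<lambda>x. s x powr (r - 1) * norm (d x) * norm (w x))"
    using H(1) r by simp
  show "(LINT x|\<Omega>. s x powr (r - 1) * norm (d x) * norm (w x)) \<le> Lp_norm Om (r + 1) s powr (r - 1) * NL d * NL w"
    using H(2) r unfolding sn by simp
qed

lemma C_op_measurable: "v \<in> L \<Longrightarrow> C_op r v \<in> borel_measurable \<Omega>"
  unfolding C_op_def using Lp_measurable[OF LM_Lp] by measurable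

lemma C_op_integrable:
  assumes v: "v \<in> L" and w: "w \<in> L"
  shows "integrable \<Omega> (\<lambda>x. C_op r v x \<bullet> w x)"
    and "\<bar>L2_inner Om (C_op r v) w\<bar> \<le> NL v powr r * NL w"
proof -
  have nv: "(\<lambda>x. norm (v x)) \<in> Lp_space Om (r + 1)"
    using Lp_measurable[OF LM_Lp[OF v]] Lp_integrable[OF LM_Lp[OF v]] by (simp add: Lp_space_def)
  note H = Holder_power[OF nv norm_ge_zero LM_Lp[OF v] LM_Lp[OF w]]
  have pw: "\<bar>C_op r v x \<bullet> w x\<bar> \<le> norm (v x) powr (r - 1) * norm (v x) * norm (w x)" for x
    using Cauchy_Schwarz_ineq2[of "C_op r v x" "w x"] by (simp add: C_op_def)
  show I: "integrable \<Omega> (\<lambda>x. C_op r v x \<bullet> w x)"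
    by (rule Bochner_Integration.integrable_bound[OF H(1)])
       (use C_op_measurable[OF v] Lp_measurable[OF LM_Lp[OF w]] pw in \<open>auto intro!: AE_I2 simp: abs_mult\<close>)
  have "\<bar>L2_inner Om (C_op r v) w\<bar> \<le> (LINT x|\<Omega>. \<bar>C_op r v x \<bullet> w x\<bar>)"
    unfolding L2_inner_def by (rule integral_abs_bound)
  also have "\<dots> \<le> (LINT x|\<Omega>. norm (v x) powr (r - 1) * norm (v x) * norm (w x))"
    using I H(1) pw by (intro integral_mono) auto
  also have "\<dots> \<le> NL v powr (r - 1) * NL v * NL w"
    using H(2) by (simp add: Lp_norm_def)
  also have "NL v powr (r - 1) * NL v = NL v powr r"
    using powr_mult_base[OF NL_nonneg, of v "r - 1"] by (simp add: mult.commute)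
  finally show "\<bar>L2_inner Om (C_op r v) w\<bar> \<le> NL v powr r * NL w" .
qed

lemma C_op_Lipschitz:
  assumes v: "v \<in> L" and v': "v' \<in> L" and w: "w \<in> L"
  shows "\<bar>L2_inner Om (C_op r v) w - L2_inner Om (C_op r v') w\<bar> \<le> r * (NL v + NL v') powr (r - 1) * NL (v - v') * NL w"
proof -
  interpret R: seminormed_space "Lp_space Om (r + 1) :: (real^'n \<Rightarrow> real) set" "Lp_norm Om (r + 1)"
    using r by (intro seminormed_Lp) simp
  define nv where "nv = (\<lambda>x. norm (v x))"
  define nv' where "nv' = (\<lambda>x. norm (v' x))"
  have nvL: "nv \<in> Lp_space Om (r + 1)" "nv' \<in> Lp_space Om (r + 1)"
    using Lp_measurable[OF LM_Lp[OF v]] Lp_integrable[OF LM_Lp[OF v]] Lp_measurable[OF LM_Lp[OF v']] Lp_integrable[OF LM_Lp[OF v']]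
    by (simp_all add: Lp_space_def nv_def nv'_def)
  have nn: "0 \<le> (nv + nv') x" for x by (simp add: nv_def nv'_def)
  have s: "Lp_norm Om (r + 1) (nv + nv') \<le> NL v + NL v'"
    using R.triangle[OF nvL] by (simp add: nv_def nv'_def Lp_norm_def)
  have dL: "v - v' \<in> L" using LS.diff_mem v v' .
  note H = Holder_power[OF R.add_mem[OF nvL] nn LM_Lp[OF dL] LM_Lp[OF w]]
  have pw: "\<bar>C_op r v x \<bullet> w x - C_op r v' x \<bullet> w x\<bar> \<le> r * ((nv + nv') x powr (r - 1) * norm ((v - v') x) * norm (w x))" for x
  proof -
    have "\<bar>C_op r v x \<bullet> w x - C_op r v' x \<bullet> w x\<bar> \<le> norm (C_op r v x - C_op r v' x) * norm (w x)"
      unfolding inner_diff_left[symmetric] by (rule Cauchy_Schwarz_ineq2)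
    also have "norm (C_op r v x - C_op r v' x) \<le> r * (norm (v x) + norm (v' x)) powr (r - 1) * norm (v x - v' x)"
      unfolding C_op_def using r by (intro power_field_Lipschitz) simp
    finally show ?thesis by (simp add: nv_def nv'_def mult.assoc mult_right_mono)
  qed
  note I = C_op_integrable(1)[OF v w] C_op_integrable(1)[OF v' w]
  have eq: "L2_inner Om (C_op r v) w - L2_inner Om (C_op r v') w = (LINT x|\<Omega>. C_op r v x \<bullet> w x - C_op r v' x \<bullet> w x)"
    using I by (simp add: L2_inner_def)
  have "\<bar>L2_inner Om (C_op r v) w - L2_inner Om (C_op r v') w\<bar> \<le> (LINT x|\<Omega>. \<bar>C_op r v x \<bullet> w x - C_op r v' x \<bullet> w x\<bar>)"
    unfolding eq by (rule integral_abs_bound)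
  also have "\<dots> \<le> (LINT x|\<Omega>. r * ((nv + nv') x powr (r - 1) * norm ((v - v') x) * norm (w x)))"
    using I H(1) pw by (intro integral_mono) auto
  also have "\<dots> = r * (LINT x|\<Omega>. (nv + nv') x powr (r - 1) * norm ((v - v') x) * norm (w x))"
    by simp
  also have "\<dots> \<le> r * (Lp_norm Om (r + 1) (nv + nv') powr (r - 1) * NL (v - v') * NL w)"
    by (intro mult_left_mono H(2)) (use r in simp)
  also have "\<dots> \<le> r * ((NL v + NL v') powr (r - 1) * NL (v - v') * NL w)"
    using s r by (intro mult_left_mono mult_right_mono powr_mono2 Lp_norm_nonneg) auto
  finally show ?thesis by (simp add: mult.assoc)
qed

lemma A_op_linear2:
  assumes u: "u \<in> V" and v: "v \<in> V" and w: "w \<in> V"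
  shows "A_op rot Om u (a *\<^sub>R v + b *\<^sub>R w) = a * A_op rot Om u v + b * A_op rot Om u w"
proof -
  have vw: "a *\<^sub>R v + b *\<^sub>R w \<in> V" using v w by (intro VS.add_mem VS.scale_mem)
  interpret B: seminormed_space "Lp_space Om 2 :: (real^'n \<Rightarrow> 'c) set" "Lp_norm Om 2" by (rule seminormed_Lp) simp
  have "A_op rot Om u (a *\<^sub>R v + b *\<^sub>R w) = L2_inner Om (curl rot Om (a *\<^sub>R v + b *\<^sub>R w)) (curl rot Om u)"
    unfolding A_op_def by (rule L2_inner_commute)
  also have "\<dots> = L2_inner Om (a *\<^sub>R curl rot Om v + b *\<^sub>R curl rot Om w) (curl rot Om u)"
    using curl_lincomb[OF V_H1[OF v] V_H1[OF w], of a b]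
    by (intro L2_inner_cong_AE Lp_measurable[of _ 2] B.add_mem B.scale_mem curl_V_L2 u v w vw) auto
  also have "\<dots> = a * L2_inner Om (curl rot Om v) (curl rot Om u) + b * L2_inner Om (curl rot Om w) (curl rot Om u)"
    by (intro L2_inner_lincomb curl_V_L2 u v w)
  finally show ?thesis unfolding A_op_def L2_inner_commute[of "curl rot Om u"] .
qed

lemma A_op_commute: "A_op rot Om u v = A_op rot Om v u"
  unfolding A_op_def by (rule L2_inner_commute)

lemma A_op_bound: "u \<in> V \<Longrightarrow> v \<in> V \<Longrightarrow> \<bar>A_op rot Om u v\<bar> \<le> NV u * NV v"
  unfolding A_op_def V_norm_def by (intro L2_inner_bound curl_V_L2)

text \<open>All four terms are integrals against the same field \<open>u - v\<close>, so the
  pointwise inequality can be integrated; the curl is additive only almost everywhere.\<close>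

lemma F_op_monotone:
  obtains \<kappa> where "0 \<le> \<kappa>" "\<And>u v. u \<in> V \<inter> L \<Longrightarrow> v \<in> V \<inter> L \<Longrightarrow>
    F u (u - v) - F v (u - v) \<ge> \<mu> / 2 * (NV (u - v))\<^sup>2 + \<beta> * damping_const * NL (u - v) powr (r + 1) - \<kappa> * (Lp_norm Om 2 (u - v))\<^sup>2"
proof -
  obtain \<kappa> where \<kappa>: "0 \<le> \<kappa>" "\<And>ca cb a b.
    \<mu> * ((ca - cb) \<bullet> (ca - cb)) + (cr ca a - cr cb b) \<bullet> (a - b) + \<alpha> * ((a - b) \<bullet> (a - b))
      + \<beta> * ((norm a powr (r - 1) *\<^sub>R a - norm b powr (r - 1) *\<^sub>R b) \<bullet> (a - b))
    \<ge> \<mu> / 2 * (norm (ca - cb))\<^sup>2 + \<beta> * damping_const * norm (a - b) powr (r + 1) - \<kappa> * (norm (a - b))\<^sup>2"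
    by (rule pointwise_monotone) (rule that)
  show ?thesis
  proof (rule that[OF \<kappa>(1)])
    fix u v assume "u \<in> V \<inter> L" "v \<in> V \<inter> L"
    then have u: "u \<in> V" "u \<in> L" and v: "v \<in> V" "v \<in> L" by auto
    define w where "w = u - v"
    have w: "w \<in> V" "w \<in> L" unfolding w_def using u v by (auto intro: VS.diff_mem LS.diff_mem)
    let ?c = "curl rot Om"
    note cL = curl_V_L2[OF u(1)] curl_V_L2[OF v(1)] curl_V_L2[OF w(1)]
    note IA = L2_inner_integrable[OF cL(1) cL(3)] L2_inner_integrable[OF cL(2) cL(3)]
    note IB = B3_integrable[OF u w(2)] B3_integrable[OF v w(2)]
    note IL = L2_inner_integrable[OF L_L2[OF u(2)] L_L2[OF w(2)]] L2_inner_integrable[OF L_L2[OF v(2)] L_L2[OF w(2)]]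
    note IC = C_op_integrable(1)[OF u(2) w(2)] C_op_integrable(1)[OF v(2) w(2)]
    let ?I = "\<lambda>x. \<mu> * (?c u x \<bullet> ?c w x - ?c v x \<bullet> ?c w x) + (cr (?c u x) (u x) \<bullet> w x - cr (?c v x) (v x) \<bullet> w x)
          + \<alpha> * (u x \<bullet> w x - v x \<bullet> w x) + \<beta> * (C_op r u x \<bullet> w x - C_op r v x \<bullet> w x)"
    let ?R = "\<lambda>x. \<mu> / 2 * (norm (?c w x))\<^sup>2 + \<beta> * damping_const * norm (w x) powr (r + 1) - \<kappa> * (norm (w x))\<^sup>2"
    have eq: "F u w - F v w = (LINT x|\<Omega>. ?I x)"
      unfolding F_op_def A_op_def B_op_def L2_inner_def using IA IB IL IC by (simp add: algebra_simps)
    have II: "integrable \<Omega> ?I" using IA IB IL IC by auto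
    note IR = Lp2_integrable[OF cL(3)] Lp_integrable[OF LM_Lp[OF w(2)]] Lp2_integrable[OF L_L2[OF w(2)]]
    have IRR: "integrable \<Omega> ?R" using IR by auto
    have "AE x in \<Omega>. ?c w x = ?c u x - ?c v x"
      using curl_lincomb[OF V_H1[OF u(1)] V_H1[OF v(1)], of 1 "-1"] by (simp add: w_def)
    then have "AE x in \<Omega>. ?R x \<le> ?I x"
    proof eventually_elim
      case (elim x)
      have wx: "w x = u x - v x" by (simp add: w_def)
      have "?I x = \<mu> * ((?c u x - ?c v x) \<bullet> (?c u x - ?c v x)) + (cr (?c u x) (u x) - cr (?c v x) (v x)) \<bullet> (u x - v x)
          + \<alpha> * ((u x - v x) \<bullet> (u x - v x))
          + \<beta> * ((norm (u x) powr (r - 1) *\<^sub>R u x - norm (v x) powr (r - 1) *\<^sub>R v x) \<bullet> (u x - v x))"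
        unfolding elim wx C_op_def inner_diff_left ..
      then show ?case
        using \<kappa>(2)[where ca="?c u x" and cb="?c v x" and a="u x" and b="v x"]
        unfolding elim wx by linarith
    qed
    then have "(LINT x|\<Omega>. ?R x) \<le> (LINT x|\<Omega>. ?I x)" by (rule integral_mono_AE[OF IRR II])
    also have "(LINT x|\<Omega>. ?R x) = \<mu> / 2 * (NV w)\<^sup>2 + \<beta> * damping_const * NL w powr (r + 1) - \<kappa> * (Lp_norm Om 2 w)\<^sup>2"
      using IR r Lp_norm_powr[of "r + 1" w] by (simp add: V_norm_def Lp_norm_square)
    finally show "F u (u - v) - F v (u - v) \<ge> \<mu> / 2 * (NV (u - v))\<^sup>2 + \<beta> * damping_const * NL (u - v) powr (r + 1) - \<kappa> * (Lp_norm Om 2 (u - v))\<^sup>2"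
      using eq unfolding w_def[symmetric] by linarith
  qed
qed

end

lemma bochner_norm_nonneg: "0 \<le> bochner_norm T p N u"
  by (simp add: bochner_norm_def)

lemma bochner_norm_le_imp:
  assumes "0 < p" "bochner_norm T p N u \<le> R"
  shows "(LINT t|time_measure T. N (u t) powr p) \<le> R powr p"
proof -
  have "(LINT t|time_measure T. N (u t) powr p) = bochner_norm T p N u powr p"
    using assms(1) by (simp add: bochner_norm_def powr_powr)
  also have "\<dots> \<le> R powr p"
    using assms bochner_norm_nonneg by (intro powr_mono2) auto
  finally show ?thesis .
qed

context cbf_operator
begin

section \<open>The Nemytskii operator split into two parts\<close>

abbreviation "tm \<equiv> time_measure T"

lemma integrable_const_tm [simp]: "integrable tm (\<lambda>t. c::real)"
  using finite_measure.integrable_const[OF finite_measure_time] .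

lemma measure_tm [simp]: "measure tm {0<..<T} = T"
  using T by (simp add: measure_restrict_space)

definition F1 :: "'n field \<Rightarrow> 'n field \<Rightarrow> real" where
  "F1 u w = \<mu> * A_op rot Om u w"

text \<open>\<open>u\<close> supplies the curl and \<open>v\<close> the field. They are independent
  because \<open>y t\<close> has one sequence of simple approximations in \<open>V\<close> and
  another one in \<open>L\<close>. On the diagonal this is the part of the operator with values in
  the dual of \<open>L\<close>.\<close>

definition F2 :: "'n field \<Rightarrow> 'n field \<Rightarrow> 'n field \<Rightarrow> real" where
  "F2 u v w = B3 u v w + \<alpha> * L2_inner Om v w + \<beta> * L2_inner Om (C_op r v) w"

lemma F_eq: "F u w = F1 u w + F2 u u w"
  by (simp add: F_op_def F1_def F2_def B_op_def B3_def)

definition K2 :: real where "K2 = embed_const 2 (r + 1)"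

lemma K2_nonneg: "0 \<le> K2"
  by (simp add: K2_def embed_const_def)

lemma L2_le_NL: "u \<in> L \<Longrightarrow> Lp_norm Om 2 u \<le> K2 * NL u"
  unfolding K2_def using r by (intro Lp_embed(2) LM_Lp) auto

lemma L2_inner_L_bound:
  assumes "v \<in> L" "w \<in> L"
  shows "\<bar>L2_inner Om v w\<bar> \<le> K2\<^sup>2 * NL v * NL w"
proof -
  have "\<bar>L2_inner Om v w\<bar> \<le> Lp_norm Om 2 v * Lp_norm Om 2 w"
    by (intro L2_inner_bound L_L2 assms)
  also have "\<dots> \<le> (K2 * NL v) * (K2 * NL w)"
    by (intro mult_mono L2_le_NL assms Lp_norm_nonneg mult_nonneg_nonneg K2_nonneg)
  finally show ?thesis by (simp add: power2_eq_square ac_simps)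
qed

lemma F1_bound: "u \<in> V \<Longrightarrow> w \<in> V \<Longrightarrow> \<bar>F1 u w\<bar> \<le> \<mu> * NV u * NV w"
  using A_op_bound[of u w] \<mu> by (simp add: F1_def abs_mult mult.assoc)

lemma F1_dual: "u \<in> V \<Longrightarrow> F1 u \<in> dual_space V NV"
proof -
  assume u: "u \<in> V"
  have "F1 u (v + w) = F1 u v + F1 u w" if "v \<in> V" "w \<in> V" for v w
    using A_op_linear2[OF u that, of 1 1] by (simp add: F1_def distrib_left)
  moreover have "F1 u (a *\<^sub>R w) = a * F1 u w" if "w \<in> V" for a w
    using A_op_linear2[OF u that that, of a 0] by (simp add: F1_def)
  ultimately show ?thesis using F1_bound[OF u] unfolding dual_space_def by blast
qed

lemma F1_diff: "u \<in> V \<Longrightarrow> u' \<in> V \<Longrightarrow> w \<in> V \<Longrightarrow> F1 u w - F1 u' w = F1 (u - u') w"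
  using A_op_linear2[of w u u' 1 "-1"] unfolding F1_def A_op_commute[of _ w]
  by (simp add: right_diff_distrib)

lemma F2_linear:
  assumes u: "u \<in> V" and v: "v \<in> L" and w: "w \<in> L" "w' \<in> L"
  shows "F2 u v (a *\<^sub>R w + b *\<^sub>R w') = a * F2 u v w + b * F2 u v w'"
proof -
  have "L2_inner Om v (a *\<^sub>R w + b *\<^sub>R w') = a * L2_inner Om v w + b * L2_inner Om v w'"
    using L2_inner_lincomb[OF L_L2[OF w(1)] L_L2[OF w(2)] L_L2[OF v], of a b] by (simp add: L2_inner_commute)
  moreover have "L2_inner Om (C_op r v) (a *\<^sub>R w + b *\<^sub>R w') = a * L2_inner Om (C_op r v) w + b * L2_inner Om (C_op r v) w'"
    using C_op_integrable(1)[OF v w(1)] C_op_integrable(1)[OF v w(2)] by (simp add: L2_inner_def inner_add_right)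
  ultimately show ?thesis using B3_linear3[OF u v w, of a b] by (simp add: F2_def algebra_simps)
qed

lemma F2_bound:
  assumes u: "u \<in> V" and v: "v \<in> L" and w: "w \<in> L"
  shows "\<bar>F2 u v w\<bar> \<le> (Kt * NV u * NL v + \<alpha> * K2\<^sup>2 * NL v + \<beta> * NL v powr r) * NL w"
proof -
  have "\<bar>\<alpha> * L2_inner Om v w\<bar> \<le> \<alpha> * (K2\<^sup>2 * NL v * NL w)"
    unfolding abs_mult using L2_inner_L_bound[OF v w] \<alpha> by simp
  moreover have "\<bar>\<beta> * L2_inner Om (C_op r v) w\<bar> \<le> \<beta> * (NL v powr r * NL w)"
    unfolding abs_mult using C_op_integrable(2)[OF v w] \<beta> by simp
  ultimately show ?thesis
    using B3_bound[OF u v w] by (simp add: F2_def algebra_simps)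
qed

lemma F2_dual:
  assumes u: "u \<in> V" and v: "v \<in> L"
  shows "F2 u v \<in> dual_space L NL"
proof -
  have "F2 u v (w + w') = F2 u v w + F2 u v w'" if "w \<in> L" "w' \<in> L" for w w'
    using F2_linear[OF u v that, of 1 1] by simp
  moreover have "F2 u v (a *\<^sub>R w) = a * F2 u v w" if "w \<in> L" for a w
    using F2_linear[OF u v that that, of a 0] by simp
  ultimately show ?thesis using F2_bound[OF u v] unfolding dual_space_def by blast
qed

text \<open>A local Lipschitz estimate with explicit powers. It yields both the strong measurability
  of the composed operator and its continuity along segments.\<close>

lemma F2_diff_bound:
  assumes u: "u \<in> V" "u' \<in> V" and v: "v \<in> L" "v' \<in> L" and w: "w \<in> L"
  shows "\<bar>F2 u v w - F2 u' v' w\<bar> \<le> (Kt * NV (u - u') * NL v + Kt * NV u' * NL (v - v') + \<alpha> * K2\<^sup>2 * NL (v - v')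
      + \<beta> * (r * (NL v + NL v') powr (r - 1) * NL (v - v'))) * NL w"
proof -
  have du: "u - u' \<in> V" "v - v' \<in> L" using u v VS.diff_mem LS.diff_mem by auto
  have "B3 u v w - B3 u' v' w = B3 (u - u') v w + B3 u' (v - v') w"
    using B3_linear1[OF u v(1) w, of 1 "-1"] B3_linear2[OF u(2) v w, of 1 "-1"] by simp
  moreover have "L2_inner Om v w - L2_inner Om v' w = L2_inner Om (v - v') w"
    using L2_inner_lincomb[OF L_L2[OF v(1)] L_L2[OF v(2)] L_L2[OF w], of 1 "-1"] by simp
  ultimately have "F2 u v w - F2 u' v' w = B3 (u - u') v w + B3 u' (v - v') w + \<alpha> * L2_inner Om (v - v') w
      + \<beta> * (L2_inner Om (C_op r v) w - L2_inner Om (C_op r v') w)"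
    by (simp add: F2_def right_diff_distrib) (simp add: algebra_simps)
  moreover have "\<bar>\<alpha> * L2_inner Om (v - v') w\<bar> \<le> \<alpha> * (K2\<^sup>2 * NL (v - v') * NL w)"
    unfolding abs_mult using L2_inner_L_bound[OF du(2) w] \<alpha> by simp
  moreover have "\<bar>\<beta> * (L2_inner Om (C_op r v) w - L2_inner Om (C_op r v') w)\<bar> \<le> \<beta> * (r * (NL v + NL v') powr (r - 1) * NL (v - v') * NL w)"
    unfolding abs_mult using C_op_Lipschitz[OF v w] \<beta> by simp
  ultimately have "\<bar>F2 u v w - F2 u' v' w\<bar> \<le> Kt * NV (u - u') * NL v * NL w + Kt * NV u' * NL (v - v') * NL w
     + \<alpha> * (K2\<^sup>2 * NL (v - v') * NL w) + \<beta> * (r * (NL v + NL v') powr (r - 1) * NL (v - v') * NL w)"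
    using B3_bound[OF du(1) v(1) w] B3_bound[OF u(2) du(2) w] by linarith
  then show ?thesis by (simp add: algebra_simps)
qed

lemma L2V_D:
  assumes "y \<in> L2V rot Om T"
  shows "AE t in tm. y t \<in> V" "strongly_measurable T V NV y" "integrable tm (\<lambda>t. NV (y t) powr 2)"
  using assms by (auto simp: bochner_space_def)

lemma LpLp_D:
  assumes "y \<in> LpLp Om T (r + 1)"
  shows "AE t in tm. y t \<in> L" "strongly_measurable T L NL y" "integrable tm (\<lambda>t. NL (y t) powr (r + 1))"
  using assms by (auto simp: bochner_space_def)

lemma F1_bochner:
  assumes y: "y \<in> L2V rot Om T"
  shows "(\<lambda>t. F1 (y t)) \<in> bochner_space T 2 (V_dual rot Om) (V_dual_norm rot Om)"
    and "(LINT t|tm. V_dual_norm rot Om (F1 (y t)) powr 2) \<le> \<mu>\<^sup>2 * (LINT t|tm. NV (y t) powr 2)"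
proof -
  interpret D: seminormed_space "V_dual rot Om" "V_dual_norm rot Om" by (rule VS.seminormed_dual)
  note Y = L2V_D[OF y]
  have ae: "AE t in tm. F1 (y t) \<in> V_dual rot Om" using Y(1) by eventually_elim (rule F1_dual)
  have sm: "strongly_measurable T (V_dual rot Om) (V_dual_norm rot Om) (\<lambda>t. F1 (y t))"
  proof (rule strongly_measurable_compose2[OF Y(2,1) Y(2,1), where \<Phi>="\<lambda>a b. F1 a"])
    show "F1 a \<in> V_dual rot Om" if "a \<in> V" for a by (rule F1_dual[OF that])
    fix a b s s'
    assume a: "a \<in> V" "\<And>k::nat. s k \<in> V" and lim: "(\<lambda>k. NV (s k - a)) \<longlonglongrightarrow> 0"
    show "(\<lambda>k. V_dual_norm rot Om (F1 (s k) - F1 a)) \<longlonglongrightarrow> 0"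
    proof (rule tendsto_sandwich[OF _ _ tendsto_const])
      show "(\<lambda>k. \<mu> * NV (s k - a)) \<longlonglongrightarrow> 0" using tendsto_mult_right_zero[OF lim] .
      show "\<forall>\<^sub>F k in sequentially. V_dual_norm rot Om (F1 (s k) - F1 a) \<le> \<mu> * NV (s k - a)"
      proof (intro always_eventually allI VS.dual_norm_le)
        show "0 \<le> \<mu> * NV (s k - a)" for k using \<mu> NV_nonneg by simp
        show "\<bar>(F1 (s k) - F1 a) w\<bar> \<le> \<mu> * NV (s k - a) * NV w" if "w \<in> V" for k w
          using F1_diff[OF a(2) a(1) that, of k] F1_bound[OF VS.diff_mem[OF a(2) a(1)] that, of k] by simp
      qed
      show "\<forall>\<^sub>F k in sequentially. 0 \<le> V_dual_norm rot Om (F1 (s k) - F1 a)"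
        by (intro always_eventually allI D.nonneg D.diff_mem F1_dual a)
    qed
  qed
  have m [measurable]: "(\<lambda>t. V_dual_norm rot Om (F1 (y t))) \<in> borel_measurable tm"
    by (rule D.N_measurable[OF sm ae])
  have le: "AE t in tm. V_dual_norm rot Om (F1 (y t)) powr 2 \<le> \<mu>\<^sup>2 * NV (y t) powr 2"
    using Y(1)
  proof eventually_elim
    case (elim t)
    have "V_dual_norm rot Om (F1 (y t)) \<le> \<mu> * NV (y t)"
      using F1_bound[OF elim] \<mu> NV_nonneg by (intro VS.dual_norm_le) auto
    then have "V_dual_norm rot Om (F1 (y t)) powr 2 \<le> (\<mu> * NV (y t)) powr 2"
      using VS.dual_norm_nonneg[OF F1_dual[OF elim]] by (intro powr_mono2) auto
    then show ?case using \<mu> NV_nonneg by (simp add: powr_mult powr_numeral)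
  qed
  have I: "integrable tm (\<lambda>t. \<mu>\<^sup>2 * NV (y t) powr 2)" using Y(3) by auto
  have I1: "integrable tm (\<lambda>t. V_dual_norm rot Om (F1 (y t)) powr 2)"
    by (rule Bochner_Integration.integrable_bound[OF I]) (use le in \<open>auto elim!: eventually_mono\<close>)
  then show "(\<lambda>t. F1 (y t)) \<in> bochner_space T 2 (V_dual rot Om) (V_dual_norm rot Om)"
    using ae sm by (simp add: bochner_space_def)
  show "(LINT t|tm. V_dual_norm rot Om (F1 (y t)) powr 2) \<le> \<mu>\<^sup>2 * (LINT t|tm. NV (y t) powr 2)"
    using integral_mono_AE[OF I1 I le] by simp
qed

definition KF :: real where "KF = Kt + \<alpha> * K2\<^sup>2 + \<beta>"

lemma KF_nonneg: "0 \<le> KF"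
  using Kt_nonneg \<alpha> \<beta> by (simp add: KF_def)

text \<open>The exponent \<open>1/2 + 1/(r + 1)\<close> of the convective term does not exceed \<open>r / (r + 1)\<close>
  because \<open>r \<ge> 3\<close>.\<close>

lemma F2_growth:
  assumes "0 \<le> a" "0 \<le> b"
  shows "(Kt * a * b + \<alpha> * K2\<^sup>2 * b + \<beta> * b powr r) powr ((r + 1) / r)
    \<le> KF powr ((r + 1) / r) * (1 + a powr 2 + b powr (r + 1))"
proof -
  \<comment> \<open>Each factor is bounded by a power of this one quantity; as it is at least 1,
    smaller exponents may be raised to \<open>r / (r + 1)\<close>.\<close>
  define m where "m = 1 + a powr 2 + b powr (r + 1)"
  have m: "m \<ge> 1" "a powr 2 \<le> m" "b powr (r + 1) \<le> m" by (auto simp: m_def add_increasing add_increasing2)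
  have "a = (a powr 2) powr (1/2)" using assms by (simp add: powr_powr)
  also have "\<dots> \<le> m powr (1/2)" using m by (intro powr_mono2) auto
  finally have a: "a \<le> m powr (1/2)" .
  have "b = (b powr (r + 1)) powr (1/(r + 1))" using assms r by (simp add: powr_powr)
  also have "\<dots> \<le> m powr (1/(r + 1))" using m r by (intro powr_mono2) auto
  finally have b: "b \<le> m powr (1/(r + 1))" .
  have ex: "1/2 + 1/(r + 1) \<le> r/(r + 1)" "1/(r + 1) \<le> r/(r + 1)"
  proof -
    have "((r + 1) / 2 + 1) / (r + 1) \<le> r / (r + 1)" using r by (intro divide_right_mono) (simp_all add: field_simps)
    moreover have "1/2 + 1/(r + 1) = ((r + 1) / 2 + 1) / (r + 1)" using r by (simp add: divide_simps)
    ultimately show "1/2 + 1/(r + 1) \<le> r/(r + 1)" by (simp only:)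
    show "1/(r + 1) \<le> r/(r + 1)" using r by (intro divide_right_mono) auto
  qed
  have "a * b \<le> m powr (1/2) * m powr (1/(r + 1))" using a b assms by (intro mult_mono) auto
  also have "\<dots> = m powr (1/2 + 1/(r + 1))" by (simp add: powr_add)
  also have "\<dots> \<le> m powr (r/(r + 1))" using ex m by (intro powr_mono) auto
  finally have ab: "a * b \<le> m powr (r/(r + 1))" .
  have b1: "b \<le> m powr (r/(r + 1))"
    using b powr_mono[OF ex(2) m(1)] by linarith
  have "b powr r = (b powr (r + 1)) powr (r/(r + 1))" using r by (simp add: powr_powr)
  also have "\<dots> \<le> m powr (r/(r + 1))" using m r by (intro powr_mono2) auto
  finally have br: "b powr r \<le> m powr (r/(r + 1))" .
  have "Kt * (a * b) + \<alpha> * K2\<^sup>2 * b + \<beta> * b powr r \<le> Kt * m powr (r/(r + 1)) + \<alpha> * K2\<^sup>2 * m powr (r/(r + 1)) + \<beta> * m powr (r/(r + 1))"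
    using ab b1 br Kt_nonneg \<alpha> \<beta> by (intro add_mono mult_left_mono) auto
  also have "\<dots> = KF * m powr (r/(r + 1))" by (simp add: KF_def algebra_simps)
  finally have "(Kt * a * b + \<alpha> * K2\<^sup>2 * b + \<beta> * b powr r) powr ((r + 1) / r) \<le> (KF * m powr (r/(r + 1))) powr ((r + 1) / r)"
    using r assms Kt_nonneg \<alpha> \<beta> by (intro powr_mono2) (auto simp: mult.assoc)
  also have "\<dots> = KF powr ((r + 1) / r) * m"
    using r m KF_nonneg by (simp add: powr_mult powr_powr)
  finally show ?thesis by (simp add: m_def)
qed

lemma F2_bochner:
  assumes y: "y \<in> L2V rot Om T" "y \<in> LpLp Om T (r + 1)"
  shows "(\<lambda>t. F2 (y t) (y t)) \<in> bochner_space T ((r + 1) / r) (LM_dual Om (r + 1)) (LM_dual_norm Om (r + 1))"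
    and "(LINT t|tm. LM_dual_norm Om (r + 1) (F2 (y t) (y t)) powr ((r + 1) / r))
      \<le> KF powr ((r + 1) / r) * (T + (LINT t|tm. NV (y t) powr 2) + (LINT t|tm. NL (y t) powr (r + 1)))"
proof -
  interpret D: seminormed_space "LM_dual Om (r + 1)" "LM_dual_norm Om (r + 1)" by (rule LS.seminormed_dual)
  note Y = L2V_D[OF y(1)] and Y' = LpLp_D[OF y(2)]
  have ae: "AE t in tm. F2 (y t) (y t) \<in> LM_dual Om (r + 1)" using Y(1) Y'(1) by eventually_elim (rule F2_dual)
  have sm: "strongly_measurable T (LM_dual Om (r + 1)) (LM_dual_norm Om (r + 1)) (\<lambda>t. F2 (y t) (y t))"
  proof (rule strongly_measurable_compose2[OF Y(2,1) Y'(2,1), where \<Phi>=F2])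
    show "F2 a b \<in> LM_dual Om (r + 1)" if "a \<in> V" "b \<in> L" for a b by (rule F2_dual[OF that])
    fix a b s s'
    assume a: "a \<in> V" "\<And>k::nat. s k \<in> V" and lim: "(\<lambda>k. NV (s k - a)) \<longlonglongrightarrow> 0"
      and b: "b \<in> L" "\<And>k::nat. s' k \<in> L" and lim': "(\<lambda>k. NL (s' k - b)) \<longlonglongrightarrow> 0"
    let ?B = "\<lambda>k. Kt * NV (s k - a) * NL (s' k) + Kt * NV a * NL (s' k - b) + \<alpha> * K2\<^sup>2 * NL (s' k - b)
      + \<beta> * (r * (NL (s' k) + NL b) powr (r - 1) * NL (s' k - b))"
    have ln: "(\<lambda>k. NL (s' k)) \<longlonglongrightarrow> NL b" by (rule LS.tendsto_N[OF b lim'])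
    have lp: "(\<lambda>k. (NL (s' k) + NL b) powr (r - 1)) \<longlonglongrightarrow> (NL b + NL b) powr (r - 1)"
      using r NL_nonneg by (intro tendsto_powr' tendsto_intros ln) auto
    show "(\<lambda>k. LM_dual_norm Om (r + 1) (F2 (s k) (s' k) - F2 a b)) \<longlonglongrightarrow> 0"
    proof (rule tendsto_sandwich[OF _ _ tendsto_const])
      have "?B \<longlonglongrightarrow> Kt * 0 * NL b + Kt * NV a * 0 + \<alpha> * K2\<^sup>2 * 0 + \<beta> * (r * (NL b + NL b) powr (r - 1) * 0)"
        by (intro tendsto_intros lim lim' ln lp)
      then show "?B \<longlonglongrightarrow> 0" by simp
      show "\<forall>\<^sub>F k in sequentially. LM_dual_norm Om (r + 1) (F2 (s k) (s' k) - F2 a b) \<le> ?B k"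
      proof (intro always_eventually allI LS.dual_norm_le)
        show "0 \<le> ?B k" for k
          using Kt_nonneg \<alpha> \<beta> r NV_nonneg NL_nonneg by (intro add_nonneg_nonneg mult_nonneg_nonneg) auto
        show "\<bar>(F2 (s k) (s' k) - F2 a b) w\<bar> \<le> ?B k * NL w" if "w \<in> L" for k w
          using F2_diff_bound[OF a(2) a(1) b(2) b(1) that, of k k] by simp
      qed
      show "\<forall>\<^sub>F k in sequentially. 0 \<le> LM_dual_norm Om (r + 1) (F2 (s k) (s' k) - F2 a b)"
        by (intro always_eventually allI D.nonneg D.diff_mem F2_dual a b)
    qed
  qed
  have m [measurable]: "(\<lambda>t. LM_dual_norm Om (r + 1) (F2 (y t) (y t))) \<in> borel_measurable tm"
    by (rule D.N_measurable[OF sm ae])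
  let ?q = "(r + 1) / r"
  have le: "AE t in tm. LM_dual_norm Om (r + 1) (F2 (y t) (y t)) powr ?q \<le> KF powr ?q * (1 + NV (y t) powr 2 + NL (y t) powr (r + 1))"
    using Y(1) Y'(1)
  proof eventually_elim
    case (elim t)
    have "LM_dual_norm Om (r + 1) (F2 (y t) (y t)) \<le> Kt * NV (y t) * NL (y t) + \<alpha> * K2\<^sup>2 * NL (y t) + \<beta> * NL (y t) powr r"
      using F2_bound[OF elim] Kt_nonneg \<alpha> \<beta> NV_nonneg NL_nonneg by (intro LS.dual_norm_le add_nonneg_nonneg mult_nonneg_nonneg) auto
    then have "LM_dual_norm Om (r + 1) (F2 (y t) (y t)) powr ?q \<le> (Kt * NV (y t) * NL (y t) + \<alpha> * K2\<^sup>2 * NL (y t) + \<beta> * NL (y t) powr r) powr ?q"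
      using r LS.dual_norm_nonneg[OF F2_dual[OF elim]] by (intro powr_mono2) auto
    also have "\<dots> \<le> KF powr ?q * (1 + NV (y t) powr 2 + NL (y t) powr (r + 1))"
      by (intro F2_growth NV_nonneg NL_nonneg)
    finally show ?case .
  qed
  have I: "integrable tm (\<lambda>t. KF powr ?q * (1 + NV (y t) powr 2 + NL (y t) powr (r + 1)))" using Y(3) Y'(3) by auto
  have I1: "integrable tm (\<lambda>t. LM_dual_norm Om (r + 1) (F2 (y t) (y t)) powr ?q)"
    by (rule Bochner_Integration.integrable_bound[OF I]) (use le in \<open>auto elim!: eventually_mono\<close>)
  then show "(\<lambda>t. F2 (y t) (y t)) \<in> bochner_space T ?q (LM_dual Om (r + 1)) (LM_dual_norm Om (r + 1))"
    using ae sm by (simp add: bochner_space_def)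
  have "(LINT t|tm. LM_dual_norm Om (r + 1) (F2 (y t) (y t)) powr ?q) \<le> (LINT t|tm. KF powr ?q * (1 + NV (y t) powr 2 + NL (y t) powr (r + 1)))"
    by (rule integral_mono_AE[OF I1 I le])
  also have "\<dots> = KF powr ?q * (T + (LINT t|tm. NV (y t) powr 2) + (LINT t|tm. NL (y t) powr (r + 1)))"
    using Y(3) Y'(3) by simp
  finally show "(LINT t|tm. LM_dual_norm Om (r + 1) (F2 (y t) (y t)) powr ?q)
      \<le> KF powr ?q * (T + (LINT t|tm. NV (y t) powr 2) + (LINT t|tm. NL (y t) powr (r + 1)))" .
qed

abbreviation "X \<equiv> X_space rot Om T r"

lemma X_D: "y \<in> X \<Longrightarrow> y \<in> L2V rot Om T" "y \<in> X \<Longrightarrow> y \<in> LpLp Om T (r + 1)"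
  by (auto simp: X_space_def)

lemma X_diff: "y \<in> X \<Longrightarrow> z \<in> X \<Longrightarrow> y - z \<in> X"
  using r by (auto simp: X_space_def intro!: VS.bochner_diff LS.bochner_diff)

lemma X_lincomb:
  assumes "y \<in> X" "z \<in> X"
  shows "(\<lambda>t. a *\<^sub>R y t + b *\<^sub>R z t) \<in> X"
  using assms r by (auto simp: X_space_def intro!: VS.bochner_lincomb LS.bochner_lincomb)

lemma F_decomposition:
  assumes "y \<in> X"
  shows "X_dual_decomposition rot Om T r (nemytskii F y) (\<lambda>t. F1 (y t)) (\<lambda>t. F2 (y t) (y t))"
  using F1_bochner(1) F2_bochner(1) X_D[OF assms]
  by (auto simp: X_dual_decomposition_def nemytskii_def F_eq)

text \<open>The dual norm is an infimum over decompositions, so the explicit decomposition into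
  \<open>F1\<close> and \<open>F2\<close> bounds it from above.\<close>

lemma F_bounded_operator:
  "bounded_operator X (X_norm rot Om T r) (X_dual rot Om T r) (X_dual_norm rot Om T r) (nemytskii F)"
  unfolding bounded_operator_def
proof (intro conjI ballI allI impI)
  show "nemytskii F y \<in> X_dual rot Om T r" if "y \<in> X" for y
    using F_decomposition[OF that] by (auto simp: X_dual_def)
  fix S assume S: "S \<subseteq> X" and "\<exists>R. \<forall>y\<in>S. X_norm rot Om T r y \<le> R"
  then obtain R where R: "\<And>y. y \<in> S \<Longrightarrow> X_norm rot Om T r y \<le> R" by blast
  let ?q = "(r + 1) / r"
  define K where "K = (\<mu>\<^sup>2 * R powr 2) powr (1/2) + (KF powr ?q * (T + R powr 2 + R powr (r + 1))) powr (1 / ?q)"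
  show "\<exists>K. \<forall>y\<in>S. X_dual_norm rot Om T r (nemytskii F y) \<le> K"
  proof (intro exI ballI)
    fix y assume yS: "y \<in> S"
    then have y: "y \<in> X" using S by auto
    note Y = X_D[OF y]
    have "L2V_norm rot Om T y \<le> R" "LpLp_norm Om T (r + 1) y \<le> R"
      using R[OF yS] bochner_norm_nonneg[of T 2 NV y] bochner_norm_nonneg[of T "r + 1" NL y]
      by (simp_all add: X_norm_def)
    from bochner_norm_le_imp[OF _ this(1)] bochner_norm_le_imp[OF _ this(2)]
    have b: "(LINT t|tm. NV (y t) powr 2) \<le> R powr 2" "(LINT t|tm. NL (y t) powr (r + 1)) \<le> R powr (r + 1)"
      using r by auto
    have "X_dual_norm rot Om T r (nemytskii F y)
       \<le> bochner_norm T 2 (V_dual_norm rot Om) (\<lambda>t. F1 (y t)) + bochner_norm T ?q (LM_dual_norm Om (r + 1)) (\<lambda>t. F2 (y t) (y t))"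
      unfolding X_dual_norm_def
    proof (rule cInf_lower)
      show "bdd_below {bochner_norm T 2 (V_dual_norm rot Om) f1 + bochner_norm T ?q (LM_dual_norm Om (r + 1)) f2 |f1 f2.
          X_dual_decomposition rot Om T r (nemytskii F y) f1 f2}"
        by (intro bdd_belowI[of _ 0]) (auto intro!: add_nonneg_nonneg bochner_norm_nonneg)
    qed (use F_decomposition[OF y] in blast)
    also have "\<dots> \<le> K"
    proof -
      have "bochner_norm T 2 (V_dual_norm rot Om) (\<lambda>t. F1 (y t)) \<le> (\<mu>\<^sup>2 * R powr 2) powr (1/2)"
      proof -
        have "(LINT t|tm. V_dual_norm rot Om (F1 (y t)) powr 2) \<le> \<mu>\<^sup>2 * (LINT t|tm. NV (y t) powr 2)"
          by (rule F1_bochner(2)[OF Y(1)])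
        also have "\<dots> \<le> \<mu>\<^sup>2 * R powr 2" using b by (intro mult_left_mono) auto
        finally show ?thesis unfolding bochner_norm_def by (intro powr_mono2) (auto intro!: integral_nonneg_AE)
      qed
      moreover have "bochner_norm T ?q (LM_dual_norm Om (r + 1)) (\<lambda>t. F2 (y t) (y t)) \<le> (KF powr ?q * (T + R powr 2 + R powr (r + 1))) powr (1 / ?q)"
      proof -
        have "(LINT t|tm. LM_dual_norm Om (r + 1) (F2 (y t) (y t)) powr ?q)
            \<le> KF powr ?q * (T + (LINT t|tm. NV (y t) powr 2) + (LINT t|tm. NL (y t) powr (r + 1)))"
          by (rule F2_bochner(2)[OF Y])
        also have "\<dots> \<le> KF powr ?q * (T + R powr 2 + R powr (r + 1))" using b by (intro mult_left_mono add_mono) auto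
        finally show ?thesis unfolding bochner_norm_def using r by (intro powr_mono2) (auto intro!: integral_nonneg_AE)
      qed
      ultimately show ?thesis by (simp add: K_def)
    qed
    finally show "X_dual_norm rot Om T r (nemytskii F y) \<le> K" .
  qed
qed

lemma conjugate_exponents: "1 < r + 1" "1 < (r + 1) / r" "1 / (r + 1) + 1 / ((r + 1) / r) = 1"
  using r by (auto simp: field_simps)

lemma F_pairing:
  assumes y: "y \<in> X" and z: "z \<in> X"
  shows "integrable tm (\<lambda>t. F (y t) (z t))"
    and "integrable tm (\<lambda>t. F1 (y t) (z t))" and "integrable tm (\<lambda>t. F2 (y t) (y t) (z t))"
    and "pairing T (nemytskii F y) z = (LINT t|tm. F1 (y t) (z t)) + (LINT t|tm. F2 (y t) (y t) (z t))"
proof -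
  show 1: "integrable tm (\<lambda>t. F1 (y t) (z t))"
    by (rule VS.pairing_bound(1)[OF _ _ _ F1_bochner(1)[OF X_D(1)[OF y]] X_D(1)[OF z]]) auto
  show 2: "integrable tm (\<lambda>t. F2 (y t) (y t) (z t))"
    by (rule LS.pairing_bound(1)[OF conjugate_exponents F2_bochner(1)[OF X_D[OF y]] X_D(2)[OF z]])
  show "integrable tm (\<lambda>t. F (y t) (z t))" unfolding F_eq using 1 2 by simp
  show "pairing T (nemytskii F y) z = (LINT t|tm. F1 (y t) (z t)) + (LINT t|tm. F2 (y t) (y t) (z t))"
    using 1 2 by (simp add: pairing_def nemytskii_def F_eq)
qed

text \<open>For fixed \<open>z\<close> the two parts of the operator are functionals on the two
  Bochner spaces, and each is tested by the corresponding weak convergence.\<close>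

lemma F_pairing_weak:
  assumes z: "z \<in> X" and ym: "\<And>m. ym m \<in> X" and y: "y \<in> X"
    and w1: "weakly_converges (L2V rot Om T) (L2V_norm rot Om T) ym y"
    and w2: "weakly_converges (LpLp Om T (r + 1)) (LpLp_norm Om T (r + 1)) ym y"
  shows "(\<lambda>m. pairing T (nemytskii F z) (ym m)) \<longlonglongrightarrow> pairing T (nemytskii F z) y"
proof -
  have "(\<lambda>u. LINT t|tm. F1 (z t) (u t)) \<in> dual_space (L2V rot Om T) (L2V_norm rot Om T)"
    by (rule VS.pairing_mem_dual[OF _ _ _ F1_bochner(1)[OF X_D(1)[OF z]]]) auto
  then have 1: "(\<lambda>m. LINT t|tm. F1 (z t) (ym m t)) \<longlonglongrightarrow> (LINT t|tm. F1 (z t) (y t))"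
    using w1 by (auto simp: weakly_converges_def)
  have "(\<lambda>u. LINT t|tm. F2 (z t) (z t) (u t)) \<in> dual_space (LpLp Om T (r + 1)) (LpLp_norm Om T (r + 1))"
    by (rule LS.pairing_mem_dual[OF conjugate_exponents F2_bochner(1)[OF X_D[OF z]]])
  then have 2: "(\<lambda>m. LINT t|tm. F2 (z t) (z t) (ym m t)) \<longlonglongrightarrow> (LINT t|tm. F2 (z t) (z t) (y t))"
    using w2 by (auto simp: weakly_converges_def)
  show ?thesis
    unfolding F_pairing(4)[OF z ym] F_pairing(4)[OF z y] by (intro tendsto_add 1 2)
qed

end

section \<open>Functions of time\<close>

lemma strongly_measurable_realI:
  assumes "f \<in> borel_measurable (time_measure T)"
  shows "strongly_measurable T UNIV (abs :: real \<Rightarrow> real) f"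
proof -
  obtain s where s: "\<And>i. simple_function (time_measure T) (s i)"
    "\<And>x. x \<in> space (time_measure T) \<Longrightarrow> (\<lambda>i. s i x) \<longlonglongrightarrow> f x"
    using borel_measurable_implies_sequence_metric[OF assms, of 0] by blast
  show ?thesis
    unfolding strongly_measurable_def
  proof (intro exI conjI allI ballI)
    show "simple_function (time_measure T) (s k)" for k by (rule s(1))
    show "AE t in time_measure T. (\<lambda>k. \<bar>s k t - f t\<bar>) \<longlonglongrightarrow> 0"
      using AE_space by eventually_elim (simp add: s(2) LIM_zero tendsto_rabs_zero)
  qed auto
qed

context seminormed_space
begin

text \<open>Bounded scalar weights times a fixed element are the test objects for weak convergence,
  both for fields and for functionals.\<close>

lemma scaled_const_bochner:
  assumes \<psi>[measurable]: "\<psi> \<in> borel_measurable (time_measure T)" and B: "\<And>t. \<bar>\<psi> t\<bar> \<le> B"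
    and c: "c \<in> X" and p: "0 < p"
  shows "(\<lambda>t. \<psi> t *\<^sub>R c) \<in> bochner_space T p X N"
proof -
  have "strongly_measurable T X N (\<lambda>t. \<psi> t *\<^sub>R c)"
  proof (rule strongly_measurable_compose2[OF strongly_measurable_realI[OF \<psi>] _
        strongly_measurable_const[OF seminormed_space_axioms c], where \<Phi>="\<lambda>a b. a *\<^sub>R b"])
    fix a :: real and b s s'
    assume a: "b \<in> X" "\<And>k::nat. s' k \<in> X" "(\<lambda>k. \<bar>s k - a\<bar>) \<longlonglongrightarrow> 0" "(\<lambda>k. N (s' k - b)) \<longlonglongrightarrow> 0"
    have sl: "s \<longlonglongrightarrow> a" using a(3) by (simp add: LIM_zero_iff tendsto_rabs_zero_iff)
    show "(\<lambda>k. N (s k *\<^sub>R s' k - a *\<^sub>R b)) \<longlonglongrightarrow> 0"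
    proof (rule tendsto_sandwich[OF _ _ tendsto_const])
      have "(\<lambda>k. \<bar>s k\<bar> * N (s' k - b) + \<bar>s k - a\<bar> * N b) \<longlonglongrightarrow> \<bar>a\<bar> * 0 + 0 * N b"
        by (intro tendsto_intros sl a)
      then show "(\<lambda>k. \<bar>s k\<bar> * N (s' k - b) + \<bar>s k - a\<bar> * N b) \<longlonglongrightarrow> 0" by simp
      show "\<forall>\<^sub>F k in sequentially. N (s k *\<^sub>R s' k - a *\<^sub>R b) \<le> \<bar>s k\<bar> * N (s' k - b) + \<bar>s k - a\<bar> * N b"
      proof (intro always_eventually allI)
        fix k
        have "s k *\<^sub>R s' k - a *\<^sub>R b = s k *\<^sub>R (s' k - b) + (s k - a) *\<^sub>R b" by (simp add: algebra_simps)
        then show "N (s k *\<^sub>R s' k - a *\<^sub>R b) \<le> \<bar>s k\<bar> * N (s' k - b) + \<bar>s k - a\<bar> * N b"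
          using triangle[of "s k *\<^sub>R (s' k - b)" "(s k - a) *\<^sub>R b"] a(1,2)
          by (simp add: homogeneous diff_mem scale_mem)
      qed
      show "\<forall>\<^sub>F k in sequentially. 0 \<le> N (s k *\<^sub>R s' k - a *\<^sub>R b)"
        by (intro always_eventually allI nonneg diff_mem scale_mem a)
    qed
  qed (auto intro: scale_mem c)
  moreover have "integrable (time_measure T) (\<lambda>t. N (\<psi> t *\<^sub>R c) powr p)"
  proof -
    have Nc: "N (\<psi> t *\<^sub>R c) = \<bar>\<psi> t\<bar> * N c" for t using homogeneous[OF c] .
    show ?thesis unfolding Nc
    proof (rule finite_measure.integrable_const_bound[OF finite_measure_time, of _ "(B * N c) powr p"])
      show "AE t in time_measure T. norm ((\<bar>\<psi> t\<bar> * N c) powr p) \<le> (B * N c) powr p"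
        using B p nonneg[OF c] by (intro AE_I2) (auto intro!: powr_mono2 mult_right_mono)
    qed measurable
  qed
  ultimately show ?thesis by (simp add: bochner_space_def scale_mem[OF c])
qed

end

section \<open>Weak derivatives of scalar functions of time\<close>

lemma deriv_smooth:
  fixes \<phi> :: "real \<Rightarrow> real"
  assumes "smooth \<phi>"
  shows "deriv \<phi> t = frechet_derivative \<phi> (at t) 1"
proof -
  have "(\<phi> has_real_derivative frechet_derivative \<phi> (at t) 1) (at t)"
    using smooth_DERIV_line[OF assms, of 0 1 t] by simp
  then show ?thesis by (rule DERIV_imp_deriv)
qed

lemma time_identity_measurable: "(\<lambda>t. t) \<in> borel_measurable (lebesgue_on S)"
  by (intro measurable_restrict_space1 measurable_completion) simp

text \<open>Integration by parts in time: \<open>P\<close> is the primitive of \<open>f\<close> from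
  the left, \<open>H\<close> the tail integral of \<open>g\<close>, and both sides integrate
  \<open>f s * g t\<close> over the triangle \<open>s < t\<close>.\<close>

lemma Fubini_triangle:
  fixes f g :: "real \<Rightarrow> real"
  assumes f: "integrable (time_measure T) f" and g: "integrable (time_measure T) g"
  defines "H \<equiv> \<lambda>s. LINT t|time_measure T. indicator {s<..} t * g t"
    and "P \<equiv> \<lambda>t. LINT s|time_measure T. indicator {..<t} s * f s"
  shows "(LINT t|time_measure T. P t * g t) = (LINT s|time_measure T. f s * H s)"
    and "H \<in> borel_measurable (time_measure T)" and "P \<in> borel_measurable (time_measure T)"
    and "\<bar>H s\<bar> \<le> (LINT t|time_measure T. \<bar>g t\<bar>)" and "\<bar>P t\<bar> \<le> (LINT t|time_measure T. \<bar>f t\<bar>)"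
proof -
  let ?M = "time_measure T"
  interpret finite_measure ?M by (rule finite_measure_time)
  interpret pr: pair_sigma_finite ?M ?M ..
  note [measurable] = borel_measurable_integrable[OF f] borel_measurable_integrable[OF g] time_identity_measurable
  have [measurable]: "fst \<in> borel_measurable (?M \<Otimes>\<^sub>M ?M)" "snd \<in> borel_measurable (?M \<Otimes>\<^sub>M ?M)"
    using measurable_compose[OF measurable_fst[of ?M ?M] time_identity_measurable] measurable_compose[OF measurable_snd[of ?M ?M] time_identity_measurable]
    by (simp_all add: comp_def)
  have [measurable]: "Measurable.pred (?M \<Otimes>\<^sub>M ?M) (\<lambda>z. fst z < snd z)" by measurable
  define k where "k = (\<lambda>s t. (if s < t then f s * g t else 0))"
  have km: "(\<lambda>(s, t). k s t) \<in> borel_measurable (?M \<Otimes>\<^sub>M ?M)"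
    unfolding k_def case_prod_beta by measurable
  have bound: "norm (k s t) \<le> \<bar>f s\<bar> * \<bar>g t\<bar>" for s t by (simp add: k_def abs_mult)
  have inner: "integrable ?M (\<lambda>t. k s t)" for s
    by (rule Bochner_Integration.integrable_bound[of _ "\<lambda>t. \<bar>f s\<bar> * \<bar>g t\<bar>"])
       (use g bound in \<open>auto simp: k_def\<close>)
  have I: "integrable (?M \<Otimes>\<^sub>M ?M) (\<lambda>(s, t). k s t)"
  proof (rule pr.Fubini_integrable[OF km])
    show "AE s in ?M. integrable ?M (\<lambda>t. (\<lambda>(s, t). k s t) (s, t))" using inner by simp
    show "integrable ?M (\<lambda>s. LINT t|?M. norm ((\<lambda>(s, t). k s t) (s, t)))"
    proof (rule Bochner_Integration.integrable_bound)
      show "integrable ?M (\<lambda>s. \<bar>f s\<bar> * (LINT t|?M. \<bar>g t\<bar>))" using f by auto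
      show "(\<lambda>s. LINT t|?M. norm ((\<lambda>(s, t). k s t) (s, t))) \<in> borel_measurable ?M"
        using borel_measurable_lebesgue_integral[of "\<lambda>s t. norm (k s t)" ?M] km by (simp add: case_prod_beta)
      show "AE s in ?M. norm (LINT t|?M. norm ((\<lambda>(s, t). k s t) (s, t))) \<le> norm (\<bar>f s\<bar> * (LINT t|?M. \<bar>g t\<bar>))"
      proof (rule AE_I2)
        fix s
        have "(LINT t|?M. norm (k s t)) \<le> (LINT t|?M. \<bar>f s\<bar> * \<bar>g t\<bar>)"
          using inner[of s] g bound by (intro integral_mono) auto
        then show "norm (LINT t|?M. norm ((\<lambda>(s, t). k s t) (s, t))) \<le> norm (\<bar>f s\<bar> * (LINT t|?M. \<bar>g t\<bar>))"
          by (simp add: integral_nonneg_AE)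
      qed
    qed
  qed
  have "(LINT t|?M. LINT s|?M. k s t) = (LINT s|?M. LINT t|?M. k s t)"
    by (rule pr.Fubini_integral[OF I])
  moreover have "(LINT s|?M. k s t) = P t * g t" for t
  proof -
    have "(\<lambda>s. k s t) = (\<lambda>s. (indicator {..<t} s * f s) * g t)" by (auto simp: k_def)
    then show ?thesis unfolding P_def by (simp only: integral_mult_left_zero)
  qed
  moreover have kH: "(LINT t|?M. k s t) = f s * H s" for s
  proof -
    have "(\<lambda>t. k s t) = (\<lambda>t. f s * (indicator {s<..} t * g t))" by (auto simp: k_def)
    then show ?thesis unfolding H_def by (simp only: integral_mult_right_zero)
  qed
  ultimately show "(LINT t|?M. P t * g t) = (LINT s|?M. f s * H s)" by simp
  have "(\<lambda>z. if fst z < snd z then g (snd z) else 0) \<in> borel_measurable (?M \<Otimes>\<^sub>M ?M)" by measurable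
  from borel_measurable_lebesgue_integral[of "\<lambda>s t. if s < t then g t else 0" ?M]
  have "(\<lambda>s. LINT t|?M. (if s < t then g t else 0)) \<in> borel_measurable ?M"
    using \<open>(\<lambda>z. if fst z < snd z then g (snd z) else 0) \<in> borel_measurable (?M \<Otimes>\<^sub>M ?M)\<close> by (simp add: case_prod_beta)
  moreover have "(\<lambda>t. if s < t then g t else 0) = (\<lambda>t. indicator {s<..} t * g t)" for s by auto
  ultimately show "H \<in> borel_measurable ?M" unfolding H_def by simp
  have "(\<lambda>z. if snd z < fst z then f (snd z) else 0) \<in> borel_measurable (?M \<Otimes>\<^sub>M ?M)" by measurable
  from borel_measurable_lebesgue_integral[of "\<lambda>s t. if t < s then f t else 0" ?M]
  have "(\<lambda>s. LINT t|?M. (if t < s then f t else 0)) \<in> borel_measurable ?M"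
    using \<open>(\<lambda>z. if snd z < fst z then f (snd z) else 0) \<in> borel_measurable (?M \<Otimes>\<^sub>M ?M)\<close> by (simp add: case_prod_beta)
  moreover have "(\<lambda>t. if t < s then f t else 0) = (\<lambda>t. indicator {..<s} t * f t)" for s by auto
  ultimately show "P \<in> borel_measurable ?M" unfolding P_def by simp
  have *: "\<bar>LINT t|?M. indicator A t * u t\<bar> \<le> (LINT t|?M. \<bar>u t\<bar>)" if u: "integrable ?M u" for A and u :: "real \<Rightarrow> real"
  proof -
    have "\<bar>LINT t|?M. indicator A t * u t\<bar> \<le> (LINT t|?M. \<bar>indicator A t * u t\<bar>)" by (rule integral_abs_bound)
    also have "\<dots> \<le> (LINT t|?M. \<bar>u t\<bar>)"
      using u by (intro integral_mono') (auto simp: indicator_def)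
    finally show ?thesis .
  qed
  show "\<bar>H s\<bar> \<le> (LINT t|?M. \<bar>g t\<bar>)" "\<bar>P t\<bar> \<le> (LINT t|?M. \<bar>f t\<bar>)"
    unfolding H_def P_def by (intro * f g)+
qed

lemma compact_subset_Ioo:
  fixes K :: "real set"
  assumes "compact K" "K \<subseteq> {0<..<T}" "T > 0"
  obtains a b where "0 < a" "b < T" "K \<subseteq> {a..b}"
proof (cases "K = {}")
  case True
  show ?thesis by (rule that[of "T/2" "T/2"]) (use True assms in auto)
next
  case False
  obtain a where a: "a \<in> K" "\<And>x. x \<in> K \<Longrightarrow> a \<le> x" using compact_attains_inf[OF assms(1) False] by blast
  obtain b where b: "b \<in> K" "\<And>x. x \<in> K \<Longrightarrow> x \<le> b" using compact_attains_sup[OF assms(1) False] by blast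
  show ?thesis by (rule that[of a b]) (use a b assms in auto)
qed

lemma test_function_integrable_on:
  assumes "f \<in> test_functions {0<..<T}"
  shows "integrable (time_measure T) f"
proof -
  obtain B where B: "\<And>x. \<bar>f x\<bar> \<le> B" using test_function_bounded[OF assms] by metis
  show ?thesis
    by (rule finite_measure.integrable_const_bound[OF finite_measure_time, of _ B])
       (use B test_functions_measurable[OF assms] in auto)
qed

text \<open>The primitive vanishes to the left of the support, and to the right of it because the
  total integral is 0; so it is again a test function.\<close>

lemma test_function_primitive:
  assumes T: "T > 0" and f: "f \<in> test_functions {0<..<T}" and int: "(LINT s|time_measure T. f s) = 0"
  obtains \<phi> where "\<phi> \<in> test_functions {0<..<T}" "\<And>t. deriv \<phi> t = f t"
    "\<And>t. t \<in> {0<..<T} \<Longrightarrow> \<phi> t = (LINT s|time_measure T. indicator {..<t} s * f s)"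
proof -
  obtain K where K: "smooth f" "compact K" "K \<subseteq> {0<..<T}" "\<And>x. x \<notin> K \<Longrightarrow> f x = 0"
    by (rule test_functionsE[OF f]) (rule that)
  obtain a b where ab: "0 < a" "b < T" "K \<subseteq> {a..b}" by (rule compact_subset_Ioo[OF K(2,3) T]) (rule that)
  have f0: "f s = 0" if "s < a \<or> b < s" for s using K(4) ab(3) that by (meson atLeastAtMost_iff not_le subsetD)
  have fc: "continuous_on S f" for S by (rule smooth_continuous_on[OF K(1)])
  have fb: "f \<in> borel_measurable borel" by (rule smooth_borel_measurable[OF K(1)])
  define \<phi> where "\<phi> t = integral {0..t} f" for t
  have conv: "\<phi> t = (LINT s|time_measure T. indicator {..<t} s * f s)" for t
  proof -
    have I: "set_integrable lborel {0..t} f" by (intro borel_integrable_atLeastAtMost') (rule fc)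
    have "\<phi> t = (LINT s|lborel. indicator {0..t} s * f s)"
      using set_borel_integral_eq_integral(2)[OF I] by (simp add: \<phi>_def set_lebesgue_integral_def)
    also have "\<dots> = (LINT s|lborel. indicator {..<t} s * f s)"
    proof (rule integral_cong_AE)
      have "AE s in lborel. s \<noteq> t" using AE_lborel_singleton[of t] by simp
      then show "AE s in lborel. indicator {0..t} s * f s = indicator {..<t} s * f s"
        by eventually_elim (use f0 ab(1) in \<open>auto simp: indicator_def\<close>)
    qed (use fb in measurable)
    also have "\<dots> = (LINT s|time_measure T. indicator {..<t} s * f s)"
    proof (rule integral_lebesgue_on_eq_lborel[symmetric])
      show "indicator {..<t} s * f s = 0" if "s \<notin> {0<..<T}" for s
        using test_function_outside[OF f that] by simp
    qed (use fb in auto)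
    finally show ?thesis .
  qed
  have \<phi>0: "\<phi> t = 0" if "t \<notin> {a..b}" for t
  proof (cases "t < a")
    case True
    then have z: "indicator {..<t} s * f s = 0" for s using f0 by (auto simp: indicator_def)
    show ?thesis unfolding conv z by simp
  next
    case False
    then have "b < t" using that by auto
    then have z: "indicator {..<t} s * f s = f s" for s using f0 by (auto simp: indicator_def not_less)
    show ?thesis unfolding conv z by (rule int)
  qed
  have D: "(\<phi> has_real_derivative f t) (at t)" for t
  proof (cases "t < a")
    case True
    have "((\<lambda>t. 0) has_real_derivative f t) (at t)" using f0 True by simp
    then show ?thesis
      by (rule has_field_derivative_transform_within_open[where S="{..<a}"]) (use True \<phi>0 in auto)
  next
    case False
    then have t: "t > 0" using ab by simp
    \<comment> \<open>The interval has \<open>t\<close> in its interior, which turns the derivative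
      within it into a full one.\<close>
    have "(\<phi> has_vector_derivative f t) (at t within {0..t + 1})"
      unfolding \<phi>_def by (rule integral_has_vector_derivative[OF fc]) (use t in auto)
    then have "(\<phi> has_vector_derivative f t) (at t)"
      using t by (subst (asm) at_within_interior) auto
    then show ?thesis by (simp add: has_real_derivative_iff_has_vector_derivative)
  qed
  have "smooth \<phi>"
  proof (rule smooth_SucI)
    show "(\<phi> has_derivative (\<lambda>v. f t * v)) (at t)" for t using D[of t] by (simp add: has_field_derivative_def)
    show "smooth (\<lambda>t. f t * v)" for v by (rule smooth_mult[OF K(1) smooth_const])
  qed
  then have "\<phi> \<in> test_functions {0<..<T}"
    by (rule test_functionsI[where K="{a..b}"]) (use ab \<phi>0 in auto)
  then show ?thesis using that DERIV_imp_deriv[OF D] conv by blast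
qed

text \<open>The du Bois-Reymond argument: subtracting a suitable multiple of \<open>\<rho>\<close>
  from a test function gives one of mean 0, hence a derivative, so \<open>h + H\<close> is constant.
  Every term on the right is an integral of \<open>h\<close> or \<open>g\<close> against a bounded
  weight that depends on neither; this is the form in which weak convergence can be used at each
  fixed time.\<close>

lemma weak_derivative_representation:
  assumes T: "T > 0" and \<rho>: "\<rho> \<in> test_functions {0<..<T}" "(LINT t|time_measure T. \<rho> t) = 1"
    and h: "integrable (time_measure T) h" and g: "integrable (time_measure T) g"
    and weak: "\<And>\<phi>. \<phi> \<in> test_functions {0<..<T} \<Longrightarrow>
      (LINT t|time_measure T. deriv \<phi> t * h t) = - (LINT t|time_measure T. \<phi> t * g t)"
  defines "H \<equiv> \<lambda>s. LINT t|time_measure T. indicator {s<..} t * g t"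
  shows "AE s in time_measure T. h s
    = (LINT t|time_measure T. \<rho> t * h t) + (LINT t|time_measure T. (LINT s|time_measure T. indicator {..<t} s * \<rho> s) * g t) - H s"
proof -
  let ?M = "time_measure T"
  have \<rho>I: "integrable ?M \<rho>" by (rule test_function_integrable_on[OF \<rho>(1)])
  have Hm [measurable]: "H \<in> borel_measurable ?M" unfolding H_def by (rule Fubini_triangle(2)[OF g g])
  have Hb: "\<bar>H s\<bar> \<le> (LINT t|?M. \<bar>g t\<bar>)" for s unfolding H_def by (rule Fubini_triangle(4)[OF g g])
  have HI: "integrable ?M H"
    by (rule finite_measure.integrable_const_bound[OF finite_measure_time, of _ "LINT t|?M. \<bar>g t\<bar>"]) (use Hb in auto)
  have prod: "integrable ?M (\<lambda>t. f t * u t)" if f: "f \<in> test_functions {0<..<T}" and u: "integrable ?M u" for f u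
  proof -
    obtain B where B: "\<And>x. \<bar>f x\<bar> \<le> B" using test_function_bounded[OF f] by metis
    show ?thesis
      by (rule Bochner_Integration.integrable_bound[of _ "\<lambda>t. B * u t"])
         (use u B[THEN order_trans[OF _ abs_ge_self]] test_functions_measurable[OF f] in \<open>auto intro!: AE_I2 simp: abs_mult mult_right_mono\<close>)
  qed
  \<comment> \<open>The value of the constant, found by testing with \<open>\<rho>\<close>, whose
    integral is 1.\<close>
  define k where "k = (LINT t|?M. \<rho> t * (h t + H t))"
  have zero: "(LINT t|?M. \<theta> t * (h t + H t)) = (LINT t|?M. \<theta> t) * k" if \<theta>: "\<theta> \<in> test_functions {0<..<T}" for \<theta>
  proof -
    define c where "c = (LINT t|?M. \<theta> t)"
    define f where "f = (\<lambda>t. \<theta> t + \<rho> t * (- c))"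
    have ft: "f \<in> test_functions {0<..<T}"
      unfolding f_def by (intro test_function_add test_function_mult \<theta> \<rho> smooth_const)
    have fI: "integrable ?M f" by (rule test_function_integrable_on[OF ft])
    have "(LINT t|?M. f t) = 0"
      using \<rho>(2) \<rho>I test_function_integrable_on[OF \<theta>] by (simp add: f_def c_def)
    from test_function_primitive[OF T ft this] obtain \<phi> where \<phi>: "\<phi> \<in> test_functions {0<..<T}" "\<And>t. deriv \<phi> t = f t"
      "\<And>t. t \<in> {0<..<T} \<Longrightarrow> \<phi> t = (LINT s|?M. indicator {..<t} s * f s)" by metis
    have "(LINT t|?M. f t * h t) = - (LINT t|?M. \<phi> t * g t)" using weak[OF \<phi>(1)] \<phi>(2) by simp
    also have "(LINT t|?M. \<phi> t * g t) = (LINT t|?M. (LINT s|?M. indicator {..<t} s * f s) * g t)"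
      using \<phi>(3) by (intro Bochner_Integration.integral_cong refl) simp
    also have "\<dots> = (LINT s|?M. f s * H s)" unfolding H_def by (rule Fubini_triangle(1)[OF fI g])
    finally have "(LINT t|?M. f t * h t) + (LINT s|?M. f s * H s) = 0" by simp
    then have "(LINT t|?M. f t * (h t + H t)) = 0"
      using prod[OF ft h] prod[OF ft HI] by (simp add: distrib_left)
    moreover have "(LINT t|?M. f t * (h t + H t)) = (LINT t|?M. \<theta> t * (h t + H t)) - c * k"
    proof -
      have hH: "integrable ?M (\<lambda>t. h t + H t)" using h HI by auto
      have "(LINT t|?M. f t * (h t + H t)) = (LINT t|?M. \<theta> t * (h t + H t) - c * (\<rho> t * (h t + H t)))"
        by (simp add: f_def algebra_simps)
      then show ?thesis using prod[OF \<theta> hH] prod[OF \<rho>(1) hH] by (simp add: k_def)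
    qed
    ultimately show ?thesis by (simp add: c_def)
  qed
  have "AE s in ?M. h s + H s - k = 0"
  proof (rule fundamental_lemma_calculus_of_variations)
    show "integrable ?M (\<lambda>s. h s + H s - k)" by (intro Bochner_Integration.integrable_diff Bochner_Integration.integrable_add h HI finite_measure.integrable_const[OF finite_measure_time])
    fix \<theta> assume \<theta>: "\<theta> \<in> test_functions {0<..<T}"
    have "integrable ?M (\<lambda>t. h t + H t)" using h HI by auto
    note I = prod[OF \<theta> this] test_function_integrable_on[OF \<theta>]
    have "(LINT x|?M. (h x + H x - k) * \<theta> x) = (LINT x|?M. \<theta> x * (h x + H x) - \<theta> x * k)"
      by (simp add: algebra_simps)
    also have "\<dots> = 0" using I zero[OF \<theta>] by simp
    finally show "(LINT x|?M. (h x + H x - k) * \<theta> x) = 0" .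
  qed auto
  moreover have "k = (LINT t|?M. \<rho> t * h t) + (LINT t|?M. (LINT s|?M. indicator {..<t} s * \<rho> s) * g t)"
  proof -
    have F: "(LINT t|?M. (LINT s|?M. indicator {..<t} s * \<rho> s) * g t) = (LINT s|?M. \<rho> s * H s)"
      unfolding H_def by (rule Fubini_triangle(1)[OF \<rho>I g])
    show ?thesis
      unfolding F k_def using prod[OF \<rho>(1) h] prod[OF \<rho>(1) HI] by (simp add: distrib_left)
  qed
  ultimately show ?thesis by (auto elim: eventually_mono)
qed

text \<open>The bound on a higher power gives uniform integrability: a square is at most a small
  multiple of that power plus the square truncated at \<open>c\<close>, and the truncated part
  converges by domination.\<close>

lemma integral_square_tendsto_zero:
  fixes h :: "nat \<Rightarrow> real \<Rightarrow> real"
  assumes p: "2 < p" and T: "T > 0"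
    and h[measurable]: "\<And>m. h m \<in> borel_measurable (time_measure T)"
    and hp: "\<And>m. integrable (time_measure T) (\<lambda>t. \<bar>h m t\<bar> powr p)"
    and bound: "\<forall>\<^sub>F m in sequentially. (LINT t|time_measure T. \<bar>h m t\<bar> powr p) \<le> K"
    and lim: "AE t in time_measure T. (\<lambda>m. h m t) \<longlonglongrightarrow> 0"
  shows "(\<lambda>m. LINT t|time_measure T. (h m t)\<^sup>2) \<longlonglongrightarrow> 0"
proof (rule tendstoI)
  fix e :: real assume e: "e > 0"
  let ?M = "time_measure T"
  define \<delta> where "\<delta> = e / (2 * (\<bar>K\<bar> + 1))"
  have \<delta>: "\<delta> > 0" using e by (simp add: \<delta>_def add_nonneg_pos)
  obtain c where c: "0 \<le> c" "\<And>s. 0 \<le> s \<Longrightarrow> s\<^sup>2 \<le> \<delta> * s powr p + c"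
    by (rule square_le_powr[OF p \<delta>]) (rule that)
  have cI: "integrable ?M (\<lambda>t. c)" using finite_measure.integrable_const[OF finite_measure_time] .
  have minI: "integrable ?M (\<lambda>t. min ((h m t)\<^sup>2) c)" for m
    by (rule Bochner_Integration.integrable_bound[OF cI]) (use c in \<open>auto intro!: AE_I2\<close>)
  have "(\<lambda>m. LINT t|?M. min ((h m t)\<^sup>2) c) \<longlonglongrightarrow> (LINT t|?M. 0)"
  proof (rule integral_dominated_convergence[where w="\<lambda>t. c"])
    show "AE t in ?M. (\<lambda>m. min ((h m t)\<^sup>2) c) \<longlonglongrightarrow> 0"
      using lim
    proof eventually_elim
      case (elim t)
      have "(\<lambda>m. min ((h m t)\<^sup>2) c) \<longlonglongrightarrow> min (0\<^sup>2) c" by (intro tendsto_intros elim)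
      then show ?case using c by simp
    qed
    show "AE t in ?M. norm (min ((h m t)\<^sup>2) c) \<le> c" for m using c by auto
  qed (use cI in auto)
  then have "\<forall>\<^sub>F m in sequentially. (LINT t|?M. min ((h m t)\<^sup>2) c) < e / 2"
    using e order_tendstoD(2)[of _ 0 sequentially "e/2"] by simp
  then show "\<forall>\<^sub>F m in sequentially. dist (LINT t|?M. (h m t)\<^sup>2) 0 < e"
    using bound
  proof eventually_elim
    case (elim m)
    have pw: "(h m t)\<^sup>2 \<le> \<delta> * \<bar>h m t\<bar> powr p + min ((h m t)\<^sup>2) c" for t
      using c(2)[of "\<bar>h m t\<bar>"] \<delta> by (auto simp: min_def)
    have "(LINT t|?M. (h m t)\<^sup>2) \<le> (LINT t|?M. \<delta> * \<bar>h m t\<bar> powr p + min ((h m t)\<^sup>2) c)"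
      using hp[of m] minI[of m] pw c(1) \<delta> by (intro integral_mono') auto
    also have "\<dots> = \<delta> * (LINT t|?M. \<bar>h m t\<bar> powr p) + (LINT t|?M. min ((h m t)\<^sup>2) c)"
      using hp[of m] minI[of m] by simp
    also have "\<dots> < \<delta> * (\<bar>K\<bar> + 1) + e / 2"
      using elim \<delta> by (intro add_le_less_mono mult_left_mono) auto
    also have "\<dots> = e"
    proof -
      have "\<bar>K\<bar> + 1 > 0" by simp
      then show ?thesis by (simp add: \<delta>_def field_simps)
    qed
    finally show ?case by (simp add: integral_nonneg_AE)
  qed
qed

section \<open>Strong convergence\<close>

context cbf_operator
begin

abbreviation "Y \<equiv> V \<inter> L"

text \<open>The bound holds for every decomposition with the same first factor, so it survives the
  infimum that defines \<open>X_dual_norm\<close>.\<close>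

lemma X_dual_decomposition_pairing:
  assumes dec: "X_dual_decomposition rot Om T r f f1 f2"
    and \<psi>[measurable]: "\<psi> \<in> borel_measurable tm" and B: "\<And>t. \<bar>\<psi> t\<bar> \<le> B" and v: "v \<in> Y"
  shows "integrable tm (\<lambda>t. \<psi> t * f t v)"
    and "\<bar>LINT t|tm. \<psi> t * f t v\<bar>
      \<le> (L2V_norm rot Om T (\<lambda>t. \<psi> t *\<^sub>R v) + LpLp_norm Om T (r + 1) (\<lambda>t. \<psi> t *\<^sub>R v))
        * (bochner_norm T 2 (V_dual_norm rot Om) f1 + bochner_norm T ((r + 1) / r) (LM_dual_norm Om (r + 1)) f2)"
proof -
  let ?u = "\<lambda>t. \<psi> t *\<^sub>R v"
  let ?a = "bochner_norm T 2 (V_dual_norm rot Om) f1" and ?b = "bochner_norm T ((r + 1) / r) (LM_dual_norm Om (r + 1)) f2"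
  have f1: "f1 \<in> bochner_space T 2 (V_dual rot Om) (V_dual_norm rot Om)"
    and f2: "f2 \<in> bochner_space T ((r + 1) / r) (LM_dual Om (r + 1)) (LM_dual_norm Om (r + 1))"
    and f: "AE t in tm. \<forall>v\<in>Y. f t v = f1 t v + f2 t v"
    using dec by (auto simp: X_dual_decomposition_def)
  have uV: "?u \<in> L2V rot Om T" using v by (intro VS.scaled_const_bochner[OF \<psi> B]) auto
  have uL: "?u \<in> LpLp Om T (r + 1)" using v r by (intro LS.scaled_const_bochner[OF \<psi> B]) auto
  note P1 = VS.pairing_bound[OF _ _ _ f1 uV] and P2 = LS.pairing_bound[OF conjugate_exponents f2 uL]
  have "AE t in tm. f1 t \<in> dual_space V NV" "AE t in tm. f2 t \<in> dual_space L NL"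
    using f1 f2 by (auto simp: bochner_space_def)
  then have eq: "AE t in tm. f1 t (?u t) + f2 t (?u t) = \<psi> t * f t v"
    using f
  proof eventually_elim
    case (elim t)
    then show ?case using v VS.dual_scale[OF elim(1), of v] LS.dual_scale[OF elim(2), of v] by (simp add: distrib_left)
  qed
  have I: "integrable tm (\<lambda>t. f1 t (?u t) + f2 t (?u t))" using P1(1) P2(1) by simp
  have m: "(\<lambda>t. \<psi> t * f t v) \<in> borel_measurable tm"
    by (rule borel_measurable_lebesgue_on_AE_cong[OF _ borel_measurable_integrable[OF I] eq]) simp
  show "integrable tm (\<lambda>t. \<psi> t * f t v)"
    by (rule integrable_cong_AE_imp[OF I m]) (use eq in \<open>auto elim: eventually_mono\<close>)
  have "(LINT t|tm. \<psi> t * f t v) = (LINT t|tm. f1 t (?u t) + f2 t (?u t))"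
    by (rule integral_cong_AE[OF m borel_measurable_integrable[OF I]]) (use eq in \<open>auto elim: eventually_mono\<close>)
  also have "\<dots> = (LINT t|tm. f1 t (?u t)) + (LINT t|tm. f2 t (?u t))" using P1(1) P2(1) by simp
  finally have "\<bar>LINT t|tm. \<psi> t * f t v\<bar> \<le> ?a * L2V_norm rot Om T ?u + ?b * LpLp_norm Om T (r + 1) ?u"
    using P1(2) P2(2) by linarith
  also have "\<dots> \<le> (L2V_norm rot Om T ?u + LpLp_norm Om T (r + 1) ?u) * (?a + ?b)"
    using bochner_norm_nonneg[of T 2 NV ?u] bochner_norm_nonneg[of T "r + 1" NL ?u]
      bochner_norm_nonneg[of T 2 "V_dual_norm rot Om" f1] bochner_norm_nonneg[of T "(r + 1) / r" "LM_dual_norm Om (r + 1)" f2]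
    by (simp add: algebra_simps)
  finally show "\<bar>LINT t|tm. \<psi> t * f t v\<bar> \<le> (L2V_norm rot Om T ?u + LpLp_norm Om T (r + 1) ?u) * (?a + ?b)" .
qed

text \<open>Through these functionals the weak convergence of the time derivatives becomes
  convergence of scalar integrals.\<close>

lemma X_dual_functional:
  assumes \<psi>: "\<psi> \<in> borel_measurable tm" and B: "\<And>t. \<bar>\<psi> t\<bar> \<le> B" and v: "v \<in> Y"
  shows "(\<lambda>f. LINT t|tm. \<psi> t * f t v) \<in> dual_space (X_dual rot Om T r) (X_dual_norm rot Om T r)"
proof -
  \<comment> \<open>The summand 1 makes the factor positive, so that it can be divided through
    before passing to the infimum.\<close>
  let ?C = "L2V_norm rot Om T (\<lambda>t. \<psi> t *\<^sub>R v) + LpLp_norm Om T (r + 1) (\<lambda>t. \<psi> t *\<^sub>R v) + 1"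
  have C: "?C > 0"
    using bochner_norm_nonneg[of T 2 NV "\<lambda>t. \<psi> t *\<^sub>R v"] bochner_norm_nonneg[of T "r + 1" NL "\<lambda>t. \<psi> t *\<^sub>R v"] by simp
  have I: "integrable tm (\<lambda>t. \<psi> t * f t v)" if "f \<in> X_dual rot Om T r" for f
    using that X_dual_decomposition_pairing(1)[OF _ \<psi> B v] by (auto simp: X_dual_def)
  have "\<bar>LINT t|tm. \<psi> t * f t v\<bar> \<le> ?C * X_dual_norm rot Om T r f" if f: "f \<in> X_dual rot Om T r" for f
  proof -
    have "\<bar>LINT t|tm. \<psi> t * f t v\<bar> / ?C \<le> X_dual_norm rot Om T r f"
      unfolding X_dual_norm_def
    proof (rule cInf_greatest)
      show "{bochner_norm T 2 (V_dual_norm rot Om) f1 + bochner_norm T ((r + 1) / r) (LM_dual_norm Om (r + 1)) f2 | f1 f2.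
          X_dual_decomposition rot Om T r f f1 f2} \<noteq> {}"
        using f by (auto simp: X_dual_def)
      fix x assume "x \<in> {bochner_norm T 2 (V_dual_norm rot Om) f1 + bochner_norm T ((r + 1) / r) (LM_dual_norm Om (r + 1)) f2 | f1 f2.
          X_dual_decomposition rot Om T r f f1 f2}"
      then obtain f1 f2 where x: "x = bochner_norm T 2 (V_dual_norm rot Om) f1 + bochner_norm T ((r + 1) / r) (LM_dual_norm Om (r + 1)) f2"
        and dec: "X_dual_decomposition rot Om T r f f1 f2" by blast
      have "\<bar>LINT t|tm. \<psi> t * f t v\<bar> \<le> (?C - 1) * x"
        using X_dual_decomposition_pairing(2)[OF dec \<psi> B v] by (simp add: x)
      also have "\<dots> \<le> ?C * x"
        using bochner_norm_nonneg[of T 2 "V_dual_norm rot Om" f1] bochner_norm_nonneg[of T "(r + 1) / r" "LM_dual_norm Om (r + 1)" f2]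
        by (intro mult_right_mono) (auto simp: x)
      finally show "\<bar>LINT t|tm. \<psi> t * f t v\<bar> / ?C \<le> x" using C by (simp add: pos_divide_le_eq mult.commute)
    qed
    then show ?thesis using C by (simp add: pos_divide_le_eq mult.commute)
  qed
  moreover have "(LINT t|tm. \<psi> t * (f + g) t v) = (LINT t|tm. \<psi> t * f t v) + (LINT t|tm. \<psi> t * g t v)"
    if "f \<in> X_dual rot Om T r" "g \<in> X_dual rot Om T r" for f g
    using I[OF that(1)] I[OF that(2)] by (simp add: distrib_left)
  moreover have "(LINT t|tm. \<psi> t * (a *\<^sub>R f) t v) = a * (LINT t|tm. \<psi> t * f t v)" for a f
    by (simp add: mult.left_commute)
  ultimately show ?thesis unfolding dual_space_def by blast
qed

lemma L2_inner_functional: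
  assumes v: "v \<in> L"
  shows "(\<lambda>w. L2_inner Om w v) \<in> LM_dual Om (r + 1)"
proof -
  have "L2_inner Om (u + w) v = L2_inner Om u v + L2_inner Om w v" if "u \<in> L" "w \<in> L" for u w
    using L2_inner_lincomb[OF L_L2[OF that(1)] L_L2[OF that(2)] L_L2[OF v], of 1 1] by simp
  moreover have "L2_inner Om (a *\<^sub>R u) v = a * L2_inner Om u v" if "u \<in> L" for u a
    using L2_inner_lincomb[OF L_L2[OF that] L_L2[OF that] L_L2[OF v], of a 0] by simp
  moreover have "\<bar>L2_inner Om u v\<bar> \<le> (K2\<^sup>2 * NL v) * NL u" if "u \<in> L" for u
    using L2_inner_L_bound[OF that v] by (simp add: ac_simps)
  ultimately show ?thesis unfolding dual_space_def by blast
qed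

text \<open>The matching test functionals for the fields themselves, adapted to weak convergence in
  the space \<open>LpLp\<close>.\<close>

lemma weighted_L2_functional:
  assumes \<psi>: "\<psi> \<in> borel_measurable tm" and B: "\<And>t. \<bar>\<psi> t\<bar> \<le> B" and v: "v \<in> L"
  shows "(\<lambda>u. LINT t|tm. \<psi> t * L2_inner Om (u t) v) \<in> dual_space (LpLp Om T (r + 1)) (LpLp_norm Om T (r + 1))"
    and "u \<in> LpLp Om T (r + 1) \<Longrightarrow> integrable tm (\<lambda>t. \<psi> t * L2_inner Om (u t) v)"
proof -
  interpret D: seminormed_space "LM_dual Om (r + 1)" "LM_dual_norm Om (r + 1)" by (rule LS.seminormed_dual)
  have f: "(\<lambda>t. \<psi> t *\<^sub>R (\<lambda>w. L2_inner Om w v)) \<in> bochner_space T ((r + 1) / r) (LM_dual Om (r + 1)) (LM_dual_norm Om (r + 1))"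
    using r by (intro D.scaled_const_bochner[OF \<psi> B] L2_inner_functional v) auto
  show "(\<lambda>u. LINT t|tm. \<psi> t * L2_inner Om (u t) v) \<in> dual_space (LpLp Om T (r + 1)) (LpLp_norm Om T (r + 1))"
    using LS.pairing_mem_dual[OF conjugate_exponents f] by simp
  show "u \<in> LpLp Om T (r + 1) \<Longrightarrow> integrable tm (\<lambda>t. \<psi> t * L2_inner Om (u t) v)"
    using LS.pairing_bound(1)[OF conjugate_exponents f] by simp
qed

lemma L2_inner_time_integrable:
  assumes "v \<in> L" "u \<in> LpLp Om T (r + 1)"
  shows "integrable tm (\<lambda>t. L2_inner Om (u t) v)"
  using weighted_L2_functional(2)[of "\<lambda>t. 1" 1, OF _ _ assms] by simp

lemma W_X: "y \<in> W_space rot Om T r \<Longrightarrow> y \<in> X"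
  by (auto simp: W_space_def X_space_def)

text \<open>The representation by the weak derivative is applied to the scalar functions (y_m - y,
  v). For almost every \<open>s\<close> its three terms are pairings with fixed bounded weights, one
  with the function and two with the derivative, and each tends to 0.\<close>

lemma weak_W_pointwise:
  assumes conv: "weak_star_converges_W rot Om T r ym y" and v: "v \<in> Y"
  shows "AE s in tm. (\<lambda>m. L2_inner Om (ym m s) v - L2_inner Om (y s) v) \<longlonglongrightarrow> 0"
proof -
  obtain dym dy where dym: "\<And>m. dym m \<in> X_dual rot Om T r" "\<And>m. is_time_derivative Om T r (ym m) (dym m)"
    and dy: "dy \<in> X_dual rot Om T r" "is_time_derivative Om T r y dy"
    and wd: "weakly_converges (X_dual rot Om T r) (X_dual_norm rot Om T r) dym dy"
    using conv by (auto simp: weak_star_converges_W_def)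
  have wL: "weakly_converges (LpLp Om T (r + 1)) (LpLp_norm Om T (r + 1)) ym y"
    using conv by (simp add: weak_star_converges_W_def)
  have yX: "ym m \<in> LpLp Om T (r + 1)" "y \<in> LpLp Om T (r + 1)" for m
    using conv W_X X_D(2) by (auto simp: weak_star_converges_W_def)
  have vL: "v \<in> L" using v by auto
  \<comment> \<open>A cutoff of the time interval, once normalised, supplies a test function of
    integral 1.\<close>
  obtain \<rho>0 where \<rho>0: "\<And>n. \<rho>0 n \<in> test_functions {0<..<T}" "\<And>n x. 0 \<le> \<rho>0 n x" "\<And>n x. \<rho>0 n x \<le> 1"
    "\<And>x. (\<lambda>n. \<rho>0 n x) \<longlonglongrightarrow> indicat_real {0<..<T} x"
    by (rule test_functions_cutoff[of "{0<..<T}"]) (simp, rule that)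
  have "(\<lambda>n. LINT t|tm. \<rho>0 n t) \<longlonglongrightarrow> (LINT t|tm. 1)"
  proof (rule integral_dominated_convergence[where w="\<lambda>t. 1"])
    show "AE t in tm. (\<lambda>n. \<rho>0 n t) \<longlonglongrightarrow> 1"
      using AE_space
    proof eventually_elim
      case (elim t)
      then show ?case using \<rho>0(4)[of t] by simp
    qed
    show "AE t in tm. norm (\<rho>0 n t) \<le> 1" for n using \<rho>0(2,3) by auto
  qed (use test_functions_measurable[OF \<rho>0(1)] in auto)
  then have "(\<lambda>n. LINT t|tm. \<rho>0 n t) \<longlonglongrightarrow> T" by simp
  then have "\<forall>\<^sub>F n in sequentially. 0 < (LINT t|tm. \<rho>0 n t)" using T order_tendstoD(1) by blast
  then obtain n where n: "0 < (LINT t|tm. \<rho>0 n t)" unfolding eventually_sequentially by blast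
  define \<rho> where "\<rho> = (\<lambda>t. \<rho>0 n t * (1 / (LINT t|tm. \<rho>0 n t)))"
  have \<rho>: "\<rho> \<in> test_functions {0<..<T}" unfolding \<rho>_def by (rule test_function_mult[OF \<rho>0(1) smooth_const])
  have \<rho>1: "(LINT t|tm. \<rho> t) = 1" using n by (simp add: \<rho>_def)
  have \<rho>I: "integrable tm \<rho>" by (rule test_function_integrable_on[OF \<rho>])
  obtain B where B: "\<And>t. \<bar>\<rho> t\<bar> \<le> B" using test_function_bounded[OF \<rho>] by metis
  define h where "h m s = L2_inner Om (ym m s) v - L2_inner Om (y s) v" for m s
  define g where "g m t = dym m t v - dy t v" for m t
  have dI: "integrable tm (\<lambda>t. f t v)" if "f \<in> X_dual rot Om T r" for f
    using that X_dual_decomposition_pairing(1)[of f _ _ "\<lambda>t. 1" 1, OF _ _ _ v] by (auto simp: X_dual_def)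
  have hI: "integrable tm (h m)" for m
    unfolding h_def by (intro Bochner_Integration.integrable_diff L2_inner_time_integrable vL yX)
  have gI: "integrable tm (g m)" for m
    unfolding g_def by (intro Bochner_Integration.integrable_diff dI dym dy)
  have glim: "(\<lambda>m. LINT t|tm. \<psi> t * g m t) \<longlonglongrightarrow> 0" if \<psi>: "\<psi> \<in> borel_measurable tm" "\<And>t. \<bar>\<psi> t\<bar> \<le> C" for \<psi> C
  proof -
    have I: "integrable tm (\<lambda>t. \<psi> t * f t v)" if "f \<in> X_dual rot Om T r" for f
      using that X_dual_decomposition_pairing(1)[OF _ \<psi> v] by (auto simp: X_dual_def)
    have "(\<lambda>m. LINT t|tm. \<psi> t * dym m t v) \<longlonglongrightarrow> (LINT t|tm. \<psi> t * dy t v)"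
      using wd X_dual_functional[OF \<psi> v] by (auto simp: weakly_converges_def)
    then have "(\<lambda>m. (LINT t|tm. \<psi> t * dym m t v) - (LINT t|tm. \<psi> t * dy t v)) \<longlonglongrightarrow> 0"
      by (rule LIM_zero)
    moreover have "(LINT t|tm. \<psi> t * g m t) = (LINT t|tm. \<psi> t * dym m t v) - (LINT t|tm. \<psi> t * dy t v)" for m
      using I[OF dym(1)] I[OF dy(1)] by (simp add: g_def right_diff_distrib)
    ultimately show ?thesis by simp
  qed
  have hlim: "(\<lambda>m. LINT t|tm. \<rho> t * h m t) \<longlonglongrightarrow> 0"
  proof -
    note F = weighted_L2_functional[OF test_functions_measurable[OF \<rho>] B vL]
    have "(\<lambda>m. LINT t|tm. \<rho> t * L2_inner Om (ym m t) v) \<longlonglongrightarrow> (LINT t|tm. \<rho> t * L2_inner Om (y t) v)"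
      using wL F(1) by (auto simp: weakly_converges_def)
    then have "(\<lambda>m. (LINT t|tm. \<rho> t * L2_inner Om (ym m t) v) - (LINT t|tm. \<rho> t * L2_inner Om (y t) v)) \<longlonglongrightarrow> 0"
      by (rule LIM_zero)
    moreover have "(LINT t|tm. \<rho> t * h m t) = (LINT t|tm. \<rho> t * L2_inner Om (ym m t) v) - (LINT t|tm. \<rho> t * L2_inner Om (y t) v)" for m
      using F(2)[OF yX(1)] F(2)[OF yX(2)] by (simp add: h_def right_diff_distrib)
    ultimately show ?thesis by simp
  qed
  have weak: "(LINT t|tm. deriv \<phi> t * h m t) = - (LINT t|tm. \<phi> t * g m t)" if \<phi>: "\<phi> \<in> test_functions {0<..<T}" for \<phi> m
  proof -
    have D: "deriv \<phi> = (\<lambda>t. frechet_derivative \<phi> (at t) 1)"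
      using deriv_smooth[OF test_function_smooth[OF \<phi>]] by auto
    have Dt: "deriv \<phi> \<in> test_functions {0<..<T}" unfolding D by (rule test_function_derivative[OF \<phi>])
    obtain C where C: "\<And>t. \<bar>deriv \<phi> t\<bar> \<le> C" using test_function_bounded[OF Dt] by metis
    obtain C' where C': "\<And>t. \<bar>\<phi> t\<bar> \<le> C'" using test_function_bounded[OF \<phi>] by metis
    note F = weighted_L2_functional(2)[OF test_functions_measurable[OF Dt] C vL]
    have G: "integrable tm (\<lambda>t. \<phi> t * f t v)" if "f \<in> X_dual rot Om T r" for f
      using that X_dual_decomposition_pairing(1)[OF _ test_functions_measurable[OF \<phi>] C' v] by (auto simp: X_dual_def)
    have "(LINT t|tm. deriv \<phi> t * L2_inner Om (ym m t) v) = - (LINT t|tm. \<phi> t * dym m t v)"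
      "(LINT t|tm. deriv \<phi> t * L2_inner Om (y t) v) = - (LINT t|tm. \<phi> t * dy t v)"
      using dym(2)[of m] dy(2) \<phi> v unfolding is_time_derivative_def by blast+
    then show ?thesis
      using F[OF yX(1)] F[OF yX(2)] G[OF dym(1)] G[OF dy(1)] by (simp add: h_def g_def right_diff_distrib)
  qed
  define P where "P t = (LINT s|tm. indicator {..<t} s * \<rho> s)" for t
  have P: "P \<in> borel_measurable tm" "\<And>t. \<bar>P t\<bar> \<le> (LINT t|tm. \<bar>\<rho> t\<bar>)"
    unfolding P_def by (rule Fubini_triangle(3)[OF \<rho>I \<rho>I], rule Fubini_triangle(5)[OF \<rho>I \<rho>I])
  have "AE s in tm. h m s = (LINT t|tm. \<rho> t * h m t) + (LINT t|tm. P t * g m t) - (LINT t|tm. indicator {s<..} t * g m t)" for m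
    unfolding P_def by (rule weak_derivative_representation[OF T \<rho> \<rho>1 hI gI weak])
  \<comment> \<open>Countably many exceptional null sets are merged, so that one \<open>s\<close>
    serves the whole sequence.\<close>
  then have "AE s in tm. \<forall>m. h m s = (LINT t|tm. \<rho> t * h m t) + (LINT t|tm. P t * g m t) - (LINT t|tm. indicator {s<..} t * g m t)"
    by (simp add: AE_all_countable)
  then show ?thesis
  proof eventually_elim
    case (elim s)
    have "(\<lambda>m. LINT t|tm. indicator {s<..} t * g m t) \<longlonglongrightarrow> 0"
    proof (rule glim[of _ 1])
      show "indicat_real {s<..} \<in> borel_measurable tm" by (intro measurable_restrict_space1 measurable_completion) simp
    qed (simp add: indicator_def)
    then have "(\<lambda>m. (LINT t|tm. \<rho> t * h m t) + (LINT t|tm. P t * g m t) - (LINT t|tm. indicator {s<..} t * g m t)) \<longlonglongrightarrow> 0 + 0 - 0"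
      by (intro tendsto_intros hlim glim[OF P])
    then have "(\<lambda>m. h m s) \<longlonglongrightarrow> 0" using elim by simp
    then show ?case by (simp add: h_def)
  qed
qed

lemma L2_norm_time:
  assumes u: "u \<in> LpLp Om T (r + 1)"
  shows "integrable tm (\<lambda>t. (Lp_norm Om 2 (u t))\<^sup>2)"
proof -
  note U = LpLp_D[OF u]
  interpret A: seminormed_space "Lp_space Om 2 :: (real^'n \<Rightarrow> real^'n) set" "Lp_norm Om 2" by (rule seminormed_Lp) simp
  have "strongly_measurable T UNIV abs (\<lambda>t. Lp_norm Om 2 (u t))"
  proof (rule strongly_measurable_compose2[OF U(2,1) U(2,1), where \<Phi>="\<lambda>a b. Lp_norm Om 2 a"])
    fix a b s s'
    assume a: "a \<in> L" "\<And>k::nat. s k \<in> L" and lim: "(\<lambda>k. NL (s k - a)) \<longlonglongrightarrow> 0"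
    have "(\<lambda>k. Lp_norm Om 2 (s k)) \<longlonglongrightarrow> Lp_norm Om 2 a"
    proof (rule A.tendsto_N[OF L_L2[OF a(1)] L_L2[OF a(2)]])
      show "(\<lambda>k. Lp_norm Om 2 (s k - a)) \<longlonglongrightarrow> 0"
      proof (rule tendsto_sandwich[OF _ _ tendsto_const])
        show "(\<lambda>k. K2 * NL (s k - a)) \<longlonglongrightarrow> 0" using tendsto_mult_right_zero[OF lim] .
        show "\<forall>\<^sub>F k in sequentially. Lp_norm Om 2 (s k - a) \<le> K2 * NL (s k - a)"
          by (intro always_eventually allI L2_le_NL LS.diff_mem a)
      qed (auto simp: Lp_norm_nonneg)
    qed
    then show "(\<lambda>k. \<bar>Lp_norm Om 2 (s k) - Lp_norm Om 2 a\<bar>) \<longlonglongrightarrow> 0"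
      by (simp add: tendsto_rabs_zero LIM_zero)
  qed auto
  then have [measurable]: "(\<lambda>t. Lp_norm Om 2 (u t)) \<in> borel_measurable tm" by (rule strongly_measurable_realD)
  have p: "2 < r + 1" using r by simp
  obtain c where c: "0 \<le> c" "\<And>s. 0 \<le> s \<Longrightarrow> s\<^sup>2 \<le> 1 * s powr (r + 1) + c"
    by (rule square_le_powr[OF p zero_less_one]) (rule that)
  show "integrable tm (\<lambda>t. (Lp_norm Om 2 (u t))\<^sup>2)"
  proof (rule Bochner_Integration.integrable_bound)
    show "integrable tm (\<lambda>t. K2\<^sup>2 * (NL (u t) powr (r + 1) + c))" using U(3) by auto
    show "AE t in tm. norm ((Lp_norm Om 2 (u t))\<^sup>2) \<le> norm (K2\<^sup>2 * (NL (u t) powr (r + 1) + c))"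
      using U(1)
    proof eventually_elim
      case (elim t)
      have "(Lp_norm Om 2 (u t))\<^sup>2 \<le> (K2 * NL (u t))\<^sup>2" by (intro power_mono L2_le_NL elim Lp_norm_nonneg)
      also have "\<dots> \<le> K2\<^sup>2 * (NL (u t) powr (r + 1) + c)"
        using c(2)[OF NL_nonneg, of "u t"] by (simp add: power_mult_distrib mult_left_mono)
      finally show ?case by simp
    qed
  qed measurable
qed

text \<open>Aubin--Lions type compactness: the spatial estimate reduces strong convergence to
  finitely many scalar functions of time.\<close>

lemma strong_L2_convergence:
  assumes conv: "weak_star_converges_W rot Om T r ym y"
    and bound: "\<forall>\<^sub>F m in sequentially. (LINT t|tm. NV ((ym m - y) t) powr 2) \<le> K \<and> (LINT t|tm. NL ((ym m - y) t) powr (r + 1)) \<le> K"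
  shows "(\<lambda>m. LINT t|tm. (Lp_norm Om 2 ((ym m - y) t))\<^sup>2) \<longlonglongrightarrow> 0"
proof (rule tendstoI)
  fix e :: real assume e: "e > 0"
  define w where "w m = ym m - y" for m
  have yX: "ym m \<in> X" "y \<in> X" for m using conv W_X by (auto simp: weak_star_converges_W_def)
  have wX: "w m \<in> X" for m unfolding w_def by (rule X_diff[OF yX])
  have p: "2 < r + 1" using r by simp
  \<comment> \<open>The bracket exceeds the time integral of 1 plus the two powers, each eventually
    at most \<open>K\<close>. The other half of \<open>e\<close> is kept for the finitely many
    functionals.\<close>
  define \<epsilon> where "\<epsilon> = e / (2 * (T + 2 * \<bar>K\<bar> + 1))"
  have den: "T + 2 * \<bar>K\<bar> + 1 > 0" using T by simp
  have \<epsilon>: "\<epsilon> > 0" using e den by (simp add: \<epsilon>_def)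
  obtain vs C where vs: "set vs \<subseteq> Y" "0 \<le> C"
    "\<And>u. u \<in> Y \<Longrightarrow> (Lp_norm Om 2 u)\<^sup>2 \<le> \<epsilon> * (1 + (NV u)\<^sup>2 + NL u powr (r + 1)) + C * (\<Sum>v\<leftarrow>vs. (L2_inner Om u v)\<^sup>2)"
    by (rule compactness_estimate[OF p \<epsilon>]) (rule that)
  have wae: "AE t in tm. w m t \<in> Y" for m
    using L2V_D(1)[OF X_D(1)[OF wX]] LpLp_D(1)[OF X_D(2)[OF wX]] by (rule AE_mp[OF _ AE_mp]) auto
  have IV: "integrable tm (\<lambda>t. (NV (w m t))\<^sup>2)" for m
    using L2V_D(3)[OF X_D(1)[OF wX]] NV_nonneg by (simp add: powr_numeral)
  have IVeq: "(LINT t|tm. (NV (w m t))\<^sup>2) = (LINT t|tm. NV (w m t) powr 2)" for m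
    using NV_nonneg by (simp add: powr_numeral)
  have IL: "integrable tm (\<lambda>t. NL (w m t) powr (r + 1))" for m
    using LpLp_D(3)[OF X_D(2)[OF wX]] .
  note I2 = L2_norm_time[OF X_D(2)[OF wX]]
  have hm: "(\<lambda>t. L2_inner Om (w m t) v) \<in> borel_measurable tm" if "v \<in> Y" for m v
    using L2_inner_time_integrable[OF _ X_D(2)[OF wX]] that by auto
  have hp: "AE t in tm. \<bar>L2_inner Om (w m t) v\<bar> powr (r + 1) \<le> (K2\<^sup>2 * NL v) powr (r + 1) * NL (w m t) powr (r + 1)" if v: "v \<in> Y" for m v
    using wae[of m]
  proof eventually_elim
    case (elim t)
    have "\<bar>L2_inner Om (w m t) v\<bar> \<le> (K2\<^sup>2 * NL v) * NL (w m t)"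
      using L2_inner_L_bound[of "w m t" v] elim v by (simp add: ac_simps)
    then have "\<bar>L2_inner Om (w m t) v\<bar> powr (r + 1) \<le> ((K2\<^sup>2 * NL v) * NL (w m t)) powr (r + 1)"
      using r by (intro powr_mono2) auto
    then show ?case using NL_nonneg by (simp add: powr_mult)
  qed
  have hpI: "integrable tm (\<lambda>t. \<bar>L2_inner Om (w m t) v\<bar> powr (r + 1))" if v: "v \<in> Y" for m v
  proof (rule Bochner_Integration.integrable_bound)
    show "integrable tm (\<lambda>t. (K2\<^sup>2 * NL v) powr (r + 1) * NL (w m t) powr (r + 1))" using IL by auto
    show "(\<lambda>t. \<bar>L2_inner Om (w m t) v\<bar> powr (r + 1)) \<in> borel_measurable tm" using hm[OF v] by measurable
    show "AE t in tm. norm (\<bar>L2_inner Om (w m t) v\<bar> powr (r + 1)) \<le> norm ((K2\<^sup>2 * NL v) powr (r + 1) * NL (w m t) powr (r + 1))"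
      using hp[OF v, of m] by eventually_elim simp
  qed
  \<comment> \<open>Convergence at almost every time, with the uniform bound on the power
    \<open>r + 1\<close>, gives convergence of the integrated squares.\<close>
  have h2: "(\<lambda>m. LINT t|tm. (L2_inner Om (w m t) v)\<^sup>2) \<longlonglongrightarrow> 0" if v: "v \<in> Y" for v
  proof (rule integral_square_tendsto_zero[OF p T hm[OF v] hpI[OF v]])
    show "\<forall>\<^sub>F m in sequentially. (LINT t|tm. \<bar>L2_inner Om (w m t) v\<bar> powr (r + 1)) \<le> (K2\<^sup>2 * NL v) powr (r + 1) * K"
      using bound
    proof eventually_elim
      case (elim m)
      have "(LINT t|tm. \<bar>L2_inner Om (w m t) v\<bar> powr (r + 1)) \<le> (LINT t|tm. (K2\<^sup>2 * NL v) powr (r + 1) * NL (w m t) powr (r + 1))"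
        using IL by (intro integral_mono_AE hpI[OF v] hp[OF v]) auto
      also have "\<dots> = (K2\<^sup>2 * NL v) powr (r + 1) * (LINT t|tm. NL (w m t) powr (r + 1))" by simp
      also have "\<dots> \<le> (K2\<^sup>2 * NL v) powr (r + 1) * K" using elim by (intro mult_left_mono) (auto simp: w_def)
      finally show ?case .
    qed
    have "AE t in tm. (\<forall>m. ym m t \<in> L) \<and> y t \<in> L"
      using LpLp_D(1)[OF X_D(2)[OF yX(1)]] LpLp_D(1)[OF X_D(2)[OF yX(2)]] by (simp add: AE_all_countable)
    then show "AE t in tm. (\<lambda>m. L2_inner Om (w m t) v) \<longlonglongrightarrow> 0"
      using weak_W_pointwise[OF conv v]
    proof eventually_elim
      case (elim t)
      have "L2_inner Om (w m t) v = L2_inner Om (ym m t) v - L2_inner Om (y t) v" for m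
        using L2_inner_lincomb[OF L_L2[of "ym m t"] L_L2[of "y t"] L_L2[of v], of 1 "-1"] elim(1) v by (simp add: w_def)
      then show ?case using elim(2) by simp
    qed
  qed
  have h2I: "integrable tm (\<lambda>t. (L2_inner Om (w m t) v)\<^sup>2)" if v: "v \<in> Y" for m v
  proof (rule Bochner_Integration.integrable_bound)
    show "integrable tm (\<lambda>t. (Lp_norm Om 2 v)\<^sup>2 * (Lp_norm Om 2 (w m t))\<^sup>2)" using I2 by auto
    show "(\<lambda>t. (L2_inner Om (w m t) v)\<^sup>2) \<in> borel_measurable tm" using hm[OF v] by measurable
    show "AE t in tm. norm ((L2_inner Om (w m t) v)\<^sup>2) \<le> norm ((Lp_norm Om 2 v)\<^sup>2 * (Lp_norm Om 2 (w m t))\<^sup>2)"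
      using wae[of m]
    proof eventually_elim
      case (elim t)
      have "\<bar>L2_inner Om (w m t) v\<bar> \<le> Lp_norm Om 2 (w m t) * Lp_norm Om 2 v"
        using elim v by (intro L2_inner_bound L_L2) auto
      then have "\<bar>L2_inner Om (w m t) v\<bar>\<^sup>2 \<le> (Lp_norm Om 2 (w m t) * Lp_norm Om 2 v)\<^sup>2" by (intro power_mono) auto
      then show ?case by (simp add: power_mult_distrib mult.commute)
    qed
  qed
  have sumI: "integrable tm (\<lambda>t. \<Sum>v\<leftarrow>us. (L2_inner Om (w m t) v)\<^sup>2) \<and>
      (LINT t|tm. (\<Sum>v\<leftarrow>us. (L2_inner Om (w m t) v)\<^sup>2)) = (\<Sum>v\<leftarrow>us. LINT t|tm. (L2_inner Om (w m t) v)\<^sup>2)"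
    if "set us \<subseteq> Y" for us m
    using that by (induction us) (auto simp: h2I)
  have "(\<lambda>m. C * (\<Sum>v\<leftarrow>vs. LINT t|tm. (L2_inner Om (w m t) v)\<^sup>2)) \<longlonglongrightarrow> C * (\<Sum>v\<leftarrow>vs. 0)"
    using vs(1) by (intro tendsto_intros tendsto_sum_list h2) auto
  then have "(\<lambda>m. C * (\<Sum>v\<leftarrow>vs. LINT t|tm. (L2_inner Om (w m t) v)\<^sup>2)) \<longlonglongrightarrow> 0" by (simp add: sum_list_0)
  then have "\<forall>\<^sub>F m in sequentially. C * (\<Sum>v\<leftarrow>vs. LINT t|tm. (L2_inner Om (w m t) v)\<^sup>2) < e / 2"
    using e order_tendstoD(2)[of _ 0 sequentially "e/2"] by simp
  then show "\<forall>\<^sub>F m in sequentially. dist (LINT t|tm. (Lp_norm Om 2 ((ym m - y) t))\<^sup>2) 0 < e"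
    using bound
  proof eventually_elim
    case (elim m)
    have "(LINT t|tm. (Lp_norm Om 2 (w m t))\<^sup>2)
        \<le> (LINT t|tm. \<epsilon> * (1 + (NV (w m t))\<^sup>2 + NL (w m t) powr (r + 1)) + C * (\<Sum>v\<leftarrow>vs. (L2_inner Om (w m t) v)\<^sup>2))"
    proof (rule integral_mono_AE[OF I2])
      show "integrable tm (\<lambda>t. \<epsilon> * (1 + (NV (w m t))\<^sup>2 + NL (w m t) powr (r + 1)) + C * (\<Sum>v\<leftarrow>vs. (L2_inner Om (w m t) v)\<^sup>2))"
        using IV[of m] IL[of m] sumI[OF vs(1), of m] by auto
      show "AE t in tm. (Lp_norm Om 2 (w m t))\<^sup>2 \<le> \<epsilon> * (1 + (NV (w m t))\<^sup>2 + NL (w m t) powr (r + 1)) + C * (\<Sum>v\<leftarrow>vs. (L2_inner Om (w m t) v)\<^sup>2)"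
        using wae[of m] by eventually_elim (rule vs(3))
    qed
    also have "\<dots> = \<epsilon> * (T + (LINT t|tm. (NV (w m t))\<^sup>2) + (LINT t|tm. NL (w m t) powr (r + 1))) + C * (\<Sum>v\<leftarrow>vs. LINT t|tm. (L2_inner Om (w m t) v)\<^sup>2)"
      using IV[of m] IL[of m] sumI[OF vs(1), of m] by simp
    also have "\<dots> < \<epsilon> * (T + 2 * \<bar>K\<bar> + 1) + e / 2"
      using elim \<epsilon> unfolding IVeq by (intro add_le_less_mono mult_left_mono) (auto simp: w_def)
    also have "\<epsilon> * (T + 2 * \<bar>K\<bar> + 1) = e / 2"
    proof -
      have "e / (2 * x) * x = e / 2" if "x > 0" for x :: real using that by simp
      from this[OF den] show ?thesis unfolding \<epsilon>_def .
    qed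
    finally have fin: "(LINT t|tm. (Lp_norm Om 2 (w m t))\<^sup>2) < e" by simp
    have "0 \<le> (LINT t|tm. (Lp_norm Om 2 (w m t))\<^sup>2)" by (intro integral_nonneg_AE) auto
    with fin show ?case unfolding w_def dist_real_def by linarith
  qed
qed

end

section \<open>Pseudomonotonicity\<close>

context cbf_operator
begin

lemma F_linear:
  assumes u: "u \<in> Y" and w: "w \<in> Y" "w' \<in> Y"
  shows "F u (a *\<^sub>R w + b *\<^sub>R w') = a * F u w + b * F u w'"
  using F2_linear[of u u w w' a b] A_op_linear2[of u w w' a b] u w
  by (simp add: F_eq F1_def algebra_simps)

lemma X_Y: "y \<in> X \<Longrightarrow> AE t in tm. y t \<in> Y"
  using L2V_D(1)[OF X_D(1), of y] LpLp_D(1)[OF X_D(2), of y] by auto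

lemma pairing_F_lincomb:
  assumes y: "y \<in> X" and z: "z \<in> X" "z' \<in> X"
  shows "pairing T (nemytskii F y) (\<lambda>t. a *\<^sub>R z t + b *\<^sub>R z' t)
    = a * pairing T (nemytskii F y) z + b * pairing T (nemytskii F y) z'"
proof -
  note I = F_pairing(1)[OF y z(1)] F_pairing(1)[OF y z(2)] F_pairing(1)[OF y X_lincomb[OF z, of a b]]
  have "(LINT t|tm. F (y t) (a *\<^sub>R z t + b *\<^sub>R z' t)) = (LINT t|tm. a * F (y t) (z t) + b * F (y t) (z' t))"
  proof (rule integral_cong_AE)
    show "AE t in tm. F (y t) (a *\<^sub>R z t + b *\<^sub>R z' t) = a * F (y t) (z t) + b * F (y t) (z' t)"
      using X_Y[OF y] X_Y[OF z(1)] X_Y[OF z(2)] by eventually_elim (rule F_linear)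
  qed (use I in auto)
  also have "\<dots> = a * (LINT t|tm. F (y t) (z t)) + b * (LINT t|tm. F (y t) (z' t))"
    using I by simp
  finally show ?thesis by (simp add: pairing_def nemytskii_def)
qed

lemma pairing_F_diff:
  assumes "y \<in> X" "z \<in> X" "z' \<in> X"
  shows "pairing T (nemytskii F y) (z - z') = pairing T (nemytskii F y) z - pairing T (nemytskii F y) z'"
  using pairing_F_lincomb[OF assms, of 1 "-1"] by (simp add: fun_diff_def)

text \<open>Both dissipative powers are retained: they bound the sequence later on, and only the L2
  term has the wrong sign.\<close>

lemma pairing_F_monotone:
  obtains \<kappa> where "0 \<le> \<kappa>" "\<And>y z. y \<in> X \<Longrightarrow> z \<in> X \<Longrightarrow>
    \<mu> / 2 * (LINT t|tm. NV ((y - z) t) powr 2) + \<beta> * damping_const * (LINT t|tm. NL ((y - z) t) powr (r + 1))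
      - \<kappa> * (LINT t|tm. (Lp_norm Om 2 ((y - z) t))\<^sup>2)
    \<le> pairing T (nemytskii F y) (y - z) - pairing T (nemytskii F z) (y - z)"
proof -
  obtain \<kappa> where \<kappa>: "0 \<le> \<kappa>" "\<And>u v. u \<in> Y \<Longrightarrow> v \<in> Y \<Longrightarrow>
    F u (u - v) - F v (u - v) \<ge> \<mu> / 2 * (NV (u - v))\<^sup>2 + \<beta> * damping_const * NL (u - v) powr (r + 1) - \<kappa> * (Lp_norm Om 2 (u - v))\<^sup>2"
    by (rule F_op_monotone) (rule that)
  show ?thesis
  proof (rule that[OF \<kappa>(1)])
    fix y z assume y: "y \<in> X" and z: "z \<in> X"
    define w where "w = y - z"
    have w: "w \<in> X" unfolding w_def by (rule X_diff[OF y z])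
    note I = F_pairing(1)[OF y w] F_pairing(1)[OF z w]
    note J = L2V_D(3)[OF X_D(1)[OF w]] LpLp_D(3)[OF X_D(2)[OF w]] L2_norm_time[OF X_D(2)[OF w]]
    have "(LINT t|tm. \<mu> / 2 * NV (w t) powr 2 + \<beta> * damping_const * NL (w t) powr (r + 1) - \<kappa> * (Lp_norm Om 2 (w t))\<^sup>2)
        \<le> (LINT t|tm. F (y t) (w t) - F (z t) (w t))"
    proof (rule integral_mono_AE)
      show "AE t in tm. \<mu> / 2 * NV (w t) powr 2 + \<beta> * damping_const * NL (w t) powr (r + 1) - \<kappa> * (Lp_norm Om 2 (w t))\<^sup>2
          \<le> F (y t) (w t) - F (z t) (w t)"
        using X_Y[OF y] X_Y[OF z]
      proof eventually_elim
        case (elim t)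
        have wt: "w t = y t - z t" by (simp add: w_def)
        show ?case using \<kappa>(2)[OF elim] NV_nonneg unfolding wt by (simp add: powr_numeral)
      qed
    qed (use I J in auto)
    also have "\<dots> = pairing T (nemytskii F y) w - pairing T (nemytskii F z) w"
      using I by (simp add: pairing_def nemytskii_def)
    also have "(LINT t|tm. \<mu> / 2 * NV (w t) powr 2 + \<beta> * damping_const * NL (w t) powr (r + 1) - \<kappa> * (Lp_norm Om 2 (w t))\<^sup>2)
      = \<mu> / 2 * (LINT t|tm. NV (w t) powr 2) + \<beta> * damping_const * (LINT t|tm. NL (w t) powr (r + 1)) - \<kappa> * (LINT t|tm. (Lp_norm Om 2 (w t))\<^sup>2)"
      using J by simp
    finally show "\<mu> / 2 * (LINT t|tm. NV ((y - z) t) powr 2) + \<beta> * damping_const * (LINT t|tm. NL ((y - z) t) powr (r + 1))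
      - \<kappa> * (LINT t|tm. (Lp_norm Om 2 ((y - z) t))\<^sup>2)
      \<le> pairing T (nemytskii F y) (y - z) - pairing T (nemytskii F z) (y - z)"
      unfolding w_def .
  qed
qed

text \<open>The coefficients of the viscous, the two convective, the linear and the power terms in
  the estimate along a segment.\<close>

definition hemi_const :: real where
  "hemi_const = \<mu> + 2 * Kt + \<alpha> * K2\<^sup>2 + \<beta> * r"

lemma hemi_const_nonneg: "0 \<le> hemi_const"
  using \<mu> \<alpha> \<beta> r Kt_nonneg by (simp add: hemi_const_def)

text \<open>Along the segment the operator changes by a multiple of \<open>\<theta>\<close>, with a
  factor that is integrable in time. The convective terms are bounded by squares in \<open>V\<close>
  and fourth powers in \<open>L\<close>, and the latter by \<open>1 + s powr (r + 1)\<close> because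
  \<open>r > 3\<close>.\<close>

lemma F_hemicontinuous_pointwise:
  assumes y: "y \<in> Y" and D: "D \<in> Y" and \<theta>: "0 < \<theta>" "\<theta> \<le> 1"
  shows "\<bar>F (1 *\<^sub>R y + (- \<theta>) *\<^sub>R D) D - F y D\<bar> \<le> \<theta> * (hemi_const *
    (1 + NV D powr 2 + NV y powr 2 + (4 powr (r + 1) * NL y powr (r + 1) + 2 powr (r + 1) * NL D powr (r + 1))))"
proof -
  define v where "v = 1 *\<^sub>R y + (- \<theta>) *\<^sub>R D"
  have yV: "y \<in> V" "y \<in> L" and DV: "D \<in> V" "D \<in> L" using y D by auto
  have v: "v \<in> V" "v \<in> L" unfolding v_def using yV DV by (auto intro: VS.add_mem VS.scale_mem VS.diff_mem LS.diff_mem LS.scale_mem)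
  define a where "a = NV D"
  define a' where "a' = NV y"
  define e where "e = NL D"
  \<comment> \<open>Bounds \<open>NL v + NL y\<close> and \<open>NL D\<close> at once.\<close>
  define s where "s = 2 * NL y + NL D"
  have nn: "0 \<le> a" "0 \<le> a'" "0 \<le> e" "e \<le> s" "0 \<le> s"
    using NV_nonneg NL_nonneg by (auto simp: a_def a'_def e_def s_def)
  have diff: "v - y = (- \<theta>) *\<^sub>R D" by (simp add: v_def)
  have NVd: "NV (v - y) = \<theta> * a" and NLd: "NL (v - y) = \<theta> * e"
    unfolding diff using VS.homogeneous[OF DV(1), of "- \<theta>"] LS.homogeneous[OF DV(2), of "- \<theta>"] \<theta> by (simp_all add: a_def e_def)
  have "NL v \<le> NL y + NL (v - y)" by (rule LS.N_le_add_diff[OF v(2) yV(2)])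
  also have "\<dots> \<le> NL y + e" unfolding NLd using \<theta> nn by (simp add: mult_left_le_one_le)
  finally have NLv: "NL v \<le> s" "NL v + NL y \<le> s" using NL_nonneg[of y] by (auto simp: s_def e_def)
  have "\<bar>F1 v D - F1 y D\<bar> = \<bar>F1 (v - y) D\<bar>" using F1_diff[OF v(1) yV(1) DV(1)] by simp
  also have "\<dots> \<le> \<mu> * (\<theta> * a) * a"
    using F1_bound[OF VS.diff_mem[OF v(1) yV(1)] DV(1)] unfolding NVd by (simp add: a_def)
  finally have 1: "\<bar>F1 v D - F1 y D\<bar> \<le> \<theta> * (\<mu> * a\<^sup>2)" by (simp add: power2_eq_square ac_simps)
  have "\<bar>F2 v v D - F2 y y D\<bar> \<le> (Kt * (\<theta> * a) * NL v + Kt * a' * (\<theta> * e) + \<alpha> * K2\<^sup>2 * (\<theta> * e)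
      + \<beta> * (r * (NL v + NL y) powr (r - 1) * (\<theta> * e))) * e"
    using F2_diff_bound[OF v(1) yV(1) v(2) yV(2) DV(2)] unfolding NVd NLd by (simp add: a'_def e_def)
  also have "\<dots> \<le> (Kt * (\<theta> * a) * s + Kt * a' * (\<theta> * e) + \<alpha> * K2\<^sup>2 * (\<theta> * e)
      + \<beta> * (r * s powr (r - 1) * (\<theta> * e))) * e"
    using NLv nn \<theta> Kt_nonneg \<beta> r NL_nonneg
    by (intro mult_right_mono add_mono mult_left_mono powr_mono2) auto
  finally have 2: "\<bar>F2 v v D - F2 y y D\<bar> \<le> \<theta> * (Kt * (a * s * e) + Kt * (a' * e * e) + \<alpha> * K2\<^sup>2 * (e * e) + \<beta> * r * (s powr (r - 1) * e * e))"
    by (simp add: algebra_simps)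
  define S where "S = s powr (r + 1)"
  have S0: "0 \<le> S" by (simp add: S_def)
  have s4: "s ^ 4 \<le> 1 + S"
  proof (cases "s \<le> 1")
    case True
    then have "s ^ 4 \<le> 1" using nn by (simp add: power_le_one)
    then show ?thesis using S0 by simp
  next
    case False
    then have "s ^ 4 = s powr 4" using powr_realpow[of s 4] by simp
    also have "\<dots> \<le> S" unfolding S_def using False r by (intro powr_mono) auto
    finally show ?thesis by simp
  qed
  have young: "x * (s * s) \<le> x\<^sup>2 + s ^ 4" for x
  proof -
    have "0 \<le> (x - s * s)\<^sup>2" "0 \<le> x\<^sup>2" "0 \<le> (s * s)\<^sup>2" by auto
    moreover have "(s * s)\<^sup>2 = s ^ 4" by (simp add: power2_eq_square power4_eq_xxxx)
    ultimately show ?thesis unfolding power2_diff by linarith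
  qed
  have ee: "e * e \<le> s * s" using nn by (intro mult_mono) auto
  have b1: "a * s * e \<le> a\<^sup>2 + (1 + S)"
  proof -
    have "a * s * e \<le> a * (s * s)" using nn by (simp add: mult.assoc mult_left_mono)
    then show ?thesis using young[of a] s4 by linarith
  qed
  have b2: "a' * e * e \<le> a'\<^sup>2 + (1 + S)"
  proof -
    have "a' * e * e \<le> a' * (s * s)" using nn ee by (simp add: mult.assoc mult_left_mono)
    then show ?thesis using young[of a'] s4 by linarith
  qed
  have b4: "s powr (r - 1) * e * e \<le> S"
  proof -
    have "s powr (r - 1) * e * e \<le> s powr (r - 1) * (s * s)" using ee by (simp add: mult.assoc mult_left_mono)
    also have "\<dots> = S"
    proof (cases "s = 0")
      case False
      then have "s powr (r - 1) * s powr 2 = S" by (simp add: S_def powr_add[symmetric] add.commute)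
      then show ?thesis using nn False by (simp add: powr_numeral power2_eq_square)
    qed (simp add: S_def)
    finally show ?thesis .
  qed
  define m where "m = 1 + a\<^sup>2 + a'\<^sup>2 + S"
  have e1: "e * e \<le> m"
  proof -
    have "e * e \<le> s * s" by (rule ee)
    also have "\<dots> \<le> 1 + S"
    proof (cases "s \<le> 1")
      case True
      then have "s * s \<le> 1 * 1" using nn by (intro mult_mono) auto
      then show ?thesis using S0 by simp
    next
      case False
      then have "s * s = s powr 2" by (simp add: powr_numeral power2_eq_square)
      also have "\<dots> \<le> S" unfolding S_def using False r by (intro powr_mono) auto
      finally show ?thesis by simp
    qed
    finally show ?thesis using zero_le_power2[of a] zero_le_power2[of a'] unfolding m_def by linarith
  qed
  have "Kt * (a * s * e) + Kt * (a' * e * e) + \<alpha> * K2\<^sup>2 * (e * e) + \<beta> * r * (s powr (r - 1) * e * e) + \<mu> * a\<^sup>2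
      \<le> Kt * m + Kt * m + \<alpha> * K2\<^sup>2 * m + \<beta> * r * m + \<mu> * m"
  proof -
    have "a * s * e \<le> m" "a' * e * e \<le> m" "s powr (r - 1) * e * e \<le> m" "a\<^sup>2 \<le> m"
      using b1 b2 b4 S0 zero_le_power2[of a] zero_le_power2[of a'] unfolding m_def by linarith+
    then show ?thesis
      using e1 Kt_nonneg \<alpha> \<beta> r \<mu> by (intro add_mono mult_left_mono) auto
  qed
  also have "\<dots> = hemi_const * m" by (simp add: hemi_const_def algebra_simps)
  finally have main: "\<bar>F v D - F y D\<bar> \<le> \<theta> * (hemi_const * m)"
  proof -
    assume le: "Kt * (a * s * e) + Kt * (a' * e * e) + \<alpha> * K2\<^sup>2 * (e * e) + \<beta> * r * (s powr (r - 1) * e * e) + \<mu> * a\<^sup>2 \<le> hemi_const * m"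
    have "\<bar>F v D - F y D\<bar> \<le> \<bar>F1 v D - F1 y D\<bar> + \<bar>F2 v v D - F2 y y D\<bar>" by (simp add: F_eq)
    also have "\<dots> \<le> \<theta> * (\<mu> * a\<^sup>2) + \<theta> * (Kt * (a * s * e) + Kt * (a' * e * e) + \<alpha> * K2\<^sup>2 * (e * e) + \<beta> * r * (s powr (r - 1) * e * e))"
      using 1 2 by linarith
    also have "\<dots> = \<theta> * (Kt * (a * s * e) + Kt * (a' * e * e) + \<alpha> * K2\<^sup>2 * (e * e) + \<beta> * r * (s powr (r - 1) * e * e) + \<mu> * a\<^sup>2)"
      by (simp add: algebra_simps)
    also have "\<dots> \<le> \<theta> * (hemi_const * m)" using le \<theta> by (intro mult_left_mono) auto
    finally show ?thesis .
  qed
  \<comment> \<open>The factors 4 and 2 come from writing \<open>s\<close> as a mean, so that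
    convexity of the power applies.\<close>
  have "S = (1/2 * (4 * NL y) + 1/2 * (2 * NL D)) powr (r + 1)" by (simp add: S_def s_def)
  also have "\<dots> \<le> 1/2 * (4 * NL y) powr (r + 1) + 1/2 * (2 * NL D) powr (r + 1)"
    using r NL_nonneg by (intro convex_powr_nonneg) auto
  also have "\<dots> \<le> (4 * NL y) powr (r + 1) + (2 * NL D) powr (r + 1)"
    by (intro add_mono) auto
  also have "\<dots> = 4 powr (r + 1) * NL y powr (r + 1) + 2 powr (r + 1) * NL D powr (r + 1)"
    using NL_nonneg by (simp add: powr_mult)
  finally have "m \<le> 1 + NV D powr 2 + NV y powr 2 + (4 powr (r + 1) * NL y powr (r + 1) + 2 powr (r + 1) * NL D powr (r + 1))"
    using NV_nonneg by (simp add: m_def a_def a'_def powr_numeral)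
  then have "\<theta> * (hemi_const * m) \<le> \<theta> * (hemi_const * (1 + NV D powr 2 + NV y powr 2 + (4 powr (r + 1) * NL y powr (r + 1) + 2 powr (r + 1) * NL D powr (r + 1))))"
    using \<theta> hemi_const_nonneg by (intro mult_left_mono) auto
  then show ?thesis using main unfolding v_def by linarith
qed

lemma pairing_F_hemicontinuous:
  assumes y: "y \<in> X" and D: "D \<in> X"
  obtains G where "0 \<le> G" "\<And>\<theta>. 0 < \<theta> \<Longrightarrow> \<theta> \<le> 1 \<Longrightarrow>
    \<bar>pairing T (nemytskii F (\<lambda>t. 1 *\<^sub>R y t + (- \<theta>) *\<^sub>R D t)) D - pairing T (nemytskii F y) D\<bar> \<le> \<theta> * G"
proof -
  define g where "g t = hemi_const * (1 + NV (D t) powr 2 + NV (y t) powr 2 + (4 powr (r + 1) * NL (y t) powr (r + 1) + 2 powr (r + 1) * NL (D t) powr (r + 1)))" for t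
  note J = L2V_D(3)[OF X_D(1)[OF y]] LpLp_D(3)[OF X_D(2)[OF y]] L2V_D(3)[OF X_D(1)[OF D]] LpLp_D(3)[OF X_D(2)[OF D]]
  have gI: "integrable tm g" unfolding g_def using J by auto
  have g0: "0 \<le> g t" for t unfolding g_def using hemi_const_nonneg by (intro mult_nonneg_nonneg add_nonneg_nonneg) auto
  show ?thesis
  proof (rule that[of "LINT t|tm. g t"])
    show "0 \<le> (LINT t|tm. g t)" using g0 by (intro integral_nonneg_AE) auto
    fix \<theta> :: real assume \<theta>: "0 < \<theta>" "\<theta> \<le> 1"
    let ?v = "\<lambda>t. 1 *\<^sub>R y t + (- \<theta>) *\<^sub>R D t"
    have v: "?v \<in> X" by (rule X_lincomb[OF y D])
    note I = F_pairing(1)[OF v D] F_pairing(1)[OF y D]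
    have "pairing T (nemytskii F ?v) D - pairing T (nemytskii F y) D = (LINT t|tm. F (?v t) (D t) - F (y t) (D t))"
      unfolding pairing_def nemytskii_def by (rule Bochner_Integration.integral_diff[OF I, symmetric])
    then have "\<bar>pairing T (nemytskii F ?v) D - pairing T (nemytskii F y) D\<bar> \<le> (LINT t|tm. \<bar>F (?v t) (D t) - F (y t) (D t)\<bar>)"
      by (simp only: integral_abs_bound)
    also have "\<dots> \<le> (LINT t|tm. \<theta> * g t)"
    proof (rule integral_mono_AE)
      show "integrable tm (\<lambda>t. \<bar>F (?v t) (D t) - F (y t) (D t)\<bar>)"
        by (intro integrable_abs Bochner_Integration.integrable_diff I)
      show "integrable tm (\<lambda>t. \<theta> * g t)" using gI by auto
      show "AE t in tm. \<bar>F (?v t) (D t) - F (y t) (D t)\<bar> \<le> \<theta> * g t"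
        using X_Y[OF y] X_Y[OF D] unfolding g_def by eventually_elim (rule F_hemicontinuous_pointwise[OF _ _ \<theta>])
    qed
    finally show "\<bar>pairing T (nemytskii F ?v) D - pairing T (nemytskii F y) D\<bar> \<le> \<theta> * (LINT t|tm. g t)"
      by simp
  qed
qed

section \<open>Passage to the limit\<close>

lemma pairing_F_weak_null:
  assumes conv: "weak_star_converges_W rot Om T r ym y" and z: "z \<in> X"
  shows "(\<lambda>m. pairing T (nemytskii F z) (ym m - y)) \<longlonglongrightarrow> 0"
proof -
  have ym: "ym m \<in> X" and y: "y \<in> X" for m
    using conv W_X by (auto simp: weak_star_converges_W_def)
  have "(\<lambda>m. pairing T (nemytskii F z) (ym m)) \<longlonglongrightarrow> pairing T (nemytskii F z) y"
    using F_pairing_weak[OF z ym y] conv by (simp add: weak_star_converges_W_def)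
  then show ?thesis unfolding pairing_F_diff[OF z ym y] by (rule LIM_zero)
qed

text \<open>Minty's trick in quantitative form: for small \<open>\<theta>\<close>, monotonicity
  between y_m and y - \<theta> (y - z) bounds the pairing with y - z from below up to a multiple of
  \<open>\<theta>\<close>, while the pairing with y_m - y eventually exceeds any negative number.
  The sum of the two pairings is the one with y_m - z.\<close>

lemma F_pseudomonotone_limit:
  assumes conv: "weak_star_converges_W rot Om T r ym y"
    and ls: "limsup (\<lambda>m. ereal (pairing T (nemytskii F (ym m)) (ym m - y))) \<le> 0"
    and z: "z \<in> X"
  shows "ereal (pairing T (nemytskii F y) (y - z)) \<le> liminf (\<lambda>m. ereal (pairing T (nemytskii F (ym m)) (ym m - z)))"
proof -
  have ym: "ym m \<in> X" and y: "y \<in> X" for m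
    using conv W_X by (auto simp: weak_star_converges_W_def)
  obtain \<kappa> where \<kappa>: "0 \<le> \<kappa>" "\<And>y z. y \<in> X \<Longrightarrow> z \<in> X \<Longrightarrow>
    \<mu> / 2 * (LINT t|tm. NV ((y - z) t) powr 2) + \<beta> * damping_const * (LINT t|tm. NL ((y - z) t) powr (r + 1))
      - \<kappa> * (LINT t|tm. (Lp_norm Om 2 ((y - z) t))\<^sup>2)
    \<le> pairing T (nemytskii F y) (y - z) - pairing T (nemytskii F z) (y - z)"
    by (rule pairing_F_monotone) (rule that)
  define w where "w m = ym m - y" for m
  have w: "w m \<in> X" for m unfolding w_def by (rule X_diff[OF ym y])
  define P where "P m = pairing T (nemytskii F (ym m)) (w m)" for m
  define S where "S m = (LINT t|tm. (Lp_norm Om 2 (w m t))\<^sup>2)" for m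
  define A where "A m = (LINT t|tm. NV (w m t) powr 2)" for m
  define B where "B m = (LINT t|tm. NL (w m t) powr (r + 1))" for m
  have nn: "0 \<le> A m" "0 \<le> B m" "0 \<le> S m" for m
    unfolding A_def B_def S_def by (intro integral_nonneg_AE AE_I2; simp)+
  define cc where "cc = \<beta> * damping_const"
  have cc: "cc > 0" using \<beta> damping_const_pos by (simp add: cc_def)
  \<comment> \<open>The limsup hypothesis as an eventual upper bound, the form in which it enters
    below.\<close>
  have Pup: "\<forall>\<^sub>F m in sequentially. P m < e" if "e > 0" for e
  proof -
    have "limsup (\<lambda>m. ereal (P m)) < ereal e"
      unfolding P_def w_def by (rule le_less_trans[OF ls]) (use that in simp)
    from Limsup_lessD[OF this] show ?thesis by simp
  qed
  have null: "\<forall>\<^sub>F m in sequentially. \<bar>pairing T (nemytskii F v) (w m)\<bar> < e" if "v \<in> X" "e > 0" for v e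
    using tendstoD[OF pairing_F_weak_null[OF conv that(1)] that(2)] by (simp add: w_def dist_real_def)
  have mono: "\<mu> / 2 * A m + cc * B m - \<kappa> * S m \<le> P m - pairing T (nemytskii F y) (w m)" for m
    using \<kappa>(2)[OF ym y, of m] unfolding A_def B_def S_def P_def w_def cc_def by simp
  have p: "2 < r + 1" using r by simp
  \<comment> \<open>With this fraction the term with \<open>\<kappa>\<close> consumes at most half
    of the damping \<open>cc\<close>.\<close>
  have "cc / (2 * (\<kappa> * K2\<^sup>2 + 1)) > 0" using cc \<kappa>(1) by (simp add: add_nonneg_pos)
  then obtain c where c: "0 \<le> c" "\<And>s. 0 \<le> s \<Longrightarrow> s\<^sup>2 \<le> cc / (2 * (\<kappa> * K2\<^sup>2 + 1)) * s powr (r + 1) + c"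
    by (rule square_le_powr[OF p]) (rule that)
  define C where "C = \<kappa> * K2\<^sup>2 * c"
  have low: "\<kappa> * S m \<le> cc / 2 * B m + T * C" for m
  proof -
    note I = L2_norm_time[OF X_D(2)[OF w]] LpLp_D(3)[OF X_D(2)[OF w]]
    have "\<kappa> * S m = (LINT t|tm. \<kappa> * (Lp_norm Om 2 (w m t))\<^sup>2)" by (simp add: S_def)
    also have "\<dots> \<le> (LINT t|tm. cc / 2 * NL (w m t) powr (r + 1) + C)"
    proof (rule integral_mono_AE)
      show "AE t in tm. \<kappa> * (Lp_norm Om 2 (w m t))\<^sup>2 \<le> cc / 2 * NL (w m t) powr (r + 1) + C"
        using X_Y[OF w, of m]
      proof eventually_elim
        case (elim t)
        have "(Lp_norm Om 2 (w m t))\<^sup>2 \<le> (K2 * NL (w m t))\<^sup>2"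
          using elim by (intro power_mono L2_le_NL Lp_norm_nonneg) auto
        also have "\<dots> \<le> K2\<^sup>2 * (cc / (2 * (\<kappa> * K2\<^sup>2 + 1)) * NL (w m t) powr (r + 1) + c)"
          unfolding power_mult_distrib using c(2)[OF NL_nonneg] by (intro mult_left_mono) auto
        finally have "\<kappa> * (Lp_norm Om 2 (w m t))\<^sup>2 \<le> \<kappa> * (K2\<^sup>2 * (cc / (2 * (\<kappa> * K2\<^sup>2 + 1)) * NL (w m t) powr (r + 1) + c))"
          using \<kappa>(1) by (intro mult_left_mono)
        also have "\<dots> = (\<kappa> * K2\<^sup>2 / (\<kappa> * K2\<^sup>2 + 1)) * (cc / 2 * NL (w m t) powr (r + 1)) + C"
          by (simp add: C_def algebra_simps)
        also have "\<dots> \<le> 1 * (cc / 2 * NL (w m t) powr (r + 1)) + C"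
        proof -
          have "\<kappa> * K2\<^sup>2 / (\<kappa> * K2\<^sup>2 + 1) \<le> 1" using \<kappa>(1) by (simp add: add_nonneg_pos)
          then show ?thesis using cc by (intro add_right_mono mult_right_mono) auto
        qed
        finally show ?case by simp
      qed
    qed (use I in auto)
    also have "\<dots> = cc / 2 * B m + T * C" using I(2)[of m] by (simp add: B_def)
    finally show ?thesis .
  qed
  \<comment> \<open>\<open>2 + T * C\<close> bounds what is left of the dissipation: 1 from the
    limsup hypothesis, 1 from the weakly null pairing and \<open>T * C\<close> from
    \<open>low\<close>.\<close>
  define K where "K = (2 + T * C) * (2 / \<mu> + 2 / cc)"
  have C0: "0 \<le> C" using \<kappa>(1) c(1) by (simp add: C_def)
  have "\<forall>\<^sub>F m in sequentially. A m \<le> K \<and> B m \<le> K"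
    using Pup[OF zero_less_one] null[OF y zero_less_one]
  proof eventually_elim
    case (elim m)
    have sum: "\<mu> / 2 * A m + cc / 2 * B m \<le> 2 + T * C"
      using mono[of m] low[of m] elim by (simp add: abs_less_iff)
    have h: "0 \<le> 2 + T * C" using T C0 by simp
    have "\<mu> / 2 * A m \<le> 2 + T * C" "cc / 2 * B m \<le> 2 + T * C"
      using sum nn[of m] \<mu> cc mult_nonneg_nonneg[of "\<mu> / 2" "A m"] mult_nonneg_nonneg[of "cc / 2" "B m"] by linarith+
    then have "A m \<le> (2 + T * C) * (2 / \<mu>)" "B m \<le> (2 + T * C) * (2 / cc)"
      using \<mu> cc by (simp_all add: field_simps)
    moreover have "(2 + T * C) * (2 / \<mu>) \<le> K" "(2 + T * C) * (2 / cc) \<le> K"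
      unfolding K_def using h \<mu> cc by (intro mult_left_mono; simp)+
    ultimately show ?case by linarith
  qed
  \<comment> \<open>From here on the L2 term of wrong sign tends to 0.\<close>
  then have Slim: "S \<longlonglongrightarrow> 0"
    using strong_L2_convergence[OF conv, of K] unfolding A_def B_def S_def w_def by simp
  define D where "D = y - z"
  have D: "D \<in> X" unfolding D_def by (rule X_diff[OF y z])
  define Q where "Q m = pairing T (nemytskii F (ym m)) D" for m
  define q where "q = pairing T (nemytskii F y) D"
  define d where "d = (LINT t|tm. (Lp_norm Om 2 (D t))\<^sup>2)"
  have d0: "0 \<le> d" unfolding d_def by (intro integral_nonneg_AE AE_I2) simp
  obtain G where G: "0 \<le> G" "\<And>\<theta>. 0 < \<theta> \<Longrightarrow> \<theta> \<le> 1 \<Longrightarrow>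
    \<bar>pairing T (nemytskii F (\<lambda>t. 1 *\<^sub>R y t + (- \<theta>) *\<^sub>R D t)) D - pairing T (nemytskii F y) D\<bar> \<le> \<theta> * G"
    by (rule pairing_F_hemicontinuous[OF y D]) (rule that)
  \<comment> \<open>The total cost divided by \<open>\<theta>\<^sup>2\<close>: 2 for the two
    pairings with \<open>w m\<close>, the terms with \<open>\<kappa>\<close> for the L2 distance
    from \<open>ym m\<close> to the comparison field, and \<open>G\<close> for moving that field
    back to \<open>y\<close>.\<close>
  define R where "R = 2 + 2 * \<kappa> + 2 * \<kappa> * d + G"
  have R: "R > 0" using \<kappa>(1) d0 G(1) by (simp add: R_def add_pos_nonneg)
  have Qlow: "\<forall>\<^sub>F m in sequentially. q - \<theta> * R \<le> Q m" if \<theta>: "0 < \<theta>" "\<theta> \<le> 1" for \<theta>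
  proof -
    define v where "v = (\<lambda>t. 1 *\<^sub>R y t + (- \<theta>) *\<^sub>R D t)"
    have v: "v \<in> X" unfolding v_def by (rule X_lincomb[OF y D])
    \<comment> \<open>All vanishing quantities are taken below \<open>\<theta>\<^sup>2\<close>, so
      that they are still of order \<open>\<theta>\<close> after division by
      \<open>\<theta>\<close>.\<close>
    have t2: "\<theta>\<^sup>2 > 0" using \<theta> by simp
    have "\<forall>\<^sub>F m in sequentially. S m < \<theta>\<^sup>2" using Slim t2 order_tendstoD(2) by blast
    then show ?thesis using Pup[OF t2] null[OF v t2]
    proof eventually_elim
      case (elim m)
      have eq: "ym m - v = (\<lambda>t. 1 *\<^sub>R w m t + \<theta> *\<^sub>R D t)"
        unfolding v_def w_def by (auto simp: fun_eq_iff)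
      define E where "E = (LINT t|tm. (Lp_norm Om 2 ((ym m - v) t))\<^sup>2)"
      have yv: "ym m - v \<in> X" by (rule X_diff[OF ym v])
      have "E \<le> (LINT t|tm. 2 * (Lp_norm Om 2 (w m t))\<^sup>2 + 2 * \<theta>\<^sup>2 * (Lp_norm Om 2 (D t))\<^sup>2)"
        unfolding E_def
      proof (rule integral_mono_AE[OF L2_norm_time[OF X_D(2)[OF yv]]])
        show "integrable tm (\<lambda>t. 2 * (Lp_norm Om 2 (w m t))\<^sup>2 + 2 * \<theta>\<^sup>2 * (Lp_norm Om 2 (D t))\<^sup>2)"
          using L2_norm_time[OF X_D(2)[OF w]] L2_norm_time[OF X_D(2)[OF D]] by auto
        interpret A2: seminormed_space "Lp_space Om 2 :: (real^'n \<Rightarrow> real^'n) set" "Lp_norm Om 2" by (rule seminormed_Lp) simp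
        show "AE t in tm. (Lp_norm Om 2 ((ym m - v) t))\<^sup>2 \<le> 2 * (Lp_norm Om 2 (w m t))\<^sup>2 + 2 * \<theta>\<^sup>2 * (Lp_norm Om 2 (D t))\<^sup>2"
          using X_Y[OF w, of m] X_Y[OF D]
        proof eventually_elim
          case (elim t)
          have L2: "w m t \<in> Lp_space Om 2" "D t \<in> Lp_space Om 2" using elim L_L2 by auto
          have "Lp_norm Om 2 (1 *\<^sub>R w m t + \<theta> *\<^sub>R D t) \<le> Lp_norm Om 2 (1 *\<^sub>R w m t) + Lp_norm Om 2 (\<theta> *\<^sub>R D t)"
            by (intro A2.triangle A2.scale_mem L2)
          also have "\<dots> = Lp_norm Om 2 (w m t) + \<theta> * Lp_norm Om 2 (D t)"
            using A2.homogeneous[OF L2(1), of 1] A2.homogeneous[OF L2(2), of \<theta>] \<theta> by simp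
          finally have "(Lp_norm Om 2 ((ym m - v) t))\<^sup>2 \<le> (Lp_norm Om 2 (w m t) + \<theta> * Lp_norm Om 2 (D t))\<^sup>2"
            unfolding eq by (intro power_mono Lp_norm_nonneg)
          also have "\<dots> \<le> 2 * (Lp_norm Om 2 (w m t))\<^sup>2 + 2 * (\<theta> * Lp_norm Om 2 (D t))\<^sup>2"
            using zero_le_power2[of "Lp_norm Om 2 (w m t) - \<theta> * Lp_norm Om 2 (D t)"] unfolding power2_sum power2_diff by simp
          finally show ?case by (simp add: power_mult_distrib)
        qed
      qed
      also have "\<dots> = 2 * S m + 2 * \<theta>\<^sup>2 * d"
        using L2_norm_time[OF X_D(2)[OF w]] L2_norm_time[OF X_D(2)[OF D]] by (simp add: S_def d_def)
      finally have E: "E \<le> 2 * S m + 2 * \<theta>\<^sup>2 * d" .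
      have "0 \<le> (LINT t|tm. NV ((ym m - v) t) powr 2)" "0 \<le> (LINT t|tm. NL ((ym m - v) t) powr (r + 1))"
        by (intro integral_nonneg_AE AE_I2; simp)+
      then have "0 \<le> \<mu> / 2 * (LINT t|tm. NV ((ym m - v) t) powr 2)" "0 \<le> \<beta> * damping_const * (LINT t|tm. NL ((ym m - v) t) powr (r + 1))"
        using \<mu> cc by (auto simp: cc_def)
      then have "- \<kappa> * E \<le> pairing T (nemytskii F (ym m)) (ym m - v) - pairing T (nemytskii F v) (ym m - v)"
        using \<kappa>(2)[OF ym v, of m] unfolding E_def by linarith
      also have "\<dots> = P m + \<theta> * Q m - pairing T (nemytskii F v) (w m) - \<theta> * pairing T (nemytskii F v) D"
        unfolding eq pairing_F_lincomb[OF ym w D] pairing_F_lincomb[OF v w D] by (simp add: P_def Q_def)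
      finally have main: "\<theta> * pairing T (nemytskii F v) D - \<kappa> * E - P m + pairing T (nemytskii F v) (w m) \<le> \<theta> * Q m" by simp
      have "q - \<theta> * G \<le> pairing T (nemytskii F v) D"
        using G(2)[OF \<theta>] unfolding v_def q_def by (simp add: abs_le_iff)
      then have "\<theta> * (q - \<theta> * G) \<le> \<theta> * pairing T (nemytskii F v) D" using \<theta> by (intro mult_left_mono) auto
      moreover have "\<kappa> * E \<le> \<kappa> * (2 * \<theta>\<^sup>2 + 2 * \<theta>\<^sup>2 * d)" using E elim(1) \<kappa>(1) by (intro mult_left_mono) auto
      ultimately have "\<theta> * (q - \<theta> * G) - \<kappa> * (2 * \<theta>\<^sup>2 + 2 * \<theta>\<^sup>2 * d) - \<theta>\<^sup>2 - \<theta>\<^sup>2 \<le> \<theta> * Q m"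
        using main elim(2,3) by (simp add: abs_less_iff)
      also have "\<theta> * (q - \<theta> * G) - \<kappa> * (2 * \<theta>\<^sup>2 + 2 * \<theta>\<^sup>2 * d) - \<theta>\<^sup>2 - \<theta>\<^sup>2 = \<theta> * (q - \<theta> * R)"
        by (simp add: R_def algebra_simps power2_eq_square)
      finally show ?case using \<theta> by simp
    qed
  qed
  \<comment> \<open>Monotonicity between \<open>ym m\<close> and \<open>y\<close>, now with the L2
    term tending to 0, supplies the lower bound that complements \<open>Pup\<close>.\<close>
  have Plow: "\<forall>\<^sub>F m in sequentially. - e \<le> P m" if e: "e > 0" for e
  proof -
    have k: "e / (2 * (\<kappa> + 1)) > 0" "e / 2 > 0" using e \<kappa>(1) by auto
    have "\<forall>\<^sub>F m in sequentially. S m < e / (2 * (\<kappa> + 1))" using Slim k(1) order_tendstoD(2) by blast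
    then show ?thesis using null[OF y k(2)]
    proof eventually_elim
      case (elim m)
      have "\<kappa> * S m \<le> \<kappa> * (e / (2 * (\<kappa> + 1)))" using elim \<kappa>(1) by (intro mult_left_mono) auto
      also have "\<dots> \<le> e / 2" using e \<kappa>(1) by (simp add: field_simps)
      finally have "\<kappa> * S m \<le> e / 2" .
      moreover have "0 \<le> \<mu> / 2 * A m + cc * B m" using nn[of m] \<mu> cc by simp
      ultimately show ?case using mono[of m] elim(2) by (simp add: abs_less_iff)
    qed
  qed
  have tot: "pairing T (nemytskii F (ym m)) (ym m - z) = P m + Q m" for m
  proof -
    have "ym m - z = (\<lambda>t. 1 *\<^sub>R w m t + 1 *\<^sub>R D t)" by (auto simp: w_def D_def fun_eq_iff)
    then show ?thesis using pairing_F_lincomb[OF ym w D, of m 1 m 1] by (simp add: P_def Q_def)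
  qed
  have "ereal q \<le> liminf (\<lambda>m. ereal (P m + Q m))"
  proof (rule ereal_le_epsilon2)
    fix e :: real assume e: "0 < e"
    \<comment> \<open>Small enough that \<open>\<theta> * R\<close> uses half of \<open>e\<close>,
      and at most 1 as the segment estimate demands.\<close>
    define \<theta> where "\<theta> = min 1 (e / (2 * R))"
    have \<theta>: "0 < \<theta>" "\<theta> \<le> 1" using e R by (auto simp: \<theta>_def)
    have "\<theta> * R \<le> e / (2 * R) * R" unfolding \<theta>_def using R by (intro mult_right_mono) auto
    then have \<theta>R: "\<theta> * R \<le> e / 2" using R by simp
    have "\<forall>\<^sub>F m in sequentially. ereal (q - e) \<le> ereal (P m + Q m)"
      using Qlow[OF \<theta>] Plow[OF half_gt_zero[OF e]]
      by eventually_elim (use \<theta>R in simp)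
    then have "ereal (q - e) \<le> liminf (\<lambda>m. ereal (P m + Q m))" by (rule Liminf_bounded)
    then have "ereal (q - e) + ereal e \<le> liminf (\<lambda>m. ereal (P m + Q m)) + ereal e" by (rule add_right_mono)
    then show "ereal q \<le> liminf (\<lambda>m. ereal (P m + Q m)) + ereal e" by simp
  qed
  then show ?thesis unfolding tot q_def D_def .
qed

lemma F_pseudomonotone: "pseudomonotone rot Om T r (nemytskii F)"
  unfolding pseudomonotone_def
  using F_bounded_operator F_pseudomonotone_limit W_X by blast

end

text \<open>\<open>cr2\<close> is a rotation by a right angle scaled by the curl, hence an isometry
  up to that factor and orthogonal to its argument.\<close>

lemma cbf_operator_2d:
  assumes "bounded_C11_domain (Om :: (real^2) set)" "T > 0" "r > 3" "\<mu> > 0" "\<alpha> > 0" "\<beta> > 0"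
  shows "cbf_operator Om rot2 cr2 T r \<mu> \<alpha> \<beta>"
proof (intro cbf_operator.intro curl_domain.intro bounded_open.intro curl_domain_axioms.intro cbf_operator_axioms.intro)
  show "open Om" "bounded Om" using assms(1) by (auto simp: bounded_C11_domain_def)
  have "linear rot2"
    by (rule linearI) (auto simp: rot2_def algebra_simps)
  then show "bounded_linear rot2" by (rule linear_conv_bounded_linear[THEN iffD1])
  show "(norm (rot2 J))\<^sup>2 = (\<Sum>i\<in>UNIV. \<Sum>j\<in>UNIV. (J $ i $ j)\<^sup>2) - (\<Sum>i\<in>UNIV. \<Sum>j\<in>UNIV. J $ i $ j * J $ j $ i)" for J
    by (simp add: rot2_def sum_2 power2_eq_square algebra_simps)
  have norm2: "norm z = sqrt ((z $ 1)\<^sup>2 + (z $ 2)\<^sup>2)" for z :: "real^2"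
    by (simp add: norm_vec_def L2_set_def sum_2)
  have n: "norm (cr2 c z) = \<bar>c\<bar> * norm z" for c z
    unfolding norm2 by (simp add: cr2_def power_mult_distrib distrib_left[symmetric] real_sqrt_mult add.commute)
  show "norm (cr2 c z) \<le> norm c * norm z" for c z using n by simp
  show "cr2 c z \<bullet> z = 0" for c z
    by (simp add: cr2_def inner_vec_def sum_2)
  show "bounded_bilinear cr2"
  proof (rule bounded_bilinear.intro)
    show "\<exists>K. \<forall>a b. norm (cr2 a b) \<le> norm a * norm b * K" by (rule exI[of _ 1]) (simp add: n)
  qed (auto simp: cr2_def vec_eq_iff forall_2 algebra_simps)
qed (use assms in auto)

text \<open>The norm bound is Lagrange's identity for the cross product.\<close>

lemma cbf_operator_3d:
  assumes "bounded_C11_domain (Om :: (real^3) set)" "T > 0" "r > 3" "\<mu> > 0" "\<alpha> > 0" "\<beta> > 0"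
  shows "cbf_operator Om rot3 cross3 T r \<mu> \<alpha> \<beta>"
proof (intro cbf_operator.intro curl_domain.intro bounded_open.intro curl_domain_axioms.intro cbf_operator_axioms.intro)
  show "open Om" "bounded Om" using assms(1) by (auto simp: bounded_C11_domain_def)
  have "linear rot3"
    by (rule linearI) (auto simp: rot3_def vec_eq_iff forall_3 algebra_simps)
  then show "bounded_linear rot3" by (rule linear_conv_bounded_linear[THEN iffD1])
  show "(norm (rot3 J))\<^sup>2 = (\<Sum>i\<in>UNIV. \<Sum>j\<in>UNIV. (J $ i $ j)\<^sup>2) - (\<Sum>i\<in>UNIV. \<Sum>j\<in>UNIV. J $ i $ j * J $ j $ i)" for J
    unfolding power2_norm_eq_inner by (simp add: rot3_def inner_vec_def sum_3 power2_eq_square algebra_simps)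
  show n: "norm (cross3 c z) \<le> norm c * norm z" for c z
  proof (rule power2_le_imp_le)
    show "(norm (cross3 c z))\<^sup>2 \<le> (norm c * norm z)\<^sup>2"
      unfolding norm_cross by (simp add: power_mult_distrib)
  qed simp
  show "cross3 c z \<bullet> z = 0" for c z by (simp add: dot_cross_self)
  show "bounded_bilinear cross3"
    by standard (auto simp: cross_add_left cross_add_right cross_mult_left cross_mult_right n intro!: exI[of _ 1])
qed (use assms in auto)

theorem proposition4p9:
  fixes Om2 :: "(real^2) set" and Om3 :: "(real^3) set" and T r \<mu> \<alpha> \<beta> :: real
  assumes "T > 0" and "r > 3" and "\<mu> > 0" and "\<alpha> > 0" and "\<beta> > 0"
  shows "(bounded_C11_domain Om2 \<longrightarrow>
            pseudomonotone rot2 Om2 T r (nemytskii (F_op rot2 cr2 Om2 r \<mu> \<alpha> \<beta>)))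
       \<and> (bounded_C11_domain Om3 \<longrightarrow>
            pseudomonotone rot3 Om3 T r (nemytskii (F_op rot3 cross3 Om3 r \<mu> \<alpha> \<beta>)))"
  using cbf_operator.F_pseudomonotone[OF cbf_operator_2d[OF _ assms]]
    cbf_operator.F_pseudomonotone[OF cbf_operator_3d[OF _ assms]]
  by blast

end
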